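(* Let $\beta=-[2]_q\in\mathbb C^*$ for a primitive even root of unity $q$, and let $\mathcal C$ be the semisimple quotient category constructed from the Temperley–Lieb category $\mathrm{TL}(\beta)$. Then every semisimple module category over $\mathcal C$ with finitely many simple objects induces a pivotal structure on its full image.
   Context: The base field is $\mathbb C$. The Temperley–Lieb category $\mathrm{TL}(\beta)$ is the $\mathbb C$-linear monoidal category with objects $\underline n$, $n\in\mathbb N$, with $\mathrm{Hom}(\underline m,\underline n)$ spanned by planar $(m,n)$-tangles modulo removing a closed loop at the cost of the factor $\beta$, composition of tangles, and $\underline n\otimes\underline m=\underline{n+m}$ (horizontal juxtaposition). Every object is self-dual through the nested caps and cups $\mathrm{cr}_n\colon\underline 0\to\underline n\otimes\underline n$ and $\mathrm{an}_n\colon\underline n\otimes\underline n\to\underline 0$, and with respect to these the pivotal structure is the identity. Here $[2]_q=q+q^{-1}$ and $q$ is a root of unity of even order. In this case $\mathrm{TL}(\beta)$ has a unique (proper nonzero) tensor ideal $\mathcal N$, and $\mathcal C$ is the spherical fusion category obtained by quotienting $\mathrm{TL}(\beta)$ by $\mathcal N$ and taking the idempotent (and additive) completion. A module category over $\mathcal C$ is a category $\mathcal B$ with a monoidal functor $\mathcal M\colon\mathcal C\to\mathrm{End}(\mathcal B)$, where $\mathrm{End}(\mathcal B)$ is the monoidal category of ($\mathbb C$-linear) endofunctors of $\mathcal B$; it is semisimple with finitely many simple objects if $\mathcal B$ is. Its full image is the rigid monoidal category $\mathcal D$ with objects $\mathcal M(X)$, $X$ in $\mathcal C$, and $\mathrm{Hom}_{\mathcal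 D}(\mathcal M(X),\mathcal M(Y))=\mathrm{Hom}_{\mathrm{End}(\mathcal B)}(\mathcal M(X),\mathcal M(Y))$. Let $\delta_X\colon{}^\vee X\to X^\vee$ be the pivotal structure of $\mathcal C$ (left dual to right dual). $\mathcal M$ induces a pivotal structure on its full image if $\alpha^\vee\circ\mathcal M(\delta_Y)=\mathcal M(\delta_X)\circ{}^\vee\alpha$ as morphisms $\mathcal M({}^\vee Y)\to\mathcal M(X^\vee)$ for all $X,Y$ in $\mathcal C$ and all $\alpha\in\mathrm{Hom}_{\mathcal D}(\mathcal M(X),\mathcal M(Y))$. *)

theory Defs
  imports Complex_Main "HOL-Library.FuncSet" "HOL-Library.Disjoint_Sets"
begin

section \<open>Linear categories\<close>

record ('o, 'm) lin_cat =
  Ob :: "'o set"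
  Hom :: "'o \<Rightarrow> 'o \<Rightarrow> 'm set"
  idm :: "'o \<Rightarrow> 'm"
  cmp :: "'m \<Rightarrow> 'm \<Rightarrow> 'm"  (infixl "\<cdot>\<index>" 70)
  zero_mor :: "'o \<Rightarrow> 'o \<Rightarrow> 'm"
  add_mor :: "'m \<Rightarrow> 'm \<Rightarrow> 'm"
  scale_mor :: "complex \<Rightarrow> 'm \<Rightarrow> 'm"

text \<open>Composition is written in the classical order: \<open>g \<cdot> f\<close> is \<open>f\<close> followed by \<open>g\<close>.\<close>

locale linear_category =
  fixes C :: "('o, 'm, 'x) lin_cat_scheme"  (structure)
  assumes Hom_disjoint:
      "\<lbrakk>X \<in> Ob C; Y \<in> Ob C; X' \<in> Ob C; Y' \<in> Ob C; f \<in> Hom C X Y; f \<in> Hom C X' Y'\<rbrakk>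
        \<Longrightarrow> X = X' \<and> Y = Y'"
    and idm_closed: "X \<in> Ob C \<Longrightarrow> idm C X \<in> Hom C X X"
    and cmp_closed:
      "\<lbrakk>X \<in> Ob C; Y \<in> Ob C; Z \<in> Ob C; f \<in> Hom C X Y; g \<in> Hom C Y Z\<rbrakk> \<Longrightarrow> g \<cdot> f \<in> Hom C X Z"
    and cmp_assoc:
      "\<lbrakk>X \<in> Ob C; Y \<in> Ob C; Z \<in> Ob C; W \<in> Ob C;
        f \<in> Hom C X Y; g \<in> Hom C Y Z; h \<in> Hom C Z W\<rbrakk> \<Longrightarrow> h \<cdot> g \<cdot> f = h \<cdot> (g \<cdot> f)"
    and cmp_idm:
      "\<lbrakk>X \<in> Ob C; Y \<in> Ob C; f \<in> Hom C X Y\<rbrakk> \<Longrightarrow> f \<cdot> idm C X = f"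
    and idm_cmp:
      "\<lbrakk>X \<in> Ob C; Y \<in> Ob C; f \<in> Hom C X Y\<rbrakk> \<Longrightarrow> idm C Y \<cdot> f = f"
    and zero_closed: "\<lbrakk>X \<in> Ob C; Y \<in> Ob C\<rbrakk> \<Longrightarrow> zero_mor C X Y \<in> Hom C X Y"
    and add_closed:
      "\<lbrakk>X \<in> Ob C; Y \<in> Ob C; f \<in> Hom C X Y; g \<in> Hom C X Y\<rbrakk> \<Longrightarrow> add_mor C f g \<in> Hom C X Y"
    and scale_closed:
      "\<lbrakk>X \<in> Ob C; Y \<in> Ob C; f \<in> Hom C X Y\<rbrakk> \<Longrightarrow> scale_mor C c f \<in> Hom C X Y"
    and add_assoc:
      "\<lbrakk>X \<in> Ob C; Y \<in> Ob C; f \<in> Hom C X Y; g \<in> Hom C X Y; h \<in> Hom C X Y\<rbrakk>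
        \<Longrightarrow> add_mor C (add_mor C f g) h = add_mor C f (add_mor C g h)"
    and add_commute:
      "\<lbrakk>X \<in> Ob C; Y \<in> Ob C; f \<in> Hom C X Y; g \<in> Hom C X Y\<rbrakk> \<Longrightarrow> add_mor C f g = add_mor C g f"
    and add_zero:
      "\<lbrakk>X \<in> Ob C; Y \<in> Ob C; f \<in> Hom C X Y\<rbrakk> \<Longrightarrow> add_mor C f (zero_mor C X Y) = f"
    and add_inverse:
      "\<lbrakk>X \<in> Ob C; Y \<in> Ob C; f \<in> Hom C X Y\<rbrakk>
        \<Longrightarrow> add_mor C f (scale_mor C (-1) f) = zero_mor C X Y"
    and scale_one:
      "\<lbrakk>X \<in> Ob C; Y \<in> Ob C; f \<in> Hom C X Y\<rbrakk> \<Longrightarrow> scale_mor C 1 f = f"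
    and scale_scale:
      "\<lbrakk>X \<in> Ob C; Y \<in> Ob C; f \<in> Hom C X Y\<rbrakk>
        \<Longrightarrow> scale_mor C a (scale_mor C b f) = scale_mor C (a * b) f"
    and scale_add_left:
      "\<lbrakk>X \<in> Ob C; Y \<in> Ob C; f \<in> Hom C X Y\<rbrakk>
        \<Longrightarrow> scale_mor C (a + b) f = add_mor C (scale_mor C a f) (scale_mor C b f)"
    and scale_add_right:
      "\<lbrakk>X \<in> Ob C; Y \<in> Ob C; f \<in> Hom C X Y; g \<in> Hom C X Y\<rbrakk>
        \<Longrightarrow> scale_mor C a (add_mor C f g) = add_mor C (scale_mor C a f) (scale_mor C a g)"
    and cmp_add_left:
      "\<lbrakk>X \<in> Ob C; Y \<in> Ob C; Z \<in> Ob C; f \<in> Hom C X Y; g \<in> Hom C Y Z; h \<in> Hom C Y Z\<rbrakk>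
        \<Longrightarrow> add_mor C g h \<cdot> f = add_mor C (g \<cdot> f) (h \<cdot> f)"
    and cmp_add_right:
      "\<lbrakk>X \<in> Ob C; Y \<in> Ob C; Z \<in> Ob C; f \<in> Hom C X Y; g \<in> Hom C X Y; h \<in> Hom C Y Z\<rbrakk>
        \<Longrightarrow> h \<cdot> add_mor C f g = add_mor C (h \<cdot> f) (h \<cdot> g)"
    and cmp_scale_left:
      "\<lbrakk>X \<in> Ob C; Y \<in> Ob C; Z \<in> Ob C; f \<in> Hom C X Y; g \<in> Hom C Y Z\<rbrakk>
        \<Longrightarrow> scale_mor C a g \<cdot> f = scale_mor C a (g \<cdot> f)"
    and cmp_scale_right:
      "\<lbrakk>X \<in> Ob C; Y \<in> Ob C; Z \<in> Ob C; f \<in> Hom C X Y; g \<in> Hom C Y Z\<rbrakk>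
        \<Longrightarrow> g \<cdot> scale_mor C a f = scale_mor C a (g \<cdot> f)"

definition Arr :: "('o, 'm, 'x) lin_cat_scheme \<Rightarrow> 'm set" where
  "Arr C = (\<Union>X\<in>Ob C. \<Union>Y\<in>Ob C. Hom C X Y)"

definition sum_mor :: "('o, 'm, 'x) lin_cat_scheme \<Rightarrow> 'o \<Rightarrow> 'o \<Rightarrow> 'm list \<Rightarrow> 'm" where
  "sum_mor C X Y fs = foldr (add_mor C) fs (zero_mor C X Y)"

definition inverse_pair :: "('o, 'm, 'x) lin_cat_scheme \<Rightarrow> 'o \<Rightarrow> 'o \<Rightarrow> 'm \<Rightarrow> 'm \<Rightarrow> bool" where
  "inverse_pair C X Y f g \<longleftrightarrow> f \<in> Hom C X Y \<and> g \<in> Hom C Y X \<and>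
     g \<cdot>\<^bsub>C\<^esub> f = idm C X \<and> f \<cdot>\<^bsub>C\<^esub> g = idm C Y"

definition iso_mor :: "('o, 'm, 'x) lin_cat_scheme \<Rightarrow> 'o \<Rightarrow> 'o \<Rightarrow> 'm \<Rightarrow> bool" where
  "iso_mor C X Y f \<longleftrightarrow> (\<exists>g. inverse_pair C X Y f g)"

definition inv_mor :: "('o, 'm, 'x) lin_cat_scheme \<Rightarrow> 'o \<Rightarrow> 'o \<Rightarrow> 'm \<Rightarrow> 'm" where
  "inv_mor C X Y f = (THE g. inverse_pair C X Y f g)"

definition isomorphic :: "('o, 'm, 'x) lin_cat_scheme \<Rightarrow> 'o \<Rightarrow> 'o \<Rightarrow> bool" where
  "isomorphic C X Y \<longleftrightarrow> (\<exists>f. iso_mor C X Y f)"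


section \<open>Semisimple categories\<close>

definition zero_object :: "('o, 'm, 'x) lin_cat_scheme \<Rightarrow> 'o \<Rightarrow> bool" where
  "zero_object C Z \<longleftrightarrow> Z \<in> Ob C \<and> idm C Z = zero_mor C Z Z"

definition direct_sum ::
  "('o, 'm, 'x) lin_cat_scheme \<Rightarrow> 'o list \<Rightarrow> 'o \<Rightarrow> bool" where
  "direct_sum C Xs P \<longleftrightarrow> P \<in> Ob C \<and> set Xs \<subseteq> Ob C \<and>
     (\<exists>\<iota> \<pi>. (\<forall>i<length Xs. \<iota> i \<in> Hom C (Xs ! i) P \<and> \<pi> i \<in> Hom C P (Xs ! i)) \<and>
        (\<forall>i<length Xs. \<forall>j<length Xs. \<pi> i \<cdot>\<^bsub>C\<^esub> \<iota> j =
           (if i = j then idm C (Xs ! i) else zero_mor C (Xs ! j) (Xs ! i))) \<and>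
        sum_mor C P P (map (\<lambda>i. \<iota> i \<cdot>\<^bsub>C\<^esub> \<pi> i) [0..<length Xs]) = idm C P)"

definition mono_mor :: "('o, 'm, 'x) lin_cat_scheme \<Rightarrow> 'o \<Rightarrow> 'o \<Rightarrow> 'm \<Rightarrow> bool" where
  "mono_mor C X Y f \<longleftrightarrow> f \<in> Hom C X Y \<and>
     (\<forall>W\<in>Ob C. \<forall>g\<in>Hom C W X. \<forall>h\<in>Hom C W X. f \<cdot>\<^bsub>C\<^esub> g = f \<cdot>\<^bsub>C\<^esub> h \<longrightarrow> g = h)"

definition epi_mor :: "('o, 'm, 'x) lin_cat_scheme \<Rightarrow> 'o \<Rightarrow> 'o \<Rightarrow> 'm \<Rightarrow> bool" where
  "epi_mor C X Y f \<longleftrightarrow> f \<in> Hom C X Y \<and>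
     (\<forall>Z\<in>Ob C. \<forall>g\<in>Hom C Y Z. \<forall>h\<in>Hom C Y Z. g \<cdot>\<^bsub>C\<^esub> f = h \<cdot>\<^bsub>C\<^esub> f \<longrightarrow> g = h)"

definition is_kernel ::
  "('o, 'm, 'x) lin_cat_scheme \<Rightarrow> 'o \<Rightarrow> 'o \<Rightarrow> 'm \<Rightarrow> 'o \<Rightarrow> 'm \<Rightarrow> bool" where
  "is_kernel C X Y f K k \<longleftrightarrow> K \<in> Ob C \<and> k \<in> Hom C K X \<and> f \<cdot>\<^bsub>C\<^esub> k = zero_mor C K Y \<and>
     (\<forall>W\<in>Ob C. \<forall>g\<in>Hom C W X. f \<cdot>\<^bsub>C\<^esub> g = zero_mor C W Y \<longrightarrow>
        (\<exists>!h. h \<in> Hom C W K \<and> k \<cdot>\<^bsub>C\<^esub> h = g))"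

definition is_cokernel ::
  "('o, 'm, 'x) lin_cat_scheme \<Rightarrow> 'o \<Rightarrow> 'o \<Rightarrow> 'm \<Rightarrow> 'o \<Rightarrow> 'm \<Rightarrow> bool" where
  "is_cokernel C X Y f Q p \<longleftrightarrow> Q \<in> Ob C \<and> p \<in> Hom C Y Q \<and> p \<cdot>\<^bsub>C\<^esub> f = zero_mor C X Q \<and>
     (\<forall>Z\<in>Ob C. \<forall>g\<in>Hom C Y Z. g \<cdot>\<^bsub>C\<^esub> f = zero_mor C X Z \<longrightarrow>
        (\<exists>!h. h \<in> Hom C Q Z \<and> h \<cdot>\<^bsub>C\<^esub> p = g))"

definition abelian_category :: "('o, 'm, 'x) lin_cat_scheme \<Rightarrow> bool" where
  "abelian_category C \<longleftrightarrow> linear_category C \<and>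
     (\<exists>Z. zero_object C Z) \<and>
     (\<forall>X\<in>Ob C. \<forall>Y\<in>Ob C. \<exists>P. direct_sum C [X, Y] P) \<and>
     (\<forall>X\<in>Ob C. \<forall>Y\<in>Ob C. \<forall>f\<in>Hom C X Y.
        (\<exists>K k. is_kernel C X Y f K k) \<and> (\<exists>Q p. is_cokernel C X Y f Q p)) \<and>
     (\<forall>X\<in>Ob C. \<forall>Y\<in>Ob C. \<forall>f. mono_mor C X Y f \<longrightarrow>
        (\<exists>Z\<in>Ob C. \<exists>g\<in>Hom C Y Z. is_kernel C Y Z g X f)) \<and>
     (\<forall>X\<in>Ob C. \<forall>Y\<in>Ob C. \<forall>f. epi_mor C X Y f \<longrightarrow>
        (\<exists>W\<in>Ob C. \<exists>g\<in>Hom C W X. is_cokernel C W X g Y f))"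

definition finite_dim_homs :: "('o, 'm, 'x) lin_cat_scheme \<Rightarrow> bool" where
  "finite_dim_homs C \<longleftrightarrow> (\<forall>X\<in>Ob C. \<forall>Y\<in>Ob C. \<exists>fs. set fs \<subseteq> Hom C X Y \<and>
     (\<forall>g\<in>Hom C X Y. \<exists>c. g = sum_mor C X Y (map (\<lambda>f. scale_mor C (c f) f) fs)))"

definition simple_object :: "('o, 'm, 'x) lin_cat_scheme \<Rightarrow> 'o \<Rightarrow> bool" where
  "simple_object C S \<longleftrightarrow> S \<in> Ob C \<and> \<not> zero_object C S \<and>
     (\<forall>X\<in>Ob C. \<forall>f. mono_mor C X S f \<longrightarrow> zero_object C X \<or> iso_mor C X S f)"

text \<open>Finite-dimensionality of the morphism spaces is part of the usual notion of a semisimple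
  category over the complex numbers; it makes the endomorphism algebra of a simple object
  one-dimensional.\<close>

definition semisimple_category :: "('o, 'm, 'x) lin_cat_scheme \<Rightarrow> bool" where
  "semisimple_category C \<longleftrightarrow> abelian_category C \<and> finite_dim_homs C \<and>
     (\<forall>X\<in>Ob C. \<exists>Ss. (\<forall>S\<in>set Ss. simple_object C S) \<and> direct_sum C Ss X)"

definition finitely_many_simples :: "('o, 'm, 'x) lin_cat_scheme \<Rightarrow> bool" where
  "finitely_many_simples C \<longleftrightarrow>
     (\<exists>\<S>. finite \<S> \<and> (\<forall>S. simple_object C S \<longrightarrow> (\<exists>T\<in>\<S>. isomorphic C S T)))"


section \<open>Strict monoidal categories, duals, tensor ideals\<close>

text \<open>All monoidal categories below (the Temperley--Lieb category, its quotients and completions,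
  and categories of endofunctors) are strict, so no associators or unitors are recorded.\<close>

record ('o, 'm) mon_cat = "('o, 'm) lin_cat" +
  unit_ob :: "'o"
  tens_ob :: "'o \<Rightarrow> 'o \<Rightarrow> 'o"  (infixr "\<odot>\<index>" 75)
  tens_mor :: "'m \<Rightarrow> 'm \<Rightarrow> 'm"  (infixr "\<otimes>\<index>" 75)

text \<open>A left dual of \<open>X\<close> has evaluation \<open>ev_l X : ldual X \<odot> X \<rightarrow> 1\<close> and coevaluation
  \<open>coev_l X : 1 \<rightarrow> X \<odot> ldual X\<close>; a right dual has \<open>ev_r X : X \<odot> rdual X \<rightarrow> 1\<close> and
  \<open>coev_r X : 1 \<rightarrow> rdual X \<odot> X\<close>. The pivotal structure is \<open>pivot X : ldual X \<rightarrow> rdual X\<close>.\<close>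

record ('o, 'm) pivotal_cat = "('o, 'm) mon_cat" +
  ldual :: "'o \<Rightarrow> 'o"
  ev_l :: "'o \<Rightarrow> 'm"
  coev_l :: "'o \<Rightarrow> 'm"
  rdual :: "'o \<Rightarrow> 'o"
  ev_r :: "'o \<Rightarrow> 'm"
  coev_r :: "'o \<Rightarrow> 'm"
  pivot :: "'o \<Rightarrow> 'm"

text \<open>The dual of \<open>f : X \<rightarrow> Y\<close>, for given dual objects \<open>X'\<close> and \<open>Y'\<close>, a coevaluation for \<open>X\<close> and an
  evaluation for \<open>Y\<close>; it is a morphism \<open>Y' \<rightarrow> X'\<close>.\<close>

definition left_mate ::
  "('o, 'm, 'x) mon_cat_scheme \<Rightarrow> 'o \<Rightarrow> 'o \<Rightarrow> 'm \<Rightarrow> 'm \<Rightarrow> 'm \<Rightarrow> 'm" where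
  "left_mate C X' Y' coevX evY f =
     (evY \<otimes>\<^bsub>C\<^esub> idm C X') \<cdot>\<^bsub>C\<^esub> (idm C Y' \<otimes>\<^bsub>C\<^esub> f \<otimes>\<^bsub>C\<^esub> idm C X') \<cdot>\<^bsub>C\<^esub> (idm C Y' \<otimes>\<^bsub>C\<^esub> coevX)"

definition right_mate ::
  "('o, 'm, 'x) mon_cat_scheme \<Rightarrow> 'o \<Rightarrow> 'o \<Rightarrow> 'm \<Rightarrow> 'm \<Rightarrow> 'm \<Rightarrow> 'm" where
  "right_mate C X' Y' coevX evY f =
     (idm C X' \<otimes>\<^bsub>C\<^esub> evY) \<cdot>\<^bsub>C\<^esub> (idm C X' \<otimes>\<^bsub>C\<^esub> f \<otimes>\<^bsub>C\<^esub> idm C Y') \<cdot>\<^bsub>C\<^esub> (coevX \<otimes>\<^bsub>C\<^esub> idm C Y')"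

definition ldual_mor :: "('o, 'm, 'x) pivotal_cat_scheme \<Rightarrow> 'o \<Rightarrow> 'o \<Rightarrow> 'm \<Rightarrow> 'm" where
  "ldual_mor C X Y f = left_mate C (ldual C X) (ldual C Y) (coev_l C X) (ev_l C Y) f"

definition rdual_mor :: "('o, 'm, 'x) pivotal_cat_scheme \<Rightarrow> 'o \<Rightarrow> 'o \<Rightarrow> 'm \<Rightarrow> 'm" where
  "rdual_mor C X Y f = right_mate C (rdual C X) (rdual C Y) (coev_r C X) (ev_r C Y) f"

definition tensor_ideal :: "('o, 'm, 'x) mon_cat_scheme \<Rightarrow> ('o \<Rightarrow> 'o \<Rightarrow> 'm set) \<Rightarrow> bool" where
  "tensor_ideal C N \<longleftrightarrow>
     (\<forall>X\<in>Ob C. \<forall>Y\<in>Ob C. N X Y \<subseteq> Hom C X Y \<and> zero_mor C X Y \<in> N X Y \<and>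
        (\<forall>f\<in>N X Y. \<forall>g\<in>N X Y. add_mor C f g \<in> N X Y) \<and>
        (\<forall>a. \<forall>f\<in>N X Y. scale_mor C a f \<in> N X Y)) \<and>
     (\<forall>X\<in>Ob C. \<forall>Y\<in>Ob C. \<forall>Z\<in>Ob C. \<forall>f\<in>N X Y. \<forall>g\<in>Hom C Y Z. g \<cdot>\<^bsub>C\<^esub> f \<in> N X Z) \<and>
     (\<forall>X\<in>Ob C. \<forall>Y\<in>Ob C. \<forall>Z\<in>Ob C. \<forall>f\<in>Hom C X Y. \<forall>g\<in>N Y Z. g \<cdot>\<^bsub>C\<^esub> f \<in> N X Z) \<and>
     (\<forall>X\<in>Ob C. \<forall>Y\<in>Ob C. \<forall>Z\<in>Ob C. \<forall>W\<in>Ob C. \<forall>f\<in>N X Y. \<forall>g\<in>Hom C Z W.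
        f \<otimes>\<^bsub>C\<^esub> g \<in> N (X \<odot>\<^bsub>C\<^esub> Z) (Y \<odot>\<^bsub>C\<^esub> W) \<and> g \<otimes>\<^bsub>C\<^esub> f \<in> N (Z \<odot>\<^bsub>C\<^esub> X) (W \<odot>\<^bsub>C\<^esub> Y))"

definition proper_nonzero_tensor_ideal ::
  "('o, 'm, 'x) mon_cat_scheme \<Rightarrow> ('o \<Rightarrow> 'o \<Rightarrow> 'm set) \<Rightarrow> bool" where
  "proper_nonzero_tensor_ideal C N \<longleftrightarrow> tensor_ideal C N \<and>
     (\<exists>X\<in>Ob C. \<exists>Y\<in>Ob C. N X Y \<noteq> Hom C X Y) \<and>
     (\<exists>X\<in>Ob C. \<exists>Y\<in>Ob C. N X Y \<noteq> {zero_mor C X Y})"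


section \<open>Quotient by a tensor ideal\<close>

definition ideal_class ::
  "('o, 'm, 'x) lin_cat_scheme \<Rightarrow> ('o \<Rightarrow> 'o \<Rightarrow> 'm set) \<Rightarrow> 'm \<Rightarrow> 'm set" where
  "ideal_class C N f =
     {g. \<exists>X\<in>Ob C. \<exists>Y\<in>Ob C. f \<in> Hom C X Y \<and> g \<in> Hom C X Y \<and>
           add_mor C g (scale_mor C (-1) f) \<in> N X Y}"

definition quotient_cat ::
  "('o, 'm) pivotal_cat \<Rightarrow> ('o \<Rightarrow> 'o \<Rightarrow> 'm set) \<Rightarrow> ('o, 'm set) pivotal_cat" where
  "quotient_cat C N =
    \<lparr> Ob = Ob C,
      Hom = (\<lambda>X Y. ideal_class C N ` Hom C X Y),
      idm = (\<lambda>X. ideal_class C N (idm C X)),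
      cmp = (\<lambda>G F. \<Union>g\<in>G. \<Union>f\<in>F. ideal_class C N (g \<cdot>\<^bsub>C\<^esub> f)),
      zero_mor = (\<lambda>X Y. ideal_class C N (zero_mor C X Y)),
      add_mor = (\<lambda>F G. \<Union>f\<in>F. \<Union>g\<in>G. ideal_class C N (add_mor C f g)),
      scale_mor = (\<lambda>a F. \<Union>f\<in>F. ideal_class C N (scale_mor C a f)),
      unit_ob = unit_ob C,
      tens_ob = tens_ob C,
      tens_mor = (\<lambda>F G. \<Union>f\<in>F. \<Union>g\<in>G. ideal_class C N (f \<otimes>\<^bsub>C\<^esub> g)),
      ldual = ldual C,
      ev_l = (\<lambda>X. ideal_class C N (ev_l C X)),
      coev_l = (\<lambda>X. ideal_class C N (coev_l C X)),
      rdual = rdual C,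
      ev_r = (\<lambda>X. ideal_class C N (ev_r C X)),
      coev_r = (\<lambda>X. ideal_class C N (coev_r C X)),
      pivot = (\<lambda>X. ideal_class C N (pivot C X)) \<rparr>"


section \<open>Additive completion\<close>

text \<open>Objects are finite lists (formal direct sums), and a morphism \<open>(xs, ys, A)\<close> is a matrix whose
  entry \<open>A (i, j)\<close> is a morphism \<open>xs ! j \<rightarrow> ys ! i\<close>. The tensor product of lists is
  lexicographic, so that the summand \<open>xs ! i \<odot> ys ! j\<close> has index \<open>i * length ys + j\<close> and the
  tensor product of matrices is the Kronecker product.\<close>

type_synonym ('o, 'm) mat_mor = "'o list \<times> 'o list \<times> (nat \<times> nat \<Rightarrow> 'm)"

definition mk_mat :: "'o list \<Rightarrow> 'o list \<Rightarrow> (nat \<Rightarrow> nat \<Rightarrow> 'm) \<Rightarrow> ('o, 'm) mat_mor" where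
  "mk_mat xs ys A = (xs, ys, \<lambda>(i, j)\<in>{..<length ys} \<times> {..<length xs}. A i j)"

definition tens_list :: "('o \<Rightarrow> 'o \<Rightarrow> 'o) \<Rightarrow> 'o list \<Rightarrow> 'o list \<Rightarrow> 'o list" where
  "tens_list t xs ys = concat (map (\<lambda>x. map (t x) ys) xs)"

definition additive_completion ::
  "('o, 'm) pivotal_cat \<Rightarrow> ('o list, ('o, 'm) mat_mor) pivotal_cat" where
  "additive_completion C =
    \<lparr> Ob = lists (Ob C),
      Hom = (\<lambda>xs ys. {(xs, ys, A) | A.
        A \<in> (\<Pi>\<^sub>E (i, j)\<in>{..<length ys} \<times> {..<length xs}. Hom C (xs ! j) (ys ! i))}),
      idm = (\<lambda>xs. mk_mat xs xs
        (\<lambda>i j. if i = j then idm C (xs ! i) else zero_mor C (xs ! j) (xs ! i))),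
      cmp = (\<lambda>(ys', zs, B) (xs, ys, A). mk_mat xs zs
        (\<lambda>i j. sum_mor C (xs ! j) (zs ! i)
           (map (\<lambda>k. B (i, k) \<cdot>\<^bsub>C\<^esub> A (k, j)) [0..<length ys]))),
      zero_mor = (\<lambda>xs ys. mk_mat xs ys (\<lambda>i j. zero_mor C (xs ! j) (ys ! i))),
      add_mor = (\<lambda>(xs, ys, A) (xs', ys', B). mk_mat xs ys (\<lambda>i j. add_mor C (A (i, j)) (B (i, j)))),
      scale_mor = (\<lambda>a (xs, ys, A). mk_mat xs ys (\<lambda>i j. scale_mor C a (A (i, j)))),
      unit_ob = [unit_ob C],
      tens_ob = tens_list (tens_ob C),
      tens_mor = (\<lambda>(xs, ys, A) (xs', ys', B).
        mk_mat (tens_list (tens_ob C) xs xs') (tens_list (tens_ob C) ys ys')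
          (\<lambda>i j. A (i div length ys', j div length xs') \<otimes>\<^bsub>C\<^esub>
                 B (i mod length ys', j mod length xs'))),
      ldual = map (ldual C),
      ev_l = (\<lambda>xs. let n = length xs; d = tens_list (tens_ob C) (map (ldual C) xs) xs in
        mk_mat d [unit_ob C]
          (\<lambda>i j. if j div n = j mod n then ev_l C (xs ! (j div n)) else zero_mor C (d ! j) (unit_ob C))),
      coev_l = (\<lambda>xs. let n = length xs; d = tens_list (tens_ob C) xs (map (ldual C) xs) in
        mk_mat [unit_ob C] d
          (\<lambda>i j. if i div n = i mod n then coev_l C (xs ! (i div n)) else zero_mor C (unit_ob C) (d ! i))),
      rdual = map (rdual C),
      ev_r = (\<lambda>xs. let n = length xs; d = tens_list (tens_ob C) xs (map (rdual C) xs) in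
        mk_mat d [unit_ob C]
          (\<lambda>i j. if j div n = j mod n then ev_r C (xs ! (j div n)) else zero_mor C (d ! j) (unit_ob C))),
      coev_r = (\<lambda>xs. let n = length xs; d = tens_list (tens_ob C) (map (rdual C) xs) xs in
        mk_mat [unit_ob C] d
          (\<lambda>i j. if i div n = i mod n then coev_r C (xs ! (i div n)) else zero_mor C (unit_ob C) (d ! i))),
      pivot = (\<lambda>xs. mk_mat (map (ldual C) xs) (map (rdual C) xs)
        (\<lambda>i j. if i = j then pivot C (xs ! i) else zero_mor C (ldual C (xs ! j)) (rdual C (xs ! i)))) \<rparr>"


section \<open>Idempotent completion\<close>

text \<open>Objects are pairs \<open>(X, e)\<close> with \<open>e\<close> an idempotent endomorphism of \<open>X\<close>; a morphism from
  \<open>(X, e)\<close> to \<open>(Y, e')\<close> is an \<open>f : X \<rightarrow> Y\<close> with \<open>e' \<cdot> f \<cdot> e = f\<close>. The duals of \<open>(X, e)\<close> are the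
  duals of \<open>X\<close> with the dual idempotents.\<close>

type_synonym ('o, 'm) kar_ob = "'o \<times> 'm"
type_synonym ('o, 'm) kar_mor = "('o, 'm) kar_ob \<times> ('o, 'm) kar_ob \<times> 'm"

definition kar_unit :: "('o, 'm) pivotal_cat \<Rightarrow> ('o, 'm) kar_ob" where
  "kar_unit C = (unit_ob C, idm C (unit_ob C))"

definition kar_tens ::
  "('o, 'm) pivotal_cat \<Rightarrow> ('o, 'm) kar_ob \<Rightarrow> ('o, 'm) kar_ob \<Rightarrow> ('o, 'm) kar_ob" where
  "kar_tens C = (\<lambda>(X, e) (Y, e'). (X \<odot>\<^bsub>C\<^esub> Y, e \<otimes>\<^bsub>C\<^esub> e'))"

definition kar_ldual :: "('o, 'm) pivotal_cat \<Rightarrow> ('o, 'm) kar_ob \<Rightarrow> ('o, 'm) kar_ob" where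
  "kar_ldual C = (\<lambda>(X, e). (ldual C X, ldual_mor C X X e))"

definition kar_rdual :: "('o, 'm) pivotal_cat \<Rightarrow> ('o, 'm) kar_ob \<Rightarrow> ('o, 'm) kar_ob" where
  "kar_rdual C = (\<lambda>(X, e). (rdual C X, rdual_mor C X X e))"

definition kar_mk ::
  "('o, 'm) pivotal_cat \<Rightarrow> ('o, 'm) kar_ob \<Rightarrow> ('o, 'm) kar_ob \<Rightarrow> 'm \<Rightarrow> ('o, 'm) kar_mor" where
  "kar_mk C P Q f = (P, Q, snd Q \<cdot>\<^bsub>C\<^esub> f \<cdot>\<^bsub>C\<^esub> snd P)"

definition idempotent_completion ::
  "('o, 'm) pivotal_cat \<Rightarrow> (('o, 'm) kar_ob, ('o, 'm) kar_mor) pivotal_cat" where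
  "idempotent_completion C =
    \<lparr> Ob = {(X, e). X \<in> Ob C \<and> e \<in> Hom C X X \<and> e \<cdot>\<^bsub>C\<^esub> e = e},
      Hom = (\<lambda>P Q. {(P, Q, f) | f. f \<in> Hom C (fst P) (fst Q) \<and> snd Q \<cdot>\<^bsub>C\<^esub> f \<cdot>\<^bsub>C\<^esub> snd P = f}),
      idm = (\<lambda>P. (P, P, snd P)),
      cmp = (\<lambda>(Q', R, g) (P, Q, f). (P, R, g \<cdot>\<^bsub>C\<^esub> f)),
      zero_mor = (\<lambda>P Q. (P, Q, zero_mor C (fst P) (fst Q))),
      add_mor = (\<lambda>(P, Q, f) (P', Q', g). (P, Q, add_mor C f g)),
      scale_mor = (\<lambda>a (P, Q, f). (P, Q, scale_mor C a f)),
      unit_ob = kar_unit C,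
      tens_ob = kar_tens C,
      tens_mor = (\<lambda>(P, Q, f) (P', Q', g). (kar_tens C P P', kar_tens C Q Q', f \<otimes>\<^bsub>C\<^esub> g)),
      ldual = kar_ldual C,
      ev_l = (\<lambda>P. kar_mk C (kar_tens C (kar_ldual C P) P) (kar_unit C) (ev_l C (fst P))),
      coev_l = (\<lambda>P. kar_mk C (kar_unit C) (kar_tens C P (kar_ldual C P)) (coev_l C (fst P))),
      rdual = kar_rdual C,
      ev_r = (\<lambda>P. kar_mk C (kar_tens C P (kar_rdual C P)) (kar_unit C) (ev_r C (fst P))),
      coev_r = (\<lambda>P. kar_mk C (kar_unit C) (kar_tens C (kar_rdual C P) P) (coev_r C (fst P))),
      pivot = (\<lambda>P. kar_mk C (kar_ldual C P) (kar_rdual C P) (pivot C (fst P))) \<rparr>"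


section \<open>The Temperley--Lieb category\<close>

text \<open>A planar \<open>(m, n)\<close>-tangle without closed loops is, up to isotopy, a noncrossing perfect matching
  of the \<open>m\<close> bottom and \<open>n\<close> top boundary points. The boundary points are ordered along the
  boundary of the strip: bottom points from left to right, then top points from right to left.\<close>

datatype point = Bot nat | Top nat

type_synonym diagram = "point set set"

definition points :: "nat \<Rightarrow> nat \<Rightarrow> point set" where
  "points m n = Bot ` {..<m} \<union> Top ` {..<n}"

fun boundary_pos :: "nat \<Rightarrow> nat \<Rightarrow> point \<Rightarrow> nat" where
  "boundary_pos m n (Bot i) = i"
| "boundary_pos m n (Top j) = m + (n - 1 - j)"

definition noncrossing :: "nat \<Rightarrow> nat \<Rightarrow> diagram \<Rightarrow> bool" where
  "noncrossing m n D \<longleftrightarrow> \<not> (\<exists>a b c d. {a, b} \<in> D \<and> {c, d} \<in> D \<and>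
     boundary_pos m n a < boundary_pos m n c \<and> boundary_pos m n c < boundary_pos m n b \<and>
     boundary_pos m n b < boundary_pos m n d)"

definition diagrams :: "nat \<Rightarrow> nat \<Rightarrow> diagram set" where
  "diagrams m n = {D. partition_on (points m n) D \<and> (\<forall>b\<in>D. card b = 2) \<and> noncrossing m n D}"

text \<open>Stacking \<open>E\<close> on top of \<open>D\<close> identifies the top points of \<open>D\<close> with the bottom points of \<open>E\<close>.
  The connected components of the result that meet the outer boundary are the strands of the
  composite; the remaining ones are closed loops.\<close>

datatype glue_point = Outer point | Middle nat

fun lower_point :: "point \<Rightarrow> glue_point" where
  "lower_point (Bot i) = Outer (Bot i)"
| "lower_point (Top j) = Middle j"

fun upper_point :: "point \<Rightarrow> glue_point" where
  "upper_point (Bot j) = Middle j"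
| "upper_point (Top k) = Outer (Top k)"

definition stack_components :: "diagram \<Rightarrow> diagram \<Rightarrow> glue_point set set" where
  "stack_components E D =
     (let S = (`) lower_point ` D \<union> (`) upper_point ` E in \<Union>S // (\<Union>b\<in>S. b \<times> b)\<^sup>+)"

definition stack :: "diagram \<Rightarrow> diagram \<Rightarrow> diagram" where
  "stack E D = (\<lambda>K. Outer -` K) ` stack_components E D - {{}}"

definition loops :: "diagram \<Rightarrow> diagram \<Rightarrow> nat" where
  "loops E D = card {K \<in> stack_components E D. Outer -` K = {}}"

fun shift_point :: "nat \<Rightarrow> nat \<Rightarrow> point \<Rightarrow> point" where
  "shift_point m n (Bot i) = Bot (m + i)"
| "shift_point m n (Top j) = Top (n + j)"

definition juxtapose :: "nat \<Rightarrow> nat \<Rightarrow> diagram \<Rightarrow> diagram \<Rightarrow> diagram" where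
  "juxtapose m n D E = D \<union> (`) (shift_point m n) ` E"

definition id_diagram :: "nat \<Rightarrow> diagram" where
  "id_diagram n = (\<lambda>i. {Bot i, Top i}) ` {..<n}"

definition cap_diagram :: "nat \<Rightarrow> diagram" where
  "cap_diagram n = (\<lambda>i. {Bot i, Bot (2 * n - 1 - i)}) ` {..<n}"

definition cup_diagram :: "nat \<Rightarrow> diagram" where
  "cup_diagram n = (\<lambda>i. {Top i, Top (2 * n - 1 - i)}) ` {..<n}"

text \<open>A morphism \<open>m \<rightarrow> n\<close> is \<open>(m, n, f)\<close> with \<open>f\<close> the coefficients of a formal linear combination of
  \<open>(m, n)\<close>-diagrams.\<close>

type_synonym tl_mor = "nat \<times> nat \<times> (diagram \<Rightarrow> complex)"

definition tl_diagram :: "nat \<Rightarrow> nat \<Rightarrow> diagram \<Rightarrow> tl_mor" where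
  "tl_diagram m n D = (m, n, \<lambda>E. if E = D then 1 else 0)"

definition tl_cap :: "nat \<Rightarrow> tl_mor" where
  "tl_cap n = tl_diagram (n + n) 0 (cap_diagram n)"

definition tl_cup :: "nat \<Rightarrow> tl_mor" where
  "tl_cup n = tl_diagram 0 (n + n) (cup_diagram n)"

definition TL :: "complex \<Rightarrow> (nat, tl_mor) pivotal_cat" where
  "TL \<beta> =
    \<lparr> Ob = UNIV,
      Hom = (\<lambda>m n. {(m, n, f) | f. \<forall>D. D \<notin> diagrams m n \<longrightarrow> f D = 0}),
      idm = (\<lambda>n. tl_diagram n n (id_diagram n)),
      cmp = (\<lambda>(n', p, g) (m, n, f). (m, p, \<lambda>F. \<Sum>E\<in>diagrams n p. \<Sum>D\<in>diagrams m n.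
        if stack E D = F then \<beta> ^ loops E D * g E * f D else 0)),
      zero_mor = (\<lambda>m n. (m, n, \<lambda>_. 0)),
      add_mor = (\<lambda>(m, n, f) (m', n', g). (m, n, \<lambda>D. f D + g D)),
      scale_mor = (\<lambda>a (m, n, f). (m, n, \<lambda>D. a * f D)),
      unit_ob = 0,
      tens_ob = (+),
      tens_mor = (\<lambda>(m, n, f) (m', n', g). (m + m', n + n', \<lambda>F. \<Sum>D\<in>diagrams m n. \<Sum>E\<in>diagrams m' n'.
        if juxtapose m n D E = F then f D * g E else 0)),
      ldual = (\<lambda>n. n),
      ev_l = tl_cap,
      coev_l = tl_cup,
      rdual = (\<lambda>n. n),
      ev_r = tl_cap,
      coev_r = tl_cup,
      pivot = (\<lambda>n. tl_diagram n n (id_diagram n)) \<rparr>"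

type_synonym fusion_ob = "(nat list, (nat, tl_mor set) mat_mor) kar_ob"
type_synonym fusion_mor = "(nat list, (nat, tl_mor set) mat_mor) kar_mor"

definition TL_fusion ::
  "complex \<Rightarrow> (nat \<Rightarrow> nat \<Rightarrow> tl_mor set) \<Rightarrow> (fusion_ob, fusion_mor) pivotal_cat" where
  "TL_fusion \<beta> N = idempotent_completion (additive_completion (quotient_cat (TL \<beta>) N))"


section \<open>Endofunctors and module categories\<close>

type_synonym ('o, 'm) endo = "('o \<Rightarrow> 'o) \<times> ('m \<Rightarrow> 'm)"
type_synonym ('o, 'm) nat_trans = "('o, 'm) endo \<times> ('o, 'm) endo \<times> ('o \<Rightarrow> 'm)"

text \<open>Both components of an endofunctor, and the components of a natural transformation, are
  extensional functions, so that equality of functors and of transformations is equality in HOL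
  and composition of endofunctors is strictly associative and unital.\<close>

definition endofunctor :: "('o, 'm, 'x) lin_cat_scheme \<Rightarrow> ('o, 'm) endo \<Rightarrow> bool" where
  "endofunctor B F \<longleftrightarrow> fst F \<in> Ob B \<rightarrow>\<^sub>E Ob B \<and> snd F \<in> extensional (Arr B) \<and>
     (\<forall>X\<in>Ob B. \<forall>Y\<in>Ob B. \<forall>f\<in>Hom B X Y. snd F f \<in> Hom B (fst F X) (fst F Y)) \<and>
     (\<forall>X\<in>Ob B. snd F (idm B X) = idm B (fst F X)) \<and>
     (\<forall>X\<in>Ob B. \<forall>Y\<in>Ob B. \<forall>Z\<in>Ob B. \<forall>f\<in>Hom B X Y. \<forall>g\<in>Hom B Y Z.
        snd F (g \<cdot>\<^bsub>B\<^esub> f) = snd F g \<cdot>\<^bsub>B\<^esub> snd F f) \<and>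
     (\<forall>X\<in>Ob B. \<forall>Y\<in>Ob B. \<forall>f\<in>Hom B X Y. \<forall>g\<in>Hom B X Y.
        snd F (add_mor B f g) = add_mor B (snd F f) (snd F g)) \<and>
     (\<forall>X\<in>Ob B. \<forall>Y\<in>Ob B. \<forall>a. \<forall>f\<in>Hom B X Y.
        snd F (scale_mor B a f) = scale_mor B a (snd F f))"

definition nat_transformation ::
  "('o, 'm, 'x) lin_cat_scheme \<Rightarrow> ('o, 'm) endo \<Rightarrow> ('o, 'm) endo \<Rightarrow> ('o \<Rightarrow> 'm) \<Rightarrow> bool" where
  "nat_transformation B F G s \<longleftrightarrow> s \<in> (\<Pi>\<^sub>E X\<in>Ob B. Hom B (fst F X) (fst G X)) \<and>
     (\<forall>X\<in>Ob B. \<forall>Y\<in>Ob B. \<forall>f\<in>Hom B X Y. s Y \<cdot>\<^bsub>B\<^esub> snd F f = snd G f \<cdot>\<^bsub>B\<^esub> s X)"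

definition endo_id :: "('o, 'm, 'x) lin_cat_scheme \<Rightarrow> ('o, 'm) endo" where
  "endo_id B = (\<lambda>X\<in>Ob B. X, \<lambda>f\<in>Arr B. f)"

definition endo_cmp ::
  "('o, 'm, 'x) lin_cat_scheme \<Rightarrow> ('o, 'm) endo \<Rightarrow> ('o, 'm) endo \<Rightarrow> ('o, 'm) endo" where
  "endo_cmp B F G = (\<lambda>X\<in>Ob B. fst F (fst G X), \<lambda>f\<in>Arr B. snd F (snd G f))"

definition End_cat ::
  "('o, 'm, 'x) lin_cat_scheme \<Rightarrow> (('o, 'm) endo, ('o, 'm) nat_trans) mon_cat" where
  "End_cat B =
    \<lparr> Ob = {F. endofunctor B F},
      Hom = (\<lambda>F G. {(F, G, s) | s. nat_transformation B F G s}),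
      idm = (\<lambda>F. (F, F, \<lambda>X\<in>Ob B. idm B (fst F X))),
      cmp = (\<lambda>(G', H, t) (F, G, s). (F, H, \<lambda>X\<in>Ob B. t X \<cdot>\<^bsub>B\<^esub> s X)),
      zero_mor = (\<lambda>F G. (F, G, \<lambda>X\<in>Ob B. zero_mor B (fst F X) (fst G X))),
      add_mor = (\<lambda>(F, G, s) (F', G', t). (F, G, \<lambda>X\<in>Ob B. add_mor B (s X) (t X))),
      scale_mor = (\<lambda>a (F, G, s). (F, G, \<lambda>X\<in>Ob B. scale_mor B a (s X))),
      unit_ob = endo_id B,
      tens_ob = endo_cmp B,
      tens_mor = (\<lambda>(F, G, s) (H, K, t). (endo_cmp B F H, endo_cmp B G K,
        \<lambda>X\<in>Ob B. s (fst K X) \<cdot>\<^bsub>B\<^esub> snd F (t X))) \<rparr>"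

record ('x, 'f, 'y, 'g) mon_functor =
  on_ob :: "'x \<Rightarrow> 'y"
  on_mor :: "'f \<Rightarrow> 'g"
  mult_iso :: "'x \<Rightarrow> 'x \<Rightarrow> 'g"
  unit_iso :: "'g"

text \<open>Linear strong monoidal functors between strict monoidal categories, with structure isomorphisms
  \<open>mult_iso M X Y : M X \<odot> M Y \<rightarrow> M (X \<odot> Y)\<close> and \<open>unit_iso M : 1 \<rightarrow> M 1\<close>.\<close>

definition monoidal_functor ::
  "('x, 'f, 'a) mon_cat_scheme \<Rightarrow> ('y, 'g, 'b) mon_cat_scheme \<Rightarrow>
   ('x, 'f, 'y, 'g) mon_functor \<Rightarrow> bool" where
  "monoidal_functor C D M \<longleftrightarrow>
     on_ob M \<in> Ob C \<rightarrow> Ob D \<and>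
     (\<forall>X\<in>Ob C. \<forall>Y\<in>Ob C. \<forall>f\<in>Hom C X Y. on_mor M f \<in> Hom D (on_ob M X) (on_ob M Y)) \<and>
     (\<forall>X\<in>Ob C. on_mor M (idm C X) = idm D (on_ob M X)) \<and>
     (\<forall>X\<in>Ob C. \<forall>Y\<in>Ob C. \<forall>Z\<in>Ob C. \<forall>f\<in>Hom C X Y. \<forall>g\<in>Hom C Y Z.
        on_mor M (g \<cdot>\<^bsub>C\<^esub> f) = on_mor M g \<cdot>\<^bsub>D\<^esub> on_mor M f) \<and>
     (\<forall>X\<in>Ob C. \<forall>Y\<in>Ob C. \<forall>f\<in>Hom C X Y. \<forall>g\<in>Hom C X Y.
        on_mor M (add_mor C f g) = add_mor D (on_mor M f) (on_mor M g)) \<and>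
     (\<forall>X\<in>Ob C. \<forall>Y\<in>Ob C. \<forall>a. \<forall>f\<in>Hom C X Y.
        on_mor M (scale_mor C a f) = scale_mor D a (on_mor M f)) \<and>
     (\<forall>X\<in>Ob C. \<forall>Y\<in>Ob C.
        iso_mor D (on_ob M X \<odot>\<^bsub>D\<^esub> on_ob M Y) (on_ob M (X \<odot>\<^bsub>C\<^esub> Y)) (mult_iso M X Y)) \<and>
     iso_mor D (unit_ob D) (on_ob M (unit_ob C)) (unit_iso M) \<and>
     (\<forall>X\<in>Ob C. \<forall>X'\<in>Ob C. \<forall>Y\<in>Ob C. \<forall>Y'\<in>Ob C. \<forall>f\<in>Hom C X X'. \<forall>g\<in>Hom C Y Y'.
        mult_iso M X' Y' \<cdot>\<^bsub>D\<^esub> (on_mor M f \<otimes>\<^bsub>D\<^esub> on_mor M g) =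
        on_mor M (f \<otimes>\<^bsub>C\<^esub> g) \<cdot>\<^bsub>D\<^esub> mult_iso M X Y) \<and>
     (\<forall>X\<in>Ob C. \<forall>Y\<in>Ob C. \<forall>Z\<in>Ob C.
        mult_iso M (X \<odot>\<^bsub>C\<^esub> Y) Z \<cdot>\<^bsub>D\<^esub> (mult_iso M X Y \<otimes>\<^bsub>D\<^esub> idm D (on_ob M Z)) =
        mult_iso M X (Y \<odot>\<^bsub>C\<^esub> Z) \<cdot>\<^bsub>D\<^esub> (idm D (on_ob M X) \<otimes>\<^bsub>D\<^esub> mult_iso M Y Z)) \<and>
     (\<forall>X\<in>Ob C.
        mult_iso M (unit_ob C) X \<cdot>\<^bsub>D\<^esub> (unit_iso M \<otimes>\<^bsub>D\<^esub> idm D (on_ob M X)) = idm D (on_ob M X) \<and>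
        mult_iso M X (unit_ob C) \<cdot>\<^bsub>D\<^esub> (idm D (on_ob M X) \<otimes>\<^bsub>D\<^esub> unit_iso M) = idm D (on_ob M X))"

definition module_category ::
  "('x, 'f, 'a) mon_cat_scheme \<Rightarrow> ('o, 'm, 'b) lin_cat_scheme \<Rightarrow>
   ('x, 'f, ('o, 'm) endo, ('o, 'm) nat_trans) mon_functor \<Rightarrow> bool" where
  "module_category C B M \<longleftrightarrow> linear_category B \<and> monoidal_functor C (End_cat B) M"

text \<open>A monoidal functor carries an evaluation \<open>e : X \<odot> Y \<rightarrow> 1\<close> to \<open>M X \<odot> M Y \<rightarrow> 1\<close> and a
  coevaluation \<open>1 \<rightarrow> X \<odot> Y\<close> to \<open>1 \<rightarrow> M X \<odot> M Y\<close>; this is the duality on its full image.\<close>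

definition image_ev ::
  "('x, 'f, 'a) mon_cat_scheme \<Rightarrow> ('y, 'g, 'b) mon_cat_scheme \<Rightarrow>
   ('x, 'f, 'y, 'g) mon_functor \<Rightarrow> 'x \<Rightarrow> 'x \<Rightarrow> 'f \<Rightarrow> 'g" where
  "image_ev C D M X Y e =
     inv_mor D (unit_ob D) (on_ob M (unit_ob C)) (unit_iso M) \<cdot>\<^bsub>D\<^esub> on_mor M e \<cdot>\<^bsub>D\<^esub> mult_iso M X Y"

definition image_coev ::
  "('x, 'f, 'a) mon_cat_scheme \<Rightarrow> ('y, 'g, 'b) mon_cat_scheme \<Rightarrow>
   ('x, 'f, 'y, 'g) mon_functor \<Rightarrow> 'x \<Rightarrow> 'x \<Rightarrow> 'f \<Rightarrow> 'g" where
  "image_coev C D M X Y c =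
     inv_mor D (on_ob M X \<odot>\<^bsub>D\<^esub> on_ob M Y) (on_ob M (X \<odot>\<^bsub>C\<^esub> Y)) (mult_iso M X Y)
       \<cdot>\<^bsub>D\<^esub> on_mor M c \<cdot>\<^bsub>D\<^esub> unit_iso M"

definition image_ldual_mor ::
  "('x, 'f, 'a) pivotal_cat_scheme \<Rightarrow> ('y, 'g, 'b) mon_cat_scheme \<Rightarrow>
   ('x, 'f, 'y, 'g) mon_functor \<Rightarrow> 'x \<Rightarrow> 'x \<Rightarrow> 'g \<Rightarrow> 'g" where
  "image_ldual_mor C D M X Y \<alpha> =
     left_mate D (on_ob M (ldual C X)) (on_ob M (ldual C Y))
       (image_coev C D M X (ldual C X) (coev_l C X)) (image_ev C D M (ldual C Y) Y (ev_l C Y)) \<alpha>"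

definition image_rdual_mor ::
  "('x, 'f, 'a) pivotal_cat_scheme \<Rightarrow> ('y, 'g, 'b) mon_cat_scheme \<Rightarrow>
   ('x, 'f, 'y, 'g) mon_functor \<Rightarrow> 'x \<Rightarrow> 'x \<Rightarrow> 'g \<Rightarrow> 'g" where
  "image_rdual_mor C D M X Y \<alpha> =
     right_mate D (on_ob M (rdual C X)) (on_ob M (rdual C Y))
       (image_coev C D M (rdual C X) X (coev_r C X)) (image_ev C D M Y (rdual C Y) (ev_r C Y)) \<alpha>"

definition induces_pivotal_on_full_image ::
  "('x, 'f, 'a) pivotal_cat_scheme \<Rightarrow> ('y, 'g, 'b) mon_cat_scheme \<Rightarrow>
   ('x, 'f, 'y, 'g) mon_functor \<Rightarrow> bool" where
  "induces_pivotal_on_full_image C D M \<longleftrightarrow>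
     (\<forall>X\<in>Ob C. \<forall>Y\<in>Ob C. \<forall>\<alpha>\<in>Hom D (on_ob M X) (on_ob M Y).
        image_rdual_mor C D M X Y \<alpha> \<cdot>\<^bsub>D\<^esub> on_mor M (pivot C Y) =
        on_mor M (pivot C X) \<cdot>\<^bsub>D\<^esub> image_ldual_mor C D M X Y \<alpha>)"

definition primitive_root_of_unity :: "nat \<Rightarrow> complex \<Rightarrow> bool" where
  "primitive_root_of_unity n q \<longleftrightarrow> n > 0 \<and> q ^ n = 1 \<and> (\<forall>k. 0 < k \<and> k < n \<longrightarrow> q ^ k \<noteq> 1)"

end

(* The functor M turns the generating object into a self-dual endofunctor F of B, and evaluation turns
   the spaces Hom(S', F S), for simple S and S', into a weighted fusion graph. A reduced walk of length
   k in it gives a morphism to F^k S that is annihilated by the evaluation of any two adjacent factors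
   but is detected by the nested evaluation. A nonzero tensor ideal of TL contains, after bending and
   multiplying with cups, a combination of (2k, 0)-diagrams in which the rainbow has a nonzero
   coefficient; every other (2k, 0)-diagram joins two neighbours among the last k points. So reduced
   walks of length k do not exist. Hence the edge spaces are one-dimensional, every closed walk
   backtracks to a point, and the ratios of the weights come from a potential t on the simple objects,
   with nonzero values. For the trace on B with weights t, Tr (ev a b) = Tr (ev b a) for all
   a : Z -> F W and b : W -> F Z. This extends to the powers of F by nesting, to direct sums and to
   retracts, and the trace is nondegenerate; so the left and the right dual of a natural transformation
   between functors in the image of M coincide. *)
theory Submission
  imports Defs "HOL-Computational_Algebra.Fundamental_Theorem_Algebra"
begin

section \<open>Connected components of a family of blocks\<close>

section \<open>Gluing diagrams\<close>

text \<open>A bound on the length of reduced walks rules out both obstructions to the weights. If an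
  edge space had two independent vectors, every vector would have a nonzero successor in the reverse
  edge space with vanishing evaluation, and one could walk to and fro forever. A cyclically reduced
  closed walk can be run through forever too, because the composite of two consecutive edges that
  does not return to its start is a morphism between different simple objects, hence zero. Isolating
  the rainbow: in a combination of (2k, 0)-diagrams take a diagram D with the largest sum of closing
  positions. Unless D is the rainbow, it has a valley, a closing point directly followed by an
  opening one. A cup at the valley sends no other diagram of at most that sum to the image of D, so
  the coefficient of D survives on two points fewer. In the last step the left mate of a
  transformation is controlled by its effect under the left evaluation; the trace converts this into
  the corresponding equation for the right evaluation, and that equation determines the right
  mate.\<close>

definition conn :: "'a set set => ('a \<times> 'a) set" where
  "conn S = (\<Union>b\<in>S. b \<times> b)\<^sup>+"

definition glue :: "diagram => diagram => glue_point set set" where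
  "glue E D = (`) lower_point ` D \<union> (`) upper_point ` E"

lemma stack_components_eq: "stack_components E D = \<Union>(glue E D) // conn (glue E D)"
  by (simp add: stack_components_def Let_def conn_def glue_def)

lemma connI: "b \<in> S ==> x \<in> b ==> y \<in> b ==> (x, y) \<in> conn S" unfolding conn_def by (rule r_into_trancl) auto

lemma conn_trans: "(x, y) \<in> conn S ==> (y, z) \<in> conn S ==> (x, z) \<in> conn S"
  unfolding conn_def by (rule trancl_trans)

lemma conn_mono: "S \<subseteq> T ==> conn S \<subseteq> conn T" unfolding conn_def by (auto intro: trancl_mono)

lemma conn_sym: "(x, y) \<in> conn S ==> (y, x) \<in> conn S"
proof -
  have "sym (\<Union>b\<in>S. b \<times> b)" by (auto simp: sym_def)
  then have "sym (conn S)" unfolding conn_def by (rule sym_trancl)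
  then show "(x, y) \<in> conn S ==> (y, x) \<in> conn S" by (auto simp: sym_def)
qed

lemma conn_closed:
  assumes "(x, y) \<in> conn S" "x \<in> K" "\<And>b. b \<in> S ==> b \<inter> K \<noteq> {} ==> b \<subseteq> K"
  shows "y \<in> K"
  using assms(1,2) unfolding conn_def by (induction rule: trancl_induct) (use assms(3) in blast)+

lemma conn_in: "(x, y) \<in> conn S ==> x \<in> \<Union>S \<and> y \<in> \<Union>S"
  unfolding conn_def by (induction rule: trancl_induct) auto

lemma equiv_conn: "equiv (\<Union>S) (conn S)"
proof (rule equivI)
  show "refl_on (\<Union>S) (conn S)" by (auto simp: refl_on_def intro: connI)
  show "sym (conn S)" by (auto simp: sym_def intro: conn_sym)
  show "conn S \<subseteq> \<Union>S \<times> \<Union>S" using conn_in by fast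
  show "trans (conn S)" by (auto simp: trans_def intro: conn_trans)
qed

lemma component_memI:
  assumes "x \<in> K" "\<And>y. y \<in> K ==> (x, y) \<in> conn S" "\<And>b. b \<in> S ==> b \<inter> K \<noteq> {} ==> b \<subseteq> K"
  shows "K \<in> \<Union>S // conn S"
proof -
  have "conn S `` {x} = K" using assms conn_closed[of x _ S K] by blast
  moreover have "x \<in> \<Union>S" using assms(1,2) conn_in by fast
  ultimately show ?thesis by (metis quotientI)
qed

lemma component_closed:
  assumes "K \<in> \<Union>S // conn S" "b \<in> S" "b \<inter> K \<noteq> {}"
  shows "b \<subseteq> K"
proof
  fix y assume "y \<in> b"
  obtain x where x: "x \<in> b" "x \<in> K" using assms(3) by blast
  have "(x, y) \<in> conn S" using x(1) \<open>y \<in> b\<close> assms(2) by (rule_tac connI)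
  then show "y \<in> K" using assms(1) x(2) equiv_conn by (metis equiv_class_eq_iff in_quotient_imp_closed)
qed

lemma component_conn: "K \<in> \<Union>S // conn S ==> x \<in> K ==> y \<in> K ==> (x, y) \<in> conn S"
  using in_quotient_imp_in_rel[OF equiv_conn, of K S x y] by simp

text \<open>Disjoint nonempty connected sets that absorb every nonempty block can only be the
  components. With this criterion a guessed family is verified without computing the transitive
  closure.\<close>

lemma components_eqI:
  assumes "\<And>b. b \<in> S ==> b \<noteq> {} ==> \<exists>K\<in>P. b \<subseteq> K"
    and "\<And>K x y. K \<in> P ==> x \<in> K ==> y \<in> K ==> (x, y) \<in> conn S"
    and "disjoint P" "{} \<notin> P"
  shows "\<Union>S // conn S = P"
proof -
  have closed: "b \<subseteq> K" if *: "K \<in> P" "b \<in> S" "b \<inter> K \<noteq> {}" for K b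
  proof -
    have "b \<noteq> {}" using *(3) by blast
    then obtain K' where "K' \<in> P" "b \<subseteq> K'" using assms(1)[OF *(2)] by blast
    with that assms(3) show ?thesis by (auto simp: disjoint_def)
  qed
  show ?thesis
  proof
    show "P \<subseteq> \<Union>S // conn S"
    proof
      fix K assume K: "K \<in> P"
      then obtain x where "x \<in> K" using assms(4) by (metis ex_in_conv)
      then show "K \<in> \<Union>S // conn S" using K assms(2) closed by (intro component_memI[of x]) auto
    qed
    show "\<Union>S // conn S \<subseteq> P"
    proof
      fix K assume K: "K \<in> \<Union>S // conn S"
      then obtain x where x: "x \<in> \<Union>S" "K = conn S `` {x}" by (rule quotientE)
      then obtain K' where K': "K' \<in> P" "x \<in> K'" using assms(1) by blast
      have "K' \<subseteq> K" using assms(2) K' x by auto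
      moreover have "K \<subseteq> K'" using x(2) K' closed conn_closed[of x _ S K'] by blast
      ultimately show "K \<in> P" using K' by simp
    qed
  qed
qed

text \<open>Serves juxtaposition, where the two gluings have no point in common.\<close>

lemma components_Un:
  assumes "\<Union>S \<inter> \<Union>S' = {}"
  shows "\<Union>(S \<union> S') // conn (S \<union> S') = \<Union>S // conn S \<union> \<Union>S' // conn S'"
proof (rule components_eqI)
  have mono: "conn S \<subseteq> conn (S \<union> S')" "conn S' \<subseteq> conn (S \<union> S')" by (simp_all add: conn_mono)
  have sub: "K \<in> \<Union>T // conn T ==> K \<subseteq> \<Union>T" for K and T :: "'a set set"
    using equiv_conn in_quotient_imp_subset by metis
  show "\<exists>K\<in>\<Union>S // conn S \<union> \<Union>S' // conn S'. b \<subseteq> K" if b: "b \<in> S \<union> S'" "b \<noteq> {}" for b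
  proof -
    from b(2) obtain x where x: "x \<in> b" by blast
    have in_component: "b \<subseteq> conn T `` {x} \<and> conn T `` {x} \<in> \<Union>T // conn T" if "b \<in> T" for T
    proof
      show "b \<subseteq> conn T `` {x}" using connI[OF that x] by blast
      show "conn T `` {x} \<in> \<Union>T // conn T" by (rule quotientI) (use that x in blast)
    qed
    show ?thesis using b(1) in_component[of S] in_component[of S'] by blast
  qed
  show "(x, y) \<in> conn (S \<union> S')" if "K \<in> \<Union>S // conn S \<union> \<Union>S' // conn S'" "x \<in> K" "y \<in> K" for K x y using that(1)
  proof
    assume "K \<in> \<Union>S // conn S"
    then show ?thesis using component_conn[OF _ that(2,3)] mono(1) by blast
  next
    assume "K \<in> \<Union>S' // conn S'"
    then show ?thesis using component_conn[OF _ that(2,3)] mono(2) by blast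
  qed
  show "disjoint (\<Union>S // conn S \<union> \<Union>S' // conn S')" unfolding disjoint_def
  proof (intro ballI impI)
    fix a b assume ab: "a \<in> \<Union>S // conn S \<union> \<Union>S' // conn S'" "b \<in> \<Union>S // conn S \<union> \<Union>S' // conn S'" "a \<noteq> b"
    have eq: "a \<inter> b = {}" if "a \<in> \<Union>T // conn T" "b \<in> \<Union>T // conn T" for T
      using quotient_disj[OF equiv_conn that] ab(3) by simp
    show "a \<inter> b = {}" using ab(1,2) eq[of S] eq[of S'] sub[of a S] sub[of b S'] sub[of a S'] sub[of b S] assms
      by (elim UnE) auto
  qed
  show "{} \<notin> \<Union>S // conn S \<union> \<Union>S' // conn S'" using in_quotient_imp_non_empty[OF equiv_conn] by blast
qed

lemma conn_image:
  assumes "(x, y) \<in> conn S"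
  shows "(f x, f y) \<in> conn ((`) f ` S)"
  using assms unfolding conn_def
proof (induction rule: trancl_induct)
  case (base y)
  then obtain b where "b \<in> S" "x \<in> b" "y \<in> b" by blast
  then show ?case unfolding conn_def[symmetric] by (intro connI[of "f ` b"]) auto
next
  case (step y z)
  then obtain b where "b \<in> S" "y \<in> b" "z \<in> b" by blast
  then have "(f y, f z) \<in> conn ((`) f ` S)" by (intro connI[of "f ` b"]) auto
  with step.IH show ?case unfolding conn_def[symmetric] by (rule conn_trans)
qed

text \<open>Transport along an injective renaming; applied to shifts to the right and to half
  turns.\<close>

lemma components_image:
  assumes "inj_on f (\<Union>S)"
  shows "\<Union>((`) f ` S) // conn ((`) f ` S) = (`) f ` (\<Union>S // conn S)"
proof (rule components_eqI)
  have sub: "K \<in> \<Union>S // conn S ==> K \<subseteq> \<Union>S" for K using equiv_conn in_quotient_imp_subset by metis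
  show "\<exists>K\<in>(`) f ` (\<Union>S // conn S). b \<subseteq> K" if b: "b \<in> (`) f ` S" "b \<noteq> {}" for b
  proof -
    obtain c x where c: "c \<in> S" "b = f ` c" "x \<in> c" using b by blast
    have "c \<subseteq> conn S `` {x}" using connI[OF c(1,3)] by blast
    moreover have "conn S `` {x} \<in> \<Union>S // conn S" by (rule quotientI) (use c in blast)
    ultimately show ?thesis using c(2) by blast
  qed
  show "(x, y) \<in> conn ((`) f ` S)" if K: "K \<in> (`) f ` (\<Union>S // conn S)" "x \<in> K" "y \<in> K" for K x y
  proof -
    from K obtain K' x' y' where K': "K' \<in> \<Union>S // conn S" "x' \<in> K'" "y' \<in> K'" "x = f x'" "y = f y'" by blast
    show ?thesis unfolding K'(4,5) by (rule conn_image, rule component_conn[OF K'(1-3)])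
  qed
  show "disjoint ((`) f ` (\<Union>S // conn S))" unfolding disjoint_def
  proof (intro ballI impI, elim imageE, hypsubst)
    fix a b assume ab: "a \<in> \<Union>S // conn S" "b \<in> \<Union>S // conn S" "f ` a \<noteq> f ` b"
    then have "a \<inter> b = {}" using quotient_disj[OF equiv_conn] by blast
    moreover have "f ` a \<inter> f ` b = f ` (a \<inter> b)"
      using inj_on_image_Int[OF assms sub[OF ab(1)] sub[OF ab(2)]] by simp
    ultimately show "f ` a \<inter> f ` b = {}" by simp
  qed
  show "{} \<notin> (`) f ` (\<Union>S // conn S)" using in_quotient_imp_non_empty[OF equiv_conn] by blast
qed

text \<open>When every glued point is joined to the outer point named by \<^term>\<open>g\<close>, and \<^term>\<open>g\<close> collapses the
  blocks to a partition of the outer points, no loop arises and that partition is the composite.\<close>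

lemma stack_relabel:
  fixes g :: "glue_point => point"
  assumes P: "partition_on R P"
    and a: "\<And>x. x \<in> \<Union>(glue E D) ==> g x \<in> R \<and> (x, Outer (g x)) \<in> conn (glue E D)"
    and b: "\<And>r. Outer r \<in> \<Union>(glue E D) ==> g (Outer r) = r"
    and c: "\<And>b. b \<in> glue E D ==> b \<noteq> {} ==> \<exists>p\<in>P. g ` b \<subseteq> p"
    and d: "\<And>p r s. p \<in> P ==> r \<in> p ==> s \<in> p ==> (Outer r, Outer s) \<in> conn (glue E D)"
  shows "stack E D = P \<and> loops E D = 0"
proof -
  define S where "S = glue E D"
  note a = a[folded S_def] and b = b[folded S_def] and c = c[folded S_def] and d = d[folded S_def]
  define C where "C p = {x \<in> \<Union>S. g x \<in> p}" for p
  have oin: "Outer r \<in> \<Union>S \<and> g (Outer r) = r" if "r \<in> p" "p \<in> P" for r p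
    using conn_in[OF d[OF that(2,1,1)]] b by simp
  have out: "Outer -` C p = p" if "p \<in> P" for p
  proof (intro set_eqI iffI)
    fix r assume "r \<in> Outer -` C p"
    then show "r \<in> p" using b[of r] by (simp add: C_def)
  next
    fix r assume "r \<in> p"
    then show "r \<in> Outer -` C p" using oin[OF _ that] by (simp add: C_def)
  qed
  have nonempty: "C p \<noteq> {}" if "p \<in> P" for p using out[OF that] partition_onD3[OF P] that by auto
  have comp: "stack_components E D = C ` P" unfolding stack_components_eq S_def[symmetric]
  proof (rule components_eqI)
    fix b assume b: "b \<in> S" "b \<noteq> {}"
    obtain p where "p \<in> P" "g ` b \<subseteq> p" using c[OF b] by (elim bexE)
    then show "\<exists>K\<in>C ` P. b \<subseteq> K" using b(1) by (intro bexI[of _ "C p"] imageI) (auto simp: C_def)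
  next
    fix K x y assume K: "K \<in> C ` P" "x \<in> K" "y \<in> K"
    then obtain p where p: "p \<in> P" "x \<in> \<Union>S" "y \<in> \<Union>S" "g x \<in> p" "g y \<in> p" by (auto simp: C_def)
    \<comment> \<open>The path runs from \<open>x\<close> to its outer name, inside \<open>p\<close>
      to the outer name of \<open>y\<close>, and from there to \<open>y\<close>.\<close>
    show "(x, y) \<in> conn S"
      using conn_trans[OF conjunct2[OF a[OF p(2)]] conn_trans[OF d[OF p(1,4,5)] conn_sym[OF conjunct2[OF a[OF p(3)]]]]] .
  next
    have "C p \<inter> C q = {}" if "p \<in> P" "q \<in> P" "C p \<noteq> C q" for p q
    proof -
      have "p \<inter> q = {}" using partition_onD2[OF P] that unfolding disjoint_def by metis
      then show ?thesis by (auto simp: C_def)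
    qed
    then show "disjoint (C ` P)" by (simp add: disjoint_def)
  next
    show "{} \<notin> C ` P" using nonempty by (metis imageE)
  qed
  have "(\<lambda>K. Outer -` K) ` C ` P = P" unfolding image_image using out by simp
  then have st: "stack E D = P" using partition_onD3[OF P] by (simp add: stack_def comp)
  have "Outer -` K \<noteq> {}" if "K \<in> C ` P" for K using that out partition_onD3[OF P] by (metis imageE)
  then have eq: "{K \<in> C ` P. Outer -` K = {}} = {}" by blast
  have "loops E D = 0" unfolding loops_def comp eq by simp
  with st show ?thesis ..
qed

lemma conn_lower: "b \<in> D ==> x \<in> b ==> y \<in> b ==> (lower_point x, lower_point y) \<in> conn (glue E D)"
  unfolding glue_def by (rule connI[of "lower_point ` b"]) auto

lemma conn_upper: "b \<in> E ==> x \<in> b ==> y \<in> b ==> (upper_point x, upper_point y) \<in> conn (glue E D)"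
  unfolding glue_def by (rule connI[of "upper_point ` b"]) auto

lemma conn_refl: "x \<in> \<Union>S ==> (x, x) \<in> conn S" by (auto intro: connI)

section \<open>Composites of planar matchings are planar matchings, by counting and parity\<close>

section \<open>Closure under stacking\<close>

lemma finite_points [simp]: "finite (points m n)" by (simp add: points_def)

lemma finite_diagrams [simp]: "finite (diagrams m n)"
proof (rule finite_subset)
  show "diagrams m n \<subseteq> Pow (Pow (points m n))" by (auto simp: diagrams_def partition_on_def)
qed simp

lemma diagramsD:
  assumes "D \<in> diagrams m n"
  shows "partition_on (points m n) D" "\<And>b. b \<in> D ==> card b = 2" "noncrossing m n D"
    "\<Union>D = points m n" "finite D" "\<And>b. b \<in> D ==> finite b"
proof -
  show *: "partition_on (points m n) D" "\<And>b. b \<in> D ==> card b = 2" "noncrossing m n D"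
    using assms by (auto simp: diagrams_def)
  then show "\<Union>D = points m n" by (simp add: partition_on_def)
  with * show "finite D" using finite_elements[OF finite_points] by blast
  show "\<And>b. b \<in> D ==> finite b" using *(2) card.infinite by fastforce
qed

lemma inj_lower [simp]: "inj lower_point"
proof (rule injI)
  fix x y show "lower_point x = lower_point y ==> x = y" by (cases x; cases y) auto
qed

lemma inj_upper [simp]: "inj upper_point"
proof (rule injI)
  fix x y show "upper_point x = upper_point y ==> x = y" by (cases x; cases y) auto
qed

lemma pos_inj: "inj_on (boundary_pos m n) (points m n)" by (auto simp: inj_on_def points_def)

text \<open>For two disjoint chords the four comparisons add up to an odd number exactly when the
  chords cross. Unlike the noncrossing condition itself, this parity is additive over unions of
  blocks.\<close>

definition inversions :: "('a => nat) => 'a set => 'a set => nat" where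
  "inversions pos P Q = (\<Sum>x\<in>P. \<Sum>y\<in>Q. of_bool (pos x < pos y))"

lemma even_inversions_pair:
  assumes "card b = 2" "card c = 2" "inj_on pos (b \<union> c)" "b \<inter> c = {}"
    and "\<And>x y z w. {x, y} = b ==> {z, w} = c ==> \<not> (pos x < pos z \<and> pos z < pos y \<and> pos y < pos w)"
    and "\<And>x y z w. {x, y} = c ==> {z, w} = b ==> \<not> (pos x < pos z \<and> pos z < pos y \<and> pos y < pos w)"
  shows "even (inversions pos b c)"
proof -
  have ord: "\<exists>x y. s = {x, y} \<and> pos x < pos y" if *: "card s = 2" "s \<subseteq> b \<union> c" for s
  proof -
    obtain x y where xy: "s = {x, y}" "x \<noteq> y" using *(1) by (auto simp: card_2_iff)
    then have "pos x \<noteq> pos y" using assms(3) *(2) by (auto simp: inj_on_def)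
    then show ?thesis using xy by (metis insert_commute linorder_neqE_nat)
  qed
  obtain x y where b: "b = {x, y}" "pos x < pos y" using ord[OF assms(1)] by auto
  obtain z w where c: "c = {z, w}" "pos z < pos w" using ord[OF assms(2)] by auto
  have ne: "pos x \<noteq> pos z" "pos x \<noteq> pos w" "pos y \<noteq> pos z" "pos y \<noteq> pos w" "x \<noteq> y" "z \<noteq> w"
    using assms(3,4) b c by (auto simp: inj_on_def)
  have "\<not> (pos x < pos z \<and> pos z < pos y \<and> pos y < pos w)" "\<not> (pos z < pos x \<and> pos x < pos w \<and> pos w < pos y)"
    using assms(5)[OF b(1)[symmetric] c(1)[symmetric]] assms(6)[OF c(1)[symmetric] b(1)[symmetric]] by blast+
  then have "pos y < pos z \<or> pos w < pos x \<or> pos x < pos z \<and> pos w < pos y \<or> pos z < pos x \<and> pos y < pos w"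
    using ne(1-4) by (metis linorder_neqE_nat)
  moreover have "inversions pos b c = (of_bool (pos x < pos z) + of_bool (pos x < pos w))
      + (of_bool (pos y < pos z) + of_bool (pos y < pos w))"
  proof -
    have two: "sum f {u, v} = f u + f v" if "u \<noteq> v" for f :: "'a => nat" and u v using that by simp
    show ?thesis unfolding b(1) c(1) inversions_def two[OF ne(5)] two[OF ne(6)] ..
  qed
  ultimately show ?thesis using b(2) c(2) by (elim disjE) simp_all
qed

text \<open>The count is bilinear in the two unions, so the statement for a pair of chords extends.
  Unions are needed because a component of a gluing meets each of the two diagrams in several
  blocks.\<close>

lemma even_inversions:
  assumes D: "D \<in> diagrams m n" and XY: "X \<subseteq> D" "Y \<subseteq> D" "X \<inter> Y = {}"
  shows "even (inversions (boundary_pos m n) (\<Union>X) (\<Union>Y))"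
proof -
  note d = diagramsD[OF D]
  let ?p = "boundary_pos m n"
  have fin: "finite X" "finite Y" using d(5) XY finite_subset by blast+
  have disj: "b \<inter> c = {}" if "b \<in> D" "c \<in> D" "b \<noteq> c" for b c
    using partition_onD2[OF d(1)] that unfolding disjoint_def by blast
  have U: "sum f (\<Union>Z) = (\<Sum>b\<in>Z. sum f b)" if "Z \<subseteq> D" for f :: "point => nat" and Z
    using sum.Union_disjoint[of Z f] that d(6) disj by (auto simp: subset_iff)
  have "inversions ?p (\<Union>X) (\<Union>Y) = (\<Sum>b\<in>X. \<Sum>x\<in>b. \<Sum>c\<in>Y. \<Sum>y\<in>c. of_bool (?p x < ?p y))"
    unfolding inversions_def using U XY(1,2) by simp
  also have "... = (\<Sum>b\<in>X. \<Sum>c\<in>Y. inversions ?p b c)"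
    unfolding inversions_def by (intro sum.cong refl) (rule sum.swap)
  also have "even ..."
  proof (intro dvd_sum)
    fix b c assume bc: "b \<in> X" "c \<in> Y"
    then have bD: "b \<in> D" "c \<in> D" "b \<noteq> c" using XY by auto
    have sub: "b \<union> c \<subseteq> points m n" using d(4) bD by blast
    show "even (inversions ?p b c)"
    proof (rule even_inversions_pair)
      show "inj_on ?p (b \<union> c)" using inj_on_subset[OF pos_inj sub] .
      show "b \<inter> c = {}" using disj bD by blast
      have nc: "\<not> (?p x < ?p z \<and> ?p z < ?p y \<and> ?p y < ?p w)" if "{x, y} \<in> D" "{z, w} \<in> D" for x y z w
        using d(3) that unfolding noncrossing_def by blast
      show "\<not> (?p x < ?p z \<and> ?p z < ?p y \<and> ?p y < ?p w)" if "{x, y} = b" "{z, w} = c" for x y z w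
        using nc[of x y z w] that bD by blast
      show "\<not> (?p x < ?p z \<and> ?p z < ?p y \<and> ?p y < ?p w)" if "{x, y} = c" "{z, w} = b" for x y z w
        using nc[of x y z w] that bD by blast
    qed (use d(2) bD in simp_all)
  qed
  finally show ?thesis .
qed

text \<open>In boundary order every bottom point precedes every top point, and top points run from
  right to left; hence the full product in the middle and the exchanged arguments at the
  end.\<close>

lemma inversions_points:
  assumes "A \<subseteq> {..<m}" "A' \<subseteq> {..<m}" "J \<subseteq> {..<n}" "J' \<subseteq> {..<n}"
  shows "inversions (boundary_pos m n) (Bot ` A \<union> Top ` J) (Bot ` A' \<union> Top ` J') =
    inversions id A A' + card A * card J' + inversions id J' J"
proof -
  have fin: "finite A" "finite A'" "finite J" "finite J'" using assms finite_subset by blast+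
  have U: "sum f (Bot ` P \<union> Top ` Q) = sum (f \<circ> Bot) P + sum (f \<circ> Top) Q"
    if "finite P" "finite Q" for f :: "point => nat" and P Q
  proof -
    have "sum f (Bot ` P \<union> Top ` Q) = sum f (Bot ` P) + sum f (Top ` Q)"
      by (rule sum.union_disjoint) (use that in auto)
    then show ?thesis by (simp add: sum.reindex inj_on_def)
  qed
  have bd: "i \<in> A ==> i < m" "i \<in> A' ==> i < m" "j \<in> J ==> j < n" "j \<in> J' ==> j < n" for i j
    using assms by auto
  let ?p = "boundary_pos m n"
  have "(\<Sum>i\<in>A. \<Sum>j\<in>J'. of_bool (?p (Bot i) < ?p (Top j))) = (\<Sum>i\<in>A. \<Sum>j\<in>J'. 1 :: nat)"
    by (intro sum.cong refl) (simp add: trans_less_add1 bd)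
  then have 1: "(\<Sum>i\<in>A. \<Sum>j\<in>J'. of_bool (?p (Bot i) < ?p (Top j))) = card A * card J'" by simp
  have 2: "(\<Sum>j\<in>J. \<Sum>i\<in>A'. of_bool (?p (Top j) < ?p (Bot i))) = (0::nat)"
  proof (intro sum.neutral ballI)
    fix j i assume "j \<in> J" "i \<in> A'"
    then show "of_bool (?p (Top j) < ?p (Bot i)) = (0::nat)" using bd(2)[of i] by simp
  qed
  have "(\<Sum>j\<in>J. \<Sum>j'\<in>J'. of_bool (?p (Top j) < ?p (Top j'))) = (\<Sum>j\<in>J. \<Sum>j'\<in>J'. of_bool (j' < j) :: nat)"
  proof (intro sum.cong refl)
    fix j j' assume "j \<in> J" "j' \<in> J'"
    then have "(?p (Top j) < ?p (Top j')) = (j' < j)" using bd(3)[of j] bd(4)[of j'] by auto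
    then show "of_bool (?p (Top j) < ?p (Top j')) = (of_bool (j' < j) :: nat)" by simp
  qed
  also have "... = inversions id J' J" unfolding inversions_def id_def by (rule sum.swap)
  finally have 3: "(\<Sum>j\<in>J. \<Sum>j'\<in>J'. of_bool (?p (Top j) < ?p (Top j'))) = inversions id J' J" .
  have 4: "(\<Sum>i\<in>A. \<Sum>i'\<in>A'. of_bool (?p (Bot i) < ?p (Bot i'))) = inversions id A A'"
    by (simp only: inversions_def boundary_pos.simps id_def)
  show ?thesis unfolding inversions_def[of ?p] U[OF fin(1,3)] U[OF fin(2,4)] o_def sum.distrib 1 2 3 4 by simp
qed

lemma inversions_swap:
  assumes "finite J" "finite J'" "J \<inter> J' = {}"
  shows "inversions id J J' + inversions id J' J = card J * card (J' :: nat set)"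
proof -
  have "inversions id J' J = (\<Sum>x\<in>J. \<Sum>y\<in>J'. of_bool (y < x))"
    unfolding inversions_def id_def by (rule sum.swap)
  then have "inversions id J J' + inversions id J' J = (\<Sum>x\<in>J. \<Sum>y\<in>J'. of_bool (x < y) + of_bool (y < x))"
    by (simp only: inversions_def sum.distrib id_def)
  also have "... = (\<Sum>x\<in>J. \<Sum>y\<in>J'. 1)"
  proof (intro sum.cong refl)
    fix x y assume "x \<in> J" "y \<in> J'"
    then have "x \<noteq> y" using assms(3) by auto
    then show "of_bool (x < y) + of_bool (y < x) = (1::nat)" by auto
  qed
  finally show ?thesis by simp
qed

text \<open>A connected graph has at most one vertex more than edges. A tree is grown from
  \<open>x\<close>: as long as it is not all of \<open>K\<close>, connectedness supplies a block
  that leaves it, and this block adds exactly one point.\<close>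

lemma card_component_le:
  assumes K: "K \<in> \<Union>S // conn S" and fin: "finite S" and two: "\<And>b. b \<in> S ==> card b = 2"
  shows "card K \<le> card {b \<in> S. b \<subseteq> K} + 1"
proof -
  have fb: "finite b" if "b \<in> S" for b using two[OF that] card.infinite by fastforce
  have "K \<subseteq> \<Union>S" using K equiv_conn in_quotient_imp_subset by metis
  then have finK: "finite K" using fin fb by (meson finite_Union finite_subset)
  obtain x where x: "x \<in> K" using in_quotient_imp_non_empty[OF equiv_conn K] by blast
  have grow: "\<exists>U T. x \<in> U \<and> U \<subseteq> K \<and> card U = k + 1 \<and> T \<subseteq> {b \<in> S. b \<subseteq> U} \<and> card T = k"
    if "k < card K" for k
    using that
  proof (induction k)
    case 0
    show ?case using x by (intro exI[of _ "{x}"] exI[of _ "{}"]) simp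
  next
    case (Suc k)
    then obtain U T where U: "x \<in> U" "U \<subseteq> K" "card U = k + 1" "T \<subseteq> {b \<in> S. b \<subseteq> U}" "card T = k" by auto
    have "\<exists>b\<in>S. b \<inter> U \<noteq> {} \<and> \<not> b \<subseteq> U"
    proof (rule ccontr)
      assume no: "\<not> (\<exists>b\<in>S. b \<inter> U \<noteq> {} \<and> \<not> b \<subseteq> U)"
      have "K \<subseteq> U"
      proof
        fix y assume "y \<in> K"
        have "(x, y) \<in> conn S" using component_conn[OF K x \<open>y \<in> K\<close>] .
        then show "y \<in> U" using U(1) by (rule conn_closed) (use no in blast)
      qed
      then show False using U Suc.prems by auto
    qed
    then obtain b where b: "b \<in> S" "b \<inter> U \<noteq> {}" "\<not> b \<subseteq> U" by blast
    then have bK: "b \<subseteq> K" using component_closed[OF K b(1)] U(2) by blast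
    obtain y z where yz: "b = {y, z}" "y \<noteq> z" using two[OF b(1)] by (auto simp: card_2_iff)
    have fU: "finite U" using U(2) finK finite_subset by blast
    have "card (U \<union> b) = Suc (card U)" using b yz fU by (auto simp: insert_absorb)
    moreover have "finite T" using U(4) fin finite_subset[of T S] by auto
    moreover have "b \<notin> T" using b U(4) by blast
    ultimately have "x \<in> U \<union> b \<and> U \<union> b \<subseteq> K \<and> card (U \<union> b) = Suc k + 1 \<and>
        insert b T \<subseteq> {c \<in> S. c \<subseteq> U \<union> b} \<and> card (insert b T) = Suc k"
      using U bK b(1) by auto
    then show ?case by (intro exI)
  qed
  have "card K > 0" using x finK card_gt_0_iff by blast
  then obtain U T where UT: "U \<subseteq> K" "T \<subseteq> {b \<in> S. b \<subseteq> U}" "card T = card K - 1"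
    using grow[of "card K - 1"] by auto
  have "card T \<le> card {b \<in> S. b \<subseteq> K}" using UT fin by (intro card_mono) auto
  then show ?thesis using UT by simp
qed

lemma Union_glue:
  assumes "\<Union>D = points m n" "\<Union>E = points n p"
  shows "\<Union>(glue E D) = Outer ` Bot ` {..<m} \<union> Outer ` Top ` {..<p} \<union> Middle ` {..<n}"
proof -
  have "\<Union>(glue E D) = lower_point ` (\<Union>D) \<union> upper_point ` (\<Union>E)"
    unfolding glue_def Union_Un_distrib image_Union by (rule refl)
  also have "... = lower_point ` points m n \<union> upper_point ` points n p" by (simp only: assms)
  also have "... = Outer ` Bot ` {..<m} \<union> Outer ` Top ` {..<p} \<union> Middle ` {..<n}"
    unfolding points_def image_Un image_image lower_point.simps upper_point.simps by (simp add: Un_ac)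
  finally show ?thesis .
qed

lemma even_Union_blocks:
  assumes "D \<in> diagrams m n" "X \<subseteq> D"
  shows "card (\<Union>X) = 2 * card X"
proof -
  note d = diagramsD[OF assms(1)]
  have "card (\<Union>X) = sum card X" using partition_onD2[OF d(1)] d(6) assms(2)
    by (intro card_Union_disjoint) (auto simp: disjoint_def pairwise_def disjnt_def)
  then show ?thesis using d(2) assms(2) by (simp add: subset_iff)
qed

text \<open>Each component \<open>K\<close> is split into its bottom points \<open>A K\<close>,
  middle points \<open>J K\<close> and top points \<open>T K\<close>. The edge count bounds the
  number of outer points by two, and the inversion parities of \<open>D\<close> and \<open>E\<close>
  combine to that of the composite.\<close>

lemma stack_closed:
  assumes D: "D \<in> diagrams m n" and E: "E \<in> diagrams n p"
  shows "stack E D \<in> diagrams m p"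
proof -
  note d = diagramsD[OF D] and e = diagramsD[OF E]
  define S where "S = glue E D"
  define A where "A K = {i. Outer (Bot i) \<in> K}" for K
  define J where "J K = {j. Middle j \<in> K}" for K
  define T where "T K = {k. Outer (Top k) \<in> K}" for K
  have US: "\<Union>S = Outer ` Bot ` {..<m} \<union> Outer ` Top ` {..<p} \<union> Middle ` {..<n}"
    unfolding S_def by (rule Union_glue[OF d(4) e(4)])
  have finS: "finite S" using d(5) e(5) by (simp add: S_def glue_def)
  have two: "card b = 2" if "b \<in> S" for b
    using that d(2) e(2) by (auto simp: S_def glue_def card_image inj_on_subset[OF inj_lower] inj_on_subset[OF inj_upper])
  have comp: "stack_components E D = \<Union>S // conn S" by (simp add: stack_components_eq S_def)
  have sub: "K \<subseteq> \<Union>S" if "K \<in> \<Union>S // conn S" for K using that equiv_conn in_quotient_imp_subset by metis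
  have bounds: "A K \<subseteq> {..<m}" "J K \<subseteq> {..<n}" "T K \<subseteq> {..<p}" if "K \<in> \<Union>S // conn S" for K
    using sub[OF that] by (auto simp: A_def J_def T_def US)
  have fin: "finite (A K)" "finite (J K)" "finite (T K)" if "K \<in> \<Union>S // conn S" for K
    using bounds[OF that] finite_subset by blast+
  have L: "Bot ` A K \<union> Top ` J K = \<Union>{b \<in> D. lower_point ` b \<subseteq> K}" if K: "K \<in> \<Union>S // conn S" for K
  proof -
    have "Bot ` A K \<union> Top ` J K = {x. lower_point x \<in> K}"
      by (auto simp: A_def J_def image_iff) (metis lower_point.simps point.exhaust)
    also have "... = {x \<in> points m n. lower_point x \<in> K}"
    proof -
      have "x \<in> points m n" if "lower_point x \<in> K" for x
        using that bounds[OF K] by (cases x) (auto simp: A_def J_def points_def)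
      then show ?thesis by blast
    qed
    also have "... = {x \<in> \<Union>D. lower_point x \<in> K}" by (simp add: d(4))
    also have "... = \<Union>{b \<in> D. lower_point ` b \<subseteq> K}"
    proof -
      have "lower_point ` b \<subseteq> K" if "b \<in> D" "x \<in> b" "lower_point x \<in> K" for b x
        using component_closed[OF K, of "lower_point ` b"] that by (auto simp: S_def glue_def)
      then show ?thesis by blast
    qed
    finally show ?thesis .
  qed
  have U: "Bot ` J K \<union> Top ` T K = \<Union>{b \<in> E. upper_point ` b \<subseteq> K}" if K: "K \<in> \<Union>S // conn S" for K
  proof -
    have "Bot ` J K \<union> Top ` T K = {x. upper_point x \<in> K}"
      by (auto simp: T_def J_def image_iff) (metis upper_point.simps point.exhaust)
    also have "... = {x \<in> points n p. upper_point x \<in> K}"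
    proof -
      have "x \<in> points n p" if "upper_point x \<in> K" for x
        using that bounds[OF K] by (cases x) (auto simp: T_def J_def points_def)
      then show ?thesis by blast
    qed
    also have "... = {x \<in> \<Union>E. upper_point x \<in> K}" by (simp add: e(4))
    also have "... = \<Union>{b \<in> E. upper_point ` b \<subseteq> K}"
    proof -
      have "upper_point ` b \<subseteq> K" if "b \<in> E" "x \<in> b" "upper_point x \<in> K" for b x
        using component_closed[OF K, of "upper_point ` b"] that by (auto simp: S_def glue_def)
      then show ?thesis by blast
    qed
    finally show ?thesis .
  qed
  have O: "Outer -` K = Bot ` A K \<union> Top ` T K" for K
    by (auto simp: A_def T_def image_iff) (metis point.exhaust)
  have cardU: "card (Bot ` P \<union> Top ` Q) = card P + card Q" if "finite P" "finite Q" for P Q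
    by (subst card_Un_disjoint) (use that in "auto simp: card_image inj_on_def")
  have cL: "card (A K) + card (J K) = 2 * card {b \<in> D. lower_point ` b \<subseteq> K}" if K: "K \<in> \<Union>S // conn S" for K
    using even_Union_blocks[OF D, of "{b \<in> D. lower_point ` b \<subseteq> K}"] L[OF K] cardU[OF fin(1,2)[OF K]] by simp
  have cU: "card (J K) + card (T K) = 2 * card {b \<in> E. upper_point ` b \<subseteq> K}" if K: "K \<in> \<Union>S // conn S" for K
    using even_Union_blocks[OF E, of "{b \<in> E. upper_point ` b \<subseteq> K}"] U[OF K] cardU[OF fin(2,3)[OF K]] by simp
  \<comment> \<open>The lower blocks in \<open>K\<close> number half of
    \<open>card (A K) + card (J K)\<close>, the upper ones half of
    \<open>card (J K) + card (T K)\<close>. Having at most one vertex more than edges leaves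
    \<open>card (A K) + card (T K) \<le> 2\<close>, and this number is even.\<close>
  have card2: "card (Outer -` K) = 2" if K: "K \<in> \<Union>S // conn S" "Outer -` K \<noteq> {}" for K
  proof -
    have "x \<in> K \<longleftrightarrow> x \<in> Outer ` (Outer -` K) \<union> Middle ` J K" for x by (cases x) (auto simp: J_def)
    then have "K = Outer ` (Bot ` A K \<union> Top ` T K) \<union> Middle ` J K" unfolding O[symmetric] by (rule set_eqI)
    moreover have "card (Outer ` (Bot ` A K \<union> Top ` T K) \<union> Middle ` J K) =
        card (Outer ` (Bot ` A K \<union> Top ` T K)) + card (Middle ` J K)"
      by (rule card_Un_disjoint) (use fin[OF K(1)] in auto)
    ultimately have cK: "card K = card (A K) + card (T K) + card (J K)"
      using cardU[OF fin(1,3)[OF K(1)]] by (simp add: card_image inj_on_def)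
    have "{b \<in> S. b \<subseteq> K} \<subseteq> (`) lower_point ` {b \<in> D. lower_point ` b \<subseteq> K} \<union> (`) upper_point ` {b \<in> E. upper_point ` b \<subseteq> K}"
      by (auto simp: S_def glue_def)
    then have "card {b \<in> S. b \<subseteq> K} \<le> card ((`) lower_point ` {b \<in> D. lower_point ` b \<subseteq> K} \<union> (`) upper_point ` {b \<in> E. upper_point ` b \<subseteq> K})"
      by (intro card_mono) (use d(5) e(5) in auto)
    also have "... \<le> card ((`) lower_point ` {b \<in> D. lower_point ` b \<subseteq> K}) + card ((`) upper_point ` {b \<in> E. upper_point ` b \<subseteq> K})"
      by (rule card_Un_le)
    also have "... \<le> card {b \<in> D. lower_point ` b \<subseteq> K} + card {b \<in> E. upper_point ` b \<subseteq> K}"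
      by (intro add_mono card_image_le) (use d(5) e(5) in auto)
    finally have "card K \<le> card {b \<in> D. lower_point ` b \<subseteq> K} + card {b \<in> E. upper_point ` b \<subseteq> K} + 1"
      using card_component_le[OF K(1) finS two] by simp
    then have le: "card (A K) + card (T K) \<le> 2" using cK cL[OF K(1)] cU[OF K(1)] by linarith
    have cO: "card (Outer -` K) = card (A K) + card (T K)" unfolding O by (rule cardU[OF fin(1,3)[OF K(1)]])
    have "finite (Outer -` K)" unfolding O using fin[OF K(1)] by simp
    then have "card (Outer -` K) > 0" using K(2) by (simp add: card_gt_0_iff)
    moreover have "even (card (A K) + card (T K))" using cL[OF K(1)] cU[OF K(1)] by presburger
    ultimately show ?thesis using le cO by presburger
  qed
  have disjK: "K \<inter> K' = {}" if "K \<in> \<Union>S // conn S" "K' \<in> \<Union>S // conn S" "K \<noteq> K'" for K K'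
    using quotient_disj[OF equiv_conn that(1,2)] that(3) by simp
  have st: "stack E D = {Outer -` K | K. K \<in> \<Union>S // conn S \<and> Outer -` K \<noteq> {}}" by (auto simp: stack_def comp)
  \<comment> \<open>The parities for \<open>D\<close> and \<open>E\<close> are added. Their middle
    contributions count the pairs of middle points of \<open>K\<close> and \<open>K'\<close> in both
    directions, so they add up to a product of cardinalities.\<close>
  have even: "even (inversions (boundary_pos m p) (Outer -` K) (Outer -` K'))"
    if K: "K \<in> \<Union>S // conn S" and K': "K' \<in> \<Union>S // conn S" and "K \<noteq> K'" for K K'
  proof -
    have dis: "K \<inter> K' = {}" using disjK that by blast
    have ne: "b \<noteq> {}" if "b \<in> D \<union> E" for b using that d(2) e(2) by fastforce
    have "even (inversions (boundary_pos m n) (Bot ` A K \<union> Top ` J K) (Bot ` A K' \<union> Top ` J K'))"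
      unfolding L[OF K] L[OF K'] by (rule even_inversions[OF D]) (use dis ne in fast)+
    then have 1: "even (inversions id (A K) (A K') + card (A K) * card (J K') + inversions id (J K') (J K))"
      by (subst (asm) inversions_points) (use bounds[OF K] bounds[OF K'] in auto)
    have "even (inversions (boundary_pos n p) (Bot ` J K \<union> Top ` T K) (Bot ` J K' \<union> Top ` T K'))"
      unfolding U[OF K] U[OF K'] by (rule even_inversions[OF E]) (use dis ne in fast)+
    then have 2: "even (inversions id (J K) (J K') + card (J K) * card (T K') + inversions id (T K') (T K))"
      by (subst (asm) inversions_points) (use bounds[OF K] bounds[OF K'] in auto)
    have 3: "inversions id (J K) (J K') + inversions id (J K') (J K) = card (J K) * card (J K')"
      by (rule inversions_swap) (use fin[OF K] fin[OF K'] dis in "auto simp: J_def")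
    have p1: "even (card (A K)) = even (card (J K))" "even (card (A K')) = even (card (J K'))"
      using cL[OF K] cL[OF K'] by presburger+
    have p2: "even (card (T K)) = even (card (J K))" "even (card (T K')) = even (card (J K'))"
      using cU[OF K] cU[OF K'] by presburger+
    \<comment> \<open>The four terms are the expansion of
      \<open>(card (A K) + card (J K)) * (card (J K') + card (T K'))\<close>, whose factors are
      even.\<close>
    have 4: "even (card (A K) * card (J K') + card (J K) * card (T K') + card (J K) * card (J K') + card (A K) * card (T K'))"
      using p1 p2 by (simp add: even_mult_iff)
    have "inversions (boundary_pos m p) (Outer -` K) (Outer -` K') =
        inversions id (A K) (A K') + card (A K) * card (T K') + inversions id (T K') (T K)"
      unfolding O by (rule inversions_points) (use bounds[OF K] bounds[OF K'] in auto)
    moreover have "even x" if "even (a + b + c)" "even (d + e + f)" "d + c = g" "even (b + e + g + h)"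
        "x = a + h + f" for a b c d e f g h x :: nat
      using that by presburger
    ultimately show ?thesis using 1 2 3 4 by blast
  qed
  have part: "partition_on (points m p) (stack E D)"
  proof (rule partition_onI)
    show "\<Union>(stack E D) = points m p"
    proof -
      have "\<Union>(stack E D) = Outer -` (\<Union>(\<Union>S // conn S))" unfolding st by blast
      also have "\<Union>(\<Union>S // conn S) = \<Union>S" by (rule Union_quotient[OF equiv_conn])
      also have "Outer -` (\<Union>S) = points m p" unfolding US by (auto simp: points_def)
      finally show ?thesis .
    qed
    show "{} \<notin> stack E D" by (auto simp: st)
    fix a b assume "a \<in> stack E D" "b \<in> stack E D" "a \<noteq> b"
    then show "disjnt a b" unfolding st disjnt_def using disjK by blast
  qed
  have "noncrossing m p (stack E D)" unfolding noncrossing_def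
  proof (intro notI, elim exE conjE)
    fix x y z w assume xy: "{x, y} \<in> stack E D" and zw: "{z, w} \<in> stack E D"
      and lt: "boundary_pos m p x < boundary_pos m p z" "boundary_pos m p z < boundary_pos m p y"
        "boundary_pos m p y < boundary_pos m p w"
    obtain K where K: "{x, y} = Outer -` K" "K \<in> \<Union>S // conn S" using xy by (auto simp: st)
    obtain K' where K': "{z, w} = Outer -` K'" "K' \<in> \<Union>S // conn S" using zw by (auto simp: st)
    have ne: "x \<noteq> y" "z \<noteq> w" using lt by auto
    have "z \<noteq> x" "z \<noteq> y" using lt by auto
    then have "K \<noteq> K'" using K(1) K'(1) by auto
    then have "even (inversions (boundary_pos m p) {x, y} {z, w})"
      unfolding K(1) K'(1) using even K(2) K'(2) by blast
    then show False using lt ne by (auto simp: inversions_def)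
  qed
  then show ?thesis using part card2 by (auto simp: diagrams_def st)
qed

section \<open>Identity, nested caps and cups, juxtaposition\<close>

lemma noncrossingI:
  assumes "\<And>a b c d. {a, b} \<in> D ==> {c, d} \<in> D ==> boundary_pos m n a < boundary_pos m n c ==>
     boundary_pos m n c < boundary_pos m n b ==> boundary_pos m n b < boundary_pos m n d ==> False"
  shows "noncrossing m n D"
  using assms unfolding noncrossing_def by blast

lemma in_points [simp]: "Bot i \<in> points m n \<longleftrightarrow> i < m" "Top i \<in> points m n \<longleftrightarrow> i < n" by (auto simp: points_def)

lemma id_diagram_closed: "id_diagram n \<in> diagrams n n"
proof -
  have "partition_on (points n n) (id_diagram n)"
    by (rule partition_onI) (auto simp: id_diagram_def points_def disjnt_def)
  moreover have "noncrossing n n (id_diagram n)"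
    by (rule noncrossingI) (auto simp: id_diagram_def doubleton_eq_iff)
  ultimately show ?thesis by (auto simp: diagrams_def id_diagram_def)
qed

lemma cap_diagram_closed: "cap_diagram n \<in> diagrams (n + n) 0"
proof -
  have "partition_on (points (n + n) 0) (cap_diagram n)"
  proof (rule partition_onI)
    have "\<Union>((\<lambda>i. {i, 2 * n - 1 - i}) ` {..<n}) = {..<n + n}"
    proof (intro set_eqI iffI)
      fix i assume i: "i \<in> {..<n + n}"
      show "i \<in> \<Union>((\<lambda>i. {i, 2 * n - 1 - i}) ` {..<n})"
      proof (cases "i < n")
        case False
        then have "i \<in> {2 * n - 1 - i, 2 * n - 1 - (2 * n - 1 - i)}" "2 * n - 1 - i < n" using i by auto
        then show ?thesis by blast
      qed auto
    qed auto
    moreover have "\<Union>(cap_diagram n) = Bot ` \<Union>((\<lambda>i. {i, 2 * n - 1 - i}) ` {..<n})"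
      by (auto simp: cap_diagram_def)
    ultimately show "\<Union>(cap_diagram n) = points (n + n) 0" by (simp add: points_def)
    show "{} \<notin> cap_diagram n" by (auto simp: cap_diagram_def)
    fix p q assume pq: "p \<in> cap_diagram n" "q \<in> cap_diagram n" "p \<noteq> q"
    obtain i j where "i < n" "j < n" "p = {Bot i, Bot (2 * n - 1 - i)}" "q = {Bot j, Bot (2 * n - 1 - j)}"
      using pq(1,2) by (auto simp: cap_diagram_def)
    then show "disjnt p q" using pq(3) by (auto simp: disjnt_def)
  qed
  moreover have "noncrossing (n + n) 0 (cap_diagram n)"
  proof (rule noncrossingI)
    \<comment> \<open>All blocks have the same sum of positions, so \<open>a < c\<close> and
      \<open>b < d\<close> cannot hold together.\<close>
    have *: "boundary_pos (n + n) 0 a + boundary_pos (n + n) 0 b = 2 * n - 1" if ab: "{a, b} \<in> cap_diagram n" for a b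
    proof -
      obtain i where i: "i < n" "{a, b} = {Bot i, Bot (2 * n - 1 - i)}"
        using ab unfolding cap_diagram_def by blast
      from i(2) show ?thesis unfolding doubleton_eq_iff by (elim disjE) (use i(1) in simp_all)
    qed
    fix a b c d assume "{a, b} \<in> cap_diagram n" "{c, d} \<in> cap_diagram n"
      "boundary_pos (n + n) 0 a < boundary_pos (n + n) 0 c" "boundary_pos (n + n) 0 b < boundary_pos (n + n) 0 d"
    then show False using *[of a b] *[of c d] by linarith
  qed
  moreover have "card {Bot i, Bot (2 * n - 1 - i)} = 2" if "i < n" for i
  proof -
    have "i \<noteq> 2 * n - 1 - i" using that by presburger
    then show ?thesis by simp
  qed
  ultimately show ?thesis by (auto simp: diagrams_def cap_diagram_def)
qed

lemma cup_diagram_closed: "cup_diagram n \<in> diagrams 0 (n + n)"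
proof -
  have "partition_on (points 0 (n + n)) (cup_diagram n)"
  proof (rule partition_onI)
    have "\<Union>((\<lambda>i. {i, 2 * n - 1 - i}) ` {..<n}) = {..<n + n}"
    proof (intro set_eqI iffI)
      fix i assume i: "i \<in> {..<n + n}"
      show "i \<in> \<Union>((\<lambda>i. {i, 2 * n - 1 - i}) ` {..<n})"
      proof (cases "i < n")
        case False
        then have "i \<in> {2 * n - 1 - i, 2 * n - 1 - (2 * n - 1 - i)}" "2 * n - 1 - i < n" using i by auto
        then show ?thesis by blast
      qed auto
    qed auto
    moreover have "\<Union>(cup_diagram n) = Top ` \<Union>((\<lambda>i. {i, 2 * n - 1 - i}) ` {..<n})"
      by (auto simp: cup_diagram_def)
    ultimately show "\<Union>(cup_diagram n) = points 0 (n + n)" by (simp add: points_def)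
    show "{} \<notin> cup_diagram n" by (auto simp: cup_diagram_def)
    fix p q assume pq: "p \<in> cup_diagram n" "q \<in> cup_diagram n" "p \<noteq> q"
    obtain i j where "i < n" "j < n" "p = {Top i, Top (2 * n - 1 - i)}" "q = {Top j, Top (2 * n - 1 - j)}"
      using pq(1,2) by (auto simp: cup_diagram_def)
    then show "disjnt p q" using pq(3) by (auto simp: disjnt_def)
  qed
  moreover have "noncrossing 0 (n + n) (cup_diagram n)"
  proof (rule noncrossingI)
    have *: "boundary_pos 0 (n + n) a + boundary_pos 0 (n + n) b = 2 * n - 1" if ab: "{a, b} \<in> cup_diagram n" for a b
    proof -
      obtain i where i: "i < n" "{a, b} = {Top i, Top (2 * n - 1 - i)}"
        using ab unfolding cup_diagram_def by blast
      from i(2) show ?thesis unfolding doubleton_eq_iff by (elim disjE) (use i(1) in simp_all)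
    qed
    fix a b c d assume "{a, b} \<in> cup_diagram n" "{c, d} \<in> cup_diagram n"
      "boundary_pos 0 (n + n) a < boundary_pos 0 (n + n) c" "boundary_pos 0 (n + n) b < boundary_pos 0 (n + n) d"
    then show False using *[of a b] *[of c d] by linarith
  qed
  moreover have "card {Top i, Top (2 * n - 1 - i)} = 2" if "i < n" for i
  proof -
    have "i \<noteq> 2 * n - 1 - i" using that by presburger
    then show ?thesis by simp
  qed
  ultimately show ?thesis by (auto simp: diagrams_def cup_diagram_def)
qed

lemma inj_shift [simp]: "inj (shift_point m n)"
proof (rule injI)
  fix x y show "shift_point m n x = shift_point m n y ==> x = y" by (cases x; cases y) auto
qed

lemma shift_points_disjoint: "x \<in> points m n ==> x \<noteq> shift_point m n y" by (cases y) (auto simp: points_def)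

lemma juxtapose_closed:
  assumes D: "D \<in> diagrams m n" and E: "E \<in> diagrams m' n'"
  shows "juxtapose m n D E \<in> diagrams (m + m') (n + n')"
proof -
  note d = diagramsD[OF D] and e = diagramsD[OF E]
  let ?s = "shift_point m n" and ?p = "boundary_pos (m + m') (n + n')"
  have "partition_on (points (m + m') (n + n')) (D \<union> (`) ?s ` E)"
  proof (rule partition_onI)
    have "\<Union>(D \<union> (`) ?s ` E) = points m n \<union> ?s ` points m' n'"
      unfolding d(4)[symmetric] e(4)[symmetric] image_Union Union_Un_distrib ..
    also have "... = points (m + m') (n + n')"
    proof (intro set_eqI iffI)
      fix x assume "x \<in> points (m + m') (n + n')"
      then consider i where "x = Bot i" "i < m + m'" | j where "x = Top j" "j < n + n'"
        by (auto simp: points_def)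
      then show "x \<in> points m n \<union> ?s ` points m' n'"
      proof cases
        case (1 i)
        then have "x \<in> points m n \<or> x = ?s (Bot (i - m)) \<and> Bot (i - m) \<in> points m' n'" by auto
        then show ?thesis by blast
      next
        case (2 j)
        then have "x \<in> points m n \<or> x = ?s (Top (j - n)) \<and> Top (j - n) \<in> points m' n'" by auto
        then show ?thesis by blast
      qed
    qed (auto simp: points_def)
    finally show "\<Union>(D \<union> (`) ?s ` E) = points (m + m') (n + n')" .
    have ne: "c \<noteq> {}" if "c \<in> D \<or> c \<in> E" for c using that d(2) e(2) by fastforce
    show "{} \<notin> D \<union> (`) ?s ` E" using ne by blast
    fix b c assume b: "b \<in> D \<union> (`) ?s ` E" and c: "c \<in> D \<union> (`) ?s ` E" "b \<noteq> c"
    have dD: "x \<inter> y = {}" if "x \<in> D" "y \<in> D" "x \<noteq> y" for x y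
      using partition_onD2[OF d(1)] that unfolding disjoint_def by blast
    have dE: "x \<inter> y = {}" if "x \<in> E" "y \<in> E" "x \<noteq> y" for x y
      using partition_onD2[OF e(1)] that unfolding disjoint_def by blast
    have dX: "x \<inter> ?s ` y = {}" if "x \<in> D" for x y using that d(4) shift_points_disjoint[of _ m n] by blast
    show "disjnt b c" unfolding disjnt_def
    proof -
      consider "b \<in> D" "c \<in> D" | b' where "b = ?s ` b'" "c \<in> D" | c' where "b \<in> D" "c = ?s ` c'"
        | b' c' where "b = ?s ` b'" "c = ?s ` c'" "b' \<in> E" "c' \<in> E" using b c by blast
      then show "b \<inter> c = {}"
      proof cases
        case (4 b' c')
        then have "b' \<inter> c' = {}" using dE c(2) by blast
        then show ?thesis unfolding 4 by (simp add: image_Int[symmetric])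
      qed (use dD dX c(2) in blast)+
    qed
  qed
  moreover have "card b = 2" if "b \<in> D \<union> (`) ?s ` E" for b
    using that d(2) e(2) by (auto simp: card_image inj_on_subset[OF inj_shift])
  moreover have "noncrossing (m + m') (n + n') (D \<union> (`) ?s ` E)"
  proof (rule noncrossingI)
    fix a b c d' assume ab: "{a, b} \<in> D \<union> (`) ?s ` E" and cd: "{c, d'} \<in> D \<union> (`) ?s ` E"
      and lt: "?p a < ?p c" "?p c < ?p b" "?p b < ?p d'"
    \<comment> \<open>In boundary order the second diagram fills the interval that starts at
      \<open>m\<close> and has length \<open>m' + n'\<close>; the upper points of the first diagram
      are pushed behind it.\<close>
    have pD: "?p x = (if boundary_pos m n x < m then boundary_pos m n x else boundary_pos m n x + (m' + n'))"
      if "x \<in> points m n" for x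
      using that by (cases x) (auto simp: points_def)
    have pE: "?p (?s x) = boundary_pos m' n' x + m" if "x \<in> points m' n'" for x
      using that by (cases x) (auto simp: points_def)
    have bE: "boundary_pos m' n' x < m' + n'" if "x \<in> points m' n'" for x
      using that by (cases x) (auto simp: points_def)
    have doubleton: "\<exists>x' y'. x = ?s x' \<and> y = ?s y' \<and> {x', y'} \<in> E" if xy: "{x, y} \<in> (`) ?s ` E" for x y
    proof -
      obtain b' where b': "b' \<in> E" "{x, y} = ?s ` b'" using xy by blast
      obtain x' y' where "x' \<in> b'" "y' \<in> b'" "x = ?s x'" "y = ?s y'" using b' by blast
      moreover have "b' = {x', y'}"
      proof -
        have "?s ` b' = ?s ` {x', y'}" using b' calculation by simp
        then show ?thesis by (simp only: inj_image_eq_iff[OF inj_shift])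
      qed
      ultimately show ?thesis using b' by blast
    qed
    have inD: "x \<in> points m n \<and> y \<in> points m n" if "{x, y} \<in> D" for x y using that d(4) by blast
    have inE: "x \<in> points m' n' \<and> y \<in> points m' n'" if "{x, y} \<in> E" for x y using that e(4) by blast
    have ncD: "\<not> (boundary_pos m n a < boundary_pos m n c \<and> boundary_pos m n c < boundary_pos m n b \<and>
      boundary_pos m n b < boundary_pos m n d')" if "{a, b} \<in> D" "{c, d'} \<in> D"
      using d(3) that unfolding noncrossing_def by blast
    show False
    proof (cases "{a, b} \<in> D"; cases "{c, d'} \<in> D")
      assume *: "{a, b} \<in> D" "{c, d'} \<in> D"
      show False using ncD[OF *] lt inD[OF *(1)] inD[OF *(2)] by (auto simp: pD split: if_splits)
    next
      assume *: "{a, b} \<in> D" "{c, d'} \<notin> D"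
      then obtain c' d'' where **: "c = ?s c'" "d' = ?s d''" "{c', d''} \<in> E" using doubleton cd by blast
      show False using lt inD[OF *(1)] inE[OF **(3)] bE[of c'] bE[of d''] unfolding **(1,2)
        by (auto simp: pD pE split: if_splits)
    next
      assume *: "{a, b} \<notin> D" "{c, d'} \<in> D"
      then obtain c' d'' where **: "a = ?s c'" "b = ?s d''" "{c', d''} \<in> E" using doubleton ab by blast
      show False using lt inD[OF *(2)] inE[OF **(3)] bE[of c'] bE[of d''] unfolding **(1,2)
        by (auto simp: pD pE split: if_splits)
    next
      assume *: "{a, b} \<notin> D" "{c, d'} \<notin> D"
      obtain a' b' where 1: "a = ?s a'" "b = ?s b'" "{a', b'} \<in> E" using doubleton ab * by blast
      obtain c' d'' where 2: "c = ?s c'" "d' = ?s d''" "{c', d''} \<in> E" using doubleton cd * by blast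
      have "\<not> (boundary_pos m' n' a' < boundary_pos m' n' c' \<and> boundary_pos m' n' c' < boundary_pos m' n' b' \<and>
        boundary_pos m' n' b' < boundary_pos m' n' d'')"
        using e(3) 1(3) 2(3) unfolding noncrossing_def by blast
      then show False using lt inE[OF 1(3)] inE[OF 2(3)] unfolding 1(1,2) 2(1,2) by (auto simp: pE)
    qed
  qed
  ultimately show ?thesis by (simp add: diagrams_def juxtapose_def)
qed

lemma juxtapose_id: "juxtapose m m (id_diagram m) (id_diagram n) = id_diagram (m + n)"
proof -
  have "(`) (shift_point m m) ` id_diagram n = (\<lambda>i. {Bot i, Top i}) ` {m..<m + n}"
  proof -
    have "{m..<m + n} = (+) m ` {..<n}" by (simp add: lessThan_atLeast0 add.commute)
    then show ?thesis by (simp add: id_diagram_def image_image)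
  qed
  moreover have "{..<m + n} = {..<m} \<union> {m..<m + n}" by auto
  ultimately show ?thesis by (simp add: juxtapose_def id_diagram_def image_Un)
qed

lemma juxtapose_assoc:
  "juxtapose (m + m') (n + n') (juxtapose m n D E) F = juxtapose m n D (juxtapose m' n' E F)"
proof -
  have "shift_point m n (shift_point m' n' x) = shift_point (m + m') (n + n') x" for x by (cases x) auto
  then show ?thesis by (auto simp: juxtapose_def image_Un image_image)
qed

lemma stack_id_right:
  assumes D: "D \<in> diagrams m n"
  shows "stack D (id_diagram m) = D" "loops D (id_diagram m) = 0"
proof -
  note d = diagramsD[OF D]
  let ?G = "glue D (id_diagram m)"
  \<comment> \<open>Middle points slide down along their identity strands.\<close>
  define g where "g x = (case x of Middle j => Bot j | Outer r => r)" for x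
  have gu: "g (upper_point x) = x" for x by (cases x) (auto simp: g_def)
  have id: "\<Union>(id_diagram m) = points m m" using diagramsD(4)[OF id_diagram_closed] .
  have U: "\<Union>?G = Outer ` Bot ` {..<m} \<union> Outer ` Top ` {..<n} \<union> Middle ` {..<m}"
    by (rule Union_glue[OF id d(4)])
  have mid: "(Middle i, Outer (Bot i)) \<in> conn ?G" if "i < m" for i
    using conn_lower[of "{Bot i, Top i}" "id_diagram m" "Top i" "Bot i" D] that by (auto simp: id_diagram_def)
  have up: "(Outer x, upper_point x) \<in> conn ?G" if "x \<in> points m n" for x
  proof (cases x)
    case (Bot i)
    then show ?thesis using mid[of i] that conn_sym by (auto simp: points_def)
  next
    case (Top i)
    then show ?thesis using that U by (auto simp: points_def intro!: conn_refl)
  qed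
  have rel: "stack D (id_diagram m) = D \<and> loops D (id_diagram m) = 0"
  proof (rule stack_relabel[where R = "points m n" and g = g])
    show "partition_on (points m n) D" by (rule d(1))
    show "g x \<in> points m n \<and> (x, Outer (g x)) \<in> conn ?G" if "x \<in> \<Union>?G" for x
      using that mid conn_refl[of x ?G] unfolding U by (auto simp: g_def points_def)
    show "g (Outer r) = r" for r by (simp add: g_def)
    show "\<exists>p\<in>D. g ` b \<subseteq> p" if b: "b \<in> ?G" "b \<noteq> {}" for b
    proof -
      have "(\<exists>i<m. b = lower_point ` {Bot i, Top i}) \<or> (\<exists>c\<in>D. b = upper_point ` c)"
        using b(1) unfolding glue_def id_diagram_def by blast
      then consider i where "i < m" "b = {Outer (Bot i), Middle i}" | c where "c \<in> D" "b = upper_point ` c"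
        by auto
      then show ?thesis
      proof cases
        case (1 i)
        then have "Bot i \<in> \<Union>D" using d(4) by (simp add: points_def)
        then show ?thesis using 1 by (auto simp: g_def)
      next
        case (2 c)
        then show ?thesis by (auto simp: gu image_image)
      qed
    qed
    show "(Outer r, Outer s) \<in> conn ?G" if "p \<in> D" "r \<in> p" "s \<in> p" for p r s
    proof -
      have "r \<in> points m n" "s \<in> points m n" using that d(4) by blast+
      then show ?thesis using up conn_upper[OF that, of "id_diagram m"] conn_sym conn_trans by metis
    qed
  qed
  then show "stack D (id_diagram m) = D" "loops D (id_diagram m) = 0" by auto
qed

lemma stack_id_left:
  assumes D: "D \<in> diagrams m n"
  shows "stack (id_diagram n) D = D" "loops (id_diagram n) D = 0"
proof -
  note d = diagramsD[OF D]
  let ?G = "glue (id_diagram n) D"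
  define g where "g x = (case x of Middle j => Top j | Outer r => r)" for x
  have gu: "g (lower_point x) = x" for x by (cases x) (auto simp: g_def)
  have id: "\<Union>(id_diagram n) = points n n" using diagramsD(4)[OF id_diagram_closed] .
  have U: "\<Union>?G = Outer ` Bot ` {..<m} \<union> Outer ` Top ` {..<n} \<union> Middle ` {..<n}"
    by (rule Union_glue[OF d(4) id])
  have mid: "(Middle i, Outer (Top i)) \<in> conn ?G" if "i < n" for i
    using conn_upper[of "{Bot i, Top i}" "id_diagram n" "Bot i" "Top i" D] that by (auto simp: id_diagram_def)
  have up: "(Outer x, lower_point x) \<in> conn ?G" if "x \<in> points m n" for x
  proof (cases x)
    case (Bot i)
    then show ?thesis using that U by (auto simp: points_def intro!: conn_refl)
  next
    case (Top i)
    then show ?thesis using mid[of i] that conn_sym by (auto simp: points_def)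
  qed
  have rel: "stack (id_diagram n) D = D \<and> loops (id_diagram n) D = 0"
  proof (rule stack_relabel[where R = "points m n" and g = g])
    show "partition_on (points m n) D" by (rule d(1))
    show "g x \<in> points m n \<and> (x, Outer (g x)) \<in> conn ?G" if "x \<in> \<Union>?G" for x
      using that mid conn_refl[of x ?G] unfolding U by (auto simp: g_def points_def)
    show "g (Outer r) = r" for r by (simp add: g_def)
    show "\<exists>p\<in>D. g ` b \<subseteq> p" if b: "b \<in> ?G" "b \<noteq> {}" for b
    proof -
      have "(\<exists>i<n. b = upper_point ` {Top i, Bot i}) \<or> (\<exists>c\<in>D. b = lower_point ` c)"
        using b(1) unfolding glue_def id_diagram_def by (blast intro: insert_commute)
      then consider i where "i < n" "b = {Outer (Top i), Middle i}" | c where "c \<in> D" "b = lower_point ` c"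
        by auto
      then show ?thesis
      proof cases
        case (1 i)
        then have "Top i \<in> \<Union>D" using d(4) by (simp add: points_def)
        then show ?thesis using 1 by (auto simp: g_def)
      next
        case (2 c)
        then show ?thesis by (auto simp: gu image_image)
      qed
    qed
    show "(Outer r, Outer s) \<in> conn ?G" if "p \<in> D" "r \<in> p" "s \<in> p" for p r s
    proof -
      have "r \<in> points m n" "s \<in> points m n" using that d(4) by blast+
      then show ?thesis using up conn_lower[OF that, of "id_diagram n"] conn_sym conn_trans by metis
    qed
  qed
  then show "stack (id_diagram n) D = D" "loops (id_diagram n) D = 0" by auto
qed

section \<open>Composites determined by exhibiting paths\<close>

section \<open>Computing composites\<close>

lemma juxtI1: "b \<in> D ==> b \<in> juxtapose m n D E" by (simp add: juxtapose_def)

lemma juxtI2: "b \<in> E ==> shift_point m n ` b \<in> juxtapose m n D E" by (simp add: juxtapose_def)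

lemma id_mem: "i < n ==> {Bot i, Top i} \<in> id_diagram n" by (simp add: id_diagram_def)

lemma cap_mem: "i < n ==> {Bot i, Bot (2 * n - 1 - i)} \<in> cap_diagram n" by (simp add: cap_diagram_def)

lemma cup_mem: "i < n ==> {Top i, Top (2 * n - 1 - i)} \<in> cup_diagram n" by (simp add: cup_diagram_def)

text \<open>The component of a point of \<open>b\<close> contains all of \<open>b\<close>, and its
  outer part has only two elements because the composite is a matching.\<close>

lemma stack_blockI:
  assumes D: "D \<in> diagrams m n" and E: "E \<in> diagrams n p" and b: "card b = 2"
    and c: "\<And>r s. r \<in> b ==> s \<in> b ==> (Outer r, Outer s) \<in> conn (glue E D)"
  shows "b \<in> stack E D"
proof -
  obtain r where r: "r \<in> b" using b by fastforce
  let ?K = "conn (glue E D) `` {Outer r}"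
  have K: "?K \<in> stack_components E D"
    unfolding stack_components_eq by (rule quotientI) (use conn_in[OF c[OF r r]] in simp)
  have sub: "b \<subseteq> Outer -` ?K" using c r by auto
  then have ne: "Outer -` ?K \<noteq> {}" using r by auto
  have mem: "Outer -` ?K \<in> stack E D" using K ne by (simp add: stack_def)
  have "card (Outer -` ?K) = 2" using diagramsD(2)[OF stack_closed[OF D E] mem] .
  then have "b = Outer -` ?K" using sub b by (intro card_subset_eq) (auto intro: card_ge_0_finite)
  then show ?thesis using mem by simp
qed

lemma loops_eq_0:
  assumes D: "D \<in> diagrams m n" and E: "E \<in> diagrams n p"
    and mid: "\<And>j. j < n ==> \<exists>r. (Middle j, Outer r) \<in> conn (glue E D)"
  shows "loops E D = 0"
proof -
  let ?G = "glue E D"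
  have "{K \<in> stack_components E D. Outer -` K = {}} = {}"
  proof (intro equals0I, elim CollectE conjE)
    fix K assume K: "K \<in> stack_components E D" "Outer -` K = {}"
    then have K': "K \<in> \<Union>?G // conn ?G" by (simp add: stack_components_eq)
    then obtain x where x: "x \<in> K" using in_quotient_imp_non_empty[OF equiv_conn K'] by blast
    have "x \<in> \<Union>?G" using K' x in_quotient_imp_subset[OF equiv_conn] by blast
    moreover have "x \<notin> range Outer" using K(2) x by blast
    ultimately obtain j where j: "x = Middle j" "j < n"
      unfolding Union_glue[OF diagramsD(4)[OF D] diagramsD(4)[OF E]] by blast
    obtain r where "(x, Outer r) \<in> conn ?G" using mid[OF j(2)] j(1) by blast
    then have "Outer r \<in> K" using x conn_closed component_closed[OF K'] by metis
    then show False using K(2) by blast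
  qed
  then show ?thesis unfolding loops_def by (simp only: card.empty)
qed

text \<open>Since composites are perfect matchings, it suffices to exhibit paths between the outer points.\<close>

lemma stack_eqI:
  assumes D: "D \<in> diagrams m n" and E: "E \<in> diagrams n p"
    and two: "\<And>b. b \<in> P ==> card b = 2"
    and c: "\<And>b r s. b \<in> P ==> r \<in> b ==> s \<in> b ==> (Outer r, Outer s) \<in> conn (glue E D)"
    and cover: "points m p \<subseteq> \<Union>P"
    and mid: "\<And>j. j < n ==> \<exists>r. (Middle j, Outer r) \<in> conn (glue E D)"
  shows "stack E D = P \<and> loops E D = 0"
proof
  let ?G = "glue E D"
  note st = diagramsD[OF stack_closed[OF D E]]
  have sub: "P \<subseteq> stack E D"
  proof
    fix b assume b: "b \<in> P"
    show "b \<in> stack E D" by (rule stack_blockI[OF D E two[OF b] c[OF b]])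
  qed
  show "stack E D = P"
  proof
    show "stack E D \<subseteq> P"
    proof
      fix B assume B: "B \<in> stack E D"
      then obtain x where x: "x \<in> B" using st(2) by fastforce
      then have "x \<in> points m p" using B st(4) by blast
      then obtain b where b: "b \<in> P" "x \<in> b" using cover by blast
      then have "B = b" using partition_onD2[OF st(1)] B sub x unfolding disjoint_def by blast
      then show "B \<in> P" using b by simp
    qed
  qed (rule sub)
  show "loops E D = 0" by (rule loops_eq_0[OF D E mid])
qed

text \<open>The second gluing is a renamed copy disjoint from the first, so components and loops are
  collected separately. This is the interchange law on the level of diagrams.\<close>

lemma stack_juxtapose:
  assumes D: "D \<in> diagrams m n" and E: "E \<in> diagrams n p"
    and D': "D' \<in> diagrams m' n'" and E': "E' \<in> diagrams n' p'"
  shows "stack (juxtapose n p E E') (juxtapose m n D D') = juxtapose m p (stack E D) (stack E' D')"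
    and "loops (juxtapose n p E E') (juxtapose m n D D') = loops E D + loops E' D'"
proof -
  define f where "f x = (case x of Outer r => Outer (shift_point m p r) | Middle j => Middle (n + j))" for x
  have inj: "inj f"
  proof (rule injI)
    fix x y assume "f x = f y"
    then show "x = y" using injD[OF inj_shift] by (cases x; cases y) (auto simp: f_def)
  qed
  have fl: "lower_point (shift_point m n x) = f (lower_point x)"
    and fu: "upper_point (shift_point n p x) = f (upper_point x)" for x
    by (cases x; simp add: f_def)+
  let ?G = "glue E D" and ?G' = "glue E' D'"
  have G: "glue (juxtapose n p E E') (juxtapose m n D D') = ?G \<union> (`) f ` ?G'"
    unfolding glue_def juxtapose_def image_Un image_image fl fu by blast
  have U: "\<Union>?G = Outer ` Bot ` {..<m} \<union> Outer ` Top ` {..<p} \<union> Middle ` {..<n}"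
    by (rule Union_glue[OF diagramsD(4)[OF D] diagramsD(4)[OF E]])
  have "f x \<notin> \<Union>?G" for x
  proof (cases x)
    case (Outer r)
    then show ?thesis unfolding U by (cases r) (auto simp: f_def)
  next
    case (Middle j)
    then show ?thesis unfolding U by (auto simp: f_def)
  qed
  then have disj: "\<Union>?G \<inter> \<Union>((`) f ` ?G') = {}" by blast
  have comp: "stack_components (juxtapose n p E E') (juxtapose m n D D') =
      stack_components E D \<union> (`) f ` stack_components E' D'"
    unfolding stack_components_eq G
    using components_Un[OF disj] components_image[OF inj_on_subset[OF inj subset_UNIV], of ?G'] by simp
  have pre: "Outer -` (f ` K) = shift_point m p ` (Outer -` K)" for K
  proof (intro set_eqI iffI)
    fix r assume "r \<in> Outer -` (f ` K)"
    then obtain x where x: "x \<in> K" "Outer r = f x" by blast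
    then obtain s where "x = Outer s" by (cases x) (auto simp: f_def)
    then show "r \<in> shift_point m p ` (Outer -` K)" using x by (auto simp: f_def)
  next
    fix r assume "r \<in> shift_point m p ` (Outer -` K)"
    then obtain s where "r = shift_point m p s" "Outer s \<in> K" by blast
    then have "Outer r = f (Outer s)" by (simp add: f_def)
    then show "r \<in> Outer -` (f ` K)" using \<open>Outer s \<in> K\<close> by blast
  qed
  show "stack (juxtapose n p E E') (juxtapose m n D D') = juxtapose m p (stack E D) (stack E' D')"
  proof -
    have "stack (juxtapose n p E E') (juxtapose m n D D') =
        ((\<lambda>K. Outer -` K) ` stack_components E D \<union>
         (`) (shift_point m p) ` (\<lambda>K. Outer -` K) ` stack_components E' D') - {{}}"
      unfolding stack_def comp image_Un image_image pre ..
    also have "... = juxtapose m p (stack E D) (stack E' D')" unfolding juxtapose_def stack_def by auto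
    finally show ?thesis .
  qed
  have empty: "Outer -` (f ` K) = {} \<longleftrightarrow> Outer -` K = {}" for K by (simp add: pre)
  have fin: "finite (stack_components E D)" if "D \<in> diagrams a b" "E \<in> diagrams b c" for D E a b c
  proof -
    have "finite (\<Union>(glue E D))"
      unfolding Union_glue[OF diagramsD(4)[OF that(1)] diagramsD(4)[OF that(2)]] by simp
    moreover have "conn S \<subseteq> \<Union>S \<times> \<Union>S" for S :: "glue_point set set" using conn_in by fast
    ultimately show ?thesis unfolding stack_components_eq by (rule finite_quotient)
  qed
  have ne: "K \<noteq> {}" "K \<subseteq> \<Union>?G" if "K \<in> stack_components E D" for K
    using in_quotient_imp_non_empty[OF equiv_conn that[unfolded stack_components_eq]]
      in_quotient_imp_subset[OF equiv_conn that[unfolded stack_components_eq]] by simp_all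
  have collect_Un_image: "{x \<in> A \<union> h ` B. P x} = {x \<in> A. P x} \<union> h ` {x \<in> B. P x}"
    if "\<And>x. P (h x) = P x" for A B :: "glue_point set set" and h P
    using that by blast
  have "{K \<in> stack_components E D \<union> (`) f ` stack_components E' D'. Outer -` K = {}} =
    {K \<in> stack_components E D. Outer -` K = {}} \<union> (`) f ` {K \<in> stack_components E' D'. Outer -` K = {}}"
    using collect_Un_image[where h = "(`) f" and P = "\<lambda>K. Outer -` K = {}", OF empty] .
  also have "card ... = card {K \<in> stack_components E D. Outer -` K = {}}
      + card ((`) f ` {K \<in> stack_components E' D'. Outer -` K = {}})"
  proof (rule card_Un_disjoint)
    have "K \<noteq> f ` K'" if "K \<in> stack_components E D" for K K' using ne[OF that] \<open>\<And>x. f x \<notin> \<Union>?G\<close> by blast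
    then show "{K \<in> stack_components E D. Outer -` K = {}} \<inter> (`) f ` {K \<in> stack_components E' D'. Outer -` K = {}} = {}"
      by blast
  qed (use fin[OF D E] fin[OF D' E'] in auto)
  also have "card ((`) f ` {K \<in> stack_components E' D'. Outer -` K = {}}) = loops E' D'"
    unfolding loops_def by (rule card_image) (meson inj inj_image_eq_iff inj_onI)
  finally show "loops (juxtapose n p E E') (juxtapose m n D D') = loops E D + loops E' D'"
    unfolding loops_def comp by simp
qed

section \<open>Half turns of diagrams as left and right mates\<close>

fun rot_point :: "nat => nat => point => point" where
  "rot_point m n (Bot i) = Top (m - 1 - i)"
| "rot_point m n (Top j) = Bot (n - 1 - j)"

definition rot :: "nat => nat => diagram => diagram" where
  "rot m n D = (`) (rot_point m n) ` D"

lemma rot_point_rot_point: "x \<in> points m n ==> rot_point n m (rot_point m n x) = x" by (auto simp: points_def)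

lemma rot_point_in: "x \<in> points m n ==> rot_point m n x \<in> points n m" by (auto simp: points_def)

lemma inj_rot_point: "inj_on (rot_point m n) (points m n)" by (metis inj_on_inverseI rot_point_rot_point)

lemma rot_rot: "D \<in> diagrams m n ==> rot n m (rot m n D) = D"
proof -
  assume D: "D \<in> diagrams m n"
  have "(\<lambda>x. rot_point n m (rot_point m n x)) ` b = b" if "b \<in> D" for b
  proof -
    have "rot_point n m (rot_point m n x) = x" if "x \<in> b" for x
      using rot_point_rot_point diagramsD(4)[OF D] that \<open>b \<in> D\<close> by blast
    then show ?thesis by simp
  qed
  then show ?thesis by (simp add: rot_def image_image)
qed

context
  fixes m n D assumes D: "D \<in> diagrams m n"
begin

private abbreviation "\<rho> x \<equiv> (case x of Bot i => Bot (n + i) | Top j => Bot (n - 1 - j))"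

text \<open>First stage of the left mate: nested caps bend the upper ends of \<open>D\<close> down
  to the left, and \<open>m\<close> through strands remain on the right. The abbreviation gives the
  new place of each point of \<open>D\<close>.\<close>

lemma left_mate_stack1:
  "stack (juxtapose (n + n) 0 (cap_diagram n) (id_diagram m))
     (juxtapose n n (id_diagram n) (juxtapose m n D (id_diagram m)))
   = (\<lambda>b. \<rho> ` b) ` D \<union> (\<lambda>i. {Bot (n + m + i), Top i}) ` {..<m} \<and>
   loops (juxtapose (n + n) 0 (cap_diagram n) (id_diagram m))
     (juxtapose n n (id_diagram n) (juxtapose m n D (id_diagram m))) = 0"
proof (rule stack_eqI)
  let ?A = "juxtapose (n + n) 0 (cap_diagram n) (id_diagram m)"
  let ?B = "juxtapose n n (id_diagram n) (juxtapose m n D (id_diagram m))"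
  let ?G = "glue ?A ?B"
  note d = diagramsD[OF D]
  show "?B \<in> diagrams (n + (m + m)) (n + (n + m))" by (intro juxtapose_closed id_diagram_closed D)
  show "?A \<in> diagrams (n + (n + m)) m"
    using juxtapose_closed[OF cap_diagram_closed[of n] id_diagram_closed[of m]] by (simp add: add.assoc)
  have c1: "(Outer (Bot i), Middle i) \<in> conn ?G" if "i < n" for i
    using conn_lower[OF juxtI1[OF id_mem[OF that]], of "Bot i" "Top i"] by simp
  have c2: "(Outer (Bot (n + m + i)), Middle (n + n + i)) \<in> conn ?G" if "i < m" for i
    using conn_lower[OF juxtI2[OF juxtI2[OF id_mem[OF that]]], of "Bot (n + m + i)" n n m n "Top (n + n + i)"]
    by (simp add: add.assoc)
  have c3: "(Middle i, Middle (2 * n - 1 - i)) \<in> conn ?G" if "i < n" for i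
    using conn_upper[OF juxtI1[OF cap_mem[OF that]], of "Bot i" "Bot (2 * n - 1 - i)"] by simp
  have c4: "(Middle (n + n + i), Outer (Top i)) \<in> conn ?G" if "i < m" for i
    using conn_upper[OF juxtI2[OF id_mem[OF that]], of "Bot (n + n + i)" "n + n" 0 "Top i"] by simp
  have c5: "(lower_point (shift_point n n x), lower_point (shift_point n n y)) \<in> conn ?G"
    if "b \<in> D" "x \<in> b" "y \<in> b" for b x y
    using conn_lower[OF juxtI2[OF juxtI1[OF that(1)]]] that(2,3) by blast
  have c6: "(Outer (\<rho> x), lower_point (shift_point n n x)) \<in> conn ?G" if "x \<in> points m n" for x
  proof (cases x)
    case (Bot i)
    have "Outer (Bot (n + i)) \<in> \<Union>?G"
      using that Bot c5 conn_in d(4) by (metis UnionE lower_point.simps(1) shift_point.simps(1))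
    then show ?thesis using Bot by (simp add: conn_refl)
  next
    case (Top j)
    then have j: "j < n" using that by simp
    then have "2 * n - 1 - (n - 1 - j) = n + j" by simp
    then show ?thesis using c1[of "n - 1 - j"] c3[of "n - 1 - j"] j Top by (auto intro: conn_trans)
  qed
  let ?P = "(\<lambda>b. \<rho> ` b) ` D \<union> (\<lambda>i. {Bot (n + m + i), Top i}) ` {..<m}"
  have inj: "inj_on (\<lambda>x. \<rho> x) (points m n)" by (auto simp: inj_on_def points_def)
  show "card b = 2" if b: "b \<in> ?P" for b
  proof -
    have "card (\<rho> ` c) = 2" if "c \<in> D" for c
    proof -
      have "inj_on (\<lambda>x. \<rho> x) c" by (rule inj_on_subset[OF inj]) (use d(4) that in blast)
      then show ?thesis using d(2)[OF that] card_image by metis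
    qed
    then show ?thesis using b by auto
  qed
  show "(Outer r, Outer s) \<in> conn ?G" if b: "b \<in> ?P" and r: "r \<in> b" and s: "s \<in> b" for b r s
  proof -
    consider c where "c \<in> D" "b = \<rho> ` c" | i where "i < m" "b = {Bot (n + m + i), Top i}" using b by blast
    then show ?thesis
    proof cases
      case (1 c)
      then obtain x y where xy: "x \<in> c" "y \<in> c" "r = \<rho> x" "s = \<rho> y" using r s by blast
      then have "x \<in> points m n" "y \<in> points m n" using d(4) 1 by blast+
      then show ?thesis using c6 c5[OF 1(1) xy(1,2)] xy(3,4) conn_sym conn_trans by metis
    next
      case (2 i)
      have 3: "(Outer (Bot (n + m + i)), Outer (Top i)) \<in> conn ?G"
        by (rule conn_trans[OF c2[OF 2(1)] c4[OF 2(1)]])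
      show ?thesis using 2(2) r s 3 conn_sym[OF 3] conn_trans[OF 3 conn_sym[OF 3]] conn_trans[OF conn_sym[OF 3] 3]
        by auto
    qed
  qed
  show "points (n + (m + m)) m \<subseteq> \<Union>?P"
  proof
    fix x assume x: "x \<in> points (n + (m + m)) m"
    have img: "\<rho> y \<in> \<Union>?P" if y: "y \<in> points m n" for y
    proof -
      obtain c where c: "c \<in> D" "y \<in> c" using y d(4) by blast
      then have "\<rho> y \<in> \<rho> ` c" "\<rho> ` c \<in> ?P" by simp_all
      then show ?thesis by (rule UnionI[rotated])
    qed
    show "x \<in> \<Union>?P"
    proof (cases x)
      case (Bot i)
      then consider "i < n" | "n \<le> i" "i < n + m" | "n + m \<le> i" "i < n + m + m" using x by fastforce
      then show ?thesis
      proof cases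
        case 1
        then show ?thesis using img[of "Top (n - 1 - i)"] Bot by simp
      next
        case 2
        then show ?thesis using img[of "Bot (i - n)"] Bot by auto
      next
        case 3
        then have "x \<in> {Bot (n + m + (i - n - m)), Top (i - n - m)}" "i - n - m < m" using Bot by auto
        then show ?thesis by blast
      qed
    qed (use x in auto)
  qed
  show "\<exists>r. (Middle j, Outer r) \<in> conn ?G" if j: "j < n + (n + m)" for j
  proof -
    consider "j < n" | "n \<le> j" "j < n + n" | "n + n \<le> j" "j < n + n + m" using j by fastforce
    then show ?thesis
    proof cases
      case 1
      then show ?thesis by (intro exI) (rule conn_sym[OF c1])
    next
      case 2
      then have "2 * n - 1 - (2 * n - 1 - j) = j" "2 * n - 1 - j < n" by auto
      then show ?thesis using c1[of "2 * n - 1 - j"] c3[of "2 * n - 1 - j"] conn_sym conn_trans by metis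
    next
      case 3
      then have "n + n + (j - n - n) = j" "j - n - n < m" by auto
      then show ?thesis using c4[of "j - n - n"] by metis
    qed
  qed
qed

text \<open>Second stage: nested cups carry the lower ends of \<open>D\<close> up along the through
  strands, which reverses their order. Altogether \<open>D\<close> has been turned by half a
  revolution.\<close>

lemma left_mate_stack2:
  defines "P \<equiv> (\<lambda>b. \<rho> ` b) ` D \<union> (\<lambda>i. {Bot (n + m + i), Top i}) ` {..<m}"
  shows "stack P (juxtapose n n (id_diagram n) (cup_diagram m)) = rot m n D \<and>
     loops P (juxtapose n n (id_diagram n) (cup_diagram m)) = 0"
proof (rule stack_eqI)
  let ?C = "juxtapose n n (id_diagram n) (cup_diagram m)"
  let ?G = "glue P ?C"
  note d = diagramsD[OF D]
  show "?C \<in> diagrams n (n + (m + m))"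
    using juxtapose_closed[OF id_diagram_closed[of n] cup_diagram_closed[of m]] by simp
  have "juxtapose n n (id_diagram n) (juxtapose m n D (id_diagram m)) \<in> diagrams (n + (m + m)) (n + (n + m))"
    by (intro juxtapose_closed id_diagram_closed D)
  moreover have "juxtapose (n + n) 0 (cap_diagram n) (id_diagram m) \<in> diagrams (n + (n + m)) m"
    using juxtapose_closed[OF cap_diagram_closed[of n] id_diagram_closed[of m]] by (simp add: add.assoc)
  ultimately show "P \<in> diagrams (n + (m + m)) m" using left_mate_stack1 stack_closed unfolding P_def by metis
  have c1: "(Outer (Bot i), Middle i) \<in> conn ?G" if "i < n" for i
    using conn_lower[OF juxtI1[OF id_mem[OF that]], of "Bot i" "Top i"] by simp
  have c2: "(Middle (n + i), Middle (n + (2 * m - 1 - i))) \<in> conn ?G" if "i < m" for i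
    using conn_lower[OF juxtI2[OF cup_mem[OF that]], of "Top (n + i)" n n "Top (n + (2 * m - 1 - i))"] by simp
  have c3: "(Middle (n + m + i), Outer (Top i)) \<in> conn ?G" if "i < m" for i
    using conn_upper[of "{Bot (n + m + i), Top i}" P "Bot (n + m + i)" "Top i" ?C] that by (simp add: P_def)
  have c4: "(upper_point (\<rho> x), upper_point (\<rho> y)) \<in> conn ?G" if "b \<in> D" "x \<in> b" "y \<in> b" for b x y
    using conn_upper[of "\<rho> ` b" P "\<rho> x" "\<rho> y" ?C] that unfolding P_def by blast
  have c5: "(Outer (rot_point m n x), upper_point (\<rho> x)) \<in> conn ?G" if "x \<in> points m n" for x
  proof (cases x)
    case (Bot i)
    then have i: "i < m" using that by simp
    have "(Middle (n + i), Middle (n + m + (m - 1 - i))) \<in> conn ?G"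
    proof -
      have "n + (2 * m - 1 - i) = n + m + (m - 1 - i)" using i by simp
      then show ?thesis using c2[OF i] by metis
    qed
    then show ?thesis using c3[of "m - 1 - i"] i Bot by (auto intro: conn_trans conn_sym)
  next
    case (Top j)
    then show ?thesis using c1[of "n - 1 - j"] that by simp
  qed
  show "card b = 2" if b: "b \<in> rot m n D" for b
  proof -
    obtain c where c: "c \<in> D" "b = rot_point m n ` c" using b by (auto simp: rot_def)
    then have "inj_on (rot_point m n) c" using inj_rot_point[of m n] d(4) inj_on_subset by blast
    then show ?thesis using d(2) c by (simp add: card_image)
  qed
  show "(Outer r, Outer s) \<in> conn ?G" if b: "b \<in> rot m n D" and r: "r \<in> b" and s: "s \<in> b" for b r s
  proof -
    obtain c x y where c: "c \<in> D" "x \<in> c" "y \<in> c" "r = rot_point m n x" "s = rot_point m n y"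
      using b r s by (auto simp: rot_def)
    then have "x \<in> points m n" "y \<in> points m n" using d(4) by blast+
    then show ?thesis using c5 c4[OF c(1-3)] c(4,5) conn_sym conn_trans by metis
  qed
  show "points n m \<subseteq> \<Union>(rot m n D)"
  proof
    fix x assume x: "x \<in> points n m"
    then have "rot_point n m x \<in> \<Union>D" using rot_point_in d(4) by simp
    then have "rot_point m n (rot_point n m x) \<in> \<Union>(rot m n D)" unfolding rot_def by blast
    then show "x \<in> \<Union>(rot m n D)" using rot_point_rot_point[OF x] by simp
  qed
  show "\<exists>r. (Middle j, Outer r) \<in> conn ?G" if j: "j < n + (m + m)" for j
  proof -
    consider "j < n" | "n \<le> j" "j < n + m" | "n + m \<le> j" "j < n + m + m" using j by fastforce
    then show ?thesis
    proof cases
      case 1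
      then show ?thesis by (intro exI) (rule conn_sym[OF c1])
    next
      case 2
      then have "Bot (j - n) \<in> points m n" "upper_point (\<rho> (Bot (j - n))) = Middle j" using 2 by auto
      then show ?thesis using c5 conn_sym by metis
    next
      case 3
      then have "n + m + (j - n - m) = j" "j - n - m < m" by auto
      then show ?thesis using c3[of "j - n - m"] by metis
    qed
  qed
qed

end

context
  fixes m n D assumes D: "D \<in> diagrams m n"
begin

private abbreviation "\<sigma> x \<equiv> (case x of Bot i => Bot (m + i) | Top j => Bot (m + m + (n - 1 - j)))"

text \<open>The mirror image of the first stage: here the upper ends of \<open>D\<close> are bent
  down to the right.\<close>

lemma right_mate_stack1:
  "stack (juxtapose m m (id_diagram m) (cap_diagram n))
     (juxtapose m m (id_diagram m) (juxtapose m n D (id_diagram n)))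
   = (\<lambda>b. \<sigma> ` b) ` D \<union> (\<lambda>i. {Bot i, Top i}) ` {..<m} \<and>
   loops (juxtapose m m (id_diagram m) (cap_diagram n))
     (juxtapose m m (id_diagram m) (juxtapose m n D (id_diagram n))) = 0"
proof (rule stack_eqI)
  let ?A = "juxtapose m m (id_diagram m) (cap_diagram n)"
  let ?B = "juxtapose m m (id_diagram m) (juxtapose m n D (id_diagram n))"
  let ?G = "glue ?A ?B"
  note d = diagramsD[OF D]
  show "?B \<in> diagrams (m + (m + n)) (m + (n + n))" by (intro juxtapose_closed id_diagram_closed D)
  show "?A \<in> diagrams (m + (n + n)) m"
    using juxtapose_closed[OF id_diagram_closed[of m] cap_diagram_closed[of n]] by simp
  have c1: "(Outer (Bot i), Middle i) \<in> conn ?G" if "i < m" for i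
    using conn_lower[OF juxtI1[OF id_mem[OF that]], of "Bot i" "Top i"] by simp
  have c4: "(Middle i, Outer (Top i)) \<in> conn ?G" if "i < m" for i
    using conn_upper[OF juxtI1[OF id_mem[OF that]], of "Bot i" "Top i"] by simp
  have c2: "(Outer (Bot (m + m + i)), Middle (m + n + i)) \<in> conn ?G" if "i < n" for i
    using conn_lower[OF juxtI2[OF juxtI2[OF id_mem[OF that]]], of "Bot (m + m + i)" m m m n "Top (m + n + i)"]
    by (simp add: add.assoc)
  have c3: "(Middle (m + i), Middle (m + (2 * n - 1 - i))) \<in> conn ?G" if "i < n" for i
    using conn_upper[OF juxtI2[OF cap_mem[OF that]], of "Bot (m + i)" m m "Bot (m + (2 * n - 1 - i))"] by simp
  have c5: "(lower_point (shift_point m m x), lower_point (shift_point m m y)) \<in> conn ?G"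
    if "b \<in> D" "x \<in> b" "y \<in> b" for b x y
    using conn_lower[OF juxtI2[OF juxtI1[OF that(1)]]] that(2,3) by blast
  have c6: "(Outer (\<sigma> x), lower_point (shift_point m m x)) \<in> conn ?G" if "x \<in> points m n" for x
  proof (cases x)
    case (Bot i)
    have "Outer (Bot (m + i)) \<in> \<Union>?G"
      using that Bot c5 conn_in d(4) by (metis UnionE lower_point.simps(1) shift_point.simps(1))
    then show ?thesis using Bot by (simp add: conn_refl)
  next
    case (Top j)
    then have j: "j < n" using that by simp
    then have "m + (2 * n - 1 - j) = m + n + (n - 1 - j)" by simp
    then have "(Middle (m + j), Middle (m + n + (n - 1 - j))) \<in> conn ?G" using c3[OF j] by metis
    then show ?thesis using c2[of "n - 1 - j"] j Top by (auto intro: conn_trans conn_sym)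
  qed
  let ?P = "(\<lambda>b. \<sigma> ` b) ` D \<union> (\<lambda>i. {Bot i, Top i}) ` {..<m}"
  have inj: "inj_on (\<lambda>x. \<sigma> x) (points m n)" by (auto simp: inj_on_def points_def)
  show "card b = 2" if b: "b \<in> ?P" for b
  proof -
    have "card (\<sigma> ` c) = 2" if "c \<in> D" for c
    proof -
      have "inj_on (\<lambda>x. \<sigma> x) c" by (rule inj_on_subset[OF inj]) (use d(4) that in blast)
      then show ?thesis using d(2)[OF that] card_image by metis
    qed
    then show ?thesis using b by auto
  qed
  show "(Outer r, Outer s) \<in> conn ?G" if b: "b \<in> ?P" and r: "r \<in> b" and s: "s \<in> b" for b r s
  proof -
    consider c where "c \<in> D" "b = \<sigma> ` c" | i where "i < m" "b = {Bot i, Top i}" using b by blast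
    then show ?thesis
    proof cases
      case (1 c)
      then obtain x y where xy: "x \<in> c" "y \<in> c" "r = \<sigma> x" "s = \<sigma> y" using r s by blast
      then have "x \<in> points m n" "y \<in> points m n" using d(4) 1 by blast+
      then show ?thesis using c6 c5[OF 1(1) xy(1,2)] xy(3,4) conn_sym conn_trans by metis
    next
      case (2 i)
      have 3: "(Outer (Bot i), Outer (Top i)) \<in> conn ?G" by (rule conn_trans[OF c1[OF 2(1)] c4[OF 2(1)]])
      show ?thesis using 2(2) r s 3 conn_sym[OF 3] conn_trans[OF 3 conn_sym[OF 3]] conn_trans[OF conn_sym[OF 3] 3]
        by auto
    qed
  qed
  show "points (m + (m + n)) m \<subseteq> \<Union>?P"
  proof
    fix x assume x: "x \<in> points (m + (m + n)) m"
    have img: "\<sigma> y \<in> \<Union>?P" if y: "y \<in> points m n" for y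
    proof -
      obtain c where c: "c \<in> D" "y \<in> c" using y d(4) by blast
      then have "\<sigma> y \<in> \<sigma> ` c" "\<sigma> ` c \<in> ?P" by simp_all
      then show ?thesis by (rule UnionI[rotated])
    qed
    show "x \<in> \<Union>?P"
    proof (cases x)
      case (Bot i)
      then consider "i < m" | "m \<le> i" "i < m + m" | "m + m \<le> i" "i < m + m + n" using x by fastforce
      then show ?thesis
      proof cases
        case 2
        then show ?thesis using img[of "Bot (i - m)"] Bot by auto
      next
        case 3
        then show ?thesis using img[of "Top (n - 1 - (i - m - m))"] Bot by auto
      qed (use Bot in auto)
    qed (use x in auto)
  qed
  show "\<exists>r. (Middle j, Outer r) \<in> conn ?G" if j: "j < m + (n + n)" for j
  proof -
    consider "j < m" | "m \<le> j" "j < m + n" | "m + n \<le> j" "j < m + n + n" using j by fastforce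
    then show ?thesis
    proof cases
      case 1
      then show ?thesis by (intro exI) (rule c4)
    next
      case 2
      then have "Top (j - m) \<in> points m n" "lower_point (shift_point m m (Top (j - m))) = Middle j" by auto
      then show ?thesis using c6 conn_sym by metis
    next
      case 3
      then have "m + n + (j - m - n) = j" "j - m - n < n" by auto
      then show ?thesis using c2[of "j - m - n"] conn_sym by metis
    qed
  qed
qed

text \<open>Although the bending went the other way round, the same half turn of \<open>D\<close>
  results. This is the combinatorial reason why left and right duals agree in the Temperley-Lieb
  category.\<close>

lemma right_mate_stack2:
  defines "P \<equiv> (\<lambda>b. \<sigma> ` b) ` D \<union> (\<lambda>i. {Bot i, Top i}) ` {..<m}"
  shows "stack P (juxtapose 0 (m + m) (cup_diagram m) (id_diagram n)) = rot m n D \<and>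
     loops P (juxtapose 0 (m + m) (cup_diagram m) (id_diagram n)) = 0"
proof (rule stack_eqI)
  let ?C = "juxtapose 0 (m + m) (cup_diagram m) (id_diagram n)"
  let ?G = "glue P ?C"
  note d = diagramsD[OF D]
  show "?C \<in> diagrams n (m + (m + n))"
    using juxtapose_closed[OF cup_diagram_closed[of m] id_diagram_closed[of n]] by (simp add: add.assoc)
  have "juxtapose m m (id_diagram m) (juxtapose m n D (id_diagram n)) \<in> diagrams (m + (m + n)) (m + (n + n))"
    by (intro juxtapose_closed id_diagram_closed D)
  moreover have "juxtapose m m (id_diagram m) (cap_diagram n) \<in> diagrams (m + (n + n)) m"
    using juxtapose_closed[OF id_diagram_closed[of m] cap_diagram_closed[of n]] by simp
  ultimately show "P \<in> diagrams (m + (m + n)) m" using right_mate_stack1 stack_closed unfolding P_def by metis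
  have c1: "(Outer (Bot i), Middle (m + m + i)) \<in> conn ?G" if "i < n" for i
    using conn_lower[OF juxtI2[OF id_mem[OF that]], of "Bot i" 0 "m + m" "Top (m + m + i)"] by simp
  have c2: "(Middle i, Middle (2 * m - 1 - i)) \<in> conn ?G" if "i < m" for i
    using conn_lower[OF juxtI1[OF cup_mem[OF that]], of "Top i" "Top (2 * m - 1 - i)"] by simp
  have c3: "(Middle i, Outer (Top i)) \<in> conn ?G" if "i < m" for i
    using conn_upper[of "{Bot i, Top i}" P "Bot i" "Top i" ?C] that by (simp add: P_def)
  have c4: "(upper_point (\<sigma> x), upper_point (\<sigma> y)) \<in> conn ?G" if "b \<in> D" "x \<in> b" "y \<in> b" for b x y
    using conn_upper[of "\<sigma> ` b" P "\<sigma> x" "\<sigma> y" ?C] that unfolding P_def by blast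
  have c5: "(Outer (rot_point m n x), upper_point (\<sigma> x)) \<in> conn ?G" if "x \<in> points m n" for x
  proof (cases x)
    case (Bot i)
    then have i: "i < m" using that by simp
    then have "2 * m - 1 - (m - 1 - i) = m + i" by simp
    then have "(Middle (m - 1 - i), Middle (m + i)) \<in> conn ?G" using c2[of "m - 1 - i"] i by simp
    then show ?thesis using c3[of "m - 1 - i"] i Bot by (auto intro: conn_trans conn_sym)
  next
    case (Top j)
    then show ?thesis using c1[of "n - 1 - j"] that by simp
  qed
  show "card b = 2" if b: "b \<in> rot m n D" for b
  proof -
    obtain c where c: "c \<in> D" "b = rot_point m n ` c" using b by (auto simp: rot_def)
    then have "inj_on (rot_point m n) c" using inj_rot_point[of m n] d(4) inj_on_subset by blast
    then show ?thesis using d(2) c by (simp add: card_image)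
  qed
  show "(Outer r, Outer s) \<in> conn ?G" if b: "b \<in> rot m n D" and r: "r \<in> b" and s: "s \<in> b" for b r s
  proof -
    obtain c x y where c: "c \<in> D" "x \<in> c" "y \<in> c" "r = rot_point m n x" "s = rot_point m n y"
      using b r s by (auto simp: rot_def)
    then have "x \<in> points m n" "y \<in> points m n" using d(4) by blast+
    then show ?thesis using c5 c4[OF c(1-3)] c(4,5) conn_sym conn_trans by metis
  qed
  show "points n m \<subseteq> \<Union>(rot m n D)"
  proof
    fix x assume x: "x \<in> points n m"
    then have "rot_point n m x \<in> \<Union>D" using rot_point_in d(4) by simp
    then have "rot_point m n (rot_point n m x) \<in> \<Union>(rot m n D)" unfolding rot_def by blast
    then show "x \<in> \<Union>(rot m n D)" using rot_point_rot_point[OF x] by simp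
  qed
  show "\<exists>r. (Middle j, Outer r) \<in> conn ?G" if j: "j < m + (m + n)" for j
  proof -
    consider "j < m" | "m \<le> j" "j < m + m" | "m + m \<le> j" "j < m + m + n" using j by fastforce
    then show ?thesis
    proof cases
      case 1
      then show ?thesis by (intro exI) (rule c3)
    next
      case 2
      then have "Bot (j - m) \<in> points m n" "upper_point (\<sigma> (Bot (j - m))) = Middle j" by auto
      then show ?thesis using c5 conn_sym by metis
    next
      case 3
      then have "m + m + (j - m - m) = j" "j - m - m < n" by auto
      then show ?thesis using c1[of "j - m - m"] conn_sym by metis
    qed
  qed
qed

text \<open>The half turn has just been written as a composite of diagrams, so closure under
  stacking applies and planarity needs no separate check.\<close>

lemma rot_closed: "rot m n D \<in> diagrams n m"
proof -
  have B: "juxtapose m m (id_diagram m) (juxtapose m n D (id_diagram n)) \<in> diagrams (m + (m + n)) (m + (n + n))"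
    by (intro juxtapose_closed id_diagram_closed D)
  have A: "juxtapose m m (id_diagram m) (cap_diagram n) \<in> diagrams (m + (n + n)) m"
    using juxtapose_closed[OF id_diagram_closed[of m] cap_diagram_closed[of n]] by simp
  have C: "juxtapose 0 (m + m) (cup_diagram m) (id_diagram n) \<in> diagrams n (m + (m + n))"
    using juxtapose_closed[OF cup_diagram_closed[of m] id_diagram_closed[of n]] by (simp add: add.assoc)
  show ?thesis using stack_closed[OF C stack_closed[OF B A]]
    unfolding conjunct1[OF right_mate_stack1] conjunct1[OF right_mate_stack2] .
qed

text \<open>Bending the top down to the right puts every point at its position in boundary order. It
  reduces questions about \<open>(m, n)\<close>-diagrams to diagrams with bottom points
  only.\<close>

lemma bend_stack:
  "stack (cap_diagram n) (juxtapose m n D (id_diagram n)) = (\<lambda>b. (Bot \<circ> boundary_pos m n) ` b) ` D \<and>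
   loops (cap_diagram n) (juxtapose m n D (id_diagram n)) = 0"
proof (rule stack_eqI)
  let ?B = "juxtapose m n D (id_diagram n)"
  let ?G = "glue (cap_diagram n) ?B"
  note d = diagramsD[OF D]
  show "?B \<in> diagrams (m + n) (n + n)" by (intro juxtapose_closed id_diagram_closed D)
  show "cap_diagram n \<in> diagrams (n + n) 0" by (rule cap_diagram_closed)
  have c2: "(Outer (Bot (m + i)), Middle (n + i)) \<in> conn ?G" if "i < n" for i
    using conn_lower[OF juxtI2[OF id_mem[OF that]], of "Bot (m + i)" m n "Top (n + i)"] by simp
  have c3: "(Middle i, Middle (2 * n - 1 - i)) \<in> conn ?G" if "i < n" for i
    using conn_upper[OF cap_mem[OF that], of "Bot i" "Bot (2 * n - 1 - i)"] by simp
  have c5: "(lower_point x, lower_point y) \<in> conn ?G" if "b \<in> D" "x \<in> b" "y \<in> b" for b x y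
    by (rule conn_lower[OF juxtI1[OF that(1)] that(2,3)])
  have c6: "(Outer (Bot (boundary_pos m n x)), lower_point x) \<in> conn ?G" if "x \<in> points m n" for x
  proof (cases x)
    case (Bot i)
    have "Outer (Bot i) \<in> \<Union>?G" using that Bot c5 conn_in d(4) by (metis UnionE lower_point.simps(1))
    then show ?thesis using Bot by (simp add: conn_refl)
  next
    case (Top j)
    then have j: "j < n" using that by simp
    then have "2 * n - 1 - j = n + (n - 1 - j)" by simp
    then have "(Middle j, Middle (n + (n - 1 - j))) \<in> conn ?G" using c3[OF j] by metis
    then show ?thesis using c2[of "n - 1 - j"] j Top by (auto intro: conn_trans conn_sym)
  qed
  let ?P = "(\<lambda>b. (Bot \<circ> boundary_pos m n) ` b) ` D"
  have inj: "inj_on (Bot \<circ> boundary_pos m n) (points m n)"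
    by (intro comp_inj_on pos_inj) (simp add: inj_on_def)
  show "card b = 2" if b: "b \<in> ?P" for b
  proof -
    obtain c where c: "c \<in> D" "b = (Bot \<circ> boundary_pos m n) ` c" using b by blast
    have "inj_on (Bot \<circ> boundary_pos m n) c" by (rule inj_on_subset[OF inj]) (use d(4) c in blast)
    then show ?thesis using d(2)[OF c(1)] c(2) card_image by metis
  qed
  show "(Outer r, Outer s) \<in> conn ?G" if b: "b \<in> ?P" and r: "r \<in> b" and s: "s \<in> b" for b r s
  proof -
    obtain c x y where xy: "c \<in> D" "x \<in> c" "y \<in> c" "r = Bot (boundary_pos m n x)" "s = Bot (boundary_pos m n y)"
      using b r s by auto
    then have "x \<in> points m n" "y \<in> points m n" using d(4) by blast+
    then show ?thesis using c6 c5[OF xy(1-3)] xy(4,5) conn_sym conn_trans by metis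
  qed
  show "points (m + n) 0 \<subseteq> \<Union>?P"
  proof
    fix x assume x: "x \<in> points (m + n) 0"
    have img: "Bot (boundary_pos m n y) \<in> \<Union>?P" if y: "y \<in> points m n" for y
    proof -
      obtain c where c: "c \<in> D" "y \<in> c" using y d(4) by blast
      then have "Bot (boundary_pos m n y) \<in> (Bot \<circ> boundary_pos m n) ` c" by simp
      then show ?thesis using c(1) by blast
    qed
    obtain i where i: "x = Bot i" "i < m + n" using x by (auto simp: points_def)
    show "x \<in> \<Union>?P"
    proof (cases "i < m")
      case True
      then show ?thesis using img[of "Bot i"] i by simp
    next
      case False
      then have "boundary_pos m n (Top (n - 1 - (i - m))) = i" "Top (n - 1 - (i - m)) \<in> points m n"
        using i by auto
      then show ?thesis using img i(1) by metis
    qed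
  qed
  show "\<exists>r. (Middle j, Outer r) \<in> conn ?G" if j: "j < n + n" for j
  proof (cases "j < n")
    case True
    then have "Top j \<in> points m n" by simp
    then show ?thesis using c6 conn_sym lower_point.simps(2) by metis
  next
    case False
    then have "n + (j - n) = j" "j - n < n" using j by auto
    then show ?thesis using c2[of "j - n"] conn_sym by metis
  qed
qed

end

text \<open>The whole glued picture is turned; middle point \<open>j\<close> goes to
  \<open>n - 1 - j\<close>, and an injective renaming preserves components.\<close>

lemma stack_rot:
  assumes D: "D \<in> diagrams m n" and E: "E \<in> diagrams n p"
  shows "stack (rot m n D) (rot n p E) = rot m p (stack E D)"
    and "loops (rot m n D) (rot n p E) = loops E D"
proof -
  define f where "f x = (case x of Outer r => Outer (rot_point m p r) | Middle j => Middle (n - 1 - j))" for x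
  let ?G = "glue E D"
  have fu: "lower_point (rot_point n p x) = f (upper_point x)"
    and fl: "upper_point (rot_point m n x) = f (lower_point x)" for x
    by (cases x; simp add: f_def)+
  have G: "glue (rot m n D) (rot n p E) = (`) f ` ?G"
    unfolding glue_def rot_def image_Un image_image fu fl by blast
  have U: "\<Union>?G = Outer ` Bot ` {..<m} \<union> Outer ` Top ` {..<p} \<union> Middle ` {..<n}"
    by (rule Union_glue[OF diagramsD(4)[OF D] diagramsD(4)[OF E]])
  have inj: "inj_on f (\<Union>?G)" unfolding U by (auto simp: inj_on_def f_def)
  have comp: "stack_components (rot m n D) (rot n p E) = (`) f ` stack_components E D"
    unfolding stack_components_eq G by (rule components_image[OF inj])
  have pre: "Outer -` (f ` K) = rot_point m p ` (Outer -` K)" for K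
  proof (intro set_eqI iffI)
    fix r assume "r \<in> Outer -` (f ` K)"
    then obtain x where x: "x \<in> K" "Outer r = f x" by blast
    then obtain s where "x = Outer s" by (cases x) (auto simp: f_def)
    then show "r \<in> rot_point m p ` (Outer -` K)" using x by (auto simp: f_def)
  next
    fix r assume "r \<in> rot_point m p ` (Outer -` K)"
    then obtain s where "r = rot_point m p s" "Outer s \<in> K" by blast
    then have "Outer r = f (Outer s)" by (simp add: f_def)
    then show "r \<in> Outer -` (f ` K)" using \<open>Outer s \<in> K\<close> by blast
  qed
  show "stack (rot m n D) (rot n p E) = rot m p (stack E D)"
  proof -
    have "stack (rot m n D) (rot n p E) = (`) (rot_point m p) ` (\<lambda>K. Outer -` K) ` stack_components E D - {{}}"
      unfolding stack_def comp image_image pre ..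
    also have "... = rot m p (stack E D)" unfolding rot_def stack_def by auto
    finally show ?thesis .
  qed
  have sub: "stack_components E D \<subseteq> Pow (\<Union>?G)"
    unfolding stack_components_eq using in_quotient_imp_subset[OF equiv_conn] by blast
  have "loops (rot m n D) (rot n p E) = card ((`) f ` {K \<in> stack_components E D. Outer -` K = {}})"
  proof -
    have "Outer -` (f ` K) = {} \<longleftrightarrow> Outer -` K = {}" for K by (simp add: pre)
    moreover have filter_image: "{x \<in> h ` B. P x} = h ` {x \<in> B. P x}" if "\<And>x. P (h x) = P x"
      for B :: "glue_point set set" and h P
      using that by blast
    ultimately have "{K \<in> (`) f ` stack_components E D. Outer -` K = {}} =
        (`) f ` {K \<in> stack_components E D. Outer -` K = {}}"
      by (intro filter_image)
    then show ?thesis unfolding loops_def comp by (rule arg_cong)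
  qed
  also have "... = loops E D"
    unfolding loops_def by (rule card_image, rule inj_on_subset[OF inj_on_image_Pow[OF inj]]) (use sub in blast)
  finally show "loops (rot m n D) (rot n p E) = loops E D" .
qed

lemma rot_id: "rot n n (id_diagram n) = id_diagram n"
proof -
  have "rot n n (id_diagram n) = (\<lambda>i. {Bot (n - 1 - i), Top (n - 1 - i)}) ` {..<n}"
    by (simp add: rot_def id_diagram_def image_image insert_commute)
  also have "... = (\<lambda>i. {Bot i, Top i}) ` (\<lambda>i. n - 1 - i) ` {..<n}" by (simp add: image_image)
  also have "(\<lambda>i. n - 1 - i) ` {..<n} = {..<n}"
  proof (intro set_eqI iffI)
    fix i assume "i \<in> {..<n}"
    then have "i = n - 1 - (n - 1 - i)" "n - 1 - i \<in> {..<n}" by auto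
    then show "i \<in> (\<lambda>i. n - 1 - i) ` {..<n}" by blast
  qed auto
  finally show ?thesis by (simp add: id_diagram_def)
qed

section \<open>A single cap or cup between two neighbouring points\<close>

fun skip_point :: "nat => point => point" where
  "skip_point i (Bot k) = Bot (if k < i then k else k + 2)"
| "skip_point i (Top k) = Top k"

lemma inj_skip [simp]: "inj (skip_point i)"
proof (rule injI)
  fix x y show "skip_point i x = skip_point i y ==> x = y" by (cases x; cases y) (auto split: if_splits)
qed

abbreviation cap_at :: "nat => nat => diagram" where
  "cap_at i r \<equiv> juxtapose i i (id_diagram i) (juxtapose 2 0 (cap_diagram 1) (id_diagram r))"

abbreviation cup_at :: "nat => nat => diagram" where
  "cup_at i r \<equiv> juxtapose i i (id_diagram i) (juxtapose 0 2 (cup_diagram 1) (id_diagram r))"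

lemma cap_at_closed: "cap_at i r \<in> diagrams (i + (2 + r)) (i + r)"
  using juxtapose_closed[OF id_diagram_closed[of i] juxtapose_closed[OF cap_diagram_closed[of 1] id_diagram_closed[of r]]]
  by (simp add: numeral_2_eq_2)

lemma cup_at_closed: "cup_at i r \<in> diagrams (i + r) (i + (2 + r))"
  using juxtapose_closed[OF id_diagram_closed[of i] juxtapose_closed[OF cup_diagram_closed[of 1] id_diagram_closed[of r]]]
  by (simp add: numeral_2_eq_2)

text \<open>Precomposing with a cap merely inserts an arc between neighbours. Read backwards, it
  recognizes such an arc as a factor.\<close>

lemma stack_cap_at:
  assumes D: "D \<in> diagrams (i + r) 0"
  shows "stack D (cap_at i r) = insert {Bot i, Bot (Suc i)} ((\<lambda>b. skip_point i ` b) ` D) \<and> loops D (cap_at i r) = 0"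
proof (rule stack_eqI[OF cap_at_closed D])
  let ?G = "glue D (cap_at i r)"
  note d = diagramsD[OF D]
  have c1: "(Outer (Bot k), Middle k) \<in> conn ?G" if "k < i" for k
    using conn_lower[OF juxtI1[OF id_mem[OF that]], of "Bot k" "Top k"] by simp
  have c2: "(Outer (Bot (i + 2 + k)), Middle (i + k)) \<in> conn ?G" if "k < r" for k
    using conn_lower[OF juxtI2[OF juxtI2[OF id_mem[OF that]]], of "Bot (i + 2 + k)" i i 2 0 "Top (i + k)"]
    by (simp add: add.assoc)
  have c3: "(Outer (Bot i), Outer (Bot (Suc i))) \<in> conn ?G"
    using conn_lower[OF juxtI2[OF juxtI1[OF cap_mem[of 0 1]]], of "Bot i" i i "Bot (Suc i)"] by simp
  have c6: "(Outer (skip_point i x), upper_point x) \<in> conn ?G" if x: "x \<in> points (i + r) 0" for x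
  proof -
    obtain k where k: "x = Bot k" "k < i + r" using x by (auto simp: points_def)
    show ?thesis
    proof (cases "k < i")
      case True
      then show ?thesis using c1 k by simp
    next
      case False
      then have "i + (k - i) = k" "i + 2 + (k - i) = k + 2" "k - i < r" using k by auto
      then show ?thesis using c2[of "k - i"] k False by simp
    qed
  qed
  let ?P = "insert {Bot i, Bot (Suc i)} ((\<lambda>b. skip_point i ` b) ` D)"
  show "card b = 2" if b: "b \<in> ?P" for b using b d(2) by (auto simp: card_image inj_on_subset[OF inj_skip])
  show "(Outer x, Outer y) \<in> conn ?G" if b: "b \<in> ?P" and x: "x \<in> b" and y: "y \<in> b" for b x y
  proof -
    consider "b = {Bot i, Bot (Suc i)}" | c where "c \<in> D" "b = skip_point i ` c" using b by blast
    then show ?thesis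
    proof cases
      case 1
      show ?thesis using 1 x y c3 conn_sym[OF c3] conn_trans[OF c3 conn_sym[OF c3]] conn_trans[OF conn_sym[OF c3] c3]
        by auto
    next
      case (2 c)
      then obtain u v where uv: "u \<in> c" "v \<in> c" "x = skip_point i u" "y = skip_point i v" using x y by blast
      then have "u \<in> points (i + r) 0" "v \<in> points (i + r) 0" using d(4) 2 by blast+
      then show ?thesis using c6 conn_upper[OF 2(1) uv(1,2)] uv(3,4) conn_sym conn_trans by metis
    qed
  qed
  show "points (i + (2 + r)) 0 \<subseteq> \<Union>?P"
  proof
    fix x assume x: "x \<in> points (i + (2 + r)) 0"
    have img: "skip_point i y \<in> \<Union>?P" if y: "y \<in> points (i + r) 0" for y using y d(4) by blast
    obtain k where k: "x = Bot k" "k < i + 2 + r" using x by (auto simp: points_def)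
    consider "k < i" | "k = i" | "k = Suc i" | "k \<ge> i + 2" by linarith
    then show "x \<in> \<Union>?P"
    proof cases
      case 1
      then show ?thesis using img[of "Bot k"] k by simp
    next
      case 4
      then have "skip_point i (Bot (k - 2)) = x" "Bot (k - 2) \<in> points (i + r) 0" using k by auto
      then show ?thesis using img by metis
    qed (use k in auto)
  qed
  show "\<exists>r'. (Middle j, Outer r') \<in> conn ?G" if j: "j < i + r" for j
  proof -
    have "Bot j \<in> points (i + r) 0" using j by simp
    then show ?thesis using c6 conn_sym upper_point.simps(1) by metis
  qed
qed

lemma conn_cup_at:
  assumes D: "D \<in> diagrams (i + (2 + r)) 0" and x: "x \<in> points (i + r) 0"
  shows "(Outer x, upper_point (skip_point i x)) \<in> conn (glue D (cup_at i r))"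
proof -
  obtain k where k: "x = Bot k" "k < i + r" using x by (auto simp: points_def)
  show ?thesis
  proof (cases "k < i")
    case True
    then show ?thesis using conn_lower[OF juxtI1[OF id_mem[OF True]], of "Bot k" "Top k"] k by simp
  next
    case False
    then have *: "k - i < r" "i + (k - i) = k" "i + 2 + (k - i) = k + 2" using k by auto
    then show ?thesis
      using conn_lower[OF juxtI2[OF juxtI2[OF id_mem[OF *(1)]]], of "Bot k" i i 0 2 "Top (k + 2)"] k False
      by (simp add: add.assoc)
  qed
qed

lemma conn_cup_at_mid: "(Middle i, Middle (Suc i)) \<in> conn (glue D (cup_at i r))"
  using conn_lower[OF juxtI2[OF juxtI1[OF cup_mem[of 0 1]]], of "Top i" i i "Top (Suc i)"] by simp

lemma range_skip: "Bot k \<in> range (skip_point i) \<longleftrightarrow> k \<noteq> i \<and> k \<noteq> Suc i"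
proof
  show "Bot k \<in> range (skip_point i) ==> k \<noteq> i \<and> k \<noteq> Suc i"
    by (elim imageE, case_tac x) (auto split: if_splits)
next
  assume "k \<noteq> i \<and> k \<noteq> Suc i"
  then have "Bot k = skip_point i (Bot (if k < i then k else k - 2))" by auto
  then show "Bot k \<in> range (skip_point i)" by blast
qed

lemma block_stack_cup_at:
  assumes D: "D \<in> diagrams (i + (2 + r)) 0" and b: "card b = 2" "b \<subseteq> points (i + (2 + r)) 0"
    "Bot i \<notin> b" "Bot (Suc i) \<notin> b"
    and c: "\<And>x y. x \<in> b ==> y \<in> b ==> (upper_point x, upper_point y) \<in> conn (glue D (cup_at i r))"
  shows "skip_point i -` b \<in> stack D (cup_at i r)"
proof (rule stack_blockI[OF cup_at_closed D])
  have "x \<in> range (skip_point i)" if x: "x \<in> b" for x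
  proof -
    obtain k where "x = Bot k" using x b(2) by (auto simp: points_def)
    then show ?thesis using x b(3,4) by (auto simp: range_skip)
  qed
  then show "card (skip_point i -` b) = 2" using b(1) by (subst card_vimage_inj) auto
  fix x y assume xy: "x \<in> skip_point i -` b" "y \<in> skip_point i -` b"
  have "z \<in> points (i + r) 0" if z: "z \<in> skip_point i -` b" for z
  proof -
    have "skip_point i z \<in> points (i + (2 + r)) 0" using b(2) z by blast
    then show ?thesis by (cases z) (auto split: if_splits)
  qed
  then show "(Outer x, Outer y) \<in> conn (glue D (cup_at i r))"
    using conn_cup_at[OF D] c[of "skip_point i x" "skip_point i y"] xy conn_sym conn_trans
    by (metis vimageD)
qed

lemma stack_cup_at_other:
  assumes D: "D \<in> diagrams (i + (2 + r)) 0" and b: "b \<in> D" "Bot i \<notin> b" "Bot (Suc i) \<notin> b"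
  shows "skip_point i -` b \<in> stack D (cup_at i r)"
  by (rule block_stack_cup_at[OF D diagramsD(2)[OF D b(1)] _ b(2,3)])
    (use b(1) diagramsD(4)[OF D] conn_upper[OF b(1)] in auto)

text \<open>The cup links the arcs ending at \<open>i\<close> and \<open>Suc i\<close> to one arc.
  The excluded case \<open>a = Suc i\<close> is the one in which the cup closes a loop.\<close>

lemma stack_cup_at_join:
  assumes D: "D \<in> diagrams (i + (2 + r)) 0" and ab: "{Bot a, Bot i} \<in> D" "{Bot (Suc i), Bot b} \<in> D" "a \<noteq> Suc i"
  shows "skip_point i -` {Bot a, Bot b} \<in> stack D (cup_at i r)" "loops D (cup_at i r) = 0" "a \<noteq> b"
proof -
  note d = diagramsD[OF D]
  let ?G = "glue D (cup_at i r)"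
  have ne: "a \<noteq> i" "b \<noteq> Suc i" using d(2)[OF ab(1)] d(2)[OF ab(2)] by auto
  have dis: "{Bot a, Bot i} \<inter> {Bot (Suc i), Bot b} = {}"
    using partition_onD2[OF d(1)] ab unfolding disjoint_def by (metis doubleton_eq_iff n_not_Suc_n point.inject(1))
  then show "a \<noteq> b" by auto
  have "b \<noteq> i" using dis by auto
  have sub: "{Bot a, Bot b} \<subseteq> points (i + (2 + r)) 0" using ab d(4) by blast
  have 1: "(Middle a, Middle i) \<in> conn ?G" using conn_upper[OF ab(1), of "Bot a" "Bot i"] by simp
  have 2: "(Middle (Suc i), Middle b) \<in> conn ?G" using conn_upper[OF ab(2), of "Bot (Suc i)" "Bot b"] by simp
  have 3: "(Middle a, Middle b) \<in> conn ?G" using conn_trans[OF 1 conn_trans[OF conn_cup_at_mid 2]] .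
  show "skip_point i -` {Bot a, Bot b} \<in> stack D (cup_at i r)"
  proof (rule block_stack_cup_at[OF D])
    show "(upper_point x, upper_point y) \<in> conn ?G" if "x \<in> {Bot a, Bot b}" "y \<in> {Bot a, Bot b}" for x y
      using that 3 conn_sym[OF 3] conn_trans[OF 3 conn_sym[OF 3]] conn_trans[OF conn_sym[OF 3] 3] by auto
  qed (use sub ne ab(3) \<open>a \<noteq> b\<close> \<open>b \<noteq> i\<close> in auto)
  have m: "\<exists>r'. (Middle j, Outer r') \<in> conn ?G" if j: "j < i + (2 + r)" "j \<noteq> i" "j \<noteq> Suc i" for j
  proof -
    obtain x where x: "Bot j = skip_point i x" using range_skip[of j i] j by blast
    then have "x \<in> points (i + r) 0" using j by (cases x) (auto split: if_splits)
    from conn_sym[OF conn_cup_at[OF D this]] show ?thesis unfolding x[symmetric] by auto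
  qed
  show "loops D (cup_at i r) = 0"
  proof (rule loops_eq_0[OF cup_at_closed D])
    fix j assume j: "j < i + (2 + r)"
    have a: "a < i + (2 + r)" using sub by simp
    obtain r' where r': "(Middle a, Outer r') \<in> conn ?G" using m[OF a ne(1) ab(3)] by blast
    have "(Middle i, Outer r') \<in> conn ?G" using conn_trans[OF conn_sym[OF 1] r'] .
    moreover have "(Middle (Suc i), Outer r') \<in> conn ?G"
      using conn_trans[OF conn_sym[OF conn_cup_at_mid] calculation] .
    ultimately show "\<exists>r'. (Middle j, Outer r') \<in> conn ?G" using m j by metis
  qed
qed

section \<open>Noncrossing matchings on a line: the rainbow, innermost arcs and valleys\<close>

section \<open>The rainbow diagram\<close>

lemma block_unique:
  assumes "D \<in> diagrams m n" "c \<in> D" "c' \<in> D" "x \<in> c" "x \<in> c'"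
  shows "c = c'"
proof (rule ccontr)
  assume "c \<noteq> c'"
  then have "c \<inter> c' = {}" using partition_onD2[OF diagramsD(1)[OF assms(1)]] assms(2,3) by (simp add: disjoint_def)
  then show False using assms(4,5) by blast
qed

definition ends :: "diagram => nat => nat" where
  "ends D i = (THE j. {Bot i, Bot j} \<in> D)"

context
  fixes M D assumes D: "D \<in> diagrams M 0"
begin

lemma ends_ex1: "i < M ==> \<exists>!j. {Bot i, Bot j} \<in> D"
proof -
  assume i: "i < M"
  note d = diagramsD[OF D]
  have "Bot i \<in> \<Union>D" using i d(4) by simp
  then obtain b where b: "b \<in> D" "Bot i \<in> b" by blast
  obtain x where x: "b = {Bot i, x}" using d(2)[OF b(1)] b(2) by (auto simp: card_2_iff)
  then have "x \<in> points M 0" using b d(4) by blast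
  then obtain j where j: "x = Bot j" by (auto simp: points_def)
  have "k = j" if "{Bot i, Bot k} \<in> D" for k
  proof -
    have "{Bot i, Bot k} = {Bot i, Bot j}" by (rule block_unique[OF D that]) (use b x j in auto)
    then show ?thesis by (auto simp: doubleton_eq_iff)
  qed
  then show ?thesis using b x j by blast
qed

lemma ends_in: "i < M ==> {Bot i, Bot (ends D i)} \<in> D" unfolding ends_def by (rule theI'[OF ends_ex1])

lemma ends_eqI: "{Bot i, Bot j} \<in> D ==> ends D i = j"
proof -
  assume a: "{Bot i, Bot j} \<in> D"
  then have "i < M" using diagramsD(4)[OF D] by (metis UnionI in_points(1) insertI1)
  then show ?thesis using ends_ex1 ends_in a by blast
qed

lemma ends_props:
  assumes "i < M"
  shows "ends D i < M" "ends D i \<noteq> i" "ends D (ends D i) = i"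
proof -
  note e = ends_in[OF assms]
  show "ends D i < M" using e diagramsD(4)[OF D] by (metis UnionI in_points(1) insertI1 insertI2)
  show "ends D i \<noteq> i" using diagramsD(2)[OF D e] by auto
  show "ends D (ends D i) = i" by (rule ends_eqI) (use e in "simp add: insert_commute")
qed

lemma ends_noncrossing:
  assumes "i < M" "j < M" "i < j" "j < ends D i" "ends D i < ends D j"
  shows False
  using diagramsD(3)[OF D] ends_in[OF assms(1)] ends_in[OF assms(2)] assms(3-5)
  unfolding noncrossing_def by fastforce

lemma diagram_eq_ends: "D = (\<lambda>i. {Bot i, Bot (ends D i)}) ` {..<M}"
proof
  show "D \<subseteq> (\<lambda>i. {Bot i, Bot (ends D i)}) ` {..<M}"
  proof
    fix b assume b: "b \<in> D"
    then obtain x where "x \<in> b" using diagramsD(2)[OF D] by fastforce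
    then have "x \<in> points M 0" using b diagramsD(4)[OF D] by blast
    then obtain i where i: "x = Bot i" "i < M" by (auto simp: points_def)
    have "b = {Bot i, Bot (ends D i)}"
      by (rule block_unique[OF D b ends_in[OF i(2)] \<open>x \<in> b\<close>]) (simp add: i(1))
    then show "b \<in> (\<lambda>i. {Bot i, Bot (ends D i)}) ` {..<M}" using i by blast
  qed
qed (use ends_in in auto)

end

text \<open>Noncrossing forces the partners of the right half to decrease from left to right. A
  strictly decreasing sequence of \<open>k\<close> numbers below \<open>k\<close> is determined;
  \<open>up\<close> and \<open>low\<close> bound it from both sides.\<close>

lemma rainbow_if_halves_joined:
  assumes D: "D \<in> diagrams (k + k) 0" and out: "\<And>i. k \<le> i ==> i < k + k ==> ends D i < k"
  shows "D = cap_diagram k"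
proof -
  let ?w = "ends D"
  note p = ends_props[OF D]
  have dec: "?w j < ?w i" if "k \<le> i" "i < j" "j < k + k" for i j
  proof (rule ccontr)
    assume "\<not> ?w j < ?w i"
    moreover have "?w i \<noteq> ?w j" using p(3)[of i] p(3)[of j] that by auto
    ultimately have "?w i < ?w j" by simp
    moreover have "?w j < k" "?w i < k" using out that by auto
    ultimately show False using ends_noncrossing[OF D, of "?w i" "?w j"] p(3)[of i] p(3)[of j] that by auto
  qed
  have up: "?w (k + j) + j \<le> k - 1" if "j < k" for j using that
  proof (induction j)
    case 0
    then show ?case using out[of k] by auto
  next
    case (Suc j)
    then show ?case using dec[of "k + j" "k + Suc j"] by auto
  qed
  have low: "j \<le> ?w (k + k - 1 - j)" if "j < k" for j using that
  proof (induction j)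
    case (Suc j)
    have "k \<le> k + k - 1 - Suc j" "k + k - 1 - Suc j < k + k - 1 - j" "k + k - 1 - j < k + k"
      using Suc.prems by auto
    from dec[OF this] show ?case using Suc by simp
  qed simp
  have hi: "?w (k + j) = k - 1 - j" if "j < k" for j
    using up[OF that] low[of "k - 1 - j"] that by (simp add: algebra_simps)
  have lo: "?w i = 2 * k - 1 - i" if "i < k" for i
  proof -
    have "?w (k + (k - 1 - i)) = i" using hi[of "k - 1 - i"] that by simp
    then show ?thesis using p(3)[of "k + (k - 1 - i)"] that by simp
  qed
  have "D = (\<lambda>i. {Bot i, Bot (?w i)}) ` {..<k + k}" by (rule diagram_eq_ends[OF D])
  also have "... = cap_diagram k"
  proof
    show "cap_diagram k \<subseteq> (\<lambda>i. {Bot i, Bot (?w i)}) ` {..<k + k}"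
      unfolding cap_diagram_def using lo by (auto simp: image_iff)
    show "(\<lambda>i. {Bot i, Bot (?w i)}) ` {..<k + k} \<subseteq> cap_diagram k"
    proof (intro image_subsetI)
      fix i assume "i \<in> {..<k + k}"
      then consider "i < k" | j where "i = k + j" "j < k" by (metis lessThan_iff less_diff_conv2 add_diff_inverse_nat nat_add_left_cancel_less)
      then show "{Bot i, Bot (?w i)} \<in> cap_diagram k"
      proof cases
        case 1
        then show ?thesis using lo cap_mem by simp
      next
        case (2 j)
        then have "2 * k - 1 - (k - 1 - j) = i" "k - 1 - j < k" by auto
        then show ?thesis using cap_mem[of "k - 1 - j" k] hi[of j] 2 by (simp add: insert_commute)
      qed
    qed
  qed
  finally show ?thesis .
qed

text \<open>If \<open>D\<close> is not the rainbow, some arc lies entirely in the right half; a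
  shortest arc of this kind joins neighbours.\<close>

lemma inner_arc:
  assumes D: "D \<in> diagrams (k + k) 0" and ne: "D \<noteq> cap_diagram k"
  shows "\<exists>i. k \<le> i \<and> Suc i < k + k \<and> {Bot i, Bot (Suc i)} \<in> D"
proof -
  let ?w = "ends D"
  note p = ends_props[OF D]
  obtain i where i: "k \<le> i" "i < k + k" "k \<le> ?w i" using rainbow_if_halves_joined[OF D] ne by (meson not_le)
  have "\<exists>i. k \<le> i \<and> i < k + k \<and> i < ?w i"
  proof (cases "i < ?w i")
    case False
    then have "?w i < i" using p(2)[OF i(2)] by simp
    then show ?thesis using i p(1)[OF i(2)] p(3)[OF i(2)] by auto
  qed (use i in blast)
  then have "\<exists>n i. k \<le> i \<and> i < k + k \<and> i < ?w i \<and> ?w i - i = n" by blast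
  then obtain i where i: "k \<le> i" "i < k + k" "i < ?w i"
    and least: "\<And>j. k \<le> j ==> j < k + k ==> j < ?w j ==> ?w i - i \<le> ?w j - j"
    using exists_least_iff[of "\<lambda>n. \<exists>i. k \<le> i \<and> i < k + k \<and> i < ?w i \<and> ?w i - i = n"] by (metis not_le)
  \<comment> \<open>Otherwise the arc at \<open>Suc i\<close> is trapped below the arc at
    \<open>i\<close>, and is shorter.\<close>
  have "?w i = Suc i"
  proof (rule ccontr)
    assume "?w i \<noteq> Suc i"
    then have lt: "Suc i < ?w i" using i by simp
    then have si: "Suc i < k + k" using p(1)[OF i(2)] by simp
    have neq: "?w (Suc i) \<noteq> ?w i" "?w (Suc i) \<noteq> i" using p(3)[OF si] p(3)[OF i(2)] lt by auto
    have "\<not> ?w i < ?w (Suc i)" using ends_noncrossing[OF D i(2) si] lt by auto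
    then have wlt: "?w (Suc i) < ?w i" using neq by simp
    have "\<not> ?w (Suc i) < i"
    proof
      assume "?w (Suc i) < i"
      then show False using ends_noncrossing[OF D p(1)[OF si] i(2)] p(3)[OF si] lt by auto
    qed
    then have "Suc i < ?w (Suc i)" using neq p(2)[OF si] by simp
    then show False using least[of "Suc i"] si i wlt by auto
  qed
  then show ?thesis using ends_in[OF D i(2)] p(1)[OF i(2)] i(1) by metis
qed

text \<open>A counting argument: without a valley all points up to the start of an innermost arc in
  the right half are opening, and there are too few points behind them for their partners.\<close>

lemma valley:
  assumes D: "D \<in> diagrams (k + k) 0" and ne: "D \<noteq> cap_diagram k"
  shows "\<exists>i. Suc i < k + k \<and> ends D i < i \<and> Suc i < ends D (Suc i)"
proof (rule ccontr)
  assume no: "\<not> ?thesis"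
  let ?w = "ends D"
  note p = ends_props[OF D]
  obtain i where i: "k \<le> i" "Suc i < k + k" "{Bot i, Bot (Suc i)} \<in> D" using inner_arc[OF D ne] by blast
  have "i < ?w i" using ends_eqI[OF D i(3)] by simp
  \<comment> \<open>Without a valley, the point before an opening point is opening as well; this
    goes down from \<open>i\<close> to 0.\<close>
  have op: "j < ?w j" if "j \<le> i" for j
  proof (rule inc_induct[OF that])
    show "i < ?w i" by fact
    fix j assume j: "j < i" "Suc j < ?w (Suc j)"
    then have "Suc j < k + k" "j < k + k" using i by auto
    then show "j < ?w j" using no j(2) p(2)[of j] by (meson linorder_neqE_nat)
  qed
  have sub: "?w ` {..i} \<subseteq> {i<..<k + k}"
  proof
    fix x assume "x \<in> ?w ` {..i}"
    then obtain j where j: "x = ?w j" "j \<le> i" by blast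
    then have jk: "j < k + k" using i by simp
    have "\<not> x \<le> i" using op[OF j(2)] op[of x] p(3)[OF jk] j(1) by auto
    then show "x \<in> {i<..<k + k}" using p(1)[OF jk] j(1) by simp
  qed
  have inj: "inj_on ?w {..i}" by (rule inj_on_inverseI[of _ ?w]) (use p(3) i in auto)
  have "card {..i} \<le> card {i<..<k + k}" using card_mono[OF _ sub] card_image[OF inj] by simp
  then show False using i by simp
qed

text \<open>The sum of the closing positions of the arcs. It orders the support of a linear
  combination so that cutting out a valley of a maximal diagram is injective enough.\<close>

definition closers :: "diagram => nat" where
  "closers D = (\<Sum>b\<in>D. Max (boundary_pos (0::nat) 0 ` b))"

lemma even_bottom:
  assumes "D \<in> diagrams M 0"
  obtains k where "M = k + k"
proof -
  have "card (points M 0) = 2 * card D"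
    using even_Union_blocks[OF assms order_refl] diagramsD(4)[OF assms] by simp
  moreover have "card (points M 0) = M" by (simp add: points_def card_image inj_on_def)
  ultimately show ?thesis using that[of "card D"] by simp
qed

text \<open>Cutting out a valley: among the diagrams with the same image, the one with the valley has the
  smallest closing positions.\<close>

lemma cup_at_maximal:
  assumes D: "D \<in> diagrams (i + (2 + r)) 0" and D0: "D0 \<in> diagrams (i + (2 + r)) 0"
    and v: "ends D0 i < i" "Suc i < ends D0 (Suc i)"
    and eq: "stack D (cup_at i r) = stack D0 (cup_at i r)" and le: "closers D \<le> closers D0"
  shows "D = D0"
proof -
  let ?M = "i + (2 + r)"
  let ?T = "stack D0 (cup_at i r)"
  let ?s = "skip_point i"
  have iM: "i < ?M" "Suc i < ?M" by auto
  define a0 b0 where "a0 = ends D0 i" and "b0 = ends D0 (Suc i)"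
  define a b where "a = ends D i" and "b = ends D (Suc i)"
  have a0: "{Bot a0, Bot i} \<in> D0" using ends_in[OF D0 iM(1)] by (simp add: a0_def insert_commute)
  have b0: "{Bot (Suc i), Bot b0} \<in> D0" using ends_in[OF D0 iM(2)] by (simp add: b0_def)
  have a: "{Bot a, Bot i} \<in> D" using ends_in[OF D iM(1)] by (simp add: a_def insert_commute)
  have b: "{Bot (Suc i), Bot b} \<in> D" using ends_in[OF D iM(2)] by (simp add: b_def)
  define O0 where "O0 = {c \<in> D0. Bot i \<notin> c \<and> Bot (Suc i) \<notin> c}"
  define Q where "Q = {c \<in> D. Bot i \<notin> c \<and> Bot (Suc i) \<notin> c}"
  note d = diagramsD[OF D] and d0 = diagramsD[OF D0]
  have T: "partition_on (points (i + r) 0) ?T" "\<And>c. c \<in> ?T ==> card c = 2" "finite ?T"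
    using diagramsD[OF stack_closed[OF cup_at_closed D0]] by auto
  have same: "c = c'" if "c \<in> E" "c' \<in> E" "x \<in> c" "x \<in> c'" "E \<in> diagrams u w" for c c' x E u w
    by (rule block_unique[OF that(5,1-4)])
  have D0_eq: "D0 = insert {Bot a0, Bot i} (insert {Bot (Suc i), Bot b0} O0)"
    using a0 b0 same[OF _ a0 _ _ D0] same[OF _ b0 _ _ D0] unfolding O0_def by blast
  have D_eq: "D = insert {Bot a, Bot i} (insert {Bot (Suc i), Bot b} Q)"
    using a b same[OF _ a _ _ D] same[OF _ b _ _ D] unfolding Q_def by blast
  have rng: "c \<subseteq> range ?s" if c: "c \<subseteq> points ?M 0" "Bot i \<notin> c" "Bot (Suc i) \<notin> c" for c
  proof
    fix x assume x: "x \<in> c"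
    then obtain j where "x = Bot j" using c(1) by (auto simp: points_def)
    then show "x \<in> range ?s" using x c(2,3) by (auto simp: range_skip)
  qed
  have img: "?s ` (?s -` c) = c" if "c \<subseteq> points ?M 0" "Bot i \<notin> c" "Bot (Suc i) \<notin> c" for c
    using rng[OF that] by (simp add: image_vimage_eq Int_absorb2)
  \<comment> \<open>The common composite, with its points put back to their places among the
    \<open>?M\<close> original ones.\<close>
  define T' where "T' = (`) ?s ` ?T"
  have T'_part: "c = c'" if c: "c \<in> T'" "c' \<in> T'" "x \<in> c" "x \<in> c'" for c c' x
  proof -
    obtain e e' where e: "e \<in> ?T" "e' \<in> ?T" "c = ?s ` e" "c' = ?s ` e'" using c(1,2) by (auto simp: T'_def)
    obtain y y' where y: "y \<in> e" "y' \<in> e'" "x = ?s y" "x = ?s y'" using e c(3,4) by blast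
    then have "y = y'" using injD[OF inj_skip] by metis
    then show ?thesis using e y same[OF e(1,2)] stack_closed[OF cup_at_closed D0] by blast
  qed
  have T'_cover: "\<exists>c\<in>T'. x \<in> c" if x: "x \<in> points ?M 0" "x \<noteq> Bot i" "x \<noteq> Bot (Suc i)" for x
  proof -
    have "{x} \<subseteq> range ?s" by (rule rng) (use x in auto)
    then obtain y where y: "x = ?s y" by blast
    then have "y \<in> points (i + r) 0" using x(1) by (cases y) (auto split: if_splits)
    then have "y \<in> \<Union>?T" using diagramsD(4)[OF stack_closed[OF cup_at_closed D0]] by simp
    then obtain e where "e \<in> ?T" "y \<in> e" by blast
    then have "?s ` e \<in> T'" "x \<in> ?s ` e" using y by (simp_all add: T'_def)
    then show ?thesis by blast
  qed
  have T'_out: "Bot i \<notin> c \<and> Bot (Suc i) \<notin> c \<and> c \<noteq> {} \<and> c \<subseteq> points ?M 0" if c: "c \<in> T'" for c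
  proof -
    obtain e where e: "e \<in> ?T" "c = ?s ` e" using c by (auto simp: T'_def)
    have "e \<noteq> {}" using T(2)[OF e(1)] by auto
    moreover have "e \<subseteq> points (i + r) 0" using diagramsD(4)[OF stack_closed[OF cup_at_closed D0]] e(1) by blast
    moreover have "?s y \<in> points ?M 0 \<and> ?s y \<noteq> Bot i \<and> ?s y \<noteq> Bot (Suc i)" if "y \<in> points (i + r) 0" for y
      using that by (cases y) (auto split: if_splits)
    ultimately have "z \<in> points ?M 0 \<and> z \<noteq> Bot i \<and> z \<noteq> Bot (Suc i)" if "z \<in> c" for z
      using that unfolding e(2) by (elim imageE) (simp only: subsetD simp_thms)
    moreover have "c \<noteq> {}" using \<open>e \<noteq> {}\<close> e(2) by simp
    ultimately show ?thesis by blast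
  qed
  have mem: "c \<in> T'" if "?s -` c \<in> ?T" "c \<subseteq> points ?M 0" "Bot i \<notin> c" "Bot (Suc i) \<notin> c" for c
    using img[OF that(2-4)] that(1) unfolding T'_def by (metis imageI)
  have cover_eq: "T' = R" if R: "R \<subseteq> T'" "\<And>x. x \<in> points ?M 0 ==> x \<noteq> Bot i ==> x \<noteq> Bot (Suc i) ==> x \<in> \<Union>R" for R
  proof
    show "T' \<subseteq> R"
    proof
      fix c assume c: "c \<in> T'"
      then obtain x where x: "x \<in> c" using T'_out by blast
      then have "x \<in> points ?M 0" "x \<noteq> Bot i" "x \<noteq> Bot (Suc i)" using T'_out[OF c] by auto
      then obtain c' where c': "c' \<in> R" "x \<in> c'" using R(2) by blast
      then show "c \<in> R" using T'_part[OF c _ x c'(2)] R(1) by blast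
    qed
  qed (rule R(1))
  have other: "c \<in> T'" if "c \<in> D \<and> stack D (cup_at i r) = ?T \<or> c \<in> D0" "Bot i \<notin> c" "Bot (Suc i) \<notin> c" for c
    using that(1)
  proof
    assume "c \<in> D \<and> stack D (cup_at i r) = ?T"
    then show ?thesis using stack_cup_at_other[OF D, of c] that(2,3) d(4) by (intro mem) auto
  next
    assume "c \<in> D0"
    then show ?thesis using stack_cup_at_other[OF D0, of c] that(2,3) d0(4) by (intro mem) auto
  qed
  have a0M: "a0 < ?M" "b0 < ?M" "a < ?M" "b < ?M"
    using ends_props(1)[OF D0] ends_props(1)[OF D] iM by (auto simp: a0_def b0_def a_def b_def)
  have v': "a0 < i" "Suc i < b0" using v by (auto simp: a0_def b0_def)
  have j0: "{Bot a0, Bot b0} \<in> T'" by (rule mem) (use stack_cup_at_join[OF D0 a0 b0] v' a0M in auto)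
  have T'0: "T' = insert {Bot a0, Bot b0} O0"
  proof (rule cover_eq)
    show "insert {Bot a0, Bot b0} O0 \<subseteq> T'" using j0 other by (auto simp: O0_def)
    fix x assume x: "x \<in> points ?M 0" "x \<noteq> Bot i" "x \<noteq> Bot (Suc i)"
    then have "x \<in> \<Union>D0" using d0(4) by simp
    then show "x \<in> \<Union>(insert {Bot a0, Bot b0} O0)" using x unfolding D0_eq by auto
  qed
  have nin0: "{Bot a0, Bot b0} \<notin> O0"
  proof
    assume "{Bot a0, Bot b0} \<in> O0"
    then have "{Bot a0, Bot b0} = {Bot a0, Bot i}" using same[OF _ a0 _ _ D0, of "{Bot a0, Bot b0}" "Bot a0"] by (auto simp: O0_def)
    then show False using v' by (auto simp: doubleton_eq_iff)
  qed
  have fin: "finite O0" "finite Q" using d0(5) d(5) by (auto simp: O0_def Q_def)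
  let ?f = "\<lambda>b. Max (boundary_pos 0 0 ` b)"
  have f2: "?f {Bot x, Bot y} = max x y" for x y by simp
  have m0: "closers D0 = i + b0 + sum ?f O0"
  proof -
    have "{Bot (Suc i), Bot b0} \<notin> O0" "{Bot a0, Bot i} \<notin> insert {Bot (Suc i), Bot b0} O0"
      using v' by (auto simp: O0_def doubleton_eq_iff)
    then show ?thesis unfolding closers_def D0_eq using fin v' by (simp add: max_def)
  qed
  \<comment> \<open>Cutting the valley removes exactly the closing position \<open>i\<close>: the
    joined arc keeps the closing end \<open>b0\<close>.\<close>
  have sT: "sum ?f T' = b0 + sum ?f O0" unfolding T'0 using nin0 fin v' by (simp add: max_def)
  show ?thesis
  proof (cases "a = Suc i")
    \<comment> \<open>Here the cup closes a loop in \<open>D\<close> and removes the closing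
      position \<open>Suc i\<close>, so \<open>D\<close> would have the larger sum.\<close>
    case True
    then have "b = i" using ends_props(3)[OF D iM(1)] by (simp add: a_def b_def)
    have "T' = Q"
    proof (rule cover_eq)
      show "Q \<subseteq> T'" using other eq by (auto simp: Q_def)
      fix x assume x: "x \<in> points ?M 0" "x \<noteq> Bot i" "x \<noteq> Bot (Suc i)"
      then have "x \<in> \<Union>D" using d(4) by simp
      then show "x \<in> \<Union>Q" using x unfolding D_eq True \<open>b = i\<close> by auto
    qed
    moreover have "closers D = Suc i + sum ?f Q"
    proof -
      have "{Bot (Suc i), Bot i} \<notin> Q" by (auto simp: Q_def)
      then show ?thesis unfolding closers_def D_eq True \<open>b = i\<close> using fin by simp
    qed
    ultimately show ?thesis using sT m0 le by simp
  next
    case False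
    note join = stack_cup_at_join[OF D a b False]
    have ab: "a \<noteq> i" "b \<noteq> Suc i" "b \<noteq> i"
      using ends_props(2)[OF D iM(1)] ends_props(2)[OF D iM(2)] ends_props(3)[OF D iM(2)] False
      by (auto simp: a_def b_def)
    have j: "{Bot a, Bot b} \<in> T'" by (rule mem) (use join(1) eq ab False a0M in auto)
    have T'Q: "T' = insert {Bot a, Bot b} Q"
    proof (rule cover_eq)
      show "insert {Bot a, Bot b} Q \<subseteq> T'" using j other eq by (auto simp: Q_def)
      fix x assume x: "x \<in> points ?M 0" "x \<noteq> Bot i" "x \<noteq> Bot (Suc i)"
      then have "x \<in> \<Union>D" using d(4) by simp
      then show "x \<in> \<Union>(insert {Bot a, Bot b} Q)" using x unfolding D_eq by auto
    qed
    have nin: "{Bot a, Bot b} \<notin> Q"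
    proof
      assume "{Bot a, Bot b} \<in> Q"
      then have "{Bot a, Bot b} = {Bot a, Bot i}" using same[OF _ a _ _ D, of "{Bot a, Bot b}" "Bot a"] by (auto simp: Q_def)
      then show False using ab by (auto simp: doubleton_eq_iff)
    qed
    have "closers D = max a i + max b (Suc i) + sum ?f Q"
    proof -
      have "{Bot (Suc i), Bot b} \<notin> Q" "{Bot a, Bot i} \<notin> insert {Bot (Suc i), Bot b} Q"
        using False ab by (auto simp: Q_def doubleton_eq_iff)
      then show ?thesis unfolding closers_def D_eq using fin by (simp add: max.commute)
    qed
    moreover have "sum ?f T' = max a b + sum ?f Q" unfolding T'Q using nin fin by simp
    ultimately have ineq: "max a i + max b (Suc i) \<le> i + max a b" using sT m0 le by simp
    have nocross: "\<not> (b < i \<and> Suc i < a)"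
    proof
      assume "b < i \<and> Suc i < a"
      then show False using ends_noncrossing[OF D a0M(4) iM(1)] ends_props(3)[OF D iM(2)] by (simp add: a_def b_def)
    qed
    \<comment> \<open>Every other position of the two partners violates the inequality between the
      sums, so \<open>D\<close> has a valley at the same place.\<close>
    have lt: "a < i" "Suc i < b" using ineq nocross ab False join(3) by (auto simp: max_def split: if_splits)
    \<comment> \<open>If the joined arcs differed, each would be an untouched arc of the other
      diagram. According to the order of \<open>a\<close> and \<open>a0\<close>, one of them would
      then cross the arc ending at \<open>i\<close> in that diagram.\<close>
    have "{Bot a, Bot b} = {Bot a0, Bot b0}"
    proof (rule ccontr)
      assume ne: "{Bot a, Bot b} \<noteq> {Bot a0, Bot b0}"
      then have "{Bot a, Bot b} \<in> O0" using j T'0 by auto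
      then have 1: "ends D0 a = b" by (intro ends_eqI[OF D0]) (simp add: O0_def)
      have "{Bot a0, Bot b0} \<in> Q" using j0 T'Q ne by auto
      then have 2: "ends D a0 = b0" by (intro ends_eqI[OF D]) (simp add: Q_def)
      have "a \<noteq> a0" using 1 ends_eqI[OF D0 a0] lt by auto
      moreover have "\<not> a < a0" using ends_noncrossing[OF D a0M(3) a0M(1)] ends_eqI[OF D a] 2 v' by auto
      moreover have "\<not> a0 < a" using ends_noncrossing[OF D0 a0M(1) a0M(3)] ends_eqI[OF D0 a0] 1 lt by auto
      ultimately show False by simp
    qed
    then have "a = a0" "b = b0" using lt v' by (auto simp: doubleton_eq_iff)
    moreover have "Q = O0" using T'Q T'0 nin nin0 calculation by (metis insert_ident)
    ultimately show ?thesis unfolding D_eq D0_eq by simp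
  qed
qed

section \<open>Multilinear extension of the operations on diagrams\<close>

section \<open>Linear combinations of diagrams\<close>

type_synonym coeffs = "diagram => complex"

definition V :: "nat => nat => coeffs set" where
  "V m n = {f. \<forall>D. D \<notin> diagrams m n \<longrightarrow> f D = 0}"

definition tcmp :: "complex => nat => nat => nat => coeffs => coeffs => coeffs" where
  "tcmp \<beta> m n p g f = (\<lambda>F. \<Sum>E\<in>diagrams n p. \<Sum>D\<in>diagrams m n.
     if stack E D = F then \<beta> ^ loops E D * g E * f D else 0)"

definition ttens :: "nat => nat => nat => nat => coeffs => coeffs => coeffs" where
  "ttens m n m' n' f g = (\<lambda>F. \<Sum>D\<in>diagrams m n. \<Sum>E\<in>diagrams m' n'.
     if juxtapose m n D E = F then f D * g E else 0)"

definition dg :: "diagram => coeffs" where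
  "dg D = (\<lambda>E. if E = D then 1 else 0)"

definition rotc :: "nat => nat => coeffs => coeffs" where
  "rotc m n f = (\<lambda>F. \<Sum>D\<in>diagrams m n. if rot m n D = F then f D else 0)"

text \<open>Stated for two index types because a definition cannot quantify over types: natural
  numbers index matrix products, diagrams index the expansion in the basis.\<close>

definition linop :: "(coeffs => coeffs) => bool" where
  "linop \<Phi> \<longleftrightarrow> (\<forall>(A :: nat set) c h. \<Phi> (\<lambda>X. \<Sum>k\<in>A. c k * h k X) = (\<lambda>F. \<Sum>k\<in>A. c k * \<Phi> (h k) F)) \<and>
    (\<forall>(A :: diagram set) c h. \<Phi> (\<lambda>X. \<Sum>k\<in>A. c k * h k X) = (\<lambda>F. \<Sum>k\<in>A. c k * \<Phi> (h k) F))"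

lemma linop_comp: "linop \<Phi> ==> linop \<Psi> ==> linop (\<lambda>f. \<Phi> (\<Psi> f))" unfolding linop_def by simp

lemma linop_id: "linop (\<lambda>f. f)" unfolding linop_def by simp

lemma double_sum_linear:
  fixes w :: "'a => 'b => complex"
  shows "(\<Sum>E\<in>A. \<Sum>D\<in>B. w E D * (\<Sum>k\<in>I. c k * h k (s E D))) = (\<Sum>k\<in>I. c k * (\<Sum>E\<in>A. \<Sum>D\<in>B. w E D * h k (s E D)))"
proof -
  have "(\<Sum>E\<in>A. \<Sum>D\<in>B. w E D * (\<Sum>k\<in>I. c k * h k (s E D))) = (\<Sum>E\<in>A. \<Sum>D\<in>B. \<Sum>k\<in>I. c k * (w E D * h k (s E D)))"
    by (simp add: sum_distrib_left mult.left_commute)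
  also have "... = (\<Sum>E\<in>A. \<Sum>k\<in>I. \<Sum>D\<in>B. c k * (w E D * h k (s E D)))" by (intro sum.cong refl sum.swap)
  also have "... = (\<Sum>k\<in>I. c k * (\<Sum>E\<in>A. \<Sum>D\<in>B. w E D * h k (s E D)))"
    unfolding sum_distrib_left by (rule sum.swap)
  finally show ?thesis .
qed

lemma linop_double_sum: "linop (\<lambda>h F. \<Sum>E\<in>A. \<Sum>D\<in>B. w F E D * h (s E D))"
  unfolding linop_def by (intro conjI allI ext double_sum_linear)

lemma linop_tcmp_right: "linop (tcmp \<beta> m n p g)"
proof -
  have "tcmp \<beta> m n p g = (\<lambda>h F. \<Sum>E\<in>diagrams n p. \<Sum>D\<in>diagrams m n. (if stack E D = F then \<beta> ^ loops E D * g E else 0) * h D)"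
    by (intro ext) (auto simp: tcmp_def intro!: sum.cong)
  then show ?thesis by (simp only: linop_double_sum)
qed

lemma linop_tcmp_left: "linop (\<lambda>g. tcmp \<beta> m n p g f)"
proof -
  have "(\<lambda>g. tcmp \<beta> m n p g f) = (\<lambda>h F. \<Sum>E\<in>diagrams n p. \<Sum>D\<in>diagrams m n. (if stack E D = F then \<beta> ^ loops E D * f D else 0) * h E)"
    by (intro ext) (auto simp: tcmp_def intro!: sum.cong)
  then show ?thesis by (simp only: linop_double_sum)
qed

lemma linop_ttens_right: "linop (ttens m n m' n' f)"
proof -
  have "ttens m n m' n' f = (\<lambda>h F. \<Sum>D\<in>diagrams m n. \<Sum>E\<in>diagrams m' n'. (if juxtapose m n D E = F then f D else 0) * h E)"
    by (intro ext) (auto simp: ttens_def intro!: sum.cong)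
  then show ?thesis by (simp only: linop_double_sum)
qed

lemma linop_ttens_left: "linop (\<lambda>f. ttens m n m' n' f g)"
proof -
  have "(\<lambda>f. ttens m n m' n' f g) = (\<lambda>h F. \<Sum>D\<in>diagrams m n. \<Sum>E\<in>diagrams m' n'. (if juxtapose m n D E = F then g E else 0) * h D)"
    by (intro ext) (auto simp: ttens_def intro!: sum.cong)
  then show ?thesis by (simp only: linop_double_sum)
qed

lemma linop_rotc: "linop (rotc m n)"
proof -
  have "rotc m n = (\<lambda>h F. \<Sum>E\<in>{()}. \<Sum>D\<in>diagrams m n. (if rot m n D = F then 1 else 0) * h D)"
    by (intro ext) (auto simp: rotc_def intro!: sum.cong)
  then show ?thesis by (simp only: linop_double_sum)
qed

lemma expand: "f \<in> V m n ==> f = (\<lambda>X. \<Sum>D\<in>diagrams m n. f D * dg D X)"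
  by (rule ext) (auto simp: dg_def V_def if_distrib[of "\<lambda>x. f _ * x"] cong: if_cong)

lemma linopD:
  fixes A :: "nat set"
  assumes "linop \<Phi>"
  shows "\<Phi> (\<lambda>X. \<Sum>k\<in>A. c k * h k X) = (\<lambda>F. \<Sum>k\<in>A. c k * \<Phi> (h k) F)"
  using conjunct1[OF assms[unfolded linop_def], rule_format, of c h A] .

lemma linop_sum:
  fixes A :: "nat set"
  assumes "linop \<Phi>"
  shows "\<Phi> (\<lambda>X. \<Sum>k\<in>A. h k X) = (\<lambda>F. \<Sum>k\<in>A. \<Phi> (h k) F)"
  using linopD[OF assms, of "\<lambda>_. 1" h A] by simp

lemma linop_scale: "linop \<Phi> ==> \<Phi> (\<lambda>X. c * h X) = (\<lambda>F. c * \<Phi> h F)"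
  using linopD[of \<Phi> "\<lambda>_. c" "\<lambda>_. h" "{0}"] by simp

lemma linop_add: "linop \<Phi> ==> \<Phi> (\<lambda>X. f X + g X) = (\<lambda>F. \<Phi> f F + \<Phi> g F)"
  using linop_sum[of \<Phi> "\<lambda>k. if k = 0 then f else g" "{0, 1}"] by simp

lemma linop_zero: "linop \<Phi> ==> \<Phi> (\<lambda>X. 0) = (\<lambda>F. 0)" using linop_scale[of \<Phi> 0] by simp

text \<open>The principle by which all identities of morphisms are reduced to diagrams, one variable
  at a time.\<close>

lemma linop_eqI:
  assumes "linop \<Phi>" "linop \<Psi>" "f \<in> V m n" "\<And>D. D \<in> diagrams m n ==> \<Phi> (dg D) = \<Psi> (dg D)"
  shows "\<Phi> f = \<Psi> f"
proof -
  have "\<Phi> (\<lambda>X. \<Sum>D\<in>diagrams m n. f D * dg D X) = \<Psi> (\<lambda>X. \<Sum>D\<in>diagrams m n. f D * dg D X)"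
    using assms(1,2,4) unfolding linop_def by (auto intro!: ext sum.cong)
  then show ?thesis by (simp only: expand[OF assms(3), symmetric])
qed

lemma tcmp_V [simp]: "tcmp \<beta> m n p g f \<in> V m p"
proof -
  have "stack E D \<noteq> F" if "F \<notin> diagrams m p" "E \<in> diagrams n p" "D \<in> diagrams m n" for D E F
    using stack_closed that by blast
  then show ?thesis by (auto simp: V_def tcmp_def intro!: sum.neutral)
qed

lemma ttens_V [simp]: "ttens m n m' n' f g \<in> V (m + m') (n + n')"
proof -
  have "juxtapose m n D E \<noteq> F" if "F \<notin> diagrams (m + m') (n + n')" "D \<in> diagrams m n" "E \<in> diagrams m' n'" for D E F
    using juxtapose_closed that by blast
  then show ?thesis by (auto simp: V_def ttens_def intro!: sum.neutral)
qed

lemma rotc_V [simp]: "rotc m n f \<in> V n m"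
proof -
  have "rot m n D \<noteq> F" if "F \<notin> diagrams n m" "D \<in> diagrams m n" for D F using rot_closed that by blast
  then show ?thesis by (auto simp: V_def rotc_def intro!: sum.neutral)
qed

lemma dg_V: "D \<in> diagrams m n ==> dg D \<in> V m n" by (auto simp: dg_def V_def)

lemma V_zero [simp]: "(\<lambda>X. 0) \<in> V m n" by (simp add: V_def)

lemma V_add: "f \<in> V m n ==> g \<in> V m n ==> (\<lambda>X. f X + g X) \<in> V m n" by (simp add: V_def)

lemma V_scale: "f \<in> V m n ==> (\<lambda>X. c * f X) \<in> V m n" by (simp add: V_def)

lemma V_sum: "(\<And>k. k \<in> A ==> f k \<in> V m n) ==> (\<lambda>X. \<Sum>k\<in>A. f k X) \<in> V m n" by (simp add: V_def)

lemma tcmp_dg_right: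
  assumes "D \<in> diagrams m n"
  shows "tcmp \<beta> m n p g (dg D) F = (\<Sum>E\<in>diagrams n p. if stack E D = F then \<beta> ^ loops E D * g E else 0)"
proof -
  have "(\<Sum>D'\<in>diagrams m n. if stack E D' = F then \<beta> ^ loops E D' * g E * dg D D' else 0) =
      (\<Sum>D'\<in>diagrams m n. if D' = D then (if stack E D = F then \<beta> ^ loops E D * g E else 0) else 0)" for E
    by (intro sum.cong refl) (simp add: dg_def)
  then show ?thesis using assms by (simp add: tcmp_def)
qed

lemma tcmp_dg:
  assumes "D \<in> diagrams m n" "E \<in> diagrams n p"
  shows "tcmp \<beta> m n p (dg E) (dg D) = (\<lambda>F. \<beta> ^ loops E D * dg (stack E D) F)"
proof
  fix F
  have "tcmp \<beta> m n p (dg E) (dg D) F =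
      (\<Sum>E'\<in>diagrams n p. if E' = E then (if stack E D = F then \<beta> ^ loops E D else 0) else 0)"
    unfolding tcmp_dg_right[OF assms(1)] by (intro sum.cong refl) (simp add: dg_def)
  then show "tcmp \<beta> m n p (dg E) (dg D) F = \<beta> ^ loops E D * dg (stack E D) F"
    using assms(2) by (simp add: dg_def)
qed

lemma tcmp_dg':
  assumes "D \<in> diagrams m n" "E \<in> diagrams n p" "stack E D = F \<and> loops E D = 0"
  shows "tcmp \<beta> m n p (dg E) (dg D) = dg F"
  using tcmp_dg[OF assms(1,2)] assms(3) by simp

lemma ttens_dg:
  assumes "D \<in> diagrams m n" "E \<in> diagrams m' n'"
  shows "ttens m n m' n' (dg D) (dg E) = dg (juxtapose m n D E)"
proof
  fix F
  have "(\<Sum>E'\<in>diagrams m' n'. if juxtapose m n D' E' = F then dg D D' * dg E E' else 0) =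
    (\<Sum>E'\<in>diagrams m' n'. if E' = E then (if juxtapose m n D' E = F then dg D D' else 0) else 0)" for D'
    by (intro sum.cong refl) (simp add: dg_def)
  then have "ttens m n m' n' (dg D) (dg E) F = (\<Sum>D'\<in>diagrams m n. if juxtapose m n D' E = F then dg D D' else 0)"
    using assms(2) by (simp add: ttens_def)
  also have "... = (\<Sum>D'\<in>diagrams m n. if D' = D then (if juxtapose m n D E = F then 1 else 0) else 0)"
    by (intro sum.cong refl) (simp add: dg_def)
  finally show "ttens m n m' n' (dg D) (dg E) F = dg (juxtapose m n D E) F"
    using assms(1) by (simp add: dg_def)
qed

lemma rotc_dg:
  assumes "D \<in> diagrams m n"
  shows "rotc m n (dg D) = dg (rot m n D)"
proof
  fix F
  have "rotc m n (dg D) F = (\<Sum>D'\<in>diagrams m n. if D' = D then (if rot m n D = F then 1 else 0) else 0)"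
    unfolding rotc_def by (intro sum.cong refl) (simp add: dg_def)
  then show "rotc m n (dg D) F = dg (rot m n D) F" using assms by (simp add: dg_def)
qed

abbreviation "idc n \<equiv> dg (id_diagram n)"
abbreviation "capc n \<equiv> dg (cap_diagram n)"
abbreviation "cupc n \<equiv> dg (cup_diagram n)"

lemma idc_V [simp]: "idc n \<in> V n n" and capc_V [simp]: "capc n \<in> V (n + n) 0" and cupc_V [simp]: "cupc n \<in> V 0 (n + n)"
  by (simp_all add: dg_V id_diagram_closed cap_diagram_closed cup_diagram_closed)

lemma tcmp_id_right: "f \<in> V m n ==> tcmp \<beta> m m n f (idc m) = f"
  by (rule linop_eqI[OF linop_tcmp_left linop_id])
    (auto intro!: tcmp_dg' id_diagram_closed simp: stack_id_right)

lemma tcmp_id_left: "f \<in> V m n ==> tcmp \<beta> m n n (idc n) f = f"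
  by (rule linop_eqI[OF linop_tcmp_right linop_id])
    (auto intro!: tcmp_dg' id_diagram_closed simp: stack_id_left)

lemma ttens_id: "ttens m m n n (idc m) (idc n) = idc (m + n)"
  by (simp add: ttens_dg id_diagram_closed juxtapose_id)

lemma rotc_rotc:
  assumes "f \<in> V m n"
  shows "rotc n m (rotc m n f) = f"
  by (rule linop_eqI[OF linop_comp[OF linop_rotc linop_rotc] linop_id assms])
    (simp_all add: rotc_dg rot_closed rot_rot)

lemma rotc_id: "rotc n n (idc n) = idc n" by (simp add: rotc_dg id_diagram_closed rot_id)

lemma rotc_tcmp:
  assumes "f \<in> V m n" "g \<in> V n p"
  shows "rotc m p (tcmp \<beta> m n p g f) = tcmp \<beta> p n m (rotc m n f) (rotc n p g)"
proof (rule linop_eqI[OF linop_comp[OF linop_rotc linop_tcmp_right] linop_comp[OF linop_tcmp_left linop_rotc] assms(1)])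
  fix D assume D: "D \<in> diagrams m n"
  show "rotc m p (tcmp \<beta> m n p g (dg D)) = tcmp \<beta> p n m (rotc m n (dg D)) (rotc n p g)"
  proof (rule linop_eqI[OF linop_comp[OF linop_rotc linop_tcmp_left] linop_comp[OF linop_tcmp_right linop_rotc] assms(2)])
    fix E assume E: "E \<in> diagrams n p"
    show "rotc m p (tcmp \<beta> m n p (dg E) (dg D)) = tcmp \<beta> p n m (rotc m n (dg D)) (rotc n p (dg E))"
      using D E by (simp add: tcmp_dg rotc_dg rot_closed linop_scale[OF linop_rotc] stack_closed stack_rot)
  qed
qed

text \<open>Both sides are linear in each of the four variables. On diagrams the loop numbers add
  under juxtaposition, so the powers of \<beta> multiply.\<close>

lemma interchange:
  assumes "f \<in> V m n" "g \<in> V n p" "f' \<in> V m' n'" "g' \<in> V n' p'"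
  shows "tcmp \<beta> (m + m') (n + n') (p + p') (ttens n p n' p' g g') (ttens m n m' n' f f') =
    ttens m p m' p' (tcmp \<beta> m n p g f) (tcmp \<beta> m' n' p' g' f')"
proof (rule linop_eqI[OF linop_comp[OF linop_tcmp_right linop_ttens_left] linop_comp[OF linop_ttens_left linop_tcmp_right] assms(1)])
  fix D assume D: "D \<in> diagrams m n"
  show "tcmp \<beta> (m + m') (n + n') (p + p') (ttens n p n' p' g g') (ttens m n m' n' (dg D) f') =
    ttens m p m' p' (tcmp \<beta> m n p g (dg D)) (tcmp \<beta> m' n' p' g' f')"
  proof (rule linop_eqI[OF linop_comp[OF linop_tcmp_left linop_ttens_left] linop_comp[OF linop_ttens_left linop_tcmp_left] assms(2)])
    fix E assume E: "E \<in> diagrams n p"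
    show "tcmp \<beta> (m + m') (n + n') (p + p') (ttens n p n' p' (dg E) g') (ttens m n m' n' (dg D) f') =
      ttens m p m' p' (tcmp \<beta> m n p (dg E) (dg D)) (tcmp \<beta> m' n' p' g' f')"
    proof (rule linop_eqI[OF linop_comp[OF linop_tcmp_right linop_ttens_right] linop_comp[OF linop_ttens_right linop_tcmp_right] assms(3)])
      fix D' assume D': "D' \<in> diagrams m' n'"
      show "tcmp \<beta> (m + m') (n + n') (p + p') (ttens n p n' p' (dg E) g') (ttens m n m' n' (dg D) (dg D')) =
        ttens m p m' p' (tcmp \<beta> m n p (dg E) (dg D)) (tcmp \<beta> m' n' p' g' (dg D'))"
      proof (rule linop_eqI[OF linop_comp[OF linop_tcmp_left linop_ttens_right] linop_comp[OF linop_ttens_right linop_tcmp_left] assms(4)])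
        fix E' assume E': "E' \<in> diagrams n' p'"
        show "tcmp \<beta> (m + m') (n + n') (p + p') (ttens n p n' p' (dg E) (dg E')) (ttens m n m' n' (dg D) (dg D')) =
          ttens m p m' p' (tcmp \<beta> m n p (dg E) (dg D)) (tcmp \<beta> m' n' p' (dg E') (dg D'))"
          using D E D' E'
          by (simp add: tcmp_dg ttens_dg stack_closed juxtapose_closed stack_juxtapose power_add
              linop_scale[OF linop_ttens_left] linop_scale[OF linop_ttens_right] mult.assoc)
      qed
    qed
  qed
qed

text \<open>The left mate formed with the nested cap and cup is the half turn. Together with
  \<open>right_mate_coeffs\<close>, which has the same right-hand side, it identifies left and right
  duals of morphisms of \<open>TL \<beta>\<close>.\<close>

lemma left_mate_coeffs:
  assumes "f \<in> V m n"
  shows "tcmp \<beta> n (n + (m + m)) m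
      (tcmp \<beta> (n + (m + m)) (n + (n + m)) m
        (ttens (n + n) 0 m m (capc n) (idc m))
        (ttens n n (m + m) (n + m) (idc n) (ttens m n m m f (idc m))))
      (ttens n n 0 (m + m) (idc n) (cupc m)) = rotc m n f"
proof (rule linop_eqI[OF linop_comp[OF linop_tcmp_left linop_comp[OF linop_tcmp_right linop_comp[OF linop_ttens_right linop_ttens_left]]] linop_rotc assms])
  fix D assume D: "D \<in> diagrams m n"
  have A: "juxtapose (n + n) 0 (cap_diagram n) (id_diagram m) \<in> diagrams (n + (n + m)) m"
    using juxtapose_closed[OF cap_diagram_closed[of n] id_diagram_closed[of m]] by (simp add: add.assoc)
  have B: "juxtapose n n (id_diagram n) (juxtapose m n D (id_diagram m)) \<in> diagrams (n + (m + m)) (n + (n + m))"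
    by (intro juxtapose_closed id_diagram_closed D)
  have C: "juxtapose n n (id_diagram n) (cup_diagram m) \<in> diagrams n (n + (m + m))"
    using juxtapose_closed[OF id_diagram_closed[of n] cup_diagram_closed[of m]] by simp
  have "ttens n n (m + m) (n + m) (idc n) (ttens m n m m (dg D) (idc m)) =
      dg (juxtapose n n (id_diagram n) (juxtapose m n D (id_diagram m)))"
    by (simp add: ttens_dg D id_diagram_closed juxtapose_closed)
  moreover have "ttens (n + n) 0 m m (capc n) (idc m) = dg (juxtapose (n + n) 0 (cap_diagram n) (id_diagram m))"
    by (simp add: ttens_dg cap_diagram_closed id_diagram_closed)
  moreover have "ttens n n 0 (m + m) (idc n) (cupc m) = dg (juxtapose n n (id_diagram n) (cup_diagram m))"
    by (simp add: ttens_dg cup_diagram_closed id_diagram_closed)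
  ultimately show "tcmp \<beta> n (n + (m + m)) m
      (tcmp \<beta> (n + (m + m)) (n + (n + m)) m
        (ttens (n + n) 0 m m (capc n) (idc m))
        (ttens n n (m + m) (n + m) (idc n) (ttens m n m m (dg D) (idc m))))
      (ttens n n 0 (m + m) (idc n) (cupc m)) = rotc m n (dg D)"
    using tcmp_dg'[OF B A left_mate_stack1[OF D]]
      tcmp_dg'[OF C _ left_mate_stack2[OF D]] stack_closed[OF B A] left_mate_stack1[OF D] rotc_dg[OF D] by simp
qed

lemma right_mate_coeffs:
  assumes "f \<in> V m n"
  shows "tcmp \<beta> n (m + (m + n)) m
      (tcmp \<beta> (m + (m + n)) (m + (n + n)) m
        (ttens m m (n + n) 0 (idc m) (capc n))
        (ttens m m (m + n) (n + n) (idc m) (ttens m n n n f (idc n))))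
      (ttens 0 (m + m) n n (cupc m) (idc n)) = rotc m n f"
proof (rule linop_eqI[OF linop_comp[OF linop_tcmp_left linop_comp[OF linop_tcmp_right linop_comp[OF linop_ttens_right linop_ttens_left]]] linop_rotc assms])
  fix D assume D: "D \<in> diagrams m n"
  have A: "juxtapose m m (id_diagram m) (cap_diagram n) \<in> diagrams (m + (n + n)) m"
    using juxtapose_closed[OF id_diagram_closed[of m] cap_diagram_closed[of n]] by simp
  have B: "juxtapose m m (id_diagram m) (juxtapose m n D (id_diagram n)) \<in> diagrams (m + (m + n)) (m + (n + n))"
    by (intro juxtapose_closed id_diagram_closed D)
  have C: "juxtapose 0 (m + m) (cup_diagram m) (id_diagram n) \<in> diagrams n (m + (m + n))"
    using juxtapose_closed[OF cup_diagram_closed[of m] id_diagram_closed[of n]] by (simp add: add.assoc)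
  have "ttens m m (m + n) (n + n) (idc m) (ttens m n n n (dg D) (idc n)) =
      dg (juxtapose m m (id_diagram m) (juxtapose m n D (id_diagram n)))"
    by (simp add: ttens_dg D id_diagram_closed juxtapose_closed)
  moreover have "ttens m m (n + n) 0 (idc m) (capc n) = dg (juxtapose m m (id_diagram m) (cap_diagram n))"
    by (simp add: ttens_dg cap_diagram_closed id_diagram_closed)
  moreover have "ttens 0 (m + m) n n (cupc m) (idc n) = dg (juxtapose 0 (m + m) (cup_diagram m) (id_diagram n))"
    by (simp add: ttens_dg cup_diagram_closed id_diagram_closed)
  ultimately show "tcmp \<beta> n (m + (m + n)) m
      (tcmp \<beta> (m + (m + n)) (m + (n + n)) m
        (ttens m m (n + n) 0 (idc m) (capc n))
        (ttens m m (m + n) (n + n) (idc m) (ttens m n n n (dg D) (idc n))))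
      (ttens 0 (m + m) n n (cupc m) (idc n)) = rotc m n (dg D)"
    using tcmp_dg'[OF B A right_mate_stack1[OF D]]
      tcmp_dg'[OF C _ right_mate_stack2[OF D]] stack_closed[OF B A] right_mate_stack1[OF D] rotc_dg[OF D] by simp
qed

section \<open>A relation in the ideal with nonzero rainbow coefficient\<close>

section \<open>Tensor ideals contain a rainbow\<close>

lemma TL_simps [simp]:
  "Ob (TL \<beta>) = UNIV" "unit_ob (TL \<beta>) = 0" "tens_ob (TL \<beta>) = (+)"
  "ldual (TL \<beta>) = (\<lambda>n. n)" "rdual (TL \<beta>) = (\<lambda>n. n)"
  "idm (TL \<beta>) n = (n, n, idc n)"
  "cmp (TL \<beta>) (n, p, g) (m, n, f) = (m, p, tcmp \<beta> m n p g f)"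
  "zero_mor (TL \<beta>) m n = (m, n, \<lambda>_. 0)"
  "add_mor (TL \<beta>) (m, n, f) (m', n', g) = (m, n, \<lambda>X. f X + g X)"
  "scale_mor (TL \<beta>) a (m, n, f) = (m, n, \<lambda>X. a * f X)"
  "tens_mor (TL \<beta>) (m, n, f) (m', n', g) = (m + m', n + n', ttens m n m' n' f g)"
  "ev_l (TL \<beta>) n = (n + n, 0, capc n)" "ev_r (TL \<beta>) n = (n + n, 0, capc n)"
  "coev_l (TL \<beta>) n = (0, n + n, cupc n)" "coev_r (TL \<beta>) n = (0, n + n, cupc n)"
  "pivot (TL \<beta>) n = (n, n, idc n)"
  by (simp_all add: TL_def tcmp_def ttens_def tl_cap_def tl_cup_def tl_diagram_def dg_def)

lemma Hom_TL: "Hom (TL \<beta>) m n = {(m, n, f) | f. f \<in> V m n}" by (simp add: TL_def V_def)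

lemma Hom_TL_iff [simp]: "(m', n', f) \<in> Hom (TL \<beta>) m n \<longleftrightarrow> m' = m \<and> n' = n \<and> f \<in> V m n" by (auto simp: Hom_TL)

locale TL_ideal =
  fixes \<beta> :: complex and N :: "nat => nat => tl_mor set"
  assumes ideal: "tensor_ideal (TL \<beta>) N"
begin

lemma N_Hom: "x \<in> N m n ==> \<exists>f. x = (m, n, f) \<and> f \<in> V m n"
proof -
  have "N m n \<subseteq> Hom (TL \<beta>) m n" using ideal unfolding tensor_ideal_def by simp
  then show "x \<in> N m n ==> ?thesis" by (auto simp: Hom_TL)
qed

lemma N_V: "(m', n', f) \<in> N m n ==> m' = m \<and> n' = n \<and> f \<in> V m n" by (drule N_Hom) simp

lemma N_zero: "(m, n, \<lambda>_. 0) \<in> N m n" using ideal unfolding tensor_ideal_def by simp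

lemma N_add:
  assumes "(m, n, f) \<in> N m n" "(m, n, g) \<in> N m n"
  shows "(m, n, \<lambda>X. f X + g X) \<in> N m n"
proof -
  have "\<forall>f\<in>N m n. \<forall>g\<in>N m n. add_mor (TL \<beta>) f g \<in> N m n" using ideal unfolding tensor_ideal_def by simp
  from this[rule_format, OF assms] show ?thesis by simp
qed

lemma N_scale:
  assumes "(m, n, f) \<in> N m n"
  shows "(m, n, \<lambda>X. a * f X) \<in> N m n"
proof -
  have "\<forall>a. \<forall>f\<in>N m n. scale_mor (TL \<beta>) a f \<in> N m n" using ideal unfolding tensor_ideal_def by simp
  from this[rule_format, OF assms] show ?thesis by simp
qed

lemma N_cmp_left: "(m, n, f) \<in> N m n ==> g \<in> V n p ==> (m, p, tcmp \<beta> m n p g f) \<in> N m p"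
proof -
  assume a: "(m, n, f) \<in> N m n" "g \<in> V n p"
  have "\<forall>f\<in>N m n. \<forall>g\<in>Hom (TL \<beta>) n p. cmp (TL \<beta>) g f \<in> N m p" using ideal unfolding tensor_ideal_def by simp
  from this[rule_format, OF a(1), of "(n, p, g)"] a(2) show ?thesis by simp
qed

lemma N_cmp_right: "(n, p, g) \<in> N n p ==> f \<in> V m n ==> (m, p, tcmp \<beta> m n p g f) \<in> N m p"
proof -
  assume a: "(n, p, g) \<in> N n p" "f \<in> V m n"
  have "\<forall>f\<in>Hom (TL \<beta>) m n. \<forall>g\<in>N n p. cmp (TL \<beta>) g f \<in> N m p" using ideal unfolding tensor_ideal_def by simp
  from this[rule_format, OF _ a(1), of "(m, n, f)"] a(2) show ?thesis by simp
qed

lemma N_tens: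
  assumes "(m, n, f) \<in> N m n" "g \<in> V m' n'"
  shows "(m + m', n + n', ttens m n m' n' f g) \<in> N (m + m') (n + n')"
    and "(m' + m, n' + n, ttens m' n' m n g f) \<in> N (m' + m) (n' + n)"
proof -
  have "\<forall>f\<in>N m n. \<forall>g\<in>Hom (TL \<beta>) m' n'. tens_mor (TL \<beta>) f g \<in> N (m + m') (n + n') \<and> tens_mor (TL \<beta>) g f \<in> N (m' + m) (n' + n)"
    using ideal unfolding tensor_ideal_def by simp
  from this[rule_format, OF assms(1), of "(m', n', g)"] assms(2)
  show "(m + m', n + n', ttens m n m' n' f g) \<in> N (m + m') (n + n')"
    "(m' + m, n' + n, ttens m' n' m n g f) \<in> N (m' + m) (n' + n)" by simp_all
qed

text \<open>Induction on the number of points. A support diagram with maximal \<open>closers\<close>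
  is the rainbow or has a valley; a cup at the valley gives an element of the ideal on two points
  fewer that is still nonzero.\<close>

lemma rainbow_of_bottom:
  assumes "(M, 0, f) \<in> N M 0" "f D \<noteq> 0"
  shows "\<exists>k g. (k + k, 0, g) \<in> N (k + k) 0 \<and> g (cap_diagram k) \<noteq> 0"
  using assms
proof (induction M arbitrary: f D rule: less_induct)
  case (less M)
  have fV: "f \<in> V M 0" using N_V less.prems(1) by blast
  have supp: "E \<in> diagrams M 0" if "f E \<noteq> 0" for E using fV that by (auto simp: V_def)
  obtain k where k: "M = k + k" using even_bottom supp less.prems(2) by metis
  let ?S = "{E \<in> diagrams M 0. f E \<noteq> 0}"
  have fin: "finite ?S" and "?S \<noteq> {}" using supp less.prems(2) by auto
  \<comment> \<open>Maximality is what \<open>cup_at_maximal\<close> needs: every other diagram of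
    the support then has a different image under the cup.\<close>
  have "Max (closers ` ?S) \<in> closers ` ?S" using fin \<open>?S \<noteq> {}\<close> by (intro Max_in) auto
  then obtain D0 where D0: "D0 \<in> ?S" "closers D0 = Max (closers ` ?S)" by (metis (lifting) imageE)
  have D0_max: "closers E \<le> closers D0" if "E \<in> ?S" for E
    unfolding D0(2) using fin that by (intro Max_ge) auto
  show ?case
  proof (cases "D0 = cap_diagram k")
    case True
    then show ?thesis using less.prems(1) D0(1) k by blast
  next
    case False
    obtain i where i: "Suc i < k + k" "ends D0 i < i" "Suc i < ends D0 (Suc i)"
      using valley[OF _ False] D0(1) k by blast
    define r where "r = M - 2 - i"
    have M: "M = i + (2 + r)" using i(1) k by (simp add: r_def)
    have D0': "D0 \<in> diagrams (i + (2 + r)) 0" using D0(1) M by simp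
    let ?C = "cup_at i r"
    let ?g = "tcmp \<beta> (i + r) (i + (2 + r)) 0 f (dg ?C)"
    have "(i + r, 0, ?g) \<in> N (i + r) 0"
      using N_cmp_right[OF less.prems(1)[unfolded M] dg_V[OF cup_at_closed]] .
    moreover have "?g (stack D0 ?C) = f D0"
    proof -
      have "?g (stack D0 ?C) = (\<Sum>E\<in>diagrams (i + (2 + r)) 0. if stack E ?C = stack D0 ?C then \<beta> ^ loops E ?C * f E else 0)"
        by (rule tcmp_dg_right[OF cup_at_closed])
      \<comment> \<open>Only \<open>D0\<close> contributes to the coefficient of its own image, and
        its factor is 1 because the cup at a valley closes no loop.\<close>
      also have "... = (\<Sum>E\<in>diagrams (i + (2 + r)) 0. if E = D0 then f D0 else 0)"
      proof (intro sum.cong refl)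
        fix E assume E: "E \<in> diagrams (i + (2 + r)) 0"
        show "(if stack E ?C = stack D0 ?C then \<beta> ^ loops E ?C * f E else 0) = (if E = D0 then f D0 else 0)"
        proof (cases "E = D0")
          case True
          have "{Bot (ends D0 i), Bot i} \<in> D0" "{Bot (Suc i), Bot (ends D0 (Suc i))} \<in> D0"
            using ends_in[OF D0', of i] ends_in[OF D0', of "Suc i"] by (auto simp: insert_commute)
          then have "loops D0 ?C = 0" using stack_cup_at_join(2)[OF D0'] i(2) by auto
          then show ?thesis using True by simp
        next
          case False
          show ?thesis
          proof (cases "f E = 0")
            case False
            then have "closers E \<le> closers D0" using D0_max[of E] E M by simp
            then have "stack E ?C \<noteq> stack D0 ?C" using cup_at_maximal[OF E D0' i(2,3)] \<open>E \<noteq> D0\<close> by blast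
            then show ?thesis using \<open>E \<noteq> D0\<close> by simp
          qed (use False in simp)
        qed
      qed
      also have "... = f D0" using D0' by simp
      finally show ?thesis .
    qed
    ultimately show ?thesis using less.IH[of "i + r" ?g "stack D0 ?C"] M D0(1) by simp
  qed
qed

lemma bend_inj:
  assumes "D \<in> diagrams m n" "E \<in> diagrams m n"
    and "(\<lambda>b. (Bot \<circ> boundary_pos m n) ` b) ` D = (\<lambda>b. (Bot \<circ> boundary_pos m n) ` b) ` E"
  shows "D = E"
proof -
  let ?h = "Bot \<circ> boundary_pos m n"
  have "inj_on ?h (points m n)" by (intro comp_inj_on pos_inj) (simp add: inj_on_def)
  then have "inj_on ((`) ?h) (Pow (points m n))" by (rule inj_on_image_Pow)
  moreover have "D \<subseteq> Pow (points m n)" "E \<subseteq> Pow (points m n)"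
    using diagramsD(4)[OF assms(1)] diagramsD(4)[OF assms(2)] by blast+
  ultimately show ?thesis using assms(3) inj_on_image_eq_iff by metis
qed

text \<open>All upper points are bent down first. This stays inside the ideal, and it is injective
  on diagrams, so a nonzero coefficient remains nonzero.\<close>

lemma contains_rainbow:
  assumes "X \<in> N m n" "X \<noteq> zero_mor (TL \<beta>) m n"
  shows "\<exists>k g. (k + k, 0, g) \<in> N (k + k) 0 \<and> g (cap_diagram k) \<noteq> 0"
proof -
  obtain f where f: "X = (m, n, f)" "f \<in> V m n" using N_Hom assms(1) by blast
  obtain D where D: "f D \<noteq> 0" using assms(2) f by (auto simp: fun_eq_iff)
  have Dd: "D \<in> diagrams m n" using D f(2) by (auto simp: V_def)
  let ?b = "\<lambda>D. (\<lambda>b. (Bot \<circ> boundary_pos m n) ` b) ` D"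
  let ?g = "tcmp \<beta> (m + n) (n + n) 0 (capc n) (ttens m n n n f (idc n))"
  have mem: "(m + n, 0, ?g) \<in> N (m + n) 0"
    using N_cmp_left[OF N_tens(1)[OF assms(1)[unfolded f(1)] idc_V] capc_V] by simp
  have "?g = (\<lambda>F. \<Sum>D\<in>diagrams m n. if ?b D = F then f D else 0)"
  proof (rule linop_eqI[OF linop_comp[OF linop_tcmp_right linop_ttens_left] _ f(2)])
    have lin: "(\<Sum>D\<in>diagrams m n. if ?b D = F then \<Sum>k\<in>A. c k * h k D else 0) =
        (\<Sum>k\<in>A. c k * (\<Sum>D\<in>diagrams m n. if ?b D = F then h k D else 0))"
      for A :: "'b set" and c and h :: "'b => coeffs" and F
    proof -
      have lin: "(\<Sum>D\<in>diagrams m n. if ?b D = F then \<Sum>k\<in>A. c k * h k D else 0) =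
        (\<Sum>D\<in>diagrams m n. \<Sum>k\<in>A. c k * (if ?b D = F then h k D else 0))"
        by (intro sum.cong refl) simp
      also have "... = (\<Sum>k\<in>A. c k * (\<Sum>D\<in>diagrams m n. if ?b D = F then h k D else 0))"
        by (subst sum.swap) (simp add: sum_distrib_left)
      finally show ?thesis .
    qed
    show "linop (\<lambda>f F. \<Sum>D\<in>diagrams m n. if ?b D = F then f D else 0)"
      unfolding linop_def by (intro conjI allI ext lin)
    fix E assume E: "E \<in> diagrams m n"
    have "(\<Sum>D\<in>diagrams m n. if ?b D = F then dg E D else 0) = dg (?b E) F" for F
    proof -
      have "(\<Sum>D\<in>diagrams m n. if ?b D = F then dg E D else 0) =
          (\<Sum>D\<in>diagrams m n. if D = E then (if ?b E = F then 1 else 0) else 0)"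
        by (intro sum.cong refl) (simp add: dg_def)
      then show ?thesis using E by (simp add: dg_def)
    qed
    moreover have "tcmp \<beta> (m + n) (n + n) 0 (capc n) (ttens m n n n (dg E) (idc n)) = dg (?b E)"
      unfolding ttens_dg[OF E id_diagram_closed]
      by (rule tcmp_dg'[OF juxtapose_closed[OF E id_diagram_closed] cap_diagram_closed bend_stack[OF E]])
    ultimately show "tcmp \<beta> (m + n) (n + n) 0 (capc n) (ttens m n n n (dg E) (idc n)) =
        (\<lambda>F. \<Sum>D\<in>diagrams m n. if ?b D = F then dg E D else 0)" by simp
  qed
  then have "?g (?b D) = (\<Sum>E\<in>diagrams m n. if ?b E = ?b D then f E else 0)" by simp
  also have "... = (\<Sum>E\<in>diagrams m n. if E = D then f D else 0)"
    by (intro sum.cong refl) (use bend_inj[OF _ Dd] in auto)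
  also have "... = f D" using Dd by simp
  finally have "?g (?b D) \<noteq> 0" using D by simp
  with mem show ?thesis using rainbow_of_bottom by blast
qed

end

section \<open>Linear categories with simple objects\<close>

text \<open>Gaussian elimination. It supplies the linear dependence among the powers of an
  endomorphism in the proof that endomorphisms of simple objects are scalars.\<close>

lemma homogeneous_system:
  fixes C :: "'i => 'j => complex"
  assumes "finite J" "finite I" "card J < card I"
  shows "\<exists>a. (\<exists>i\<in>I. a i \<noteq> 0) \<and> (\<forall>j\<in>J. (\<Sum>i\<in>I. a i * C i j) = 0)"
  using assms
proof (induction J arbitrary: I C rule: finite_induct)
  case empty
  then obtain i where "i \<in> I" by fastforce
  then show ?case by (intro exI[of _ "\<lambda>_. 1"]) auto
next
  case (insert j0 J)
  show ?case
  proof (cases "\<forall>i\<in>I. C i j0 = 0")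
    case True
    have "card J < card I" using insert by simp
    then obtain a where a: "\<exists>i\<in>I. a i \<noteq> 0" "\<forall>j\<in>J. (\<Sum>i\<in>I. a i * C i j) = 0"
      using insert.IH[OF insert.prems(1)] by blast
    then show ?thesis using True by (intro exI[of _ a]) simp
  next
    case False
    then obtain i0 where i0: "i0 \<in> I" "C i0 j0 \<noteq> 0" by blast
    let ?I = "I - {i0}"
    \<comment> \<open>The unknown \<open>i0\<close>, whose coefficient in equation \<open>j0\<close>
      is nonzero, is eliminated from all the other equations.\<close>
    let ?C = "\<lambda>i j. C i j - C i j0 / C i0 j0 * C i0 j"
    have "card J < card ?I" using insert i0(1) by simp
    then obtain a where a: "\<exists>i\<in>?I. a i \<noteq> 0" "\<And>j. j \<in> J ==> (\<Sum>i\<in>?I. a i * ?C i j) = 0"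
      using insert.IH[of ?I ?C] insert.prems(1) by auto
    define b where "b i = (if i = i0 then - (\<Sum>i\<in>?I. a i * C i j0) / C i0 j0 else a i)" for i
    have split: "(\<Sum>i\<in>I. b i * C i j) = b i0 * C i0 j + (\<Sum>i\<in>?I. a i * C i j)" for j
      using insert.prems(1) i0(1) by (subst sum.remove[of _ i0]) (auto simp: b_def intro!: sum.cong)
    have "(\<Sum>i\<in>I. b i * C i j) = 0" if "j \<in> insert j0 J" for j
    proof (cases "j = j0")
      case True
      then show ?thesis unfolding split using i0(2) by (simp add: b_def)
    next
      case False
      then have "0 = (\<Sum>i\<in>?I. a i * ?C i j)" using a(2) that by simp
      also have "... = (\<Sum>i\<in>?I. a i * C i j) - (\<Sum>i\<in>?I. a i * C i j0) / C i0 j0 * C i0 j"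
        by (simp add: algebra_simps sum_subtractf sum_distrib_left sum_divide_distrib)
      finally show ?thesis unfolding split by (simp add: b_def)
    qed
    moreover have "\<exists>i\<in>I. b i \<noteq> 0" using a(1) by (auto simp: b_def)
    ultimately show ?thesis by blast
  qed
qed

section \<open>Calculation with arrows in a linear category\<close>

locale lincat = linear_category B for B :: "('o, 'm, 'x) lin_cat_scheme"
begin

abbreviation comp (infixr "**" 70) where "g ** f \<equiv> cmp B g f"
abbreviation "ad \<equiv> add_mor B"
abbreviation "sc \<equiv> scale_mor B"
abbreviation "zr \<equiv> zero_mor B"
abbreviation "i1 \<equiv> idm B"

text \<open>Since Hom sets are disjoint, source and target become functions of the morphism; the
  typing conditions of composites are then equations that rewriting can discharge.\<close>

definition arr where "arr f \<longleftrightarrow> (\<exists>X\<in>Ob B. \<exists>Y\<in>Ob B. f \<in> Hom B X Y)"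
definition src where "src f = (THE X. X \<in> Ob B \<and> (\<exists>Y\<in>Ob B. f \<in> Hom B X Y))"
definition tgt where "tgt f = (THE Y. Y \<in> Ob B \<and> (\<exists>X\<in>Ob B. f \<in> Hom B X Y))"

lemma HomD:
  assumes "f \<in> Hom B X Y" "X \<in> Ob B" "Y \<in> Ob B"
  shows "arr f" "src f = X" "tgt f = Y"
proof -
  show "arr f" using assms by (auto simp: arr_def)
  show "src f = X" unfolding src_def by (rule the_equality) (use assms Hom_disjoint in blast)+
  show "tgt f = Y" unfolding tgt_def by (rule the_equality) (use assms Hom_disjoint in blast)+
qed

lemma arrD:
  assumes "arr f"
  shows "f \<in> Hom B (src f) (tgt f)" "src f \<in> Ob B" "tgt f \<in> Ob B"
  using assms HomD unfolding arr_def by auto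

lemma HomI: "arr f ==> src f = X ==> tgt f = Y ==> f \<in> Hom B X Y" using arrD by blast

lemma Hom_iff: "X \<in> Ob B ==> Y \<in> Ob B ==> f \<in> Hom B X Y \<longleftrightarrow> arr f \<and> src f = X \<and> tgt f = Y"
  using HomD HomI by blast

declare arrD(2,3) [simp]

lemma comp_arr [simp]:
  assumes "arr f" "arr g" "src g = tgt f"
  shows "arr (g ** f)" "src (g ** f) = src f" "tgt (g ** f) = tgt g"
  using HomD[OF cmp_closed[OF arrD(2)[OF assms(1)] arrD(3)[OF assms(1)] arrD(3)[OF assms(2)] arrD(1)[OF assms(1)]]]
    arrD[OF assms(1)] arrD[OF assms(2)] assms(3) by auto

lemma assoc [simp]:
  assumes "arr f" "arr g" "arr h" "src g = tgt f" "src h = tgt g"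
  shows "(h ** g) ** f = h ** g ** f"
  using cmp_assoc[of "src f" "tgt f" "tgt g" "tgt h" f g h] arrD[OF assms(1)] arrD[OF assms(2)] arrD[OF assms(3)] assms(4,5)
  by simp

lemma id_arr [simp]:
  assumes "X \<in> Ob B" shows "arr (i1 X)" "src (i1 X) = X" "tgt (i1 X) = X"
  using HomD[OF idm_closed[OF assms] assms assms] .

lemma comp_id [simp]: "arr f ==> src f = X ==> f ** i1 X = f" using cmp_idm arrD by blast

lemma id_comp [simp]: "arr f ==> tgt f = X ==> i1 X ** f = f" using idm_cmp arrD by blast

lemma zr_arr [simp]:
  assumes "X \<in> Ob B" "Y \<in> Ob B" shows "arr (zr X Y)" "src (zr X Y) = X" "tgt (zr X Y) = Y"
  using HomD[OF zero_closed[OF assms] assms] .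

lemma ad_arr [simp]:
  assumes "arr f" "arr g" "src f = src g" "tgt f = tgt g"
  shows "arr (ad f g)" "src (ad f g) = src g" "tgt (ad f g) = tgt g"
  using HomD[OF add_closed[OF arrD(2,3)[OF assms(2)] _ arrD(1)[OF assms(2)], of f]] arrD[OF assms(1)] arrD[OF assms(2)] assms(3,4)
  by (auto simp: Hom_iff)

lemma sc_arr [simp]:
  assumes "arr f" shows "arr (sc c f)" "src (sc c f) = src f" "tgt (sc c f) = tgt f"
  using HomD[OF scale_closed[OF arrD(2,3,1)[OF assms]] arrD(2,3)[OF assms]] .

definition par where "par f g \<longleftrightarrow> arr f \<and> arr g \<and> src f = src g \<and> tgt f = tgt g"

lemma ad_commute: "par f g ==> ad f g = ad g f"
  using add_commute[of "src f" "tgt f" f g] arrD[of f] arrD[of g] by (auto simp: par_def)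

lemma ad_assoc: "par f g ==> par g h ==> ad (ad f g) h = ad f (ad g h)"
  using add_assoc[of "src f" "tgt f" f g h] arrD[of f] arrD[of g] arrD[of h] by (auto simp: par_def)

lemma ad_zr [simp]: "arr f ==> src f = X ==> tgt f = Y ==> ad f (zr X Y) = f" using add_zero arrD by blast

lemma zr_ad [simp]: "arr f ==> src f = X ==> tgt f = Y ==> ad (zr X Y) f = f"
  using ad_zr ad_commute[of "zr X Y" f] by (auto simp: par_def)

lemma ad_neg: "arr f ==> ad f (sc (-1) f) = zr (src f) (tgt f)" using add_inverse arrD by blast

lemma sc_1 [simp]: "arr f ==> sc 1 f = f" using scale_one arrD by blast

lemma sc_sc [simp]: "arr f ==> sc a (sc b f) = sc (a * b) f" using scale_scale arrD by blast

lemma sc_add: "arr f ==> sc (a + b) f = ad (sc a f) (sc b f)" using scale_add_left arrD by blast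

lemma sc_ad: "par f g ==> sc a (ad f g) = ad (sc a f) (sc a g)"
  using scale_add_right[of "src f" "tgt f" f g a] arrD[of f] arrD[of g] by (auto simp: par_def)

lemma sc_0 [simp]: "arr f ==> sc 0 f = zr (src f) (tgt f)" using sc_add[of f 1 "-1"] ad_neg[of f] by simp

lemma sc_zr [simp]: "X \<in> Ob B ==> Y \<in> Ob B ==> sc a (zr X Y) = zr X Y" using sc_sc[of "zr X Y" a 0] by simp

lemma ad_comp: "par g h ==> arr f ==> src g = tgt f ==> ad g h ** f = ad (g ** f) (h ** f)"
  using cmp_add_left[of "src f" "tgt f" "tgt g" f g h] arrD[of f] arrD[of g] arrD[of h] by (auto simp: par_def)

lemma comp_ad: "par f g ==> arr h ==> src h = tgt f ==> h ** ad f g = ad (h ** f) (h ** g)"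
  using cmp_add_right[of "src f" "tgt f" "tgt h" f g h] arrD[of f] arrD[of g] arrD[of h] by (auto simp: par_def)

lemma sc_comp [simp]: "arr g ==> arr f ==> src g = tgt f ==> sc a g ** f = sc a (g ** f)"
  using cmp_scale_left[of "src f" "tgt f" "tgt g" f g a] arrD[of f] arrD[of g] by auto

lemma comp_sc [simp]: "arr g ==> arr f ==> src g = tgt f ==> g ** sc a f = sc a (g ** f)"
  using cmp_scale_right[of "src f" "tgt f" "tgt g" f g a] arrD[of f] arrD[of g] by auto

lemma zr_comp [simp]: "arr f ==> tgt f = X ==> Y \<in> Ob B ==> zr X Y ** f = zr (src f) Y"
  using sc_comp[of "zr X Y" f 0] by auto

lemma comp_zr [simp]: "arr f ==> src f = Y ==> X \<in> Ob B ==> f ** zr X Y = zr X (tgt f)"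
  using comp_sc[of f "zr X Y" 0] by auto

lemma eq_if_diff_zero: "par f g ==> ad f (sc (-1) g) = zr (src f) (tgt f) ==> f = g"
proof -
  assume p: "par f g" and e: "ad f (sc (-1) g) = zr (src f) (tgt f)"
  have "f = ad f (ad (sc (-1) g) g)" using ad_neg[of g] ad_commute[of "sc (-1) g" g] p by (simp add: par_def)
  also have "... = ad (ad f (sc (-1) g)) g" using p by (subst ad_assoc) (auto simp: par_def)
  also have "... = g" using p e by (simp add: par_def)
  finally show ?thesis .
qed

lemma sc_eq_zeroD: "arr f ==> sc a f = zr (src f) (tgt f) ==> a = 0 \<or> f = zr (src f) (tgt f)"
proof (rule disjCI)
  assume a: "arr f" "sc a f = zr (src f) (tgt f)" "f \<noteq> zr (src f) (tgt f)"
  show "a = 0"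
  proof (rule ccontr)
    assume "a \<noteq> 0"
    then have "f = sc (1 / a) (sc a f)" using a(1) by simp
    then show False using a by simp
  qed
qed

abbreviation SM where "SM X Y h n \<equiv> sum_mor B X Y (map h [0..<n])"

lemma sum_mor_arr [simp]:
  assumes "X \<in> Ob B" "Y \<in> Ob B" "\<forall>f\<in>set fs. arr f \<and> src f = X \<and> tgt f = Y"
  shows "arr (sum_mor B X Y fs)" "src (sum_mor B X Y fs) = X" "tgt (sum_mor B X Y fs) = Y"
proof -
  have "arr (sum_mor B X Y fs) \<and> src (sum_mor B X Y fs) = X \<and> tgt (sum_mor B X Y fs) = Y"
    using assms(3) by (induction fs) (auto simp: sum_mor_def assms(1,2))
  then show "arr (sum_mor B X Y fs)" "src (sum_mor B X Y fs) = X" "tgt (sum_mor B X Y fs) = Y" by auto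
qed

lemma sum_mor_simps [simp]:
  "sum_mor B X Y [] = zr X Y" "sum_mor B X Y (f # fs) = ad f (sum_mor B X Y fs)"
  by (simp_all add: sum_mor_def)

lemma sum_mor_functional:
  fixes \<phi> :: "'m => complex"
  assumes "X \<in> Ob B" "Y \<in> Ob B" "\<And>f. f \<in> set fs ==> arr f \<and> src f = X \<and> tgt f = Y"
    and "\<And>f g. par f g ==> src f = X ==> tgt f = Y ==> \<phi> (ad f g) = \<phi> f + \<phi> g" "\<phi> (zr X Y) = 0"
  shows "\<phi> (sum_mor B X Y fs) = sum_list (map \<phi> fs)"
  using assms(3)
proof (induction fs)
  case (Cons f fs)
  then have "arr f \<and> src f = X \<and> tgt f = Y" "\<And>f. f \<in> set fs ==> arr f \<and> src f = X \<and> tgt f = Y" by auto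
  then have "\<phi> (ad f (sum_mor B X Y fs)) = \<phi> f + \<phi> (sum_mor B X Y fs)"
    by (intro assms(4)) (auto simp: par_def assms(1,2))
  then show ?case using Cons by simp
qed (simp add: assms(5))

lemma SM_functional:
  fixes \<phi> :: "'m => complex"
  assumes "X \<in> Ob B" "Y \<in> Ob B" "\<And>k. k < n ==> arr (h k) \<and> src (h k) = X \<and> tgt (h k) = Y"
    and "\<And>f g. par f g ==> src f = X ==> tgt f = Y ==> \<phi> (ad f g) = \<phi> f + \<phi> g" "\<phi> (zr X Y) = 0"
  shows "\<phi> (SM X Y h n) = (\<Sum>k<n. \<phi> (h k))"
  using sum_mor_functional[of X Y "map h [0..<n]" \<phi>] assms
  by (auto simp: comp_def interv_sum_list_conv_sum_set_nat atLeast0LessThan)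

lemma comp_sum_mor:
  assumes "X \<in> Ob B" "Y \<in> Ob B" "\<And>f. f \<in> set fs ==> arr f \<and> src f = X \<and> tgt f = Y" "arr g" "src g = Y"
  shows "g ** sum_mor B X Y fs = sum_mor B X (tgt g) (map (\<lambda>f. g ** f) fs)"
  using assms(3)
proof (induction fs)
  case (Cons f fs)
  then have "arr f \<and> src f = X \<and> tgt f = Y" "\<And>f. f \<in> set fs ==> arr f \<and> src f = X \<and> tgt f = Y" by auto
  then show ?case using Cons.IH assms(1,2,4,5) by (simp add: comp_ad par_def)
qed (simp add: assms)

lemma sum_mor_comp:
  assumes "X \<in> Ob B" "Y \<in> Ob B" "\<And>f. f \<in> set fs ==> arr f \<and> src f = X \<and> tgt f = Y" "arr g" "tgt g = X"
  shows "sum_mor B X Y fs ** g = sum_mor B (src g) Y (map (\<lambda>f. f ** g) fs)"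
  using assms(3)
proof (induction fs)
  case (Cons f fs)
  then have "arr f \<and> src f = X \<and> tgt f = Y" "\<And>f. f \<in> set fs ==> arr f \<and> src f = X \<and> tgt f = Y" by auto
  then show ?case using Cons.IH assms(1,2,4,5) by (simp add: ad_comp par_def)
qed (simp add: assms)

lemma SM_nonzero:
  assumes "X \<in> Ob B" "Y \<in> Ob B" "\<And>k. k < n ==> h k = zr X Y"
  shows "SM X Y h n = zr X Y"
proof -
  have "sum_mor B X Y fs = zr X Y" if "\<forall>f\<in>set fs. f = zr X Y" for fs
    using that assms(1,2) by (induction fs) auto
  from this[of "map h [0..<n]"] show ?thesis using assms(3) by auto
qed

lemma sum_mor_ad:
  assumes "X \<in> Ob B" "Y \<in> Ob B" "\<And>k. k \<in> set ks ==> arr (h k) \<and> src (h k) = X \<and> tgt (h k) = Y"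
    "\<And>k. k \<in> set ks ==> arr (h' k) \<and> src (h' k) = X \<and> tgt (h' k) = Y"
  shows "sum_mor B X Y (map (\<lambda>k. ad (h k) (h' k)) ks) = ad (sum_mor B X Y (map h ks)) (sum_mor B X Y (map h' ks))"
  using assms(3,4)
proof (induction ks)
  case (Cons k ks)
  let ?s = "sum_mor B X Y (map h ks)" and ?t = "sum_mor B X Y (map h' ks)"
  have k: "arr (h k)" "arr (h' k)" "src (h k) = X" "tgt (h k) = Y" "src (h' k) = X" "tgt (h' k) = Y"
    using Cons.prems by (auto simp: par_def)
  have s: "arr ?s" "src ?s = X" "tgt ?s = Y" "arr ?t" "src ?t = X" "tgt ?t = Y"
    using Cons.prems assms(1,2) by (auto simp: par_def)
  have "ad (ad (h k) (h' k)) (ad ?s ?t) = ad (h k) (ad (h' k) (ad ?s ?t))"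
    by (rule ad_assoc) (auto simp: par_def k s)
  also have "ad (h' k) (ad ?s ?t) = ad (ad (h' k) ?s) ?t" by (rule ad_assoc[symmetric]) (auto simp: par_def k s)
  also have "ad (h' k) ?s = ad ?s (h' k)" by (rule ad_commute) (auto simp: par_def k s)
  also have "ad (ad ?s (h' k)) ?t = ad ?s (ad (h' k) ?t)" by (rule ad_assoc) (auto simp: par_def k s)
  also have "ad (h k) (ad ?s (ad (h' k) ?t)) = ad (ad (h k) ?s) (ad (h' k) ?t)"
    by (rule ad_assoc[symmetric]) (auto simp: par_def k s)
  finally show ?case using Cons by simp
qed (simp add: assms)

lemma sc_sum_mor:
  assumes "X \<in> Ob B" "Y \<in> Ob B" "\<And>k. k \<in> set ks ==> arr (h k) \<and> src (h k) = X \<and> tgt (h k) = Y"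
  shows "sc c (sum_mor B X Y (map h ks)) = sum_mor B X Y (map (\<lambda>k. sc c (h k)) ks)"
  using assms(3)
proof (induction ks)
  case (Cons k ks)
  then have "par (h k) (sum_mor B X Y (map h ks))" using assms(1,2) by (auto simp: par_def)
  then show ?case using Cons by (simp add: sc_ad)
qed (simp add: assms)

primrec pw where
  "pw S f 0 = i1 S"
| "pw S f (Suc n) = f ** pw S f n"

lemma pw_arr [simp]:
  assumes "S \<in> Ob B" "arr f" "src f = S" "tgt f = S"
  shows "arr (pw S f n)" "src (pw S f n) = S" "tgt (pw S f n) = S"
proof -
  have "arr (pw S f n) \<and> src (pw S f n) = S \<and> tgt (pw S f n) = S" by (induction n) (use assms in auto)
  then show "arr (pw S f n)" "src (pw S f n) = S" "tgt (pw S f n) = S" by auto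
qed

lemma SM_Suc:
  assumes "X \<in> Ob B" "Y \<in> Ob B" "\<And>k. k \<le> n ==> arr (h k) \<and> src (h k) = X \<and> tgt (h k) = Y"
  shows "SM X Y h (Suc n) = ad (SM X Y h n) (h n)"
proof -
  have "sum_mor B X Y (fs @ [g]) = ad (sum_mor B X Y fs) g"
    if "\<forall>f\<in>set fs. arr f \<and> src f = X \<and> tgt f = Y" "arr g \<and> src g = X \<and> tgt g = Y" for fs g
    using that
  proof (induction fs)
    case (Cons f fs)
    then show ?case using assms(1,2) by (simp add: ad_assoc[symmetric] par_def)
  qed (use assms in simp)
  from this[of "map h [0..<n]" "h n"] show ?thesis using assms(3) by auto
qed

lemma SM_Suc_shift: "SM X Y h (Suc n) = ad (h 0) (SM X Y (\<lambda>k. h (Suc k)) n)"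
  by (simp add: upt_conv_Cons map_Suc_upt[symmetric] comp_def del: upt_Suc)

lemma SM_extend:
  assumes "X \<in> Ob B" "Y \<in> Ob B" "\<And>k. arr (h k) \<and> src (h k) = X \<and> tgt (h k) = Y" "\<And>k. k \<ge> n ==> h k = zr X Y"
    and "n \<le> m"
  shows "SM X Y h m = SM X Y h n"
  using assms(5)
proof (induction m rule: dec_induct)
  case (step m)
  have "SM X Y h (Suc m) = ad (SM X Y h m) (h m)" by (rule SM_Suc) (use assms in auto)
  then show ?case using step assms by (simp add: assms(3) del: upt_Suc)
qed simp

end

section \<open>Schur's lemma over the complex numbers\<close>

locale sscat = lincat B for B :: "('o, 'm) lin_cat" +
  assumes ss: "semisimple_category B"
begin

lemma simple_Ob: "simple_object B S ==> S \<in> Ob B" by (simp add: simple_object_def)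

lemma simple_id_nonzero: "simple_object B S ==> i1 S \<noteq> zr S S"
  by (simp add: simple_object_def zero_object_def)

text \<open>The kernel of \<open>f\<close> is a subobject of the simple object \<open>S\<close>. If
  it is all of \<open>S\<close>, then \<open>f\<close> vanishes; if it is zero, then
  \<open>f\<close> is mono, and simplicity of \<open>S'\<close> makes it invertible.\<close>

lemma schur:
  assumes S: "simple_object B S" and S': "simple_object B S'"
    and f: "arr f" "src f = S" "tgt f = S'" "f \<noteq> zr S S'"
  shows "\<exists>g. arr g \<and> src g = S' \<and> tgt g = S \<and> g ** f = i1 S \<and> f ** g = i1 S'"
proof -
  have ob: "S \<in> Ob B" "S' \<in> Ob B" using S S' simple_Ob by auto
  have "\<forall>X\<in>Ob B. \<forall>Y\<in>Ob B. \<forall>f\<in>Hom B X Y. (\<exists>K k. is_kernel B X Y f K k) \<and> (\<exists>Q p. is_cokernel B X Y f Q p)"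
    using ss unfolding semisimple_category_def abelian_category_def by (elim conjE) assumption
  moreover have "f \<in> Hom B S S'" using f ob by (simp add: Hom_iff)
  ultimately obtain K k where K: "is_kernel B S S' f K k" using ob by blast
  then have k: "K \<in> Ob B" "arr k" "src k = K" "tgt k = S" "f ** k = zr K S'"
    using ob by (auto simp: is_kernel_def Hom_iff)
  have fact: "\<exists>!h. h \<in> Hom B W K \<and> k ** h = g" if "W \<in> Ob B" "g \<in> Hom B W S" "f ** g = zr W S'" for W g
    using K that by (simp add: is_kernel_def)
  have "mono_mor B K S k" unfolding mono_mor_def
  proof (intro conjI ballI impI)
    show "k \<in> Hom B K S" using k ob by (simp add: Hom_iff)
    fix W g h assume W: "W \<in> Ob B" "g \<in> Hom B W K" "h \<in> Hom B W K" "k ** g = k ** h"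
    then have gh: "arr g" "src g = W" "tgt g = K" "arr h" "src h = W" "tgt h = K" using k by (auto simp: Hom_iff)
    have "f ** k ** g = zr W S'" using assoc[of g k f] gh k f ob by simp
    then have "\<exists>!u. u \<in> Hom B W K \<and> k ** u = k ** g" using gh k W ob by (intro fact) (auto simp: Hom_iff)
    then show "g = h" using W by metis
  qed
  then have "zero_object B K \<or> iso_mor B K S k" using S k(1) by (simp add: simple_object_def)
  then show ?thesis
  proof
    assume "iso_mor B K S k"
    then obtain k' where "inverse_pair B K S k k'" unfolding iso_mor_def by (elim exE)
    then have "arr k'" "src k' = S" "tgt k' = K" "k ** k' = i1 S"
      using k ob by (simp_all add: inverse_pair_def Hom_iff)
    moreover have "f ** k ** k' = zr S S'" using assoc[of k' k f] calculation k f ob by simp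
    ultimately have "f = zr S S'" using f by simp
    then show ?thesis using f by simp
  next
    assume Z: "zero_object B K"
    have "mono_mor B S S' f" unfolding mono_mor_def
    proof (intro conjI ballI impI)
      show "f \<in> Hom B S S'" by fact
      fix W g h assume W: "W \<in> Ob B" "g \<in> Hom B W S" "h \<in> Hom B W S" "f ** g = f ** h"
      then have gh: "arr g" "src g = W" "tgt g = S" "arr h" "src h = W" "tgt h = S" using ob by (auto simp: Hom_iff)
      let ?d = "ad g (sc (-1) h)"
      have "f ** ?d = ad (f ** h) (sc (-1) (f ** h))" using gh f W(4) by (simp add: comp_ad par_def)
      also have "... = zr W S'" using ad_neg[of "f ** h"] gh f by simp
      finally obtain u where u: "u \<in> Hom B W K" "k ** u = ?d"
        using fact[OF W(1), of ?d] gh W(1) ob by (auto simp: Hom_iff)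
      then have ua: "arr u" "src u = W" "tgt u = K" using W k by (auto simp: Hom_iff)
      have "u = i1 K ** u" using ua by simp
      also have "... = zr W K" using Z ua k(1) by (simp add: zero_object_def)
      finally have d0: "?d = zr W S" using u(2) k W(1) by simp
      have "par g h" using gh by (simp add: par_def)
      then show "g = h" by (rule eq_if_diff_zero) (simp only: d0 gh)
    qed
    then have "zero_object B S \<or> iso_mor B S S' f" using S' ob unfolding simple_object_def by metis
    then have "iso_mor B S S' f" using S unfolding simple_object_def by metis
    then obtain g where "inverse_pair B S S' f g" unfolding iso_mor_def by (elim exE)
    then show ?thesis using ob by (intro exI[of _ g]) (simp add: inverse_pair_def Hom_iff)
  qed
qed

text \<open>If \<open>f\<close> is no scalar, every \<open>f - r\<close> is nonzero and so
  invertible. Splitting a polynomial into linear factors then makes every nonzero polynomial in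
  \<open>f\<close> invertible, although a finite-dimensional endomorphism space forces one of them
  to vanish.\<close>

lemma schur_scalar:
  assumes S: "simple_object B S" and f: "arr f" "src f = S" "tgt f = S"
  shows "\<exists>c. f = sc c (i1 S)"
proof (rule ccontr)
  assume no: "\<not> ?thesis"
  have ob: "S \<in> Ob B" using S by (rule simple_Ob)
  \<comment> \<open>The value of the polynomial \<open>p\<close> at \<open>f\<close>.\<close>
  define P where "P = (\<lambda>p. SM S S (\<lambda>k. sc (poly.coeff p k) (pw S f k)) (Suc (degree p)))"
  have trm: "arr (sc a (pw S f k)) \<and> src (sc a (pw S f k)) = S \<and> tgt (sc a (pw S f k)) = S" for a k
    using ob f by simp
  have P_ext: "P p = SM S S (\<lambda>k. sc (poly.coeff p k) (pw S f k)) n" if "n > degree p" for p n unfolding P_def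
    by (rule SM_extend[symmetric]) (use ob f trm that in "auto simp: coeff_eq_0 Suc_le_eq")
  have P_arr: "arr (P p)" "src (P p) = S" "tgt (P p) = S" for p unfolding P_def using ob trm by auto
  have iso: "p \<noteq> 0 ==> \<exists>g. arr g \<and> src g = S \<and> tgt g = S \<and> P p ** g = i1 S" for p
  proof (induction "degree p" arbitrary: p rule: less_induct)
    case less
    show ?case
    proof (cases "degree p = 0")
      case True
      then obtain a where a: "p = [:a:]" "a \<noteq> 0" using less.prems by (metis degree_eq_zeroE pCons_0_0)
      have "P p = sc a (i1 S)" unfolding P_def a(1) using ob by simp
      then show ?thesis using a(2) ob by (intro exI[of _ "sc (1 / a) (i1 S)"]) simp
    next
      case False
      then have "\<not> constant (poly p)" by (simp add: constant_degree)
      then obtain r where "poly p r = 0" using fundamental_theorem_of_algebra by blast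
      then obtain q where q: "p = [:- r, 1:] * q" by (metis poly_eq_0_iff_dvd dvdE)
      have q0: "q \<noteq> 0" using q less.prems by auto
      have dq: "degree p = Suc (degree q)" unfolding q by (subst degree_mult_eq) (use q0 in auto)
      \<comment> \<open>The coefficients of the product with the linear factor are those of
        \<open>q\<close> shifted by one, minus \<open>r\<close> times those of \<open>q\<close>. The
        two sums below realize exactly these two contributions, taken up to a common length.\<close>
      have cp: "poly.coeff p k = (case k of 0 => - r * poly.coeff q 0 | Suc j => poly.coeff q j - r * poly.coeff q (Suc j))" for k
        unfolding q by (cases k) (simp_all add: coeff_pCons)
      obtain g where g: "arr g" "src g = S" "tgt g = S" "P q ** g = i1 S" using less.hyps[of q] dq q0 by auto
      let ?fr = "ad f (sc (- r) (i1 S))"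
      let ?n = "Suc (degree q)"
      have "P p = SM S S (\<lambda>k. sc (poly.coeff p k) (pw S f k)) (Suc ?n)" by (rule P_ext) (simp add: dq)
      also have "... = SM S S (\<lambda>k. ad (case k of 0 => zr S S | Suc j => sc (poly.coeff q j) (pw S f (Suc j)))
          (sc (- r) (sc (poly.coeff q k) (pw S f k)))) (Suc ?n)"
      proof (intro arg_cong[of _ _ "sum_mor B S S"] map_cong refl)
        fix k
        show "sc (poly.coeff p k) (pw S f k) = ad (case k of 0 => zr S S | Suc j => sc (poly.coeff q j) (pw S f (Suc j)))
          (sc (- r) (sc (poly.coeff q k) (pw S f k)))"
          using ob f pw_arr[OF ob f] unfolding cp
          by (cases k) (simp_all add: sc_add[symmetric] del: pw.simps(2))
      qed
      also have "... = ad (SM S S (\<lambda>k. case k of 0 => zr S S | Suc j => sc (poly.coeff q j) (pw S f (Suc j))) (Suc ?n))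
          (SM S S (\<lambda>k. sc (- r) (sc (poly.coeff q k) (pw S f k))) (Suc ?n))"
        by (rule sum_mor_ad) (use ob f in "auto simp: par_def split: nat.split")
      also have "SM S S (\<lambda>k. case k of 0 => zr S S | Suc j => sc (poly.coeff q j) (pw S f (Suc j))) (Suc ?n)
          = SM S S (\<lambda>j. f ** sc (poly.coeff q j) (pw S f j)) ?n"
      proof -
        let ?h = "\<lambda>j. sc (poly.coeff q j) (pw S f (Suc j))"
        have "SM S S (\<lambda>j. f ** sc (poly.coeff q j) (pw S f j)) ?n = SM S S ?h ?n"
          by (intro arg_cong[of _ _ "sum_mor B S S"] map_cong refl) (use ob f in simp)
        moreover have "ad (zr S S) (SM S S ?h ?n) = SM S S ?h ?n"
        proof -
          have "\<forall>g\<in>set (map ?h [0..<?n]). arr g \<and> src g = S \<and> tgt g = S" using trm unfolding set_map by blast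
          from sum_mor_arr[OF ob ob this] show ?thesis by (rule zr_ad)
        qed
        ultimately show ?thesis by (subst SM_Suc_shift) (simp del: upt_Suc)
      qed
      also have "... = f ** P q"
      proof -
        have *: "\<And>g. g \<in> set (map (\<lambda>k. sc (poly.coeff q k) (pw S f k)) [0..<?n]) ==> arr g \<and> src g = S \<and> tgt g = S"
          using trm unfolding set_map by blast
        from comp_sum_mor[OF ob ob * f(1,2)] show ?thesis unfolding P_def by (simp only: f(3) map_map comp_def)
      qed
      also have "SM S S (\<lambda>k. sc (- r) (sc (poly.coeff q k) (pw S f k))) (Suc ?n) = sc (- r) (P q)"
        unfolding P_ext[of q "Suc ?n", OF less_SucI[OF lessI]]
        by (rule sc_sum_mor[symmetric]) (use ob trm in auto)
      also have "ad (f ** P q) (sc (- r) (P q)) = ?fr ** P q" using ob f P_arr by (simp add: ad_comp par_def)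
      finally have Pp: "P p = ?fr ** P q" .
      have fr: "arr ?fr" "src ?fr = S" "tgt ?fr = S" using ob f by auto
      have "?fr \<noteq> zr S S"
      proof
        assume z: "?fr = zr S S"
        have "f = sc r (i1 S)" by (rule eq_if_diff_zero) (use ob f z in "auto simp: par_def")
        then show False using no by blast
      qed
      then obtain h where h: "arr h" "src h = S" "tgt h = S" "?fr ** h = i1 S" using schur[OF S S fr] by blast
      have "P p ** (g ** h) = ?fr ** (P q ** g) ** h" unfolding Pp using fr P_arr g(1-3) h(1-3) by simp
      also have "... = i1 S" unfolding g(4) using h by simp
      finally show ?thesis using g h by (intro exI[of _ "g ** h"]) simp
    qed
  qed
  obtain fs where fs: "set fs \<subseteq> Hom B S S"
    "\<forall>g\<in>Hom B S S. \<exists>c. g = sum_mor B S S (map (\<lambda>f. sc (c f) f) fs)"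
    using ss ob unfolding semisimple_category_def finite_dim_homs_def by blast
  let ?n = "length fs"
  have fsa: "arr (fs ! j) \<and> src (fs ! j) = S \<and> tgt (fs ! j) = S" if "j < ?n" for j
    using fs(1) that ob by (metis Hom_iff nth_mem subsetD)
  have "\<exists>c. pw S f k = SM S S (\<lambda>j. sc (c j) (fs ! j)) ?n" for k
  proof -
    obtain c where "pw S f k = sum_mor B S S (map (\<lambda>f. sc (c f) f) fs)"
      using fs(2) pw_arr[OF ob f, of k] ob by (metis Hom_iff)
    also have "map (\<lambda>f. sc (c f) f) fs = map (\<lambda>j. sc (c (fs ! j)) (fs ! j)) [0..<?n]"
      by (rule nth_equalityI) auto
    finally show ?thesis by (intro exI[of _ "\<lambda>j. c (fs ! j)"])
  qed
  then obtain C where C: "\<And>k. pw S f k = SM S S (\<lambda>j. sc (C k j) (fs ! j)) ?n" by metis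
  \<comment> \<open>There are \<open>?n + 1\<close> powers of \<open>f\<close> in the span of
    \<open>?n\<close> morphisms; \<open>a\<close> is a linear relation between them and becomes the
    coefficient sequence of \<open>p\<close>.\<close>
  obtain a where a: "\<exists>i\<in>{..?n}. a i \<noteq> 0" "\<forall>j\<in>{..<?n}. (\<Sum>i\<in>{..?n}. a i * C i j) = 0"
    using homogeneous_system[of "{..<?n}" "{..?n}" C] by auto
  define p where "p = (\<Sum>i\<le>?n. monom (a i) i)"
  have cp: "poly.coeff p k = (if k \<le> ?n then a k else 0)" for k by (simp add: p_def coeff_sum)
  have "p \<noteq> 0" using a(1) cp by (metis atMost_iff coeff_0)
  have "degree p \<le> ?n" by (rule degree_le) (simp add: cp)
  then have "P p = SM S S (\<lambda>k. sc (poly.coeff p k) (pw S f k)) (Suc ?n)" by (intro P_ext) simp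
  also have "... = SM S S (\<lambda>k. sc (a k) (pw S f k)) (Suc ?n)"
    by (intro arg_cong[of _ _ "sum_mor B S S"] map_cong refl) (auto simp: cp simp del: sc_0)
  also have "... = SM S S (\<lambda>j. sc (\<Sum>i<Suc ?n. a i * C i j) (fs ! j)) ?n"
  proof -
    have "SM S S (\<lambda>k. sc (a k) (pw S f k)) m = SM S S (\<lambda>j. sc (\<Sum>i<m. a i * C i j) (fs ! j)) ?n" for m
    proof (induction m)
      case 0
      have "SM S S (\<lambda>j. sc 0 (fs ! j)) ?n = zr S S" by (rule SM_nonzero) (use ob fsa in auto)
      then show ?case by simp
    next
      case (Suc m)
      have "SM S S (\<lambda>k. sc (a k) (pw S f k)) (Suc m) = ad (SM S S (\<lambda>k. sc (a k) (pw S f k)) m) (sc (a m) (pw S f m))"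
        by (rule SM_Suc) (use ob trm in auto)
      also have "sc (a m) (pw S f m) = SM S S (\<lambda>j. sc (a m) (sc (C m j) (fs ! j))) ?n"
        unfolding C by (rule sc_sum_mor) (use ob fsa in auto)
      also have "... = SM S S (\<lambda>j. sc (a m * C m j) (fs ! j)) ?n"
        by (intro arg_cong[of _ _ "sum_mor B S S"] map_cong refl) (use fsa in auto)
      also have "ad (SM S S (\<lambda>k. sc (a k) (pw S f k)) m) ... =
          SM S S (\<lambda>j. ad (sc (\<Sum>i<m. a i * C i j) (fs ! j)) (sc (a m * C m j) (fs ! j))) ?n"
        unfolding Suc.IH by (rule sum_mor_ad[symmetric]) (use ob fsa in "auto simp: par_def")
      also have "... = SM S S (\<lambda>j. sc (\<Sum>i<Suc m. a i * C i j) (fs ! j)) ?n"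
        by (intro arg_cong[of _ _ "sum_mor B S S"] map_cong refl) (use fsa in "auto simp: sc_add")
      finally show ?case .
    qed
    then show ?thesis .
  qed
  also have "... = zr S S"
    by (rule SM_nonzero) (use ob fsa a(2) in "auto simp: lessThan_Suc_atMost simp del: sum.lessThan_Suc")
  finally have "P p = zr S S" .
  moreover obtain g where "arr g" "src g = S" "tgt g = S" "P p ** g = i1 S" using iso[OF \<open>p \<noteq> 0\<close>] by blast
  ultimately have "i1 S = zr S S" using ob by simp
  then show False using simple_id_nonzero[OF S] by simp
qed

end

section \<open>Multiplicative edge weights on graphs without endless reduced walks\<close>

section \<open>Potentials on graphs without long reduced walks\<close>

fun walk_prod :: "('v => 'v => complex) => 'v list => complex" where
  "walk_prod \<rho> (u # v # vs) = \<rho> u v * walk_prod \<rho> (v # vs)"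
| "walk_prod \<rho> _ = 1"

fun walk :: "('v => 'v => bool) => 'v list => bool" where
  "walk E (u # v # vs) \<longleftrightarrow> E u v \<and> walk E (v # vs)"
| "walk E vs \<longleftrightarrow> vs \<noteq> []"

lemma walk_append: "walk E (xs @ y # zs) \<longleftrightarrow> walk E (xs @ [y]) \<and> walk E (y # zs)"
proof (induction xs)
  case (Cons x xs)
  then show ?case by (cases xs) auto
qed simp

lemma walk_prod_append: "walk_prod \<rho> (xs @ y # zs) = walk_prod \<rho> (xs @ [y]) * walk_prod \<rho> (y # zs)"
proof (induction xs)
  case (Cons x xs)
  then show ?case by (cases xs) auto
qed simp

lemma walk_nth: "walk E vs ==> Suc h < length vs ==> E (vs ! h) (vs ! Suc h)"
proof (induction E vs arbitrary: h rule: walk.induct)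
  case (1 E u v vs)
  then show ?case by (cases h) auto
qed auto

lemma walk_rev: "(\<And>u v. E u v ==> E v u) ==> walk E vs ==> walk E (rev vs)"
proof (induction E vs rule: walk.induct)
  case (1 E u v vs)
  then have "walk E (rev vs @ [v])" by simp
  moreover have "walk E [v, u]" using 1 by simp
  ultimately show ?case using walk_append[of E "rev vs" v "[u]"] by simp
qed auto

text \<open>The last assumption is a coinductive way to exclude endless reduced walks: a set
  \<open>Q\<close> of directed edges, each of which can be continued in \<open>Q\<close> without
  turning back, is empty.\<close>

locale reduced_graph =
  fixes E :: "'v => 'v => bool" and \<rho> :: "'v => 'v => complex"
  assumes sym: "E u v ==> E v u"
    and inv: "E u v ==> \<rho> u v * \<rho> v u = 1" and loop: "E u u ==> \<rho> u u = 1"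
    and no_reduced: "\<And>Q. (\<And>u v. Q u v ==> E u v) ==> (\<And>u v. Q u v ==> \<exists>w. Q v w \<and> w \<noteq> u) ==> \<not> Q u v"
begin

text \<open>Induction on the length. A backtrack, inside the walk or across its base point,
  contributes a factor \<open>\<rho> x y * \<rho> y x = 1\<close> and can be removed. A longer walk
  without any backtrack could be repeated endlessly.\<close>

lemma closed_walk:
  assumes "walk E vs" "hd vs = last vs"
  shows "walk_prod \<rho> vs = 1"
  using assms
proof (induction "length vs" arbitrary: vs rule: less_induct)
  case less
  show ?case
  proof (cases "\<exists>as x y bs. vs = as @ x # y # x # bs")
    \<comment> \<open>A backtrack inside the walk is cut out.\<close>
    case True
    then obtain as x y bs where vs: "vs = as @ x # y # x # bs" by blast
    have "walk E (as @ x # bs)" "E x y"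
      using less.prems(1) unfolding vs walk_append[of E as x "y # x # bs"] walk_append[of E as x bs] by auto
    moreover have "hd (as @ x # bs) = last (as @ x # bs)"
      using less.prems(2) unfolding vs by (cases as; cases bs) auto
    ultimately have "walk_prod \<rho> (as @ x # bs) = 1" using less.hyps[of "as @ x # bs"] vs by simp
    moreover have "walk_prod \<rho> vs = walk_prod \<rho> (as @ [x]) * (\<rho> x y * \<rho> y x * walk_prod \<rho> (x # bs))"
      unfolding vs walk_prod_append[of \<rho> as x "y # x # bs"] by simp
    ultimately show ?thesis using inv[OF \<open>E x y\<close>] unfolding walk_prod_append[of \<rho> as x bs] by simp
  next
    case False
    have nb: "vs ! h \<noteq> vs ! Suc (Suc h)" if "Suc (Suc h) < length vs" for h
    proof
      assume "vs ! h = vs ! Suc (Suc h)"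
      then have "vs = take h vs @ vs ! h # vs ! Suc h # vs ! h # drop (Suc (Suc (Suc h))) vs"
        using that by (metis Cons_nth_drop_Suc Suc_lessD append_take_drop_id)
      then show False using False by blast
    qed
    have "vs \<noteq> []" using less.prems(1) by auto
    then consider x where "vs = [x]" | x y where "vs = [x, y]" | "length vs \<ge> 3"
      by (cases vs; cases "tl vs"; cases "tl (tl vs)") auto
    then show ?thesis
    proof cases
      case 2
      then show ?thesis using less.prems loop by simp
    next
      case 3
      define n where "n = length vs - 1"
      have n: "n \<ge> 2" "length vs = Suc n" using 3 by (auto simp: n_def)
      have ends: "vs ! n = vs ! 0"
        using less.prems(2) \<open>vs \<noteq> []\<close> by (simp add: hd_conv_nth last_conv_nth n_def)
      show ?thesis
      proof (cases "vs ! 1 = vs ! (n - 1)")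
        \<comment> \<open>The walk backtracks across its base point \<open>u\<close>: it is a
          conjugate of the shorter closed walk \<open>ws\<close>.\<close>
        case True
        obtain u ws where u: "vs = u # ws @ [u]" "ws \<noteq> []"
        proof -
          obtain u zs where zs: "vs = u # zs" "zs \<noteq> []" using 3 by (cases vs; cases "tl vs") auto
          then have "last zs = u" using less.prems(2) by simp
          then have "zs = butlast zs @ [u]" using zs(2) by (metis append_butlast_last_id)
          moreover have "butlast zs \<noteq> []" using 3 zs by (cases zs; cases "tl zs") auto
          ultimately show thesis using that zs(1) by metis
        qed
        have len: "length ws = n - 1" using n(2) u(1) by simp
        have hw: "hd ws = vs ! 1" using u by (simp add: hd_conv_nth nth_append)
        have lw: "last ws = vs ! (n - 1)" using u len n(1)
          by (cases "n - 1") (auto simp: last_conv_nth nth_append)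
        obtain w where w: "hd ws = w" "last ws = w" using hw lw True by simp
        obtain zs where zs: "ws = zs @ [w]" using w(2) u(2) by (metis append_butlast_last_id)
        obtain ys where ys: "ws = w # ys" using w(1) u(2) by (cases ws) auto
        have "walk E ws" "E u w"
        proof -
          show "E u w" using less.prems(1) u(1) ys by simp
          have "walk E (zs @ [w])" using less.prems(1) u(1) ys zs walk_append[of E zs w "[u]"]
            by (metis append.assoc append_Cons append_Nil walk.simps(1))
          then show "walk E ws" using zs by simp
        qed
        then have "walk_prod \<rho> ws = 1" using less.hyps[of ws] u(1) w by simp
        moreover have "walk_prod \<rho> vs = \<rho> u w * (walk_prod \<rho> ws * \<rho> w u)"
        proof -
          have "walk_prod \<rho> vs = \<rho> u w * walk_prod \<rho> (ws @ [u])" using u(1) ys by simp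
          also have "walk_prod \<rho> (ws @ [u]) = walk_prod \<rho> ws * \<rho> w u"
            unfolding zs using walk_prod_append[of \<rho> zs w "[u]"] by simp
          finally show ?thesis .
        qed
        ultimately show ?thesis using inv[OF \<open>E u w\<close>] by simp
      next
        case False
        \<comment> \<open>The edges of a cyclically reduced closed walk. After the last edge the
          walk goes on with the first one, and it does not turn back there either.\<close>
        define Q where "Q u v \<longleftrightarrow> (\<exists>h<n. u = vs ! h \<and> v = vs ! Suc h)" for u v
        have "\<not> Q (vs ! 0) (vs ! 1)"
        proof (rule no_reduced)
          fix u v assume "Q u v"
          then show "E u v" using walk_nth[OF less.prems(1)] n(2) by (auto simp: Q_def)
        next
          fix u v assume "Q u v"
          then obtain h where h: "h < n" "u = vs ! h" "v = vs ! Suc h" by (auto simp: Q_def)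
          show "\<exists>w. Q v w \<and> w \<noteq> u"
          proof (cases "Suc h < n")
            case True
            then show ?thesis using h nb[of h] n(2) unfolding Q_def by (intro exI[of _ "vs ! Suc (Suc h)"]) auto
          next
            case F: False
            then have "h = n - 1" using h(1) by simp
            then show ?thesis using h ends n(1) False unfolding Q_def
              by (intro exI[of _ "vs ! 1"] conjI exI[of _ 0]) auto
          qed
        qed
        then show ?thesis using n(1) by (auto simp: Q_def)
      qed
    qed simp
  qed
qed

text \<open>The potential of a vertex is the product along any walk from the base point of its
  component; \<open>closed_walk\<close> makes this independent of the walk.\<close>

lemma potential: "\<exists>t. \<forall>u v. t u \<noteq> 0 \<and> (E u v \<longrightarrow> t v = t u * \<rho> u v)"
proof -
  define wk where "wk u v vs \<longleftrightarrow> walk E vs \<and> hd vs = u \<and> last vs = v" for u v vs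
  have refl: "wk u u [u]" for u by (simp add: wk_def)
  have step: "wk u w (vs @ [w]) \<and> walk_prod \<rho> (vs @ [w]) = walk_prod \<rho> vs * \<rho> v w" if wk: "wk u v vs" "E v w" for u v w vs
  proof -
    have "vs \<noteq> []" using wk(1) by (auto simp: wk_def)
    then obtain zs where zs: "vs = zs @ [v]" using wk(1) unfolding wk_def by (metis append_butlast_last_id)
    then have "walk E (zs @ v # [w])" using wk walk_append[of E zs v "[w]"] by (simp add: wk_def)
    moreover have "walk_prod \<rho> (zs @ v # [w]) = walk_prod \<rho> vs * \<rho> v w"
      unfolding zs using walk_prod_append[of \<rho> zs v "[w]"] by simp
    ultimately show ?thesis using wk(1) zs by (cases zs) (auto simp: wk_def)
  qed
  have wrev: "wk v u (rev vs)" if "wk u v vs" for u v vs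
    using that walk_rev[OF sym] by (auto simp: wk_def hd_rev last_rev)
  have trans: "\<exists>zs. wk u w zs \<and> walk_prod \<rho> zs = walk_prod \<rho> xs * walk_prod \<rho> ys" if xy: "wk u v xs" "wk v w ys" for u v w xs ys
  proof -
    have "xs \<noteq> []" "ys \<noteq> []" using xy by (auto simp: wk_def)
    then obtain as bs where ab: "xs = as @ [v]" "ys = v # bs"
      using xy unfolding wk_def by (metis append_butlast_last_id list.collapse)
    then have "wk u w (as @ v # bs)" using xy walk_append[of E as v bs] by (cases as) (auto simp: wk_def)
    moreover have "walk_prod \<rho> (as @ v # bs) = walk_prod \<rho> xs * walk_prod \<rho> ys"
      unfolding ab by (rule walk_prod_append)
    ultimately show ?thesis by blast
  qed
  have closed: "walk_prod \<rho> vs = 1" if "wk u u vs" for u vs using that closed_walk by (simp add: wk_def)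
  have uniq: "walk_prod \<rho> xs = walk_prod \<rho> ys" if xy: "wk u v xs" "wk u v ys" for u v xs ys
  proof -
    have 1: "walk_prod \<rho> xs * walk_prod \<rho> (rev xs) = 1" using trans[OF xy(1) wrev[OF xy(1)]] closed by metis
    have 2: "walk_prod \<rho> ys * walk_prod \<rho> (rev xs) = 1" using trans[OF xy(2) wrev[OF xy(1)]] closed by metis
    show ?thesis using 1 2 by (metis mult.commute mult.left_commute mult_1_right)
  qed
  \<comment> \<open>The base point of the component of \<open>u\<close>. Adjacent vertices have the
    same base point because the choice operator is applied to the same predicate.\<close>
  define r where "r u = (SOME v. \<exists>vs. wk v u vs)" for u
  have r: "\<exists>vs. wk (r u) u vs" for u unfolding r_def by (rule someI_ex) (use refl in blast)
  have r_eq: "r u = r v" if e: "E u v" for u v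
  proof -
    have "(\<exists>vs. wk w u vs) \<longleftrightarrow> (\<exists>vs. wk w v vs)" for w using step e sym[OF e] by blast
    then show ?thesis unfolding r_def by simp
  qed
  define p where "p u = (SOME vs. wk (r u) u vs)" for u
  have p: "wk (r u) u (p u)" for u unfolding p_def by (rule someI_ex[OF r])
  have "walk_prod \<rho> (p u) \<noteq> 0" for u
    using trans[OF p wrev[OF p]] closed by (metis mult_zero_left zero_neq_one)
  moreover have "walk_prod \<rho> (p v) = walk_prod \<rho> (p u) * \<rho> u v" if "E u v" for u v
    using uniq[of "r v" v "p v" "p u @ [v]"] step[OF p that] p[of v] r_eq[OF that] by simp
  ultimately show ?thesis by (intro exI[of _ "\<lambda>u. walk_prod \<rho> (p u)"]) simp
qed

end

section \<open>Representatives of the simple objects and weighted traces\<close>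

section \<open>Traces on semisimple categories\<close>

context sscat
begin

definition iso_ob where
  "iso_ob S T \<longleftrightarrow> (\<exists>f g. arr f \<and> src f = S \<and> tgt f = T \<and> arr g \<and> src g = T \<and> tgt g = S \<and> g ** f = i1 S \<and> f ** g = i1 T)"

definition rep where "rep S = (SOME T. simple_object B T \<and> iso_ob S T)"

definition VV where "VV = rep ` {S. simple_object B S}"

lemma iso_ob_refl: "S \<in> Ob B ==> iso_ob S S" unfolding iso_ob_def by (intro exI[of _ "i1 S"]) simp

lemma iso_ob_sym: "iso_ob S T ==> iso_ob T S" unfolding iso_ob_def by blast

lemma iso_ob_trans:
  assumes "iso_ob S T" "iso_ob T U" shows "iso_ob S U"
proof -
  obtain f g where f: "arr f" "src f = S" "tgt f = T" "arr g" "src g = T" "tgt g = S" "g ** f = i1 S" "f ** g = i1 T"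
    using assms(1) unfolding iso_ob_def by blast
  obtain h k where h: "arr h" "src h = T" "tgt h = U" "arr k" "src k = U" "tgt k = T" "k ** h = i1 T" "h ** k = i1 U"
    using assms(2) unfolding iso_ob_def by blast
  have "(g ** k) ** (h ** f) = g ** (k ** h) ** f" "(h ** f) ** (g ** k) = h ** (f ** g) ** k"
    using f(1-6) h(1-6) by simp_all
  then have "(g ** k) ** (h ** f) = i1 S" "(h ** f) ** (g ** k) = i1 U" unfolding h(7) f(8) using f h by simp_all
  then show ?thesis unfolding iso_ob_def using f(1-6) h(1-6)
    by (intro exI[of "\<lambda>u. \<exists>v. _ u v" "h ** f"], intro exI[of "\<lambda>v. _ v" "g ** k"]) simp
qed

lemma rep: "simple_object B S ==> simple_object B (rep S) \<and> iso_ob S (rep S)"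
  unfolding rep_def by (rule someI[of _ S]) (simp add: iso_ob_refl simple_Ob)

lemma VV_simple: "T \<in> VV ==> simple_object B T" using rep by (auto simp: VV_def)

lemma VV_Ob [simp]: "T \<in> VV ==> T \<in> Ob B" using VV_simple simple_Ob by blast

lemma VV_eq:
  assumes "S \<in> VV" "T \<in> VV" "arr x" "src x = S" "tgt x = T" "x \<noteq> zr S T"
  shows "S = T"
proof -
  obtain S0 T0 where S0: "S = rep S0" "simple_object B S0" and T0: "T = rep T0" "simple_object B T0"
    using assms(1,2) by (auto simp: VV_def)
  have "iso_ob S T"
    using schur[OF VV_simple[OF assms(1)] VV_simple[OF assms(2)] assms(3-6)] assms(3-5) unfolding iso_ob_def by blast
  then have ST: "iso_ob S0 T0" using rep[OF S0(2)] rep[OF T0(2)] S0(1) T0(1) iso_ob_sym iso_ob_trans by metis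
  \<comment> \<open>Isomorphic objects define the same predicate, so the choice in
    \<open>rep\<close> returns the same representative.\<close>
  have "iso_ob S0 U \<longleftrightarrow> iso_ob T0 U" for U using ST iso_ob_sym iso_ob_trans by blast
  then show ?thesis unfolding S0(1) T0(1) rep_def by simp
qed

lemma VV_zero: "S \<in> VV ==> T \<in> VV ==> S \<noteq> T ==> arr x ==> src x = S ==> tgt x = T ==> x = zr S T"
  using VV_eq by blast

definition scal where "scal T f = (THE c. f = sc c (i1 T))"

lemma scal_unique: "T \<in> VV ==> sc c (i1 T) = sc d (i1 T) ==> c = d"
proof -
  assume T: "T \<in> VV" and e: "sc c (i1 T) = sc d (i1 T)"
  have "sc (c - d) (i1 T) = ad (sc c (i1 T)) (sc (- d) (i1 T))" using sc_add[of "i1 T" c "- d"] T by simp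
  also have "... = zr T T" unfolding e using ad_neg[of "sc d (i1 T)"] T by simp
  finally have "c - d = 0" using sc_eq_zeroD[of "i1 T" "c - d"] T simple_id_nonzero[OF VV_simple[OF T]] by auto
  then show ?thesis by simp
qed

lemma scal_sc_id [simp]: "T \<in> VV ==> scal T (sc c (i1 T)) = c"
  unfolding scal_def by (rule the_equality) (use scal_unique in auto)

lemma scal_id [simp]: "T \<in> VV ==> scal T (i1 T) = 1" using scal_sc_id[of T 1] by simp

lemma scal: "T \<in> VV ==> arr f ==> src f = T ==> tgt f = T ==> f = sc (scal T f) (i1 T)"
  using schur_scalar[OF VV_simple] scal_sc_id by metis

lemma scal_zr [simp]: "T \<in> VV ==> scal T (zr T T) = 0" using scal_sc_id[of T 0] by simp

lemma scal_eq_0: "T \<in> VV ==> arr f ==> src f = T ==> tgt f = T ==> scal T f = 0 ==> f = zr T T"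
  using scal[of T f] by simp

lemma scal_ad:
  assumes "T \<in> VV" "arr f" "src f = T" "tgt f = T" "arr g" "src g = T" "tgt g = T"
  shows "scal T (ad f g) = scal T f + scal T g"
proof -
  have "ad f g = sc (scal T f + scal T g) (i1 T)"
    using scal[OF assms(1-4)] scal[OF assms(1,5-7)] sc_add[of "i1 T"] assms(1) by (metis VV_Ob id_arr(1))
  then show ?thesis using assms(1) by simp
qed

lemma scal_sc: "T \<in> VV ==> arr f ==> src f = T ==> tgt f = T ==> scal T (sc c f) = c * scal T f"
proof -
  assume a: "T \<in> VV" "arr f" "src f = T" "tgt f = T"
  have "sc c f = sc (c * scal T f) (i1 T)" using scal[OF a] a(1) by (metis VV_Ob id_arr(1) sc_sc)
  then show ?thesis using a(1) by simp
qed

lemma scal_comp: "T \<in> VV ==> arr f ==> src f = T ==> tgt f = T ==> arr g ==> src g = T ==> tgt g = T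
   ==> scal T (g ** f) = scal T g * scal T f"
proof -
  assume a: "T \<in> VV" "arr f" "src f = T" "tgt f = T" "arr g" "src g = T" "tgt g = T"
  have "g ** f = sc (scal T g) (i1 T) ** f" using scal[OF a(1,5-7)] by simp
  also have "... = sc (scal T g) f" using a by simp
  finally show ?thesis using scal_sc[OF a(1-4)] by simp
qed

text \<open>For different representatives both composites vanish, for equal ones scalars commute.
  Hence the weights can be arbitrary here, and the trace below is cyclic for every
  \<open>t\<close>.\<close>

lemma scal_commute:
  assumes "S \<in> VV" "T \<in> VV" "arr u" "src u = S" "tgt u = T" "arr v" "src v = T" "tgt v = S"
  shows "t S * scal S (v ** u) = t T * scal T (u ** v)"
proof (cases "S = T")
  case True
  then show ?thesis using assms scal_comp by simp
next
  case False
  then have "u = zr S T" using VV_zero assms by blast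
  then show ?thesis using assms by simp
qed

definition decomposition where
  "decomposition Z n S \<iota> \<pi> \<longleftrightarrow> (\<forall>k<n. S k \<in> VV \<and> arr (\<iota> k) \<and> src (\<iota> k) = S k \<and> tgt (\<iota> k) = Z \<and>
     arr (\<pi> k) \<and> src (\<pi> k) = Z \<and> tgt (\<pi> k) = S k) \<and> SM Z Z (\<lambda>k. \<iota> k ** \<pi> k) n = i1 Z"

text \<open>The simple summands given by semisimplicity are replaced by their representatives; the
  chosen isomorphisms cancel in every term of the sum.\<close>

lemma decomposition_ex:
  assumes Z: "Z \<in> Ob B"
  shows "\<exists>n S \<iota> \<pi>. decomposition Z n S \<iota> \<pi>"
proof -
  obtain Ss where Ss: "\<forall>S\<in>set Ss. simple_object B S" "direct_sum B Ss Z"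
    using ss Z unfolding semisimple_category_def by blast
  obtain \<iota> \<pi> where \<iota>\<pi>: "\<forall>i<length Ss. \<iota> i \<in> Hom B (Ss ! i) Z \<and> \<pi> i \<in> Hom B Z (Ss ! i)"
    "sum_mor B Z Z (map (\<lambda>i. \<iota> i ** \<pi> i) [0..<length Ss]) = i1 Z"
    using Ss(2) unfolding direct_sum_def by blast
  have "\<forall>S. \<exists>p. simple_object B S \<longrightarrow> arr (fst p) \<and> src (fst p) = S \<and> tgt (fst p) = rep S \<and>
      arr (snd p) \<and> src (snd p) = rep S \<and> tgt (snd p) = S \<and> snd p ** fst p = i1 S"
  proof
    fix S
    show "\<exists>p. simple_object B S \<longrightarrow> arr (fst p) \<and> src (fst p) = S \<and> tgt (fst p) = rep S \<and>
      arr (snd p) \<and> src (snd p) = rep S \<and> tgt (snd p) = S \<and> snd p ** fst p = i1 S"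
    proof (cases "simple_object B S")
      case True
      then obtain f g where "arr f" "src f = S" "tgt f = rep S" "arr g" "src g = rep S" "tgt g = S" "g ** f = i1 S"
        using rep unfolding iso_ob_def by meson
      then show ?thesis by (intro exI[of _ "(f, g)"]) simp
    qed simp
  qed
  then obtain p where p: "\<And>S. simple_object B S ==> arr (fst (p S)) \<and> src (fst (p S)) = S \<and> tgt (fst (p S)) = rep S \<and>
      arr (snd (p S)) \<and> src (snd (p S)) = rep S \<and> tgt (snd (p S)) = S \<and> snd (p S) ** fst (p S) = i1 S"
    by metis
  define f g where "f S = fst (p S)" and "g S = snd (p S)" for S
  have fg: "arr (f S)" "src (f S) = S" "tgt (f S) = rep S" "arr (g S)" "src (g S) = rep S" "tgt (g S) = S" "g S ** f S = i1 S"
    if "simple_object B S" for S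
    using p[OF that] by (auto simp: f_def g_def)
  let ?n = "length Ss"
  have k: "simple_object B (Ss ! k)" "arr (\<iota> k)" "src (\<iota> k) = Ss ! k" "tgt (\<iota> k) = Z"
    "arr (\<pi> k)" "src (\<pi> k) = Z" "tgt (\<pi> k) = Ss ! k" if "k < ?n" for k
    using \<iota>\<pi>(1) Ss(1) that Z simple_Ob by (auto simp: Hom_iff)
  have "decomposition Z ?n (\<lambda>k. rep (Ss ! k)) (\<lambda>k. \<iota> k ** g (Ss ! k)) (\<lambda>k. f (Ss ! k) ** \<pi> k)"
    unfolding decomposition_def
  proof (intro conjI allI impI)
    fix i assume i: "i < ?n"
    show "rep (Ss ! i) \<in> VV" using k(1)[OF i] by (auto simp: VV_def)
    show "arr (\<iota> i ** g (Ss ! i))" "src (\<iota> i ** g (Ss ! i)) = rep (Ss ! i)" "tgt (\<iota> i ** g (Ss ! i)) = Z"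
      "arr (f (Ss ! i) ** \<pi> i)" "src (f (Ss ! i) ** \<pi> i) = Z" "tgt (f (Ss ! i) ** \<pi> i) = rep (Ss ! i)"
      using k[OF i] fg[OF k(1)[OF i]] by auto
  next
    have "(\<iota> i ** g (Ss ! i)) ** (f (Ss ! i) ** \<pi> i) = \<iota> i ** \<pi> i" if i: "i < ?n" for i
    proof -
      note fg = fg[OF k(1)[OF i]] and k = k[OF i]
      have "(\<iota> i ** g (Ss ! i)) ** (f (Ss ! i) ** \<pi> i) = \<iota> i ** (g (Ss ! i) ** f (Ss ! i)) ** \<pi> i"
        using k fg(1-6) by simp
      also have "... = \<iota> i ** \<pi> i" unfolding fg(7) using k by simp
      finally show ?thesis .
    qed
    then have "SM Z Z (\<lambda>i. (\<iota> i ** g (Ss ! i)) ** (f (Ss ! i) ** \<pi> i)) ?n = SM Z Z (\<lambda>i. \<iota> i ** \<pi> i) ?n"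
      by (intro arg_cong[of _ _ "sum_mor B Z Z"] map_cong) auto
    then show "SM Z Z (\<lambda>i. (\<iota> i ** g (Ss ! i)) ** (f (Ss ! i) ** \<pi> i)) ?n = i1 Z" using \<iota>\<pi>(2) by simp
  qed
  then show ?thesis by blast
qed

lemma decompositionD:
  assumes "decomposition Z n S \<iota> \<pi>" "k < n"
  shows "S k \<in> VV" "arr (\<iota> k)" "src (\<iota> k) = S k" "tgt (\<iota> k) = Z" "arr (\<pi> k)" "src (\<pi> k) = Z" "tgt (\<pi> k) = S k"
  using assms by (auto simp: decomposition_def)

lemma decomposition_functional:
  fixes \<phi> :: "'m => complex"
  assumes d: "decomposition Z n S \<iota> \<pi>" and Z: "Z \<in> Ob B"
    and "\<And>f g. par f g ==> src f = Z ==> tgt f = Z ==> \<phi> (ad f g) = \<phi> f + \<phi> g" "\<phi> (zr Z Z) = 0"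
  shows "\<phi> (i1 Z) = (\<Sum>k<n. \<phi> (\<iota> k ** \<pi> k))"
proof -
  have "\<phi> (SM Z Z (\<lambda>k. \<iota> k ** \<pi> k) n) = (\<Sum>k<n. \<phi> (\<iota> k ** \<pi> k))"
    by (rule SM_functional) (use decompositionD[OF d] assms in auto)
  then show ?thesis using d by (simp add: decomposition_def)
qed

lemma exists_\<iota>:
  assumes d: "decomposition W n S \<iota> \<pi>" and W: "W \<in> Ob B" and h: "arr h" "src h = W" "h \<noteq> zr W (tgt h)"
  shows "\<exists>k<n. h ** \<iota> k \<noteq> zr (S k) (tgt h)"
proof (rule ccontr)
  assume no: "\<not> ?thesis"
  have "h = h ** SM W W (\<lambda>k. \<iota> k ** \<pi> k) n" using d h by (simp add: decomposition_def)
  also have "... = sum_mor B W (tgt h) (map (\<lambda>f. h ** f) (map (\<lambda>k. \<iota> k ** \<pi> k) [0..<n]))"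
    by (rule comp_sum_mor) (use decompositionD[OF d] h W in auto)
  also have "map (\<lambda>f. h ** f) (map (\<lambda>k. \<iota> k ** \<pi> k) [0..<n]) = map (\<lambda>k. h ** \<iota> k ** \<pi> k) [0..<n]" by simp
  also have "SM W (tgt h) (\<lambda>k. h ** \<iota> k ** \<pi> k) n = zr W (tgt h)"
  proof (rule SM_nonzero)
    fix k assume k: "k < n"
    have "h ** \<iota> k ** \<pi> k = (h ** \<iota> k) ** \<pi> k" using decompositionD[OF d k] h by simp
    also have "... = zr W (tgt h)" using no k decompositionD[OF d k] h by auto
    finally show "h ** \<iota> k ** \<pi> k = zr W (tgt h)" .
  qed (use h W in auto)
  finally show False using h by simp
qed

lemma exists_\<pi>:
  assumes d: "decomposition W n S \<iota> \<pi>" and W: "W \<in> Ob B" and h: "arr h" "tgt h = W" "h \<noteq> zr (src h) W"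
  shows "\<exists>k<n. \<pi> k ** h \<noteq> zr (src h) (S k)"
proof (rule ccontr)
  assume no: "\<not> ?thesis"
  have "h = SM W W (\<lambda>k. \<iota> k ** \<pi> k) n ** h" using d h by (simp add: decomposition_def)
  also have "... = sum_mor B (src h) W (map (\<lambda>f. f ** h) (map (\<lambda>k. \<iota> k ** \<pi> k) [0..<n]))"
    by (rule sum_mor_comp) (use decompositionD[OF d] h W in auto)
  also have "map (\<lambda>f. f ** h) (map (\<lambda>k. \<iota> k ** \<pi> k) [0..<n]) = map (\<lambda>k. (\<iota> k ** \<pi> k) ** h) [0..<n]" by simp
  also have "SM (src h) W (\<lambda>k. (\<iota> k ** \<pi> k) ** h) n = zr (src h) W"
  proof (rule SM_nonzero)
    fix k assume k: "k < n"
    have "\<pi> k ** h = zr (src h) (S k)" using no k by auto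
    then show "(\<iota> k ** \<pi> k) ** h = zr (src h) W" using decompositionD[OF d k] h by simp
  qed (use h W in auto)
  finally show False using h by simp
qed

text \<open>On some summand of its source, \<open>y\<close> is a nonzero scalar multiple of the
  identity of \<open>S\<close>; the rescaled inclusion of that summand is the section.\<close>

lemma split_epi:
  assumes S: "S \<in> VV" and y: "arr y" "tgt y = S" "y \<noteq> zr (src y) S"
  shows "\<exists>b. arr b \<and> src b = S \<and> tgt b = src y \<and> y ** b = i1 S"
proof -
  have ob: "src y \<in> Ob B" using y by simp
  obtain n T \<iota> \<pi> where d: "decomposition (src y) n T \<iota> \<pi>" using decomposition_ex[OF ob] by blast
  obtain k where k: "k < n" "y ** \<iota> k \<noteq> zr (T k) (tgt y)" using exists_\<iota>[OF d ob y(1)] y by auto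
  note dk = decompositionD[OF d k(1)]
  have T: "T k = S" using VV_eq[OF dk(1) S, of "y ** \<iota> k"] k(2) dk y by auto
  let ?c = "scal S (y ** \<iota> k)"
  have e: "y ** \<iota> k = sc ?c (i1 S)" by (rule scal[OF S]) (use dk y T in auto)
  have "?c \<noteq> 0" using k(2) e S T y by auto
  moreover have "y ** sc (1 / ?c) (\<iota> k) = sc (1 / ?c) (sc ?c (i1 S))" using dk y T e by simp
  ultimately have "y ** sc (1 / ?c) (\<iota> k) = i1 S" using S by simp
  then show ?thesis using dk T by (intro exI[of _ "sc (1 / ?c) (\<iota> k)"]) simp
qed

end

context sscat
begin

definition "dec Z = (SOME d. case d of (n, S, \<iota>, \<pi>) => decomposition Z n S \<iota> \<pi>)"
definition "dN Z = fst (dec Z)"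
definition "dS Z = fst (snd (dec Z))"
definition "dI Z = fst (snd (snd (dec Z)))"
definition "dP Z = snd (snd (snd (dec Z)))"

lemma dec: "Z \<in> Ob B ==> decomposition Z (dN Z) (dS Z) (dI Z) (dP Z)"
proof -
  assume "Z \<in> Ob B"
  then obtain n S \<iota> \<pi> where "decomposition Z n S \<iota> \<pi>" using decomposition_ex by blast
  then have "\<exists>d. case d of (n, S, \<iota>, \<pi>) => decomposition Z n S \<iota> \<pi>" by (intro exI[of _ "(n, S, \<iota>, \<pi>)"]) simp
  then have "case dec Z of (n, S, \<iota>, \<pi>) => decomposition Z n S \<iota> \<pi>" unfolding dec_def by (rule someI_ex)
  then show ?thesis by (simp add: dN_def dS_def dI_def dP_def split: prod.splits)
qed

lemmas decD [simp] = decompositionD[OF dec]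

text \<open>The trace in which an endomorphism of a simple object \<open>T\<close> counts with the
  weight \<open>t T\<close>. It is computed from one chosen decomposition of
  \<open>Z\<close>.\<close>

definition Tr :: "('o => complex) => 'o => 'm => complex" where
  "Tr t Z f = (\<Sum>k<dN Z. t (dS Z k) * scal (dS Z k) (dP Z k ** f ** dI Z k))"

lemma Tr_ad:
  assumes "par f g" "src f = Z" "tgt f = Z" "Z \<in> Ob B"
  shows "Tr t Z (ad f g) = Tr t Z f + Tr t Z g"
proof -
  have fg: "arr f" "arr g" "src f = Z" "tgt f = Z" "src g = Z" "tgt g = Z" using assms by (auto simp: par_def)
  have "scal (dS Z k) (dP Z k ** ad f g ** dI Z k) =
      scal (dS Z k) (dP Z k ** f ** dI Z k) + scal (dS Z k) (dP Z k ** g ** dI Z k)" if "k < dN Z" for k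
  proof -
    have "dP Z k ** ad f g ** dI Z k = ad (dP Z k ** f ** dI Z k) (dP Z k ** g ** dI Z k)"
      using fg assms(4) that by (simp add: par_def ad_comp comp_ad)
    then show ?thesis using fg assms(4) that by (simp add: scal_ad)
  qed
  then show ?thesis unfolding Tr_def by (simp add: distrib_left sum.distrib)
qed

lemma Tr_zr: "Z \<in> Ob B ==> Tr t Z (zr Z Z) = 0" unfolding Tr_def by (intro sum.neutral) simp

text \<open>A decomposition of the identity of \<open>W\<close> is inserted between the factors;
  this is the double sum over matrix entries.\<close>

lemma Tr_cyclic_expand:
  assumes f: "arr f" "src f = W" "tgt f = Z" and g: "arr g" "src g = Z" "tgt g = W"
  shows "Tr t Z (f ** g) = (\<Sum>k<dN Z. \<Sum>l<dN W. t (dS Z k) * scal (dS Z k) ((dP Z k ** f ** dI W l) ** (dP W l ** g ** dI Z k)))"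
proof -
  have ob: "W \<in> Ob B" "Z \<in> Ob B" using arrD(2,3)[OF f(1)] f by auto
  have "scal (dS Z k) (dP Z k ** (f ** g) ** dI Z k) =
      (\<Sum>l<dN W. scal (dS Z k) ((dP Z k ** f ** dI W l) ** (dP W l ** g ** dI Z k)))" if k: "k < dN Z" for k
  proof -
    let ?\<phi> = "\<lambda>h. scal (dS Z k) (dP Z k ** f ** h ** g ** dI Z k)"
    have "?\<phi> (i1 W) = (\<Sum>l<dN W. ?\<phi> (dI W l ** dP W l))"
    proof (rule decomposition_functional[OF dec[OF ob(1)] ob(1)])
      fix u v assume "par u v" "src u = W" "tgt u = W"
      then have uv: "arr u" "arr v" "src u = W" "tgt u = W" "src v = W" "tgt v = W" by (auto simp: par_def)
      have "dP Z k ** f ** ad u v ** g ** dI Z k = ad (dP Z k ** f ** u ** g ** dI Z k) (dP Z k ** f ** v ** g ** dI Z k)"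
        using uv f g k ob by (simp add: par_def ad_comp comp_ad)
      then show "?\<phi> (ad u v) = ?\<phi> u + ?\<phi> v" using uv f g k ob by (simp add: scal_ad)
    qed (use f g k ob in simp)
    moreover have "?\<phi> (i1 W) = scal (dS Z k) (dP Z k ** (f ** g) ** dI Z k)" using f g k ob by simp
    moreover have "?\<phi> (dI W l ** dP W l) = scal (dS Z k) ((dP Z k ** f ** dI W l) ** (dP W l ** g ** dI Z k))"
      if "l < dN W" for l using f g k ob that by simp
    ultimately show ?thesis by simp
  qed
  then show ?thesis unfolding Tr_def by (simp add: sum_distrib_left)
qed

lemma Tr_cyclic:
  assumes f: "arr f" "src f = W" "tgt f = Z" and g: "arr g" "src g = Z" "tgt g = W"
  shows "Tr t Z (f ** g) = Tr t W (g ** f)"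
proof -
  have ob: "W \<in> Ob B" "Z \<in> Ob B" using arrD(2,3)[OF f(1)] f by auto
  have "t (dS Z k) * scal (dS Z k) ((dP Z k ** f ** dI W l) ** (dP W l ** g ** dI Z k)) =
      t (dS W l) * scal (dS W l) ((dP W l ** g ** dI Z k) ** (dP Z k ** f ** dI W l))"
    if "k < dN Z" "l < dN W" for k l
    by (rule scal_commute) (use that f g ob in simp_all)
  then have "Tr t Z (f ** g) = (\<Sum>k<dN Z. \<Sum>l<dN W. t (dS W l) * scal (dS W l) ((dP W l ** g ** dI Z k) ** (dP Z k ** f ** dI W l)))"
    unfolding Tr_cyclic_expand[OF f g] by (intro sum.cong refl) simp
  also have "... = Tr t W (g ** f)" unfolding Tr_cyclic_expand[OF g f] by (rule sum.swap)
  finally show ?thesis .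
qed

text \<open>The decomposition chosen for \<open>T\<close> itself can be any. Moving its inclusions
  to the other side by \<open>scal_commute\<close> leaves the scalars of
  \<open>dI T k ** dP T k\<close>, which add up to that of the identity.\<close>

lemma Tr_simple:
  assumes T: "T \<in> VV" and f: "arr f" "src f = T" "tgt f = T"
  shows "Tr t T f = t T * scal T f"
proof -
  have ob: "T \<in> Ob B" using T by simp
  have "t (dS T k) * scal (dS T k) (dP T k ** f ** dI T k) = t T * (scal T f * scal T (dI T k ** dP T k))"
    if k: "k < dN T" for k
  proof -
    have "t (dS T k) * scal (dS T k) (dP T k ** (f ** dI T k)) = t T * scal T ((f ** dI T k) ** dP T k)"
      by (rule scal_commute) (use k f T ob in simp_all)
    also have "scal T ((f ** dI T k) ** dP T k) = scal T (f ** (dI T k ** dP T k))" using k f T ob by simp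
    also have "... = scal T f * scal T (dI T k ** dP T k)" by (rule scal_comp) (use k f T ob in simp_all)
    finally show ?thesis .
  qed
  then have "Tr t T f = t T * (scal T f * (\<Sum>k<dN T. scal T (dI T k ** dP T k)))"
    unfolding Tr_def by (simp add: sum_distrib_left)
  also have "(\<Sum>k<dN T. scal T (dI T k ** dP T k)) = scal T (i1 T)"
    by (rule decomposition_functional[OF dec[OF ob] ob, symmetric]) (use T in "auto simp: par_def scal_ad")
  finally show ?thesis using T by simp
qed

text \<open>A nonzero \<open>h\<close> has a nonzero matrix entry between equal representatives, and
  the matrix unit in the opposite place detects it.\<close>

lemma Tr_nondegenerate:
  assumes t: "\<And>T. T \<in> VV ==> t T \<noteq> 0"
    and h: "arr h" "src h = W" "tgt h = Z" "\<And>g. arr g ==> src g = Z ==> tgt g = W ==> Tr t Z (h ** g) = 0"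
  shows "h = zr W Z"
proof (rule ccontr)
  assume ne: "h \<noteq> zr W Z"
  have ob: "W \<in> Ob B" "Z \<in> Ob B" using arrD(2,3)[OF h(1)] h by auto
  obtain l where l: "l < dN W" "h ** dI W l \<noteq> zr (dS W l) Z"
    using exists_\<iota>[OF dec[OF ob(1)] ob(1) h(1,2)] ne h(3) by auto
  have "arr (h ** dI W l)" "src (h ** dI W l) = dS W l" "tgt (h ** dI W l) = Z" using l(1) ob h by simp_all
  then obtain k where k: "k < dN Z" "dP Z k ** h ** dI W l \<noteq> zr (dS W l) (dS Z k)"
    using exists_\<pi>[OF dec[OF ob(2)] ob(2), of "h ** dI W l"] l by auto
  let ?u = "dP Z k ** h ** dI W l"
  have u: "arr ?u" "src ?u = dS W l" "tgt ?u = dS Z k" using k l ob h by simp_all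
  have V: "dS W l \<in> VV" "dS Z k \<in> VV" using k l ob by simp_all
  have eq: "dS W l = dS Z k" using VV_eq[OF V u k(2)] .
  \<comment> \<open>\<open>dI W l ** dP Z k\<close> is the matrix unit; it is well typed because
    both summands have the same representative.\<close>
  have "0 = Tr t Z (h ** (dI W l ** dP Z k))" using h k l ob eq by simp
  also have "h ** (dI W l ** dP Z k) = (h ** dI W l) ** dP Z k" using h k l ob eq by simp
  also have "Tr t Z ... = Tr t (dS Z k) ?u" by (rule Tr_cyclic) (use h k l ob eq in simp_all)
  also have "... = t (dS Z k) * scal (dS Z k) ?u" by (rule Tr_simple) (use u eq V in simp_all)
  finally have "scal (dS Z k) ?u = 0" using t V(2) by simp
  then show False using scal_eq_0[OF V(2)] u eq k(2) by auto
qed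

end

section \<open>A self-dual endofunctor and its weighted fusion graph\<close>

locale endo_data = lincat B for B :: "('o, 'm, 'x) lin_cat_scheme" +
  fixes Fo :: "'o => 'o" and Fm :: "'m => 'm"
  assumes Fo [simp]: "X \<in> Ob B ==> Fo X \<in> Ob B"
    and Fm [simp]: "arr f ==> arr (Fm f)" "arr f ==> src (Fm f) = Fo (src f)" "arr f ==> tgt (Fm f) = Fo (tgt f)"
    and Fm_id [simp]: "X \<in> Ob B ==> Fm (i1 X) = i1 (Fo X)"
    and Fm_comp [simp]: "arr f ==> arr g ==> src g = tgt f ==> Fm (g ** f) = Fm g ** Fm f"
    and Fm_ad [simp]: "arr f ==> arr g ==> src f = src g ==> tgt f = tgt g ==> Fm (ad f g) = ad (Fm f) (Fm g)"
    and Fm_sc [simp]: "arr f ==> Fm (sc c f) = sc c (Fm f)"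
begin

lemma Fm_zr [simp]: "X \<in> Ob B ==> Y \<in> Ob B ==> Fm (zr X Y) = zr (Fo X) (Fo Y)"
  using Fm_sc[of "zr X Y" 0] by simp

end

text \<open>\<open>E\<close> and \<open>H\<close> are evaluation and coevaluation. The last
  assumption is coinductive, as in \<open>reduced_graph\<close>, but for vectors in edge spaces: no
  nonempty set of nonzero edge vectors is such that each of its members has a successor in it with
  vanishing evaluation.\<close>

locale self_dual = sscat B + endo_data B Fo Fm for B :: "('o, 'm) lin_cat" and Fo Fm +
  fixes E H
  assumes E [simp]: "Z \<in> Ob B ==> arr (E Z)" "Z \<in> Ob B ==> src (E Z) = Fo (Fo Z)" "Z \<in> Ob B ==> tgt (E Z) = Z"
    and H [simp]: "Z \<in> Ob B ==> arr (H Z)" "Z \<in> Ob B ==> src (H Z) = Z" "Z \<in> Ob B ==> tgt (H Z) = Fo (Fo Z)"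
    and E_nat: "arr f ==> E (tgt f) ** Fm (Fm f) = f ** E (src f)"
    and H_nat: "arr f ==> H (tgt f) ** f = Fm (Fm f) ** H (src f)"
    and zig: "Z \<in> Ob B ==> Fm (E Z) ** H (Fo Z) = i1 (Fo Z)"
    and no_reduced_walk: "\<And>\<P> S S' x.
      (\<And>S S' x. \<P> S S' x ==> S \<in> VV \<and> S' \<in> VV \<and> arr x \<and> src x = S' \<and> tgt x = Fo S \<and> x \<noteq> zr S' (Fo S)) ==>
      (\<And>S S' x. \<P> S S' x ==> \<exists>S'' x'. \<P> S' S'' x' \<and> E S ** Fm x ** x' = zr S'' S) ==> \<not> \<P> S S' x"
begin

text \<open>The transpose of \<open>a\<close> under the adjunction of the functor with
  itself.\<close>

definition mate where "mate i a = E i ** Fm a"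

lemma mate [simp]:
  assumes "arr a" "tgt a = Fo i" "i \<in> Ob B"
  shows "arr (mate i a)" "src (mate i a) = Fo (src a)" "tgt (mate i a) = i"
  using assms by (auto simp: mate_def)

lemma mate_inverse:
  assumes "arr a" "tgt a = Fo i" "i \<in> Ob B"
  shows "Fm (mate i a) ** H (src a) = a"
proof -
  have "Fm (mate i a) ** H (src a) = Fm (E i) ** Fm (Fm a) ** H (src a)" using assms by (simp add: mate_def)
  also have "Fm (Fm a) ** H (src a) = H (Fo i) ** a" using H_nat[of a] assms by simp
  also have "Fm (E i) ** H (Fo i) ** a = (Fm (E i) ** H (Fo i)) ** a" using assms by simp
  also have "... = a" unfolding zig[OF assms(3)] using assms by simp
  finally show ?thesis .
qed

lemma mate_nonzero:
  assumes "arr a" "tgt a = Fo i" "i \<in> Ob B" "a \<noteq> zr (src a) (Fo i)"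
  shows "mate i a \<noteq> zr (Fo (src a)) i"
proof
  assume "mate i a = zr (Fo (src a)) i"
  then have "a = zr (Fo (Fo (src a))) (Fo i) ** H (src a)" using mate_inverse[OF assms(1-3)] assms(1,3) by simp
  also have "... = zr (src a) (Fo i)" using assms(1,3) by simp
  finally show False using assms(4) by simp
qed

definition hom where "hom j i a \<longleftrightarrow> arr a \<and> src a = j \<and> tgt a = Fo i"

text \<open>The pairing of the edge space from \<open>j\<close> to \<open>i\<close> with the reverse
  edge space. It need not be symmetric when \<open>i\<close> and \<open>j\<close> are exchanged; the
  weights have to compensate for that.\<close>

definition pr where "pr i a b = scal i (mate i a ** b)"

lemma homD [simp]: "hom j i a ==> arr a" "hom j i a ==> src a = j" "hom j i a ==> tgt a = Fo i"
  by (auto simp: hom_def)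

lemma homI: "arr a ==> src a = j ==> tgt a = Fo i ==> hom j i a" unfolding hom_def by simp

lemma hom_sc: "hom j i a ==> hom j i (sc c a)" unfolding hom_def by simp

lemma hom_ad: "hom j i a ==> hom j i a' ==> hom j i (ad a a')" unfolding hom_def by simp

lemma hom_diff_zero:
  assumes a': "hom j i a'" and a: "hom j i a" and z: "ad a' (sc (- c) a) = zr j (Fo i)"
  shows "a' = sc c a"
proof (rule eq_if_diff_zero)
  show "par a' (sc c a)" unfolding par_def using homD[OF a] homD[OF a'] by simp
  have "sc (- 1) (sc c a) = sc (- c) a" using homD[OF a] by simp
  then show "ad a' (sc (- 1) (sc c a)) = zr (src a') (tgt a')" using z homD[OF a'] by simp
qed

lemma mate_sc: "hom j i a ==> i \<in> Ob B ==> mate i (sc c a) = sc c (mate i a)" by (simp add: mate_def)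

lemma mate_ad: "hom j i a ==> hom j i a' ==> i \<in> Ob B ==> mate i (ad a a') = ad (mate i a) (mate i a')"
  by (simp add: mate_def comp_ad par_def)

lemma pr_sc_left: "i \<in> VV ==> hom j i a ==> hom i j b ==> pr i (sc c a) b = c * pr i a b"
  by (simp add: pr_def mate_sc scal_sc)

lemma pr_sc_right: "i \<in> VV ==> hom j i a ==> hom i j b ==> pr i a (sc c b) = c * pr i a b"
  by (simp add: pr_def scal_sc)

lemma pr_ad_right: "i \<in> VV ==> hom j i a ==> hom i j b ==> hom i j b' ==> pr i a (ad b b') = pr i a b + pr i a b'"
  by (simp add: pr_def comp_ad par_def scal_ad)

text \<open>The mate of a nonzero edge vector is a nonzero morphism onto a simple object, hence
  split. So the pairing is nondegenerate.\<close>

lemma pr_partner: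
  assumes i: "i \<in> VV" and a: "hom j i a" "a \<noteq> zr j (Fo i)"
  shows "\<exists>b. hom i j b \<and> pr i a b = 1"
proof -
  have "mate i a \<noteq> zr (Fo j) i" using mate_nonzero[of a i] a i by simp
  then obtain b where "arr b" "src b = i" "tgt b = Fo j" "mate i a ** b = i1 i"
    using split_epi[OF i, of "mate i a"] a i by auto
  then show ?thesis using i unfolding hom_def pr_def by auto
qed

text \<open>Says that the edge space has dimension at least two.\<close>

definition indep where "indep j i \<longleftrightarrow> (\<exists>a a'. hom j i a \<and> hom j i a' \<and> a \<noteq> zr j (Fo i) \<and> (\<forall>c. a' \<noteq> sc c a))"

text \<open>The pairing transports dimension: \<open>z\<close> is dual to \<open>a\<close>, and
  \<open>z'\<close> is dual to a vector that annihilates \<open>z\<close>, so \<open>z\<close> and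
  \<open>z'\<close> are independent.\<close>

lemma indep_sym:
  assumes i: "i \<in> VV" and j: "j \<in> VV" and ind: "indep j i"
  shows "indep i j"
proof -
  obtain a a' where a: "hom j i a" "hom j i a'" "a \<noteq> zr j (Fo i)" "\<And>c. a' \<noteq> sc c a" using ind unfolding indep_def by blast
  obtain z where z: "hom i j z" "pr i a z = 1" using pr_partner[OF i a(1,3)] by blast
  define c where "c = pr i a' z"
  \<comment> \<open>\<open>a'\<close> corrected by a multiple of \<open>a\<close> so that its
    pairing with \<open>z\<close> vanishes.\<close>
  define d where "d = ad a' (sc (- c) a)"
  have d: "hom j i d" unfolding d_def by (intro hom_ad hom_sc a)
  have "d \<noteq> zr j (Fo i)"
  proof
    assume "d = zr j (Fo i)"
    then have "a' = sc c a" unfolding d_def by (rule hom_diff_zero[OF a(2,1)])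
    then show False using a(4) by blast
  qed
  then obtain z' where z': "hom i j z'" "pr i d z' = 1" using pr_partner[OF i d] by blast
  have "pr i d z = 0"
  proof -
    have "mate i d ** z = ad (mate i a' ** z) (sc (- c) (mate i a ** z))"
      unfolding d_def using a(1,2) z(1) i by (simp add: mate_ad[OF a(2) hom_sc[OF a(1)]] mate_sc[OF a(1)] ad_comp par_def)
    then have "pr i d z = pr i a' z + (- c) * pr i a z"
      using a(1,2) z(1) i by (simp add: pr_def scal_ad scal_sc)
    then show ?thesis by (simp add: c_def z(2))
  qed
  have "z' \<noteq> sc e z" for e
  proof
    assume "z' = sc e z"
    then have "pr i d z' = e * pr i d z" using pr_sc_right[OF i d z(1)] by simp
    then show False using \<open>pr i d z = 0\<close> z'(2) by simp
  qed
  moreover have "z \<noteq> zr i (Fo j)"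
  proof
    assume "z = zr i (Fo j)"
    then have "pr i a z = 0" using a(1) i j by (simp add: pr_def)
    then show False using z(2) by simp
  qed
  ultimately show ?thesis unfolding indep_def using z(1) z'(1) by blast
qed

text \<open>Pairing with \<open>x\<close> is a linear functional, and a space of dimension at least
  two contains a nonzero vector on which it vanishes. This vector continues \<open>x\<close> to a
  reduced walk.\<close>

lemma next_indep:
  assumes i: "i \<in> VV" and j: "j \<in> VV" and ind: "indep i j" and x: "hom j i x"
  shows "\<exists>x'. hom i j x' \<and> x' \<noteq> zr i (Fo j) \<and> E i ** Fm x ** x' = zr i i"
proof -
  obtain a a' where a: "hom i j a" "hom i j a'" "a \<noteq> zr i (Fo j)" "\<And>c. a' \<noteq> sc c a" using ind unfolding indep_def by blast
  have *: "\<exists>x'. hom i j x' \<and> x' \<noteq> zr i (Fo j) \<and> pr i x x' = 0"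
  proof (cases "pr i x a = 0")
    case False
    let ?c = "pr i x a' / pr i x a"
    let ?x = "ad a' (sc (- ?c) a)"
    have "?x \<noteq> zr i (Fo j)"
    proof
      assume "?x = zr i (Fo j)"
      then have "a' = sc ?c a" by (rule hom_diff_zero[OF a(2,1)])
      then show False using a(4) by blast
    qed
    moreover have "pr i x ?x = 0"
      using pr_ad_right[OF i x a(2) hom_sc[OF a(1)]] pr_sc_right[OF i x a(1)] False by simp
    ultimately show ?thesis using hom_ad[OF a(2) hom_sc[OF a(1)]] by blast
  qed (use a in blast)
  then obtain x' where x': "hom i j x'" "x' \<noteq> zr i (Fo j)" "pr i x x' = 0" by blast
  have "mate i x ** x' = zr i i" by (rule scal_eq_0[OF i]) (use x x' i in "auto simp: pr_def")
  then have "E i ** Fm x ** x' = zr i i" using x x'(1) i by (simp add: mate_def)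
  then show ?thesis using x' by blast
qed

text \<open>A double edge would allow an endless reduced walk to and fro between \<open>i\<close>
  and \<open>j\<close>.\<close>

lemma not_indep:
  assumes i: "i \<in> VV" and j: "j \<in> VV"
  shows "\<not> indep j i"
proof
  assume ind: "indep j i"
  have ind': "indep i j" by (rule indep_sym[OF i j ind])
  obtain a where a: "hom j i a" "a \<noteq> zr j (Fo i)" using ind unfolding indep_def by blast
  \<comment> \<open>All nonzero edge vectors between \<open>i\<close> and \<open>j\<close> in either
    direction; \<open>next_indep\<close> continues each of them within this set.\<close>
  let ?P = "\<lambda>S S' x. (S = i \<and> S' = j \<or> S = j \<and> S' = i) \<and> hom S' S x \<and> x \<noteq> zr S' (Fo S)"
  have "\<not> ?P i j a"
  proof (rule no_reduced_walk[of ?P])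
    fix S S' x assume P: "?P S S' x"
    then have "S \<in> VV" "S' \<in> VV" "indep S S'" using i j ind ind' by auto
    then obtain x' where "hom S S' x'" "x' \<noteq> zr S (Fo S')" "E S ** Fm x ** x' = zr S S"
      using next_indep[of S S' x] P by blast
    then show "\<exists>S'' x'. ?P S' S'' x' \<and> E S ** Fm x ** x' = zr S'' S"
      using P by (intro exI[of _ S] exI[of _ x']) auto
  qed (use i j in auto)
  then show False using a by blast
qed

definition edge where "edge i j \<longleftrightarrow> i \<in> VV \<and> j \<in> VV \<and> (\<exists>a. hom j i a \<and> a \<noteq> zr j (Fo i))"

lemma edge_sym: "edge i j ==> edge j i"
proof -
  assume e: "edge i j"
  then obtain a where a: "i \<in> VV" "j \<in> VV" "hom j i a" "a \<noteq> zr j (Fo i)" unfolding edge_def by blast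
  obtain b where b: "hom i j b" "pr i a b = 1" using pr_partner[OF a(1,3,4)] by blast
  have "b \<noteq> zr i (Fo j)"
  proof
    assume "b = zr i (Fo j)"
    then have "pr i a b = 0" using a by (simp add: pr_def)
    then show False using b(2) by simp
  qed
  then show ?thesis unfolding edge_def using a b by blast
qed

definition pick where "pick i j = (SOME a. hom j i a \<and> a \<noteq> zr j (Fo i))"

lemma pick: "edge i j ==> hom j i (pick i j) \<and> pick i j \<noteq> zr j (Fo i)"
  unfolding pick_def by (rule someI_ex) (auto simp: edge_def)

lemma pick_arr: "edge i j ==> arr (pick i j) \<and> src (pick i j) = j \<and> tgt (pick i j) = Fo i \<and> i \<in> VV \<and> j \<in> VV"
  using pick[of i j] unfolding hom_def edge_def by blast

lemma pick_scalar: "edge i j ==> hom j i a ==> \<exists>c. a = sc c (pick i j)"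
  using not_indep[of i j] pick[of i j] unfolding indep_def edge_def by blast

text \<open>Compares the two orders in which an edge vector and a reverse one can be paired.
  Rescaling either pick changes numerator and denominator by the same factor.\<close>

definition ratio where "ratio i j = pr i (pick i j) (pick j i) / pr j (pick j i) (pick i j)"

text \<open>By nondegeneracy some vector pairs to 1 with the pick, and as edge spaces are
  one-dimensional it is a multiple of the reverse pick.\<close>

lemma pr_pick_nonzero: "edge i j ==> pr i (pick i j) (pick j i) \<noteq> 0"
proof
  assume e: "edge i j" and z: "pr i (pick i j) (pick j i) = 0"
  have V: "i \<in> VV" "j \<in> VV" using e by (auto simp: edge_def)
  obtain b where b: "hom i j b" "pr i (pick i j) b = 1" using pr_partner[OF V(1)] pick[OF e] by blast
  obtain c where "b = sc c (pick j i)" using pick_scalar[OF edge_sym[OF e] b(1)] by blast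
  moreover have "pr i (pick i j) (sc c (pick j i)) = c * pr i (pick i j) (pick j i)"
    by (rule pr_sc_right[OF V(1) conjunct1[OF pick[OF e]] conjunct1[OF pick[OF edge_sym[OF e]]]])
  ultimately show False using b(2) z by simp
qed

sublocale graph: reduced_graph edge ratio
proof
  show "edge v u" if "edge u v" for u v using edge_sym that .
  show "ratio u v * ratio v u = 1" if "edge u v" for u v
    using pr_pick_nonzero[OF that] pr_pick_nonzero[OF edge_sym[OF that]] by (simp add: ratio_def)
  show "ratio u u = 1" if "edge u u" for u using pr_pick_nonzero[OF that] by (simp add: ratio_def)
  fix Q u v
  assume Q: "\<And>u v. Q u v ==> edge u v" "\<And>u v. Q u v ==> \<exists>w. Q v w \<and> w \<noteq> u"
  let ?P = "\<lambda>S S' x. Q S S' \<and> x = pick S S'"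
  have "\<not> ?P u v (pick u v)"
  proof (rule no_reduced_walk[of ?P])
    fix S S' x assume P: "?P S S' x"
    then have e: "edge S S'" and x: "x = pick S S'" using Q(1) by auto
    then show "S \<in> VV \<and> S' \<in> VV \<and> arr x \<and> src x = S' \<and> tgt x = Fo S \<and> x \<noteq> zr S' (Fo S)"
      using pick[OF e] pick_arr[OF e] x by simp
    obtain w where w: "Q S' w" "w \<noteq> S" using Q(2) P by blast
    have e': "edge S' w" using Q(1) w(1) .
    \<comment> \<open>This is a morphism from \<open>w\<close> to \<open>S\<close>, two different
      representatives, since the walk does not turn back.\<close>
    have "mate S x ** pick S' w = zr w S"
      unfolding x using w(2) pick_arr[OF e] pick_arr[OF e'] by (intro VV_zero) simp_all
    moreover have "mate S x ** pick S' w = E S ** Fm x ** pick S' w"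
      unfolding mate_def x using pick_arr[OF e] pick_arr[OF e'] by simp
    ultimately show "\<exists>S'' x'. ?P S' S'' x' \<and> E S ** Fm x ** x' = zr S'' S" using w(1) by auto
  qed
  then show "\<not> Q u v" by simp
qed

text \<open>The potential of \<open>ratio\<close> makes up for the asymmetry of the pairing. On an
  edge it suffices to compare the picks; elsewhere both sides vanish.\<close>

lemma weights: "\<exists>t. (\<forall>T. t T \<noteq> 0) \<and> (\<forall>i j a b. i \<in> VV \<longrightarrow> j \<in> VV \<longrightarrow> hom j i a \<longrightarrow> hom i j b \<longrightarrow>
    t i * pr i a b = t j * pr j b a)"
proof -
  obtain t where t: "\<And>u v. t u \<noteq> 0 \<and> (edge u v \<longrightarrow> t v = t u * ratio u v)" using graph.potential by blast
  have "t i * pr i a b = t j * pr j b a" if V: "i \<in> VV" "j \<in> VV" and a: "hom j i a" and b: "hom i j b" for i j a b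
  proof (cases "edge i j")
    case True
    note p = pick[OF True] pick[OF edge_sym[OF True]]
    obtain c where c: "a = sc c (pick i j)" using pick_scalar[OF True a] by blast
    obtain d where d: "b = sc d (pick j i)" using pick_scalar[OF edge_sym[OF True] b] by blast
    have 1: "pr i a b = c * (d * pr i (pick i j) (pick j i))"
      using pr_sc_left[OF V(1) _ b] pr_sc_right[OF V(1)] p unfolding c d by (simp add: hom_sc)
    have 2: "pr j b a = d * (c * pr j (pick j i) (pick i j))"
      using pr_sc_left[OF V(2) _ a] pr_sc_right[OF V(2)] p unfolding c d by (simp add: hom_sc)
    show ?thesis unfolding 1 2
      using t[of i j] True pr_pick_nonzero[OF edge_sym[OF True]] by (simp add: ratio_def field_simps)
  next
    case False
    then have "a = zr j (Fo i)" "b = zr i (Fo j)" using a b V edge_sym[of j i] unfolding edge_def by blast+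
    then show ?thesis using V by (simp add: pr_def mate_def)
  qed
  then show ?thesis using t by blast
qed

text \<open>Both traces expand into sums over summands of \<open>W\<close> and \<open>Z\<close>; the
  symmetry of the weighted pairing matches them term by term.\<close>

lemma trace_exists:
  "\<exists>t. (\<forall>T. t T \<noteq> 0) \<and> (\<forall>Z W a b. arr a \<longrightarrow> src a = Z \<longrightarrow> tgt a = Fo W \<longrightarrow> arr b \<longrightarrow> src b = W \<longrightarrow> tgt b = Fo Z \<longrightarrow>
     Z \<in> Ob B \<longrightarrow> W \<in> Ob B \<longrightarrow> Tr t W (E W ** Fm a ** b) = Tr t Z (E Z ** Fm b ** a))"
proof -
  obtain t where t: "\<And>T. t T \<noteq> 0"
    and w: "\<And>i j a b. i \<in> VV ==> j \<in> VV ==> hom j i a ==> hom i j b ==> t i * pr i a b = t j * pr j b a"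
    using weights by blast
  have expand: "Tr t W (E W ** Fm a ** b) = (\<Sum>l<dN W. \<Sum>k<dN Z. t (dS W l) *
      pr (dS W l) (Fm (dP W l) ** a ** dI Z k) (Fm (dP Z k) ** b ** dI W l))"
    if a: "arr a" "src a = Z" "tgt a = Fo W" and b: "arr b" "src b = W" "tgt b = Fo Z" and ob: "Z \<in> Ob B" "W \<in> Ob B"
    for Z W a b
  proof -
    have "scal (dS W l) (dP W l ** (E W ** Fm a ** b) ** dI W l) =
        (\<Sum>k<dN Z. pr (dS W l) (Fm (dP W l) ** a ** dI Z k) (Fm (dP Z k) ** b ** dI W l))" if l: "l < dN W" for l
    proof -
      \<comment> \<open>A slot for an endomorphism of \<open>Z\<close> between \<open>Fm a\<close>
        and \<open>b\<close>; the decomposition of the identity of \<open>Z\<close> is inserted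
        there.\<close>
      let ?\<phi> = "\<lambda>h. scal (dS W l) (dP W l ** E W ** Fm a ** Fm h ** b ** dI W l)"
      have "?\<phi> (i1 Z) = (\<Sum>k<dN Z. ?\<phi> (dI Z k ** dP Z k))"
      proof (rule decomposition_functional[OF dec[OF ob(1)] ob(1)])
        fix u v assume "par u v" "src u = Z" "tgt u = Z"
        then have uv: "arr u" "arr v" "src u = Z" "tgt u = Z" "src v = Z" "tgt v = Z" by (auto simp: par_def)
        have "dP W l ** E W ** Fm a ** Fm (ad u v) ** b ** dI W l =
            ad (dP W l ** E W ** Fm a ** Fm u ** b ** dI W l) (dP W l ** E W ** Fm a ** Fm v ** b ** dI W l)"
          using uv a b l ob by (simp add: par_def ad_comp comp_ad)
        then show "?\<phi> (ad u v) = ?\<phi> u + ?\<phi> v" using uv a b l ob by (simp add: scal_ad)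
      qed (use a b l ob in simp)
      moreover have "?\<phi> (i1 Z) = scal (dS W l) (dP W l ** (E W ** Fm a ** b) ** dI W l)" using a b l ob by simp
      moreover have "?\<phi> (dI Z k ** dP Z k) =
          pr (dS W l) (Fm (dP W l) ** a ** dI Z k) (Fm (dP Z k) ** b ** dI W l)" if k: "k < dN Z" for k
      proof -
        have "mate (dS W l) (Fm (dP W l) ** a ** dI Z k) ** (Fm (dP Z k) ** b ** dI W l) =
            (E (dS W l) ** Fm (Fm (dP W l))) ** Fm a ** Fm (dI Z k) ** Fm (dP Z k) ** b ** dI W l"
          using a b l k ob by (simp add: mate_def)
        also have "E (dS W l) ** Fm (Fm (dP W l)) = dP W l ** E W" using E_nat[of "dP W l"] l ob by simp
        finally show ?thesis using a b l k ob by (simp add: pr_def)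
      qed
      ultimately show ?thesis by simp
    qed
    then show ?thesis unfolding Tr_def by (simp add: sum_distrib_left)
  qed
  have "Tr t W (E W ** Fm a ** b) = Tr t Z (E Z ** Fm b ** a)"
    if a: "arr a" "src a = Z" "tgt a = Fo W" and b: "arr b" "src b = W" "tgt b = Fo Z" and ob: "Z \<in> Ob B" "W \<in> Ob B"
    for Z W a b
  proof -
    have "Tr t W (E W ** Fm a ** b) = (\<Sum>l<dN W. \<Sum>k<dN Z. t (dS Z k) *
        pr (dS Z k) (Fm (dP Z k) ** b ** dI W l) (Fm (dP W l) ** a ** dI Z k))"
      unfolding expand[OF a b ob]
    proof (intro sum.cong refl)
      fix l k assume "l \<in> {..<dN W}" "k \<in> {..<dN Z}"
      then show "t (dS W l) * pr (dS W l) (Fm (dP W l) ** a ** dI Z k) (Fm (dP Z k) ** b ** dI W l) =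
          t (dS Z k) * pr (dS Z k) (Fm (dP Z k) ** b ** dI W l) (Fm (dP W l) ** a ** dI Z k)"
        using a b ob by (intro w) (auto intro!: homI)
    qed
    also have "... = Tr t Z (E Z ** Fm b ** a)" unfolding expand[OF b a ob(2,1)] by (rule sum.swap)
    finally show ?thesis .
  qed
  then show ?thesis using t by blast
qed

end

section \<open>Calculation with classes modulo the ideal\<close>

section \<open>The quotient by a tensor ideal\<close>

context TL_ideal
begin

definition q :: "nat => nat => coeffs => tl_mor set" where
  "q m n f = ideal_class (TL \<beta>) N (m, n, f)"

abbreviation Q where "Q \<equiv> quotient_cat (TL \<beta>) N"
abbreviation "z0 \<equiv> (\<lambda>_ :: diagram. 0 :: complex)"

definition eqv :: "nat => nat => coeffs => coeffs => bool" where
  "eqv m n f g \<longleftrightarrow> (m, n, \<lambda>X. f X + - 1 * g X) \<in> N m n"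

lemma eqv_refl: "eqv m n f f" using N_zero by (simp add: eqv_def)

lemma eqv_sym: "eqv m n f g ==> eqv m n g f"
  using N_scale[of m n "\<lambda>X. f X + - 1 * g X" "-1"] by (simp add: eqv_def algebra_simps)

lemma eqv_trans: "eqv m n f g ==> eqv m n g h ==> eqv m n f h"
  using N_add[of m n "\<lambda>X. f X + - 1 * g X" "\<lambda>X. g X + - 1 * h X"] by (simp add: eqv_def)

lemma q_set: "f \<in> V m n ==> q m n f = {(m, n, g) | g. g \<in> V m n \<and> eqv m n g f}"
  unfolding q_def ideal_class_def eqv_def by (auto simp: Hom_TL)

lemma q_self: "f \<in> V m n ==> (m, n, f) \<in> q m n f" using q_set eqv_refl by auto

lemma q_eqI:
  assumes a: "f \<in> V m n" "g \<in> V m n" "eqv m n f g"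
  shows "q m n f = q m n g"
proof -
  have "eqv m n h f \<longleftrightarrow> eqv m n h g" for h using a(3) eqv_sym[OF a(3)] eqv_trans[of m n h] by blast
  then show ?thesis by (simp add: q_set a)
qed

lemma eqv_linop:
  assumes "linop \<Phi>" "eqv m n f g" "\<And>h. (m, n, h) \<in> N m n ==> (m', n', \<Phi> h) \<in> N m' n'"
  shows "eqv m' n' (\<Phi> f) (\<Phi> g)"
proof -
  have "\<Phi> (\<lambda>X. f X + - 1 * g X) = (\<lambda>X. \<Phi> f X + - 1 * \<Phi> g X)"
    using linop_add[OF assms(1), of f "\<lambda>X. - 1 * g X"] linop_scale[OF assms(1), of "-1" g] by simp
  then show ?thesis using assms(2,3) unfolding eqv_def by metis
qed

lemma union_const: "A \<noteq> {} ==> (\<And>x. x \<in> A ==> h x = y) ==> (\<Union>x\<in>A. h x) = y" by auto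

text \<open>The operations of the quotient are unions over all representatives. As every choice
  yields the same class, the union is that class.\<close>

lemma Q_bilinear:
  assumes f: "f \<in> V m n" and g: "g \<in> V m' n'"
    and op: "\<And>f g. op (m, n, f) (m', n', g) = (m'', n'', \<Phi> f g)"
    and c: "\<And>f' g'. f' \<in> V m n ==> g' \<in> V m' n' ==> eqv m n f' f ==> eqv m' n' g' g ==>
       \<Phi> f' g' \<in> V m'' n'' \<and> eqv m'' n'' (\<Phi> f' g') (\<Phi> f g)"
  shows "(\<Union>x\<in>q m n f. \<Union>y\<in>q m' n' g. ideal_class (TL \<beta>) N (op x y)) = q m'' n'' (\<Phi> f g)"
proof (rule union_const)
  show "q m n f \<noteq> {}" using q_self[OF f] by blast
  fix x assume "x \<in> q m n f"
  then obtain f' where x: "x = (m, n, f')" "f' \<in> V m n" "eqv m n f' f" by (auto simp: q_set[OF f])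
  show "(\<Union>y\<in>q m' n' g. ideal_class (TL \<beta>) N (op x y)) = q m'' n'' (\<Phi> f g)"
  proof (rule union_const)
    show "q m' n' g \<noteq> {}" using q_self[OF g] by blast
    fix y assume "y \<in> q m' n' g"
    then obtain g' where y: "y = (m', n', g')" "g' \<in> V m' n'" "eqv m' n' g' g" by (auto simp: q_set[OF g])
    have 1: "\<Phi> f' g' \<in> V m'' n''" "eqv m'' n'' (\<Phi> f' g') (\<Phi> f g)" using c x y by blast+
    have 2: "\<Phi> f g \<in> V m'' n''" using c[OF f g eqv_refl eqv_refl] by blast
    show "ideal_class (TL \<beta>) N (op x y) = q m'' n'' (\<Phi> f g)"
      unfolding x(1) y(1) op q_def[symmetric] by (rule q_eqI[OF 1(1) 2 1(2)])
  qed
qed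

lemma Q_cmp:
  assumes "f \<in> V m n" "g \<in> V n p"
  shows "cmp Q (q n p g) (q m n f) = q m p (tcmp \<beta> m n p g f)"
proof -
  have "(\<Union>x\<in>q n p g. \<Union>y\<in>q m n f. ideal_class (TL \<beta>) N (cmp (TL \<beta>) x y)) = q m p (tcmp \<beta> m n p g f)"
  proof (rule Q_bilinear[OF assms(2,1)])
    fix g' f' assume a: "g' \<in> V n p" "f' \<in> V m n" "eqv n p g' g" "eqv m n f' f"
    have "eqv m p (tcmp \<beta> m n p g' f') (tcmp \<beta> m n p g' f)"
      by (rule eqv_linop[OF linop_tcmp_right a(4) N_cmp_left[OF _ a(1)]])
    moreover have "eqv m p (tcmp \<beta> m n p g' f) (tcmp \<beta> m n p g f)"
      by (rule eqv_linop[OF linop_tcmp_left a(3) N_cmp_right[OF _ assms(1)]])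
    ultimately show "tcmp \<beta> m n p g' f' \<in> V m p \<and> eqv m p (tcmp \<beta> m n p g' f') (tcmp \<beta> m n p g f)"
      using eqv_trans by auto
  qed simp_all
  then show ?thesis by (simp add: quotient_cat_def)
qed

lemma Q_tens:
  assumes "f \<in> V m n" "g \<in> V m' n'"
  shows "tens_mor Q (q m n f) (q m' n' g) = q (m + m') (n + n') (ttens m n m' n' f g)"
proof -
  have "(\<Union>x\<in>q m n f. \<Union>y\<in>q m' n' g. ideal_class (TL \<beta>) N (tens_mor (TL \<beta>) x y)) = q (m + m') (n + n') (ttens m n m' n' f g)"
  proof (rule Q_bilinear[OF assms])
    fix f' g' assume a: "f' \<in> V m n" "g' \<in> V m' n'" "eqv m n f' f" "eqv m' n' g' g"
    have "eqv (m + m') (n + n') (ttens m n m' n' f' g') (ttens m n m' n' f' g)"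
      by (rule eqv_linop[OF linop_ttens_right a(4) N_tens(2)[OF _ a(1)]])
    moreover have "eqv (m + m') (n + n') (ttens m n m' n' f' g) (ttens m n m' n' f g)"
      by (rule eqv_linop[OF linop_ttens_left a(3) N_tens(1)[OF _ assms(2)]])
    ultimately show "ttens m n m' n' f' g' \<in> V (m + m') (n + n') \<and>
        eqv (m + m') (n + n') (ttens m n m' n' f' g') (ttens m n m' n' f g)"
      using eqv_trans by auto
  qed simp_all
  then show ?thesis by (simp add: quotient_cat_def)
qed

lemma Q_add:
  assumes "f \<in> V m n" "g \<in> V m n"
  shows "add_mor Q (q m n f) (q m n g) = q m n (\<lambda>X. f X + g X)"
proof -
  have "(\<Union>x\<in>q m n f. \<Union>y\<in>q m n g. ideal_class (TL \<beta>) N (add_mor (TL \<beta>) x y)) = q m n (\<lambda>X. f X + g X)"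
  proof (rule Q_bilinear[OF assms])
    fix f' g' assume a: "f' \<in> V m n" "g' \<in> V m n" "eqv m n f' f" "eqv m n g' g"
    have "eqv m n (\<lambda>X. f' X + g' X) (\<lambda>X. f X + g X)"
      using N_add[OF a(3)[unfolded eqv_def] a(4)[unfolded eqv_def]] by (simp add: eqv_def algebra_simps)
    then show "(\<lambda>X. f' X + g' X) \<in> V m n \<and> eqv m n (\<lambda>X. f' X + g' X) (\<lambda>X. f X + g X)"
      using a by (simp add: V_add)
  qed simp_all
  then show ?thesis by (simp add: quotient_cat_def)
qed

lemma Q_scale:
  assumes "f \<in> V m n"
  shows "scale_mor Q c (q m n f) = q m n (\<lambda>X. c * f X)"
proof -
  have "(\<Union>x\<in>q m n f. ideal_class (TL \<beta>) N (scale_mor (TL \<beta>) c x)) = q m n (\<lambda>X. c * f X)"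
  proof (rule union_const)
    show "q m n f \<noteq> {}" using q_self[OF assms] by blast
    fix x assume "x \<in> q m n f"
    then obtain f' where x: "x = (m, n, f')" "f' \<in> V m n" "eqv m n f' f" by (auto simp: q_set[OF assms])
    have "eqv m n (\<lambda>X. c * f' X) (\<lambda>X. c * f X)"
      using N_scale[OF x(3)[unfolded eqv_def], of c] by (simp add: eqv_def algebra_simps)
    then show "ideal_class (TL \<beta>) N (scale_mor (TL \<beta>) c x) = q m n (\<lambda>X. c * f X)"
      unfolding x(1) TL_simps q_def[symmetric] using x(2) assms by (intro q_eqI V_scale)
  qed
  then show ?thesis by (simp add: quotient_cat_def)
qed

lemma Q_simps [simp]:
  "Ob Q = UNIV" "unit_ob Q = 0" "tens_ob Q = (+)" "ldual Q = (\<lambda>n. n)" "rdual Q = (\<lambda>n. n)"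
  "idm Q n = q n n (idc n)" "zero_mor Q m n = q m n z0"
  "ev_l Q n = q (n + n) 0 (capc n)" "ev_r Q n = q (n + n) 0 (capc n)"
  "coev_l Q n = q 0 (n + n) (cupc n)" "coev_r Q n = q 0 (n + n) (cupc n)"
  "pivot Q n = q n n (idc n)"
  by (simp_all add: quotient_cat_def q_def)

lemma Hom_Q: "Hom Q m n = q m n ` V m n" by (auto simp: quotient_cat_def Hom_TL q_def)

lemma Q_sum:
  assumes "\<And>k. k < l ==> h k \<in> V m n"
  shows "sum_mor Q m n (map (\<lambda>k. q m n (h k)) [0..<l]) = q m n (\<lambda>X. \<Sum>k<l. h k X)"
proof -
  have "sum_mor Q m n (map (\<lambda>k. q m n (h k)) ks) = q m n (\<lambda>X. \<Sum>k\<leftarrow>ks. h k X) \<and> (\<lambda>X. \<Sum>k\<leftarrow>ks. h k X) \<in> V m n"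
    if "\<forall>k\<in>set ks. h k \<in> V m n" for ks
    using that by (induction ks) (auto simp: sum_mor_def Q_add V_add)
  from this[of "[0..<l]"] show ?thesis using assms
    by (simp add: interv_sum_list_conv_sum_set_nat atLeast0LessThan)
qed

section \<open>Matrix calculus of the additive completion\<close>

section \<open>Matrices over the quotient\<close>

abbreviation K where "K \<equiv> additive_completion Q"

text \<open>Matrices are described by representatives of their entries, so that identities between
  them reduce to identities of coefficients.\<close>

definition mat :: "nat list => nat list => (nat => nat => coeffs) => (nat, tl_mor set) mat_mor" where
  "mat xs ys a = mk_mat xs ys (\<lambda>i j. q (xs ! j) (ys ! i) (a i j))"

definition VM :: "nat list => nat list => (nat => nat => coeffs) => bool" where
  "VM xs ys a \<longleftrightarrow> (\<forall>i<length ys. \<forall>j<length xs. a i j \<in> V (xs ! j) (ys ! i))"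

abbreviation tl where "tl \<equiv> tens_list ((+) :: nat => nat => nat)"

lemma VM_D: "VM xs ys a ==> i < length ys ==> j < length xs ==> a i j \<in> V (xs ! j) (ys ! i)"
  by (simp add: VM_def)

lemma VM_I: "(\<And>i j. i < length ys ==> j < length xs ==> a i j \<in> V (xs ! j) (ys ! i)) ==> VM xs ys a"
  by (simp add: VM_def)

lemma mk_mat_cong:
  "(\<And>i j. i < length ys ==> j < length xs ==> A i j = A' i j) ==> mk_mat xs ys A = mk_mat xs ys A'"
  by (auto simp: mk_mat_def restrict_def fun_eq_iff)

lemma mat_cong:
  "(\<And>i j. i < length ys ==> j < length xs ==> a i j = a' i j) ==> mat xs ys a = mat xs ys a'"
  unfolding mat_def by (rule mk_mat_cong) simp

lemma mat_eqvI:
  assumes "VM xs ys a" "VM xs ys a'" "\<And>i j. i < length ys ==> j < length xs ==> eqv (xs ! j) (ys ! i) (a i j) (a' i j)"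
  shows "mat xs ys a = mat xs ys a'"
  unfolding mat_def by (rule mk_mat_cong) (use assms in "simp add: q_eqI VM_D")

lemma Ob_K [simp]: "Ob K = UNIV" by (simp add: additive_completion_def)

lemma Hom_K: "Hom K xs ys = {mat xs ys a | a. VM xs ys a}"
proof (intro set_eqI iffI)
  fix x assume "x \<in> Hom K xs ys"
  then obtain A where x: "x = (xs, ys, A)"
    and A: "A \<in> (\<Pi>\<^sub>E (i, j)\<in>{..<length ys} \<times> {..<length xs}. Hom Q (xs ! j) (ys ! i))"
    by (auto simp: additive_completion_def)
  have "\<exists>f. i < length ys \<longrightarrow> j < length xs \<longrightarrow> f \<in> V (xs ! j) (ys ! i) \<and> A (i, j) = q (xs ! j) (ys ! i) f" for i j
    using PiE_mem[OF A, of "(i, j)"] by (auto simp: Hom_Q)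
  then obtain a where a: "\<And>i j. i < length ys ==> j < length xs ==> a i j \<in> V (xs ! j) (ys ! i) \<and> A (i, j) = q (xs ! j) (ys ! i) (a i j)"
    by metis
  have "A = (\<lambda>(i, j)\<in>{..<length ys} \<times> {..<length xs}. q (xs ! j) (ys ! i) (a i j))"
  proof
    fix p :: "nat \<times> nat"
    show "A p = (\<lambda>(i, j)\<in>{..<length ys} \<times> {..<length xs}. q (xs ! j) (ys ! i) (a i j)) p"
    proof (cases "p \<in> {..<length ys} \<times> {..<length xs}")
      case True
      then show ?thesis using a by auto
    next
      case False
      then show ?thesis using PiE_arb[OF A False] by auto
    qed
  qed
  then have "x = mat xs ys a" unfolding x mat_def mk_mat_def by simp
  moreover have "VM xs ys a" using a by (simp add: VM_def)
  ultimately show "x \<in> {mat xs ys a | a. VM xs ys a}" by blast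
next
  fix x assume "x \<in> {mat xs ys a | a. VM xs ys a}"
  then obtain a where "x = mat xs ys a" "VM xs ys a" by blast
  then show "x \<in> Hom K xs ys"
    by (auto simp: additive_completion_def mat_def mk_mat_def Hom_Q VM_def restrict_PiE_iff)
qed

lemma mat_Hom: "VM xs ys a ==> mat xs ys a \<in> Hom K xs ys" using Hom_K by blast

lemma K_cmp:
  assumes a: "VM xs ys a" and b: "VM ys zs b"
  shows "cmp K (mat ys zs b) (mat xs ys a) =
    mat xs zs (\<lambda>i j X. \<Sum>k<length ys. tcmp \<beta> (xs ! j) (ys ! k) (zs ! i) (b i k) (a k j) X)"
proof -
  have "cmp K (mat ys zs b) (mat xs ys a) = mk_mat xs zs (\<lambda>i j. sum_mor Q (xs ! j) (zs ! i)
      (map (\<lambda>k. cmp Q ((\<lambda>(i, j)\<in>{..<length zs} \<times> {..<length ys}. q (ys ! j) (zs ! i) (b i j)) (i, k))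
        ((\<lambda>(i, j)\<in>{..<length ys} \<times> {..<length xs}. q (xs ! j) (ys ! i) (a i j)) (k, j))) [0..<length ys]))"
    by (simp add: additive_completion_def mat_def mk_mat_def)
  also have "... = mat xs zs (\<lambda>i j X. \<Sum>k<length ys. tcmp \<beta> (xs ! j) (ys ! k) (zs ! i) (b i k) (a k j) X)"
    unfolding mat_def
  proof (rule mk_mat_cong)
    fix i j assume ij: "i < length zs" "j < length xs"
    have "map (\<lambda>k. cmp Q ((\<lambda>(i, j)\<in>{..<length zs} \<times> {..<length ys}. q (ys ! j) (zs ! i) (b i j)) (i, k))
        ((\<lambda>(i, j)\<in>{..<length ys} \<times> {..<length xs}. q (xs ! j) (ys ! i) (a i j)) (k, j))) [0..<length ys] =
      map (\<lambda>k. q (xs ! j) (zs ! i) (tcmp \<beta> (xs ! j) (ys ! k) (zs ! i) (b i k) (a k j))) [0..<length ys]"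
      using ij a b by (intro map_cong refl) (simp add: Q_cmp VM_D)
    then show "sum_mor Q (xs ! j) (zs ! i)
      (map (\<lambda>k. cmp Q ((\<lambda>(i, j)\<in>{..<length zs} \<times> {..<length ys}. q (ys ! j) (zs ! i) (b i j)) (i, k))
        ((\<lambda>(i, j)\<in>{..<length ys} \<times> {..<length xs}. q (xs ! j) (ys ! i) (a i j)) (k, j))) [0..<length ys]) =
      q (xs ! j) (zs ! i) (\<lambda>X. \<Sum>k<length ys. tcmp \<beta> (xs ! j) (ys ! k) (zs ! i) (b i k) (a k j) X)"
      by (simp only: Q_sum tcmp_V)
  qed
  finally show ?thesis .
qed

lemma K_cmp_VM: "VM xs zs (\<lambda>i j X. \<Sum>k<length ys. tcmp \<beta> (xs ! j) (ys ! k) (zs ! i) (b i k) (a k j) X)"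
  by (intro VM_I V_sum) simp

lemma K_cmp_Hom: "f \<in> Hom K xs ys ==> g \<in> Hom K ys zs ==> cmp K g f \<in> Hom K xs zs"
  unfolding Hom_K using K_cmp K_cmp_VM by blast

lemma length_tl [simp]: "length (tl xs ys) = length xs * length ys"
  by (induction xs) (simp_all add: tens_list_def)

lemma nth_tl: "k < length xs * length ys ==> tl xs ys ! k = xs ! (k div length ys) + ys ! (k mod length ys)"
proof (induction xs arbitrary: k)
  case (Cons x xs)
  show ?case
  proof (cases "k < length ys")
    case True
    then show ?thesis by (simp add: tens_list_def nth_append)
  next
    case False
    then have l: "length ys > 0" "k \<ge> length ys" using Cons.prems by (auto intro: ccontr)
    have "tl (x # xs) ys ! k = tl xs ys ! (k - length ys)" using False by (simp add: tens_list_def nth_append)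
    also have "... = xs ! ((k - length ys) div length ys) + ys ! ((k - length ys) mod length ys)"
      using Cons.prems l by (intro Cons.IH) simp
    finally show ?thesis using l by (simp add: le_div_geq le_mod_geq)
  qed
qed simp

lemma tl_unit [simp]: "tl [0] xs = xs" "tl xs [0] = xs" by (induction xs) (simp_all add: tens_list_def)

lemma tl_assoc: "tl (tl xs ys) zs = tl xs (tl ys zs)"
proof -
  have 1: "tl (map ((+) x) ys) zs = map ((+) x) (tl ys zs)" for x ys
    by (induction ys) (simp_all add: tens_list_def comp_def add.assoc)
  have 2: "tl (us @ vs) zs = tl us zs @ tl vs zs" for us vs by (simp add: tens_list_def)
  have 3: "tl (x # us) vs = map ((+) x) vs @ tl us vs" for x us vs by (simp add: tens_list_def)
  have 4: "tl [] vs = []" for vs by (simp add: tens_list_def)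
  show ?thesis by (induction xs) (simp_all add: 1 2 3 4)
qed

lemma div_mod_bound: "k < m * n ==> k div n < m \<and> k mod n < (n :: nat)"
  by (metis less_mult_imp_div_less mod_less_divisor mult_0_right not_gr_zero not_less_zero)

abbreviation "tmat xs ys xs' ys' a b \<equiv> (\<lambda>i j. ttens (xs ! (j div length xs')) (ys ! (i div length ys'))
  (xs' ! (j mod length xs')) (ys' ! (i mod length ys')) (a (i div length ys') (j div length xs'))
  (b (i mod length ys') (j mod length xs')))"

lemma K_tens:
  assumes a: "VM xs ys a" and b: "VM xs' ys' b"
  shows "tens_mor K (mat xs ys a) (mat xs' ys' b) = mat (tl xs xs') (tl ys ys') (tmat xs ys xs' ys' a b)"
proof -
  have "tens_mor K (mat xs ys a) (mat xs' ys' b) = mk_mat (tl xs xs') (tl ys ys') (\<lambda>i j.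
      tens_mor Q ((\<lambda>(i, j)\<in>{..<length ys} \<times> {..<length xs}. q (xs ! j) (ys ! i) (a i j)) (i div length ys', j div length xs'))
        ((\<lambda>(i, j)\<in>{..<length ys'} \<times> {..<length xs'}. q (xs' ! j) (ys' ! i) (b i j)) (i mod length ys', j mod length xs')))"
    by (simp add: additive_completion_def mat_def mk_mat_def)
  also have "... = mat (tl xs xs') (tl ys ys') (tmat xs ys xs' ys' a b)" unfolding mat_def
  proof (rule mk_mat_cong)
    fix i j assume "i < length (tl ys ys')" "j < length (tl xs xs')"
    then have i: "i < length ys * length ys'" "i div length ys' < length ys" "i mod length ys' < length ys'"
      and j: "j < length xs * length xs'" "j div length xs' < length xs" "j mod length xs' < length xs'"
      using div_mod_bound by auto
    show "tens_mor Q ((\<lambda>(i, j)\<in>{..<length ys} \<times> {..<length xs}. q (xs ! j) (ys ! i) (a i j)) (i div length ys', j div length xs'))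
        ((\<lambda>(i, j)\<in>{..<length ys'} \<times> {..<length xs'}. q (xs' ! j) (ys' ! i) (b i j)) (i mod length ys', j mod length xs')) =
      q (tl xs xs' ! j) (tl ys ys' ! i) (tmat xs ys xs' ys' a b i j)"
      using i j VM_D[OF a i(2) j(2)] VM_D[OF b i(3) j(3)] by (simp add: Q_tens nth_tl)
  qed
  finally show ?thesis .
qed

lemma K_tens_VM:
  assumes "VM xs ys a" "VM xs' ys' b"
  shows "VM (tl xs xs') (tl ys ys') (tmat xs ys xs' ys' a b)"
  by (rule VM_I) (simp add: nth_tl)

lemma K_tens_Hom: "f \<in> Hom K xs ys ==> g \<in> Hom K xs' ys' ==> tens_mor K f g \<in> Hom K (tl xs xs') (tl ys ys')"
  unfolding Hom_K using K_tens K_tens_VM by blast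

definition idmat where "idmat xs i j = (if i = j then idc (xs ! i) else z0)"

lemma idmat_VM: "VM xs xs (idmat xs)" by (rule VM_I) (simp add: idmat_def)

lemma K_id: "idm K xs = mat xs xs (idmat xs)"
  unfolding mat_def additive_completion_def by (simp add: idmat_def) (rule mk_mat_cong, simp)

lemma K_zero: "zero_mor K xs ys = mat xs ys (\<lambda>_ _. z0)" by (simp add: additive_completion_def mat_def)

lemma K_add:
  assumes "VM xs ys a" "VM xs ys b"
  shows "add_mor K (mat xs ys a) (mat xs ys b) = mat xs ys (\<lambda>i j X. a i j X + b i j X)"
  using assms unfolding mat_def additive_completion_def mk_mat_def
  by (auto simp: fun_eq_iff restrict_def Q_add VM_D)

lemma K_scale:
  assumes "VM xs ys a"
  shows "scale_mor K c (mat xs ys a) = mat xs ys (\<lambda>i j X. c * a i j X)"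
  using assms unfolding mat_def additive_completion_def mk_mat_def
  by (auto simp: fun_eq_iff restrict_def Q_scale VM_D)

lemma tcmp_zero [simp]: "tcmp \<beta> m n p z0 f = z0" "tcmp \<beta> m n p g z0 = z0"
  using linop_zero[OF linop_tcmp_left] linop_zero[OF linop_tcmp_right] by auto

lemma ttens_zero [simp]: "ttens m n m' n' z0 f = z0" "ttens m n m' n' g z0 = z0"
  using linop_zero[OF linop_ttens_left] linop_zero[OF linop_ttens_right] by auto

lemma K_id_left: "f \<in> Hom K xs ys ==> cmp K (idm K ys) f = f"
proof -
  assume "f \<in> Hom K xs ys"
  then obtain a where a: "f = mat xs ys a" "VM xs ys a" by (auto simp: Hom_K)
  have "(\<Sum>k<length ys. tcmp \<beta> (xs ! j) (ys ! k) (ys ! i) (idmat ys i k) (a k j) X) = a i j X"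
    if "i < length ys" "j < length xs" for i j X
  proof -
    have "(\<Sum>k<length ys. tcmp \<beta> (xs ! j) (ys ! k) (ys ! i) (idmat ys i k) (a k j) X) =
      (\<Sum>k<length ys. if k = i then a i j X else 0)"
      using that a(2) by (intro sum.cong refl) (simp add: idmat_def tcmp_id_left VM_D)
    then show ?thesis using that by simp
  qed
  then show ?thesis unfolding a(1) K_id K_cmp[OF a(2) idmat_VM] by (intro mat_cong ext)
qed

lemma K_id_right: "f \<in> Hom K xs ys ==> cmp K f (idm K xs) = f"
proof -
  assume "f \<in> Hom K xs ys"
  then obtain a where a: "f = mat xs ys a" "VM xs ys a" by (auto simp: Hom_K)
  have "(\<Sum>k<length xs. tcmp \<beta> (xs ! j) (xs ! k) (ys ! i) (a i k) (idmat xs k j) X) = a i j X"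
    if "i < length ys" "j < length xs" for i j X
  proof -
    have "(\<Sum>k<length xs. tcmp \<beta> (xs ! j) (xs ! k) (ys ! i) (a i k) (idmat xs k j) X) =
      (\<Sum>k<length xs. if k = j then a i j X else 0)"
      using that a(2) by (intro sum.cong refl) (simp add: idmat_def tcmp_id_right VM_D)
    then show ?thesis using that by simp
  qed
  then show ?thesis unfolding a(1) K_id K_cmp[OF idmat_VM a(2)] by (intro mat_cong ext)
qed

lemma K_id_Hom: "idm K xs \<in> Hom K xs xs" unfolding K_id by (rule mat_Hom[OF idmat_VM])

lemma K_id_tens: "tens_mor K (idm K xs) (idm K ys) = idm K (tl xs ys)"
  unfolding K_id K_tens[OF idmat_VM idmat_VM]
proof (rule mat_cong)
  fix i j assume "i < length (tl xs ys)" "j < length (tl xs ys)"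
  then have i: "i < length xs * length ys" and j: "j < length xs * length ys" by auto
  have "i = j \<longleftrightarrow> i div length ys = j div length ys \<and> i mod length ys = j mod length ys"
    by (metis div_mult_mod_eq)
  then show "tmat xs xs ys ys (idmat xs) (idmat ys) i j = idmat (tl xs ys) i j"
    using i j by (auto simp: idmat_def ttens_id nth_tl)
qed

text \<open>The lexicographic numbering of the summands of a tensor product turns one sum over
  indices into a double sum.\<close>

lemma sum_div_mod: "(\<Sum>k<m * n. F (k div n) (k mod n)) = (\<Sum>a<m. \<Sum>b<n. F a b)" for F :: "nat => nat => complex"
proof (cases "n = 0")
  case False
  have b: "a * n + b < m * n" if "a < m" "b < n" for a b
  proof -
    have "a * n + b < Suc a * n" using that by simp
    also have "... \<le> m * n" using that by (intro mult_le_mono1) simp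
    finally show ?thesis .
  qed
  have "(\<Sum>a<m. \<Sum>b<n. F a b) = (\<Sum>(a, b)\<in>{..<m} \<times> {..<n}. F a b)" by (simp add: sum.cartesian_product)
  also have "... = (\<Sum>k<m * n. F (k div n) (k mod n))"
    by (rule sum.reindex_bij_witness[of _ "\<lambda>k. (k div n, k mod n)" "\<lambda>(a, b). a * n + b"])
      (use False b in "auto simp: div_mod_bound")
  finally show ?thesis by simp
qed simp

end

section \<open>A strong monoidal functor into endofunctors as families of morphisms of the
  base\<close>

section \<open>Monoidal functors to endofunctors, componentwise\<close>

context lincat
begin

text \<open>Composites are kept in right-nested form, where \<open>a ** b\<close> is no subterm of
  \<open>a ** b ** r\<close>. Applied to an equation, this lemma gives the version that matches
  there.\<close>

lemma rw: "a ** b = c ==> arr a ==> arr b ==> arr r ==> src a = tgt b ==> src b = tgt r ==> a ** b ** r = c ** r"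
  by (metis assoc)

lemma Arr_iff: "f \<in> Arr B \<longleftrightarrow> arr f" unfolding Arr_def arr_def by blast

lemma nat_transformationD:
  assumes "nat_transformation B F G s"
  shows "Z \<in> Ob B ==> s Z \<in> Hom B (fst F Z) (fst G Z)"
    and "arr f ==> s (tgt f) ** snd F f = snd G f ** s (src f)"
    and "s \<in> extensional (Ob B)"
  using assms arrD unfolding nat_transformation_def by (auto simp: PiE_iff)

lemma Hom_End: "x \<in> Hom (End_cat B) F G \<longleftrightarrow> x = (F, G, snd (snd x)) \<and> nat_transformation B F G (snd (snd x))"
  by (auto simp: End_cat_def)

lemma End_simps [simp]:
  "cmp (End_cat B) (G', H, t) (F, G, s) = (F, H, \<lambda>X\<in>Ob B. t X ** s X)"
  "idm (End_cat B) F = (F, F, \<lambda>X\<in>Ob B. i1 (fst F X))"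
  "tens_ob (End_cat B) = endo_cmp B"
  "tens_mor (End_cat B) (F, G, s) (F', G', s') = (endo_cmp B F F', endo_cmp B G G', \<lambda>X\<in>Ob B. s (fst G' X) ** snd F (s' X))"
  "unit_ob (End_cat B) = endo_id B"
  "add_mor (End_cat B) (F, G, s) (F', G', s') = (F, G, \<lambda>X\<in>Ob B. ad (s X) (s' X))"
  "scale_mor (End_cat B) c (F, G, s) = (F, G, \<lambda>X\<in>Ob B. sc c (s X))"
  "Ob (End_cat B) = {F. endofunctor B F}"
  by (simp_all add: End_cat_def)

lemma endo_simps [simp]:
  "Z \<in> Ob B ==> fst (endo_cmp B F G) Z = fst F (fst G Z)"
  "arr f ==> snd (endo_cmp B F G) f = snd F (snd G f)"
  "Z \<in> Ob B ==> fst (endo_id B) Z = Z"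
  "arr f ==> snd (endo_id B) f = f"
  by (simp_all add: endo_cmp_def endo_id_def Arr_iff)

text \<open>\<open>inv_mor\<close> is a definite description; it denotes an inverse once uniqueness
  is known, which is checked on components.\<close>

lemma inv_mor_pair:
  assumes iso: "iso_mor (End_cat B) F G f" and F: "\<And>Z. Z \<in> Ob B ==> fst F Z \<in> Ob B" and G: "\<And>Z. Z \<in> Ob B ==> fst G Z \<in> Ob B"
  shows "inverse_pair (End_cat B) F G f (inv_mor (End_cat B) F G f)"
proof -
  obtain g where g: "inverse_pair (End_cat B) F G f g" using iso by (auto simp: iso_mor_def)
  have "g' = g" if g': "inverse_pair (End_cat B) F G f g'" for g'
  proof -
    obtain s where s: "f = (F, G, s)" "nat_transformation B F G s"
      using g by (auto simp: inverse_pair_def Hom_End)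
    obtain t where t: "g = (G, F, t)" "nat_transformation B G F t"
      using g by (auto simp: inverse_pair_def Hom_End)
    obtain t' where t': "g' = (G, F, t')" "nat_transformation B G F t'"
      using g' by (auto simp: inverse_pair_def Hom_End)
    have "t' Z = t Z" if Z: "Z \<in> Ob B" for Z
    proof -
      note S = HomD[OF nat_transformationD(1)[OF s(2) Z] F[OF Z] G[OF Z]]
      note T = HomD[OF nat_transformationD(1)[OF t(2) Z] G[OF Z] F[OF Z]]
      note T' = HomD[OF nat_transformationD(1)[OF t'(2) Z] G[OF Z] F[OF Z]]
      have 1: "(\<lambda>X\<in>Ob B. s X ** t X) Z = (\<lambda>X\<in>Ob B. i1 (fst G X)) Z"
        using g by (simp add: inverse_pair_def s t)
      have 2: "(\<lambda>X\<in>Ob B. t' X ** s X) Z = (\<lambda>X\<in>Ob B. i1 (fst F X)) Z"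
        using g' by (simp add: inverse_pair_def s t')
      have "t' Z = t' Z ** s Z ** t Z" using 1 Z T' G by simp
      also have "... = (t' Z ** s Z) ** t Z" using S T T' by simp
      also have "... = t Z" using 2 Z T F by simp
      finally show ?thesis .
    qed
    then have "t' = t" using nat_transformationD(3)[OF t(2)] nat_transformationD(3)[OF t'(2)]
      by (intro extensionalityI) auto
    then show ?thesis by (simp add: t t')
  qed
  then show ?thesis unfolding inv_mor_def using g by (metis theI)
qed

lemma inverse_pairD:
  assumes "inverse_pair (End_cat B) F G f g"
  shows "f \<in> Hom (End_cat B) F G" "g \<in> Hom (End_cat B) G F"
    "Z \<in> Ob B ==> snd (snd g) Z ** snd (snd f) Z = i1 (fst F Z)"
    "Z \<in> Ob B ==> snd (snd f) Z ** snd (snd g) Z = i1 (fst G Z)"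
proof -
  show f: "f \<in> Hom (End_cat B) F G" and g: "g \<in> Hom (End_cat B) G F"
    using assms by (auto simp: inverse_pair_def)
  obtain s where s: "f = (F, G, s)" using f by (auto simp: Hom_End)
  obtain t where t: "g = (G, F, t)" using g by (auto simp: Hom_End)
  have 1: "(\<lambda>X\<in>Ob B. t X ** s X) = (\<lambda>X\<in>Ob B. i1 (fst F X))" "(\<lambda>X\<in>Ob B. s X ** t X) = (\<lambda>X\<in>Ob B. i1 (fst G X))"
    using assms by (simp_all add: inverse_pair_def s t)
  show "snd (snd g) Z ** snd (snd f) Z = i1 (fst F Z)" if "Z \<in> Ob B"
    using fun_cong[OF 1(1), of Z] that by (simp add: s t)
  show "snd (snd f) Z ** snd (snd g) Z = i1 (fst G Z)" if "Z \<in> Ob B"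
    using fun_cong[OF 1(2), of Z] that by (simp add: s t)
qed

end

text \<open>\<open>S\<close> is a set of objects on which the tensor product is strictly associative
  and unital. For the fusion category these will be the objects whose idempotent is an identity;
  every object is a retract of one of them.\<close>

locale module_functor = sscat B for B :: "('o, 'm) lin_cat" +
  fixes C :: "('x, 'x \<times> 'x \<times> 'k, 'z) mon_cat_scheme" (structure)
    and M :: "('x, 'x \<times> 'x \<times> 'k, ('o, 'm) endo, ('o, 'm) nat_trans) mon_functor"
    and S :: "'x set"
  assumes mf: "monoidal_functor C (End_cat B) M"
    and tens_Ob [simp]: "X \<in> Ob C ==> Y \<in> Ob C ==> X \<odot> Y \<in> Ob C"
    and S_Ob [simp]: "X \<in> S ==> X \<in> Ob C"
    and unit_S [simp]: "unit_ob C \<in> S"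
    and tens_S [simp]: "X \<in> S ==> Y \<in> S ==> X \<odot> Y \<in> S"
    and tens_assoc [simp]: "X \<in> S ==> Y \<in> S ==> W \<in> S ==> (X \<odot> Y) \<odot> W = X \<odot> Y \<odot> W"
    and tens_unit [simp]: "X \<in> S ==> unit_ob C \<odot> X = X" "X \<in> S ==> X \<odot> unit_ob C = X"
    and C_id: "X \<in> Ob C ==> idm C X \<in> Hom C X X"
    and C_tens: "X \<in> Ob C ==> Y \<in> Ob C ==> X' \<in> Ob C ==> Y' \<in> Ob C ==> f \<in> Hom C X Y ==> g \<in> Hom C X' Y' ==>
      f \<otimes> g \<in> Hom C (X \<odot> X') (Y \<odot> Y')"
    and Hom_fst: "f \<in> Hom C X Y ==> fst f = X \<and> fst (snd f) = Y"
begin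

text \<open>The data of \<open>M\<close> in terms of \<open>B\<close>: \<open>A\<close> and
  \<open>Am\<close> are the action of an object on objects and arrows, \<open>mm\<close> gives the
  components of the image of a morphism, \<open>mu\<close> and \<open>un\<close> those of the
  structure isomorphisms, \<open>mui\<close> and \<open>uni\<close> those of their inverses.\<close>

definition A where "A X = fst (on_ob M X)"
definition Am where "Am X = snd (on_ob M X)"
definition mm where "mm f = snd (snd (on_mor M f))"
definition mu where "mu X Y = snd (snd (mult_iso M X Y))"
definition mui where "mui X Y = snd (snd (inv_mor (End_cat B) (endo_cmp B (on_ob M X) (on_ob M Y)) (on_ob M (X \<odot> Y)) (mult_iso M X Y)))"
definition un where "un = snd (snd (unit_iso M))"
definition uni where "uni = snd (snd (inv_mor (End_cat B) (endo_id B) (on_ob M (unit_ob C)) (unit_iso M)))"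

abbreviation "U \<equiv> unit_ob C"

lemmas mf0 = mf[unfolded monoidal_functor_def]
lemmas mf_ob = mf0[THEN conjunct1] and mf1 = mf0[THEN conjunct2]
lemmas mf_Hom = mf1[THEN conjunct1, rule_format] and mf2 = mf1[THEN conjunct2]
lemmas mf_id = mf2[THEN conjunct1, rule_format] and mf3 = mf2[THEN conjunct2]
lemmas mf_cmp = mf3[THEN conjunct1, rule_format] and mf4 = mf3[THEN conjunct2]
lemmas mf_ad = mf4[THEN conjunct1, rule_format] and mf5 = mf4[THEN conjunct2]
lemmas mf_sc = mf5[THEN conjunct1, rule_format] and mf6 = mf5[THEN conjunct2]
lemmas mf_mult = mf6[THEN conjunct1, rule_format] and mf7 = mf6[THEN conjunct2]
lemmas mf_unit = mf7[THEN conjunct1] and mf8 = mf7[THEN conjunct2]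
lemmas mf_tens = mf8[THEN conjunct1, rule_format] and mf9 = mf8[THEN conjunct2]
lemmas mf_assoc = mf9[THEN conjunct1, rule_format] and mf10 = mf9[THEN conjunct2]
lemmas mf_units = mf10[rule_format]

lemma on_ob: "X \<in> Ob C ==> endofunctor B (on_ob M X)" using mf_ob by (auto simp: Pi_iff)

lemma A_Ob [simp]: "X \<in> Ob C ==> Z \<in> Ob B ==> A X Z \<in> Ob B"
  using on_ob unfolding endofunctor_def A_def by (metis PiE_mem)

lemma Am_Hom: "X \<in> Ob C ==> arr f ==> Am X f \<in> Hom B (A X (src f)) (A X (tgt f))"
  using on_ob arrD unfolding endofunctor_def A_def Am_def by metis

lemma Am_arr [simp]:
  assumes "X \<in> Ob C" "arr f"
  shows "arr (Am X f)" "src (Am X f) = A X (src f)" "tgt (Am X f) = A X (tgt f)"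
  using HomD[OF Am_Hom[OF assms]] arrD assms by auto

lemma Am_id [simp]: "X \<in> Ob C ==> Z \<in> Ob B ==> Am X (i1 Z) = i1 (A X Z)"
  using on_ob unfolding endofunctor_def A_def Am_def by metis

lemma Am_comp [simp]: "X \<in> Ob C ==> arr f ==> arr g ==> src g = tgt f ==> Am X (g ** f) = Am X g ** Am X f"
  using on_ob arrD unfolding endofunctor_def Am_def by metis

lemma Am_ad [simp]: "X \<in> Ob C ==> arr f ==> arr g ==> src f = src g ==> tgt f = tgt g ==> Am X (ad f g) = ad (Am X f) (Am X g)"
  using on_ob arrD unfolding endofunctor_def Am_def by metis

lemma Am_sc [simp]: "X \<in> Ob C ==> arr f ==> Am X (sc c f) = sc c (Am X f)"
  using on_ob arrD unfolding endofunctor_def Am_def by metis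

lemma endo_data: "X \<in> Ob C ==> endo_data B (A X) (Am X)" by unfold_locales auto

lemma Am_zr [simp]: "X \<in> Ob C ==> Y \<in> Ob B ==> Z \<in> Ob B ==> Am X (zr Y Z) = zr (A X Y) (A X Z)"
  using endo_data.Fm_zr[OF endo_data] .

lemma on_mor:
  assumes "X \<in> Ob C" "Y \<in> Ob C" "f \<in> Hom C X Y"
  shows "on_mor M f = (on_ob M X, on_ob M Y, mm f)" "nat_transformation B (on_ob M X) (on_ob M Y) (mm f)"
proof -
  have "on_mor M f \<in> Hom (End_cat B) (on_ob M X) (on_ob M Y)" using mf_Hom assms by simp
  then show "on_mor M f = (on_ob M X, on_ob M Y, mm f)" "nat_transformation B (on_ob M X) (on_ob M Y) (mm f)"
    unfolding Hom_End mm_def by auto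
qed

definition ca where "ca f \<longleftrightarrow> fst f \<in> Ob C \<and> fst (snd f) \<in> Ob C \<and> f \<in> Hom C (fst f) (fst (snd f))"

lemma on_mor_eq: "ca f ==> on_mor M f = (on_ob M (fst f), on_ob M (fst (snd f)), mm f)"
  using on_mor(1) unfolding ca_def by blast

lemma caI: "X \<in> Ob C ==> Y \<in> Ob C ==> f \<in> Hom C X Y ==> ca f" using Hom_fst unfolding ca_def by fastforce

lemma ca_Ob [simp]: "ca f ==> fst f \<in> Ob C" "ca f ==> fst (snd f) \<in> Ob C" by (auto simp: ca_def)

lemma ca_id [simp]: "X \<in> Ob C ==> ca (idm C X)" "X \<in> Ob C ==> fst (idm C X) = X" "X \<in> Ob C ==> fst (snd (idm C X)) = X"
  using C_id Hom_fst caI by (blast+)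

lemma ca_tens [simp]:
  assumes "ca f" "ca g"
  shows "ca (f \<otimes> g)" "fst (f \<otimes> g) = fst f \<odot> fst g" "fst (snd (f \<otimes> g)) = fst (snd f) \<odot> fst (snd g)"
proof -
  have 1: "f \<otimes> g \<in> Hom C (fst f \<odot> fst g) (fst (snd f) \<odot> fst (snd g))"
    using assms C_tens unfolding ca_def by blast
  show "ca (f \<otimes> g)" by (rule caI[OF _ _ 1]) (use assms in auto)
  show "fst (f \<otimes> g) = fst f \<odot> fst g" "fst (snd (f \<otimes> g)) = fst (snd f) \<odot> fst (snd g)"
    using Hom_fst[OF 1] by auto
qed

lemma mm_arr [simp]:
  assumes "ca f" "Z \<in> Ob B"
  shows "arr (mm f Z)" "src (mm f Z) = A (fst f) Z" "tgt (mm f Z) = A (fst (snd f)) Z"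
proof -
  have "mm f Z \<in> Hom B (A (fst f) Z) (A (fst (snd f)) Z)"
    using on_mor(2)[of "fst f" "fst (snd f)" f] assms nat_transformationD(1) unfolding ca_def A_def by blast
  then show "arr (mm f Z)" "src (mm f Z) = A (fst f) Z" "tgt (mm f Z) = A (fst (snd f)) Z"
    using HomD assms by auto
qed

lemma mm_nat: "ca f ==> arr h ==> mm f (tgt h) ** Am (fst f) h = Am (fst (snd f)) h ** mm f (src h)"
  using on_mor(2)[of "fst f" "fst (snd f)" f] nat_transformationD(2) unfolding ca_def Am_def by blast

lemma mm_id [simp]: "X \<in> Ob C ==> Z \<in> Ob B ==> mm (idm C X) Z = i1 (A X Z)"
proof -
  assume "X \<in> Ob C" "Z \<in> Ob B"
  moreover have "on_mor M (idm C X) = idm (End_cat B) (on_ob M X)" using mf_id \<open>X \<in> Ob C\<close> by simp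
  ultimately show ?thesis unfolding mm_def by (simp add: A_def)
qed

lemma mm_cmp:
  assumes "ca f" "ca g" "fst g = fst (snd f)" "Z \<in> Ob B"
  shows "mm (g \<cdot> f) Z = mm g Z ** mm f Z"
proof -
  have "on_mor M (g \<cdot> f) = on_mor M g \<cdot>\<^bsub>End_cat B\<^esub> on_mor M f"
    using mf_cmp[of "fst f" "fst (snd f)" "fst (snd g)" f g] assms unfolding ca_def by simp
  then show ?thesis using on_mor(1)[of "fst f" "fst (snd f)" f] on_mor(1)[of "fst g" "fst (snd g)" g] assms
    unfolding ca_def mm_def[of "g \<cdot> f"] by simp
qed

lemma mm_ad:
  assumes "ca f" "ca g" "fst g = fst f" "fst (snd g) = fst (snd f)" "Z \<in> Ob B"
  shows "mm (add_mor C f g) Z = ad (mm f Z) (mm g Z)"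
proof -
  have "on_mor M (add_mor C f g) = add_mor (End_cat B) (on_mor M f) (on_mor M g)"
    using mf_ad[of "fst f" "fst (snd f)" f g] assms unfolding ca_def by simp
  then show ?thesis using on_mor(1)[of "fst f" "fst (snd f)" f] on_mor(1)[of "fst g" "fst (snd g)" g] assms
    unfolding ca_def mm_def[of "add_mor C f g"] by simp
qed

lemma mm_sc:
  assumes "ca f" "Z \<in> Ob B"
  shows "mm (scale_mor C c f) Z = sc c (mm f Z)"
proof -
  have "on_mor M (scale_mor C c f) = scale_mor (End_cat B) c (on_mor M f)"
    using mf_sc[of "fst f" "fst (snd f)" f c] assms unfolding ca_def by simp
  then show ?thesis using on_mor(1)[of "fst f" "fst (snd f)" f] assms
    unfolding ca_def mm_def[of "scale_mor C c f"] by simp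
qed

lemma mult_pair:
  assumes "X \<in> Ob C" "Y \<in> Ob C"
  shows "inverse_pair (End_cat B) (endo_cmp B (on_ob M X) (on_ob M Y)) (on_ob M (X \<odot> Y)) (mult_iso M X Y)
    (inv_mor (End_cat B) (endo_cmp B (on_ob M X) (on_ob M Y)) (on_ob M (X \<odot> Y)) (mult_iso M X Y))"
proof (rule inv_mor_pair)
  show "iso_mor (End_cat B) (endo_cmp B (on_ob M X) (on_ob M Y)) (on_ob M (X \<odot> Y)) (mult_iso M X Y)"
    using mf_mult assms by simp
qed (use assms A_Ob in "auto simp: A_def[symmetric]")

lemma unit_pair: "inverse_pair (End_cat B) (endo_id B) (on_ob M U) (unit_iso M)
    (inv_mor (End_cat B) (endo_id B) (on_ob M U) (unit_iso M))"
proof (rule inv_mor_pair)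
  show "iso_mor (End_cat B) (endo_id B) (on_ob M U) (unit_iso M)" using mf_unit by simp
qed (use A_Ob in "auto simp: A_def[symmetric]")

lemma mult_iso_eq: "X \<in> Ob C ==> Y \<in> Ob C ==>
    mult_iso M X Y = (endo_cmp B (on_ob M X) (on_ob M Y), on_ob M (X \<odot> Y), mu X Y)"
  using inverse_pairD(1)[OF mult_pair] unfolding Hom_End mu_def by blast

lemma mult_iso_inv: "X \<in> Ob C ==> Y \<in> Ob C ==>
    inv_mor (End_cat B) (endo_cmp B (on_ob M X) (on_ob M Y)) (on_ob M (X \<odot> Y)) (mult_iso M X Y) =
      (on_ob M (X \<odot> Y), endo_cmp B (on_ob M X) (on_ob M Y), mui X Y)"
  using inverse_pairD(2)[OF mult_pair] unfolding Hom_End mui_def by blast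

lemma unit_iso_eq: "unit_iso M = (endo_id B, on_ob M U, un)"
  using inverse_pairD(1)[OF unit_pair] unfolding Hom_End un_def by blast

lemma unit_iso_inv: "inv_mor (End_cat B) (endo_id B) (on_ob M U) (unit_iso M) = (on_ob M U, endo_id B, uni)"
  using inverse_pairD(2)[OF unit_pair] unfolding Hom_End uni_def by blast

lemma mu_arr [simp]:
  assumes "X \<in> Ob C" "Y \<in> Ob C" "Z \<in> Ob B"
  shows "arr (mu X Y Z)" "src (mu X Y Z) = A X (A Y Z)" "tgt (mu X Y Z) = A (X \<odot> Y) Z"
proof -
  have "mu X Y Z \<in> Hom B (A X (A Y Z)) (A (X \<odot> Y) Z)"
    using inverse_pairD(1)[OF mult_pair[OF assms(1,2)]] nat_transformationD(1)[OF _ assms(3)] assms(3)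
    unfolding Hom_End mu_def A_def by fastforce
  from HomD[OF this] show "arr (mu X Y Z)" "src (mu X Y Z) = A X (A Y Z)" "tgt (mu X Y Z) = A (X \<odot> Y) Z"
    using assms by auto
qed

lemma mui_arr [simp]:
  assumes "X \<in> Ob C" "Y \<in> Ob C" "Z \<in> Ob B"
  shows "arr (mui X Y Z)" "src (mui X Y Z) = A (X \<odot> Y) Z" "tgt (mui X Y Z) = A X (A Y Z)"
proof -
  have "mui X Y Z \<in> Hom B (A (X \<odot> Y) Z) (A X (A Y Z))"
    using inverse_pairD(2)[OF mult_pair[OF assms(1,2)]] nat_transformationD(1)[OF _ assms(3)] assms(3)
    unfolding Hom_End mui_def A_def by fastforce
  from HomD[OF this] show "arr (mui X Y Z)" "src (mui X Y Z) = A (X \<odot> Y) Z" "tgt (mui X Y Z) = A X (A Y Z)"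
    using assms by auto
qed

lemma un_arr [simp]:
  assumes "Z \<in> Ob B"
  shows "arr (un Z)" "src (un Z) = Z" "tgt (un Z) = A U Z"
proof -
  have "un Z \<in> Hom B Z (A U Z)" using inverse_pairD(1)[OF unit_pair] nat_transformationD(1)[OF _ assms] assms
    unfolding Hom_End un_def A_def by fastforce
  from HomD[OF this] show "arr (un Z)" "src (un Z) = Z" "tgt (un Z) = A U Z" using assms by auto
qed

lemma uni_arr [simp]:
  assumes "Z \<in> Ob B"
  shows "arr (uni Z)" "src (uni Z) = A U Z" "tgt (uni Z) = Z"
proof -
  have "uni Z \<in> Hom B (A U Z) Z" using inverse_pairD(2)[OF unit_pair] nat_transformationD(1)[OF _ assms] assms
    unfolding Hom_End uni_def A_def by fastforce
  from HomD[OF this] show "arr (uni Z)" "src (uni Z) = A U Z" "tgt (uni Z) = Z" using assms by auto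
qed

lemma mu_mui [simp]: "X \<in> Ob C ==> Y \<in> Ob C ==> Z \<in> Ob B ==> mu X Y Z ** mui X Y Z = i1 (A (X \<odot> Y) Z)"
  using inverse_pairD(4)[OF mult_pair] unfolding mu_def mui_def A_def by blast

lemma mui_mu [simp]: "X \<in> Ob C ==> Y \<in> Ob C ==> Z \<in> Ob B ==> mui X Y Z ** mu X Y Z = i1 (A X (A Y Z))"
  using inverse_pairD(3)[OF mult_pair] unfolding mu_def mui_def A_def by fastforce

lemma un_uni [simp]: "Z \<in> Ob B ==> un Z ** uni Z = i1 (A U Z)"
  using inverse_pairD(4)[OF unit_pair] unfolding un_def uni_def A_def by blast

lemma uni_un [simp]: "Z \<in> Ob B ==> uni Z ** un Z = i1 Z"
  using inverse_pairD(3)[OF unit_pair] unfolding un_def uni_def A_def by fastforce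

lemma mu_nat: "X \<in> Ob C ==> Y \<in> Ob C ==> arr h ==> mu X Y (tgt h) ** Am X (Am Y h) = Am (X \<odot> Y) h ** mu X Y (src h)"
  using inverse_pairD(1)[OF mult_pair] nat_transformationD(2) unfolding Hom_End mu_def Am_def by fastforce

lemma un_nat: "arr h ==> un (tgt h) ** h = Am U h ** un (src h)"
  using inverse_pairD(1)[OF unit_pair] nat_transformationD(2) unfolding Hom_End un_def Am_def by fastforce

lemma mui_nat:
  assumes "X \<in> Ob C" "Y \<in> Ob C" "arr h"
  shows "mui X Y (tgt h) ** Am (X \<odot> Y) h = Am X (Am Y h) ** mui X Y (src h)"
  using inverse_pairD(2)[OF mult_pair[OF assms(1,2)]] nat_transformationD(2) assms(3) unfolding Hom_End mui_def Am_def by fastforce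

lemma uni_nat: "arr h ==> uni (tgt h) ** Am U h = h ** uni (src h)"
  using inverse_pairD(2)[OF unit_pair] nat_transformationD(2) unfolding Hom_End uni_def Am_def by fastforce

lemma mm_tens:
  assumes "ca f" "ca g" "Z \<in> Ob B"
  shows "mm (f \<otimes> g) Z ** mu (fst f) (fst g) Z =
    mu (fst (snd f)) (fst (snd g)) Z ** mm f (A (fst (snd g)) Z) ** Am (fst f) (mm g Z)"
proof -
  have "mult_iso M (fst (snd f)) (fst (snd g)) \<cdot>\<^bsub>End_cat B\<^esub> (on_mor M f \<otimes>\<^bsub>End_cat B\<^esub> on_mor M g) =
      on_mor M (f \<otimes> g) \<cdot>\<^bsub>End_cat B\<^esub> mult_iso M (fst f) (fst g)"
    using mf_tens[of "fst f" "fst (snd f)" "fst g" "fst (snd g)" f g] assms unfolding ca_def by simp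
  then have "(\<lambda>X\<in>Ob B. mu (fst (snd f)) (fst (snd g)) X ** (\<lambda>X\<in>Ob B. mm f (fst (on_ob M (fst (snd g))) X) ** snd (on_ob M (fst f)) (mm g X)) X) =
     (\<lambda>X\<in>Ob B. mm (f \<otimes> g) X ** mu (fst f) (fst g) X)"
    unfolding on_mor_eq[OF assms(1)] on_mor_eq[OF assms(2)] on_mor_eq[OF ca_tens(1)[OF assms(1,2)]]
      ca_tens(2,3)[OF assms(1,2)] mult_iso_eq[OF ca_Ob(1)[OF assms(1)] ca_Ob(1)[OF assms(2)]]
      mult_iso_eq[OF ca_Ob(2)[OF assms(1)] ca_Ob(2)[OF assms(2)]] by simp
  from fun_cong[OF this, of Z] assms(3) show ?thesis by (simp add: A_def Am_def)
qed

lemma mm_tens_id: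
  assumes "ca f" "W \<in> Ob C" "Z \<in> Ob B"
  shows "mm (f \<otimes> idm C W) Z ** mu (fst f) W Z = mu (fst (snd f)) W Z ** mm f (A W Z)"
  using mm_tens[of f "idm C W" Z] assms by simp

lemma mm_id_tens:
  assumes "ca f" "W \<in> Ob C" "Z \<in> Ob B"
  shows "mm (idm C W \<otimes> f) Z ** mu W (fst f) Z = mu W (fst (snd f)) Z ** Am W (mm f Z)"
  using mm_tens[of "idm C W" f Z] assms by simp

lemma mu_assoc:
  assumes "X \<in> S" "Y \<in> S" "W \<in> S" "Z \<in> Ob B"
  shows "mu (X \<odot> Y) W Z ** mu X Y (A W Z) = mu X (Y \<odot> W) Z ** Am X (mu Y W Z)"
proof -
  have "mult_iso M (X \<odot> Y) W \<cdot>\<^bsub>End_cat B\<^esub> (mult_iso M X Y \<otimes>\<^bsub>End_cat B\<^esub> idm (End_cat B) (on_ob M W)) =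
      mult_iso M X (Y \<odot> W) \<cdot>\<^bsub>End_cat B\<^esub> (idm (End_cat B) (on_ob M X) \<otimes>\<^bsub>End_cat B\<^esub> mult_iso M Y W)"
    using mf_assoc assms by simp
  then have "(\<lambda>V\<in>Ob B. mu (X \<odot> Y) W V ** (\<lambda>V\<in>Ob B. mu X Y (A W V) ** snd (endo_cmp B (on_ob M X) (on_ob M Y)) ((\<lambda>V\<in>Ob B. i1 (A W V)) V)) V) =
     (\<lambda>V\<in>Ob B. mu X (Y \<odot> W) V ** (\<lambda>V\<in>Ob B. (\<lambda>V\<in>Ob B. i1 (A X V)) (A (Y \<odot> W) V) ** Am X (mu Y W V)) V)"
    by (simp add: mult_iso_eq assms A_def Am_def)
  from fun_cong[OF this, of Z] show ?thesis using assms by (simp add: A_def[symmetric] Am_def[symmetric])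
qed

lemma mu_unit_left [simp]:
  assumes "X \<in> S" "Z \<in> Ob B"
  shows "mu U X Z ** un (A X Z) = i1 (A X Z)"
proof -
  have "mult_iso M U X \<cdot>\<^bsub>End_cat B\<^esub> (unit_iso M \<otimes>\<^bsub>End_cat B\<^esub> idm (End_cat B) (on_ob M X)) = idm (End_cat B) (on_ob M X)"
    using mf_units assms by simp
  then have "(\<lambda>V\<in>Ob B. mu U X V ** (\<lambda>V\<in>Ob B. un (A X V) ** snd (endo_id B) ((\<lambda>V\<in>Ob B. i1 (A X V)) V)) V) = (\<lambda>V\<in>Ob B. i1 (A X V))"
    by (simp add: mult_iso_eq unit_iso_eq assms A_def)
  from fun_cong[OF this, of Z] show ?thesis using assms by simp
qed

lemma mu_unit_right [simp]:
  assumes "X \<in> S" "Z \<in> Ob B"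
  shows "mu X U Z ** Am X (un Z) = i1 (A X Z)"
proof -
  have "mult_iso M X U \<cdot>\<^bsub>End_cat B\<^esub> (idm (End_cat B) (on_ob M X) \<otimes>\<^bsub>End_cat B\<^esub> unit_iso M) = idm (End_cat B) (on_ob M X)"
    using mf_units assms by simp
  then have "(\<lambda>V\<in>Ob B. mu X U V ** (\<lambda>V\<in>Ob B. (\<lambda>V\<in>Ob B. i1 (A X V)) (A U V) ** Am X (un V)) V) = (\<lambda>V\<in>Ob B. i1 (A X V))"
    by (simp add: mult_iso_eq unit_iso_eq assms A_def Am_def)
  from fun_cong[OF this, of Z] show ?thesis using assms by simp
qed

section \<open>Images of evaluations and coevaluations, and their naturality\<close>

definition th where "th X Y e Z = uni Z ** mm e Z ** mu X Y Z"
definition et where "et X Y c Z = mui X Y Z ** mm c Z ** un Z"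

lemma th_arr [simp]:
  assumes "X \<in> Ob C" "Y \<in> Ob C" "ca e" "fst e = X \<odot> Y" "fst (snd e) = U" "Z \<in> Ob B"
  shows "arr (th X Y e Z)" "src (th X Y e Z) = A X (A Y Z)" "tgt (th X Y e Z) = Z"
  using assms by (simp_all add: th_def)

lemma et_arr [simp]:
  assumes "X \<in> Ob C" "Y \<in> Ob C" "ca c" "fst c = U" "fst (snd c) = X \<odot> Y" "Z \<in> Ob B"
  shows "arr (et X Y c Z)" "src (et X Y c Z) = Z" "tgt (et X Y c Z) = A X (A Y Z)"
  using assms by (simp_all add: et_def)

lemma th_nat:
  assumes "X \<in> Ob C" "Y \<in> Ob C" "ca e" "fst e = X \<odot> Y" "fst (snd e) = U" "arr h"
  shows "th X Y e (tgt h) ** Am X (Am Y h) = h ** th X Y e (src h)"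
proof -
  note [simp] = assms
  have [simp]: "src h \<in> Ob B" "tgt h \<in> Ob B" using arrD by auto
  show ?thesis using mu_nat[of X Y h] mm_nat[of e h] rw[OF mm_nat[of e h], of "mu X Y (src h)"]
      rw[OF uni_nat[of h], of "mm e (src h) ** mu X Y (src h)"]
    by (simp add: th_def)
qed

lemma et_nat:
  assumes "X \<in> Ob C" "Y \<in> Ob C" "ca c" "fst c = U" "fst (snd c) = X \<odot> Y" "arr h"
  shows "et X Y c (tgt h) ** h = Am X (Am Y h) ** et X Y c (src h)"
proof -
  note [simp] = assms
  have [simp]: "src h \<in> Ob B" "tgt h \<in> Ob B" using arrD by auto
  show ?thesis using un_nat[of h] rw[OF mm_nat[of c h], of "un (src h)"]
      rw[OF mui_nat[of X Y h], of "mm c (src h) ** un (src h)"]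
    by (simp add: et_def)
qed

lemma un_th:
  assumes "X \<in> Ob C" "Y \<in> Ob C" "ca e" "fst e = X \<odot> Y" "fst (snd e) = U" "Z \<in> Ob B"
  shows "un Z ** th X Y e Z = mm e Z ** mu X Y Z"
  using assms by (simp add: th_def rw[OF un_uni])

lemma mu_et:
  assumes "X \<in> Ob C" "Y \<in> Ob C" "ca c" "fst c = U" "fst (snd c) = X \<odot> Y" "Z \<in> Ob B"
  shows "mu X Y Z ** et X Y c Z = mm c Z ** un Z"
  using assms by (simp add: et_def rw[OF mu_mui])

text \<open>A strong monoidal functor preserves mates. Here \<open>g\<close> is the right mate of
  \<open>f\<close> on a self-dual object; its three factors are rewritten separately by moving the
  structure maps \<open>mu\<close> through them.\<close>

lemma mate_transport:
  assumes [simp]: "X \<in> S" "Z \<in> Ob B"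
    and ev [simp]: "ca e" "fst e = X \<odot> X" "fst (snd e) = U"
    and cv [simp]: "ca c" "fst c = U" "fst (snd c) = X \<odot> X"
    and f [simp]: "ca f" "fst f = X" "fst (snd f) = X"
    and k [simp]: "ca k" "fst k = X \<odot> X \<odot> X" "fst (snd k) = X" and k4: "k = (idm C X \<otimes> e) \<cdot> (idm C X \<otimes> f \<otimes> idm C X)"
    and g: "k \<cdot> (c \<otimes> idm C X) = g"
  shows "Am X (th X X e Z ** mm f (A X Z)) ** et X X c (A X Z) = mm g Z"
proof -
  have 1: "mm (c \<otimes> idm C X) Z = mu X (X \<odot> X) Z ** Am X (mu X X Z) ** et X X c (A X Z)"
  proof -
    \<comment> \<open>The inserted factors compose to an identity by the left unit
      constraint.\<close>
    have "mm (c \<otimes> idm C X) Z = mm (c \<otimes> idm C X) Z ** mu U X Z ** un (A X Z)" by simp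
    also have "... = mu (X \<odot> X) X Z ** mm c (A X Z) ** un (A X Z)"
      using rw[OF mm_tens_id[of c X Z], of "un (A X Z)"] by (simp del: tens_assoc)
    also have "... = mu (X \<odot> X) X Z ** mu X X (A X Z) ** et X X c (A X Z)"
      using mu_et[of X X c "A X Z"] by simp
    also have "... = mu X (X \<odot> X) Z ** Am X (mu X X Z) ** et X X c (A X Z)"
      using rw[OF mu_assoc[of X X X Z], of "et X X c (A X Z)"] by simp
    finally show ?thesis .
  qed
  have 2: "mm (idm C X \<otimes> f \<otimes> idm C X) Z ** mu X (X \<odot> X) Z ** Am X (mu X X Z) =
      mu X (X \<odot> X) Z ** Am X (mu X X Z) ** Am X (mm f (A X Z))"
  proof -
    have a: "mm (f \<otimes> idm C X) Z ** mu X X Z = mu X X Z ** mm f (A X Z)" using mm_tens_id[of f X Z] by simp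
    have "Am X (mm (f \<otimes> idm C X) Z) ** Am X (mu X X Z) = Am X (mu X X Z) ** Am X (mm f (A X Z))"
      using arg_cong[OF a, of "Am X"] by simp
    then show ?thesis using rw[OF mm_id_tens[of "f \<otimes> idm C X" X Z], of "Am X (mu X X Z)"] by simp
  qed
  have 3: "mm (idm C X \<otimes> e) Z ** mu X (X \<odot> X) Z ** Am X (mu X X Z) = Am X (th X X e Z)"
  proof -
    have "mm (idm C X \<otimes> e) Z ** mu X (X \<odot> X) Z ** Am X (mu X X Z) = mu X U Z ** Am X (mm e Z) ** Am X (mu X X Z)"
      using rw[OF mm_id_tens[of e X Z], of "Am X (mu X X Z)"] by simp
    also have "... = mu X U Z ** Am X (un Z) ** Am X (th X X e Z)"
      using arg_cong[OF un_th[of X X e Z], of "Am X"] by simp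
    also have "... = Am X (th X X e Z)" using rw[OF mu_unit_right[of X Z], of "Am X (th X X e Z)"] by simp
    finally show ?thesis .
  qed
  have "mm g Z = mm k Z ** mm (c \<otimes> idm C X) Z" unfolding g[symmetric] by (rule mm_cmp) simp_all
  also have "mm k Z = mm (idm C X \<otimes> e) Z ** mm (idm C X \<otimes> f \<otimes> idm C X) Z"
    unfolding k4 by (rule mm_cmp) simp_all
  also have "... ** mm (c \<otimes> idm C X) Z = mm (idm C X \<otimes> e) Z ** (mm (idm C X \<otimes> f \<otimes> idm C X) Z ** mu X (X \<odot> X) Z ** Am X (mu X X Z)) ** et X X c (A X Z)"
    unfolding 1 by simp
  also have "... = (mm (idm C X \<otimes> e) Z ** mu X (X \<odot> X) Z ** Am X (mu X X Z)) ** Am X (mm f (A X Z)) ** et X X c (A X Z)"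
    unfolding 2 by simp
  also have "... = Am X (th X X e Z ** mm f (A X Z)) ** et X X c (A X Z)" unfolding 3 by simp
  finally show ?thesis by simp
qed

text \<open>When \<open>k\<close> evaluates the inner pair with \<open>d\<close> and then the outer
  one with \<open>e\<close>, its image is the composite of the two image evaluations, up to
  structure maps.\<close>

lemma th_nested:
  assumes [simp]: "X \<in> S" "Y \<in> S" "Z \<in> Ob B"
    and e [simp]: "ca e" "fst e = X \<odot> X" "fst (snd e) = U"
    and d [simp]: "ca d" "fst d = Y \<odot> Y" "fst (snd d) = U"
    and k: "mm k Z = mm e Z ** mm (idm C X \<otimes> d \<otimes> idm C X) Z"
  shows "th (X \<odot> Y) (Y \<odot> X) k Z ** mu X Y (A (Y \<odot> X) Z) ** Am X (Am Y (mu Y X Z)) = th X X e Z ** Am X (th Y Y d (A X Z))"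
proof -
  have 1: "mm (d \<otimes> idm C X) Z ** mu (Y \<odot> Y) X Z ** mu Y Y (A X Z) = th Y Y d (A X Z)"
  proof -
    have "mm (d \<otimes> idm C X) Z ** mu (Y \<odot> Y) X Z ** mu Y Y (A X Z) = mu U X Z ** mm d (A X Z) ** mu Y Y (A X Z)"
      using rw[OF mm_tens_id[of d X Z], of "mu Y Y (A X Z)"] by simp
    also have "... = mu U X Z ** un (A X Z) ** th Y Y d (A X Z)" by (simp add: un_th)
    also have "... = th Y Y d (A X Z)" using rw[OF mu_unit_left[of X Z], of "th Y Y d (A X Z)"] by simp
    finally show ?thesis .
  qed
  have 2: "mu Y (Y \<odot> X) Z ** Am Y (mu Y X Z) = mu (Y \<odot> Y) X Z ** mu Y Y (A X Z)"
    using mu_assoc[of Y Y X Z] by simp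
  have 3: "mu (X \<odot> Y) (Y \<odot> X) Z ** mu X Y (A (Y \<odot> X) Z) ** Am X (Am Y (mu Y X Z)) =
      mu X (Y \<odot> Y \<odot> X) Z ** Am X (mu (Y \<odot> Y) X Z ** mu Y Y (A X Z))"
  proof -
    have "mu (X \<odot> Y) (Y \<odot> X) Z ** mu X Y (A (Y \<odot> X) Z) ** Am X (Am Y (mu Y X Z)) =
        mu X (Y \<odot> Y \<odot> X) Z ** Am X (mu Y (Y \<odot> X) Z) ** Am X (Am Y (mu Y X Z))"
      using rw[OF mu_assoc[of X Y "Y \<odot> X" Z], of "Am X (Am Y (mu Y X Z))"] by simp
    also have "... = mu X (Y \<odot> Y \<odot> X) Z ** Am X (mu Y (Y \<odot> X) Z ** Am Y (mu Y X Z))" by simp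
    finally show ?thesis unfolding 2 .
  qed
  have 4: "mm (idm C X \<otimes> d \<otimes> idm C X) Z ** mu X (Y \<odot> Y \<odot> X) Z = mu X X Z ** Am X (mm (d \<otimes> idm C X) Z)"
    using mm_id_tens[of "d \<otimes> idm C X" X Z] by simp
  have "th (X \<odot> Y) (Y \<odot> X) k Z ** mu X Y (A (Y \<odot> X) Z) ** Am X (Am Y (mu Y X Z)) =
      uni Z ** mm e Z ** mm (idm C X \<otimes> d \<otimes> idm C X) Z ** (mu (X \<odot> Y) (Y \<odot> X) Z ** mu X Y (A (Y \<odot> X) Z) ** Am X (Am Y (mu Y X Z)))"
    using k by (simp add: th_def)
  also have "... = uni Z ** mm e Z ** (mm (idm C X \<otimes> d \<otimes> idm C X) Z ** mu X (Y \<odot> Y \<odot> X) Z) ** Am X (mu (Y \<odot> Y) X Z ** mu Y Y (A X Z))"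
    unfolding 3 by simp
  also have "... = uni Z ** mm e Z ** mu X X Z ** Am X (mm (d \<otimes> idm C X) Z ** mu (Y \<odot> Y) X Z ** mu Y Y (A X Z))"
    unfolding 4 by simp
  finally show ?thesis unfolding 1 by (simp add: th_def)
qed

section \<open>Evaluations that are symmetric under the trace\<close>

definition balanced where
  "balanced t X e \<longleftrightarrow> (\<forall>Z W a b. Z \<in> Ob B \<longrightarrow> W \<in> Ob B \<longrightarrow> arr a \<longrightarrow> src a = Z \<longrightarrow> tgt a = A X W \<longrightarrow>
     arr b \<longrightarrow> src b = W \<longrightarrow> tgt b = A X Z \<longrightarrow>
     Tr t W (th X X e W ** Am X a ** b) = Tr t Z (th X X e Z ** Am X b ** a))"

lemma balancedD:
  "balanced t X e ==> arr a ==> arr b ==> tgt a = A X (src b) ==> tgt b = A X (src a) ==>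
     Tr t (src b) (th X X e (src b) ** Am X a ** b) = Tr t (src a) (th X X e (src a) ** Am X b ** a)"
  unfolding balanced_def using arrD by blast

text \<open>The nested evaluation is read with \<open>Y\<close> outside in one trace and with
  \<open>X\<close> outside in the other, which is why both factorizations \<open>k1\<close> and
  \<open>k2\<close> are required. In between, the symmetry for \<open>Y\<close>, cyclicity and the
  symmetry for \<open>X\<close> are used once each.\<close>

lemma balanced_nested:
  assumes [simp]: "X \<in> S" "Y \<in> S"
    and e [simp]: "ca e" "fst e = X \<odot> X" "fst (snd e) = U"
    and d [simp]: "ca d" "fst d = Y \<odot> Y" "fst (snd d) = U"
    and k [simp]: "ca k" "fst k = X \<odot> Y \<odot> Y \<odot> X" "fst (snd k) = U"
    and k1: "\<And>Z. Z \<in> Ob B ==> mm k Z = mm e Z ** mm (idm C X \<otimes> d \<otimes> idm C X) Z"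
    and k2: "\<And>Z. Z \<in> Ob B ==> mm k Z = mm d Z ** mm (idm C Y \<otimes> e \<otimes> idm C Y) Z"
    and comm: "Y \<odot> X = X \<odot> Y"
    and be: "balanced t X e" and bd: "balanced t Y d"
  shows "balanced t (X \<odot> Y) k"
  unfolding balanced_def
proof (intro allI impI)
  let ?V = "X \<odot> Y" and ?T = "th (X \<odot> Y) (X \<odot> Y) k"
  fix Z W a b
  assume [simp]: "Z \<in> Ob B" "W \<in> Ob B" "arr a" "src a = Z" "tgt a = A ?V W" "arr b" "src b = W" "tgt b = A ?V Z"
  \<comment> \<open>The target of \<open>a\<close> is split with \<open>X\<close> outside, that of
    \<open>b\<close> with \<open>Y\<close> outside; this is possible because the two tensor products
    are equal objects.\<close>
  define a1 where "a1 = mui X Y W ** a"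
  define b1 where "b1 = mui Y X Z ** b"
  have a1 [simp]: "arr a1" "src a1 = Z" "tgt a1 = A X (A Y W)" by (simp_all add: a1_def)
  have b1 [simp]: "arr b1" "src b1 = W" "tgt b1 = A Y (A X Z)" by (simp_all add: b1_def comm)
  have a: "a = mu X Y W ** a1" by (simp add: a1_def rw[OF mu_mui])
  have b: "b = mu Y X Z ** b1" by (simp add: b1_def rw[OF mu_mui] comm)
  have k': "fst k = ?V \<odot> ?V" "(Y \<odot> X) \<odot> ?V = ?V \<odot> ?V" "?V \<odot> (Y \<odot> X) = ?V \<odot> ?V"
  proof -
    have "X \<odot> Y \<odot> Y \<odot> X = ?V \<odot> (Y \<odot> X)" by simp
    then show "fst k = ?V \<odot> ?V" unfolding k(2) comm by simp
  qed (simp_all only: comm)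
  have nX: "?T Z ** mu X Y (A ?V Z) ** Am X (Am Y (mu Y X Z)) = th X X e Z ** Am X (th Y Y d (A X Z))"
    using th_nested[OF assms(1,2) _ e d k1, of Z] by (simp add: comm)
  have nY: "?T W ** mu Y X (A ?V W) ** Am Y (Am X (mu X Y W)) = th Y Y d W ** Am Y (th X X e (A Y W))"
    using th_nested[OF assms(2,1) _ d e k2, of W] by (simp add: comm)
  have thk [simp]: "V \<in> Ob B ==> arr (?T V)" "V \<in> Ob B ==> src (?T V) = A ?V (A ?V V)"
    "V \<in> Ob B ==> tgt (?T V) = V" for V
    using k' by simp_all
  have "?T W ** Am ?V a ** b = th Y Y d W ** Am Y (th X X e (A Y W) ** Am X a1) ** b1"
  proof -
    have 1: "Am ?V a ** mu Y X Z = mu Y X (A ?V W) ** Am Y (Am X a)"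
      using mu_nat[of Y X a] by (simp add: comm)
    have "?T W ** Am ?V a ** b = ?T W ** (Am ?V a ** mu Y X Z) ** b1" unfolding b by (simp add: comm)
    also have "... = ?T W ** mu Y X (A ?V W) ** Am Y (Am X a) ** b1" unfolding 1 by (simp add: comm)
    also have "... = (?T W ** mu Y X (A ?V W) ** Am Y (Am X (mu X Y W))) ** Am Y (Am X a1) ** b1"
      unfolding a by (simp add: comm)
    finally show ?thesis unfolding nY by simp
  qed
  \<comment> \<open>The symmetry for \<open>Y\<close>, with the evaluation of \<open>X\<close>
    counted as part of the first argument.\<close>
  then have "Tr t W (?T W ** Am ?V a ** b) =
      Tr t (A X Z) (th Y Y d (A X Z) ** Am Y b1 ** th X X e (A Y W) ** Am X a1)"
    using balancedD[OF bd, of "th X X e (A Y W) ** Am X a1" b1] by simp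
  also have "... = Tr t (A Y W) ((th X X e (A Y W) ** Am X a1) ** (th Y Y d (A X Z) ** Am Y b1))"
    using Tr_cyclic[of "th Y Y d (A X Z) ** Am Y b1" "A Y W" "A X Z" "th X X e (A Y W) ** Am X a1" t] by simp
  also have "... = Tr t Z (th X X e Z ** Am X (th Y Y d (A X Z) ** Am Y b1) ** a1)"
    using balancedD[OF be, of a1 "th Y Y d (A X Z) ** Am Y b1"] by simp
  also have "th X X e Z ** Am X (th Y Y d (A X Z) ** Am Y b1) ** a1 = ?T Z ** Am ?V b ** a"
  proof -
    have 1: "Am ?V b ** mu X Y W = mu X Y (A ?V Z) ** Am X (Am Y b)" using mu_nat[of X Y b] by simp
    have "?T Z ** Am ?V b ** a = ?T Z ** (Am ?V b ** mu X Y W) ** a1" unfolding a by simp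
    also have "... = ?T Z ** mu X Y (A ?V Z) ** Am X (Am Y b) ** a1" unfolding 1 by simp
    also have "... = (?T Z ** mu X Y (A ?V Z) ** Am X (Am Y (mu Y X Z))) ** Am X (Am Y b1) ** a1"
      unfolding b by (simp add: comm)
    finally show ?thesis unfolding nX by simp
  qed
  finally show "Tr t W (?T W ** Am ?V a ** b) = Tr t Z (?T Z ** Am ?V b ** a)" .
qed

lemma balanced_add:
  assumes [simp]: "X \<in> Ob C" and e [simp]: "ca e" "fst e = X \<odot> X" "fst (snd e) = U"
    and e' [simp]: "ca e'" "fst e' = X \<odot> X" "fst (snd e') = U"
    and s [simp]: "ca (add_mor C e e')" "fst (add_mor C e e') = X \<odot> X" "fst (snd (add_mor C e e')) = U"
    and "balanced t X e" "balanced t X e'"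
  shows "balanced t X (add_mor C e e')"
  unfolding balanced_def
proof (intro allI impI)
  fix Z W a b
  assume [simp]: "Z \<in> Ob B" "W \<in> Ob B" "arr a" "src a = Z" "tgt a = A X W" "arr b" "src b = W" "tgt b = A X Z"
  have 1: "th X X (add_mor C e e') V = ad (th X X e V) (th X X e' V)" if [simp]: "V \<in> Ob B" for V
    by (simp add: th_def mm_ad ad_comp comp_ad par_def)
  have 2: "Tr t (src b) (th X X (add_mor C e e') (src b) ** Am X a ** b) =
      Tr t (src b) (th X X e (src b) ** Am X a ** b) + Tr t (src b) (th X X e' (src b) ** Am X a ** b)"
    if [simp]: "arr a" "arr b" "tgt a = A X (src b)" "tgt b = A X (src a)" "src b \<in> Ob B" "src a \<in> Ob B" for a b
    unfolding 1[OF that(5)] by (simp add: ad_comp par_def Tr_ad)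
  show "Tr t W (th X X (add_mor C e e') W ** Am X a ** b) = Tr t Z (th X X (add_mor C e e') Z ** Am X b ** a)"
    using 2[of a b] 2[of b a] balancedD[OF assms(11), of a b] balancedD[OF assms(12), of a b] by simp
qed

lemma th_restrict:
  assumes [simp]: "ca e" "fst e = P \<odot> P'" "fst (snd e) = U" "ca f" "ca g" "fst (snd f) = P" "fst (snd g) = P'" "Z \<in> Ob B"
    and X: "fst f = X" "fst g = Y"
  shows "th X Y (e \<cdot> (f \<otimes> g)) Z = th P P' e Z ** mm f (A P' Z) ** Am X (mm g Z)"
proof -
  note [simp] = X[symmetric]
  have [simp]: "P \<in> Ob C" "P' \<in> Ob C" using ca_Ob(2)[of f] ca_Ob(2)[of g] by simp_all
  have "mm (e \<cdot> (f \<otimes> g)) Z = mm e Z ** mm (f \<otimes> g) Z" by (rule mm_cmp) simp_all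
  then show ?thesis using mm_tens[of f g Z] by (simp add: th_def)
qed

lemma et_restrict:
  assumes [simp]: "ca c" "fst (snd c) = P \<odot> P'" "fst c = U" "ca f" "ca g" "fst f = P" "fst g = P'" "Z \<in> Ob B"
    and X: "fst (snd f) = X" "fst (snd g) = Y"
  shows "et X Y ((f \<otimes> g) \<cdot> c) Z = mm f (A Y Z) ** Am P (mm g Z) ** et P P' c Z"
proof -
  note [simp] = X[symmetric]
  have [simp]: "P \<in> Ob C" "P' \<in> Ob C" using ca_Ob(1)[of f] ca_Ob(1)[of g] by simp_all
  have 1: "mm ((f \<otimes> g) \<cdot> c) Z = mm (f \<otimes> g) Z ** mm c Z" by (rule mm_cmp) simp_all
  have "mm (f \<otimes> g) Z ** mm c Z ** un Z = mm (f \<otimes> g) Z ** mu P P' Z ** et P P' c Z"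
    using mu_et[of P P' c Z] by simp
  also have "... = mu X Y Z ** mm f (A Y Z) ** Am P (mm g Z) ** et P P' c Z"
    using rw[OF mm_tens[of f g Z], of "et P P' c Z"] by simp
  finally show ?thesis unfolding et_def[of X Y] 1 by (simp add: rw[OF mui_mu])
qed

text \<open>Naturality moves the two copies of \<open>f\<close> onto \<open>a\<close> and
  \<open>b\<close>, and the symmetry for \<open>P\<close> applies to the resulting arrows.\<close>

lemma balanced_restrict:
  assumes [simp]: "ca e" "fst e = P \<odot> P" "fst (snd e) = U" "ca f" "fst f = X" "fst (snd f) = P"
    and bal: "balanced t P e"
  shows "balanced t X (e \<cdot> (f \<otimes> f))"
  unfolding balanced_def
proof (intro allI impI)
  fix Z W a b
  assume [simp]: "Z \<in> Ob B" "W \<in> Ob B" "arr a" "src a = Z" "tgt a = A X W" "arr b" "src b = W" "tgt b = A X Z"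
  have [simp]: "P \<in> Ob C" "X \<in> Ob C" using ca_Ob[of f] by simp_all
  have 1: "th X X (e \<cdot> (f \<otimes> f)) (src b) ** Am X a ** b = th P P e (src b) ** Am P (mm f (src b) ** a) ** mm f (src a) ** b"
    if [simp]: "arr a" "arr b" "tgt a = A X (src b)" "tgt b = A X (src a)" "src b \<in> Ob B" "src a \<in> Ob B" for a b
  proof -
    have "mm f (A P (src b)) ** Am X (mm f (src b) ** a) = Am P (mm f (src b) ** a) ** mm f (src a)"
      using mm_nat[of f "mm f (src b) ** a"] by simp
    from rw[OF this, of b] show ?thesis by (simp add: th_restrict[of e P P f f])
  qed
  show "Tr t W (th X X (e \<cdot> (f \<otimes> f)) W ** Am X a ** b) = Tr t Z (th X X (e \<cdot> (f \<otimes> f)) Z ** Am X b ** a)"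
    using 1[of a b] 1[of b a] balancedD[OF bal, of "mm f W ** a" "mm f Z ** b"] by simp
qed

text \<open>A left and a right duality between \<open>X\<close> and the same object
  \<open>X'\<close>, each with one zigzag identity, linked by the trace in the last
  condition.\<close>

definition duality where
  "duality t X X' el hl er hr \<longleftrightarrow> X \<in> Ob C \<and> X' \<in> Ob C \<and>
    (\<forall>Z\<in>Ob B. arr (el Z) \<and> src (el Z) = A X' (A X Z) \<and> tgt (el Z) = Z) \<and>
    (\<forall>Z\<in>Ob B. arr (hl Z) \<and> src (hl Z) = Z \<and> tgt (hl Z) = A X (A X' Z)) \<and>
    (\<forall>Z\<in>Ob B. arr (er Z) \<and> src (er Z) = A X (A X' Z) \<and> tgt (er Z) = Z) \<and>
    (\<forall>Z\<in>Ob B. arr (hr Z) \<and> src (hr Z) = Z \<and> tgt (hr Z) = A X' (A X Z)) \<and>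
    (\<forall>h. arr h \<longrightarrow> el (tgt h) ** Am X' (Am X h) = h ** el (src h)) \<and>
    (\<forall>h. arr h \<longrightarrow> hl (tgt h) ** h = Am X (Am X' h) ** hl (src h)) \<and>
    (\<forall>h. arr h \<longrightarrow> hr (tgt h) ** h = Am X' (Am X h) ** hr (src h)) \<and>
    (\<forall>Z\<in>Ob B. Am X (el Z) ** hl (A X Z) = i1 (A X Z)) \<and>
    (\<forall>Z\<in>Ob B. Am X' (er Z) ** hr (A X' Z) = i1 (A X' Z)) \<and>
    (\<forall>a b. arr a \<longrightarrow> arr b \<longrightarrow> tgt a = A X (src b) \<longrightarrow> tgt b = A X' (src a) \<longrightarrow>
      Tr t (src b) (el (src b) ** Am X' a ** b) = Tr t (src a) (er (src a) ** Am X b ** a))"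

lemma dualityD_arr:
  assumes "duality t X X' el hl er hr" "Z \<in> Ob B"
  shows "arr (el Z)" "src (el Z) = A X' (A X Z)" "tgt (el Z) = Z" "arr (hl Z)" "src (hl Z) = Z" "tgt (hl Z) = A X (A X' Z)"
    "arr (er Z)" "src (er Z) = A X (A X' Z)" "tgt (er Z) = Z" "arr (hr Z)" "src (hr Z) = Z" "tgt (hr Z) = A X' (A X Z)"
  using assms by (simp_all add: duality_def)

lemma dualityD:
  assumes "duality t X X' el hl er hr"
  shows "arr h ==> el (tgt h) ** Am X' (Am X h) = h ** el (src h)"
    "arr h ==> hl (tgt h) ** h = Am X (Am X' h) ** hl (src h)"
    "arr h ==> hr (tgt h) ** h = Am X' (Am X h) ** hr (src h)"
    "Z \<in> Ob B ==> Am X (el Z) ** hl (A X Z) = i1 (A X Z)"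
    "Z \<in> Ob B ==> Am X' (er Z) ** hr (A X' Z) = i1 (A X' Z)"
    "arr a ==> arr b ==> tgt a = A X (src b) ==> tgt b = A X' (src a) ==>
      Tr t (src b) (el (src b) ** Am X' a ** b) = Tr t (src a) (er (src a) ** Am X b ** a)"
  using assms unfolding duality_def by blast+

text \<open>The left mate \<open>l\<close> is characterized through the left evaluations. The trace
  turns this into the equation \<open>r\<close> for the right evaluations, from which the right mate
  is recovered by the zigzag identity.\<close>

theorem mates_agree:
  assumes dX: "duality t X X' el hl er hr" and dY: "duality t Y Y' el' hl' er' hr'"
    and t: "\<And>T. t T \<noteq> 0"
    and \<alpha> [simp]: "\<And>Z. Z \<in> Ob B ==> arr (\<alpha> Z)" "\<And>Z. Z \<in> Ob B ==> src (\<alpha> Z) = A X Z" "\<And>Z. Z \<in> Ob B ==> tgt (\<alpha> Z) = A Y Z"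
    and \<alpha>_nat: "\<And>h. arr h ==> \<alpha> (tgt h) ** Am X h = Am Y h ** \<alpha> (src h)"
    and [simp]: "Z \<in> Ob B"
  shows "Am X' (er' Z) ** Am X' (\<alpha> (A Y' Z)) ** hr (A Y' Z) = el' (A X' Z) ** Am Y' (\<alpha> (A X' Z)) ** Am Y' (hl Z)"
proof -
  have [simp]: "X \<in> Ob C" "X' \<in> Ob C" "Y \<in> Ob C" "Y' \<in> Ob C" using dX dY by (auto simp: duality_def)
  note [simp] = dualityD_arr[OF dX] dualityD_arr[OF dY]
  \<comment> \<open>The left mate of \<open>\<alpha>\<close> as a family of components.\<close>
  define l where "l V = el' (A X' V) ** Am Y' (\<alpha> (A X' V)) ** Am Y' (hl V)" for V
  have l [simp]: "V \<in> Ob B ==> arr (l V)" "V \<in> Ob B ==> src (l V) = A Y' V" "V \<in> Ob B ==> tgt (l V) = A X' V" for V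
    by (simp_all add: l_def)
  have l_nat: "l (tgt h) ** Am Y' h = Am X' h ** l (src h)" if [simp]: "arr h" for h
  proof -
    have [simp]: "src h \<in> Ob B" "tgt h \<in> Ob B" using arrD by auto
    have 1: "hl (tgt h) ** h = Am X (Am X' h) ** hl (src h)" using dualityD(2)[OF dX, of h] by simp
    have 2: "\<alpha> (A X' (tgt h)) ** Am X (Am X' h) = Am Y (Am X' h) ** \<alpha> (A X' (src h))" using \<alpha>_nat[of "Am X' h"] by simp
    have 3: "el' (A X' (tgt h)) ** Am Y' (Am Y (Am X' h)) = Am X' h ** el' (A X' (src h))"
      using dualityD(1)[OF dY, of "Am X' h"] by simp
    have "l (tgt h) ** Am Y' h = el' (A X' (tgt h)) ** Am Y' (\<alpha> (A X' (tgt h))) ** Am Y' (hl (tgt h) ** h)"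
      by (simp add: l_def)
    also have "... = el' (A X' (tgt h)) ** Am Y' (\<alpha> (A X' (tgt h)) ** Am X (Am X' h)) ** Am Y' (hl (src h))"
      unfolding 1 by simp
    also have "... = (el' (A X' (tgt h)) ** Am Y' (Am Y (Am X' h))) ** Am Y' (\<alpha> (A X' (src h))) ** Am Y' (hl (src h))"
      unfolding 2 by simp
    finally show ?thesis unfolding 3 by (simp add: l_def)
  qed
  \<comment> \<open>The left evaluation of \<open>X\<close> after \<open>l\<close> equals that of
    \<open>Y\<close> after \<open>\<alpha>\<close>: naturality of the evaluations and of
    \<open>\<alpha>\<close>, then the zigzag identity.\<close>
  have l_ev: "el W ** l (A X W) = el' W ** Am Y' (\<alpha> W)" if [simp]: "W \<in> Ob B" for W
  proof -
    have 1: "el' W ** Am Y' (Am Y (el W)) = el W ** el' (A X' (A X W))"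
      using dualityD(1)[OF dY, of "el W"] by simp
    have 2: "Am Y (el W) ** \<alpha> (A X' (A X W)) = \<alpha> W ** Am X (el W)" using \<alpha>_nat[of "el W"] by simp
    have 3: "Am X (el W) ** hl (A X W) = i1 (A X W)" using dualityD(4)[OF dX] by simp
    have "el W ** l (A X W) = (el W ** el' (A X' (A X W))) ** Am Y' (\<alpha> (A X' (A X W))) ** Am Y' (hl (A X W))"
      by (simp add: l_def)
    also have "... = el' W ** Am Y' (Am Y (el W) ** \<alpha> (A X' (A X W))) ** Am Y' (hl (A X W))"
      unfolding 1[symmetric] by simp
    also have "... = el' W ** Am Y' (\<alpha> W) ** Am Y' (Am X (el W) ** hl (A X W))" unfolding 2 by simp
    finally show ?thesis unfolding 3 by simp
  qed
  \<comment> \<open>Tested against an arbitrary \<open>a\<close>, both sides have the same trace: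
    the link between left and right evaluation is used for \<open>X\<close> with \<open>l\<close>,
    and for \<open>Y\<close> with the identity. Nondegeneracy gives equality.\<close>
  have r: "er Z ** Am X (l Z) = er' Z ** \<alpha> (A Y' Z)"
  proof (rule eq_if_diff_zero)
    show "par (er Z ** Am X (l Z)) (er' Z ** \<alpha> (A Y' Z))" by (simp add: par_def)
    let ?d = "ad (er Z ** Am X (l Z)) (sc (-1) (er' Z ** \<alpha> (A Y' Z)))"
    have "?d = zr (A X (A Y' Z)) Z"
    proof (rule Tr_nondegenerate[of t])
      fix a assume [simp]: "arr a" "src a = Z" "tgt a = A X (A Y' Z)"
      have 1: "Tr t (A Y' Z) (el (A Y' Z) ** Am X' a ** l Z) = Tr t Z (er Z ** Am X (l Z) ** a)"
        using dualityD(6)[OF dX, of a "l Z"] by simp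
      have 2: "Tr t (A Y' Z) (el' (A Y' Z) ** Am Y' (\<alpha> (A Y' Z) ** a) ** i1 (A Y' Z)) = Tr t Z (er' Z ** Am Y (i1 (A Y' Z)) ** (\<alpha> (A Y' Z) ** a))"
        using dualityD(6)[OF dY, of "\<alpha> (A Y' Z) ** a" "i1 (A Y' Z)"] by simp
      have 3: "Am X' a ** l Z = l (A X (A Y' Z)) ** Am Y' a" using l_nat[of a] by simp
      have "el (A Y' Z) ** Am X' a ** l Z = (el (A Y' Z) ** l (A X (A Y' Z))) ** Am Y' a" unfolding 3 by simp
      also have "... = el' (A Y' Z) ** Am Y' (\<alpha> (A Y' Z) ** a)" using l_ev[of "A Y' Z"] by simp
      finally have "Tr t Z (er Z ** Am X (l Z) ** a) = Tr t Z (er' Z ** \<alpha> (A Y' Z) ** a)" using 1 2 by simp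
      moreover have "Tr t Z (sc (-1) (er' Z ** \<alpha> (A Y' Z) ** a)) = - Tr t Z (er' Z ** \<alpha> (A Y' Z) ** a)"
      proof -
        let ?f = "er' Z ** \<alpha> (A Y' Z) ** a"
        have "Tr t Z (ad ?f (sc (-1) ?f)) = 0" using ad_neg[of ?f] Tr_zr[of Z t] by simp
        then show ?thesis using Tr_ad[of ?f "sc (-1) ?f" Z t] by (simp add: par_def add_eq_0_iff)
      qed
      ultimately show "Tr t Z (?d ** a) = 0" by (simp add: ad_comp par_def Tr_ad)
    qed (use t in simp_all)
    then show "?d = zr (src (er Z ** Am X (l Z))) (tgt (er Z ** Am X (l Z)))" by simp
  qed
  \<comment> \<open>Naturality of the right coevaluation pulls \<open>l\<close> out, after which the
    right zigzag identity cancels.\<close>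
  have 1: "hr (A X' Z) ** l Z = Am X' (Am X (l Z)) ** hr (A Y' Z)" using dualityD(3)[OF dX, of "l Z"] by simp
  have 2: "Am X' (er Z) ** hr (A X' Z) = i1 (A X' Z)" using dualityD(5)[OF dX] by simp
  have "Am X' (er' Z) ** Am X' (\<alpha> (A Y' Z)) ** hr (A Y' Z) = Am X' (er' Z ** \<alpha> (A Y' Z)) ** hr (A Y' Z)" by simp
  also have "... = Am X' (er Z) ** Am X' (Am X (l Z)) ** hr (A Y' Z)" unfolding r[symmetric] by simp
  also have "... = (Am X' (er Z) ** hr (A X' Z)) ** l Z" unfolding 1[symmetric] by simp
  also have "... = l Z" unfolding 2 by simp
  finally show ?thesis by (simp add: l_def)
qed

text \<open>Naturality collects all maps between \<open>X'\<close> and \<open>P\<close> in the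
  composite \<open>i' p'\<close>, whose mate is \<open>i p\<close> by assumption; what remains is
  \<open>p i p i\<close>, an identity.\<close>

lemma retract_zigzag:
  assumes [simp]: "P \<in> Ob C" "ca e" "fst e = P \<odot> P" "fst (snd e) = U" "ca c" "fst c = U" "fst (snd c) = P \<odot> P"
    and [simp]: "ca i" "fst i = X" "fst (snd i) = P" "ca p" "fst p = P" "fst (snd p) = X"
    and [simp]: "ca i'" "fst i' = X'" "fst (snd i') = P" "ca p'" "fst p' = P" "fst (snd p') = X'"
    and [simp]: "Z \<in> Ob B"
    and pi: "mm p Z ** mm i Z = i1 (A X Z)"
    and mate: "Am P (th P P e Z ** mm i' (A P Z) ** mm p' (A P Z)) ** et P P c (A P Z) = mm i Z ** mm p Z"
  shows "Am X (th P P e Z ** mm i' (A P Z) ** Am X' (mm i Z)) **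
    (mm p (A X' (A X Z)) ** Am P (mm p' (A X Z)) ** et P P c (A X Z)) = i1 (A X Z)"
proof -
  let ?e = "th P P e" and ?c = "et P P c"
  have [simp]: "X \<in> Ob C" "X' \<in> Ob C" using ca_Ob[of i] ca_Ob[of i'] by simp_all
  let ?h = "?e Z ** mm i' (A P Z) ** Am X' (mm i Z)"
  have 1: "Am X ?h ** mm p (A X' (A X Z)) = mm p Z ** Am P ?h" using mm_nat[of p ?h] by simp
  have 2: "Am X' (mm i Z) ** mm p' (A X Z) = mm p' (A P Z) ** Am P (mm i Z)" using mm_nat[of p' "mm i Z"] by simp
  have 3: "Am P (Am P (mm i Z)) ** ?c (A X Z) = ?c (A P Z) ** mm i Z" using et_nat[of P P c "mm i Z"] by simp
  have "Am X ?h ** (mm p (A X' (A X Z)) ** Am P (mm p' (A X Z)) ** ?c (A X Z)) =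
      (Am X ?h ** mm p (A X' (A X Z))) ** Am P (mm p' (A X Z)) ** ?c (A X Z)" by simp
  also have "... = mm p Z ** Am P (?e Z ** mm i' (A P Z) ** (Am X' (mm i Z) ** mm p' (A X Z))) ** ?c (A X Z)"
    unfolding 1 by simp
  also have "... = mm p Z ** Am P (?e Z ** mm i' (A P Z) ** mm p' (A P Z)) ** (Am P (Am P (mm i Z)) ** ?c (A X Z))"
    unfolding 2 by simp
  also have "... = mm p Z ** (Am P (?e Z ** mm i' (A P Z) ** mm p' (A P Z)) ** ?c (A P Z)) ** mm i Z"
    unfolding 3 by simp
  also have "... = (mm p Z ** mm i Z) ** (mm p Z ** mm i Z)" unfolding mate by simp
  finally show ?thesis unfolding pi by simp
qed

text \<open>Self-duality of \<open>P\<close> restricts to a duality between retracts whose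
  idempotents are mates of each other. Symmetry under the trace is inherited because the inclusions
  can be moved onto \<open>a\<close> and \<open>b\<close>.\<close>

lemma retract_duality:
  assumes [simp]: "P \<in> Ob C" "ca e" "fst e = P \<odot> P" "fst (snd e) = U" "ca c" "fst c = U" "fst (snd c) = P \<odot> P"
    and [simp]: "ca i" "fst i = X" "fst (snd i) = P" "ca p" "fst p = P" "fst (snd p) = X"
    and [simp]: "ca i'" "fst i' = X'" "fst (snd i') = P" "ca p'" "fst p' = P" "fst (snd p') = X'"
    and pi: "\<And>Z. Z \<in> Ob B ==> mm p Z ** mm i Z = i1 (A X Z)" "\<And>Z. Z \<in> Ob B ==> mm p' Z ** mm i' Z = i1 (A X' Z)"
    and mate: "\<And>Z. Z \<in> Ob B ==> Am P (th P P e Z ** mm i' (A P Z) ** mm p' (A P Z)) ** et P P c (A P Z) = mm i Z ** mm p Z"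
      "\<And>Z. Z \<in> Ob B ==> Am P (th P P e Z ** mm i (A P Z) ** mm p (A P Z)) ** et P P c (A P Z) = mm i' Z ** mm p' Z"
    and bal: "balanced t P e"
  shows "duality t X X' (\<lambda>Z. th P P e Z ** mm i' (A P Z) ** Am X' (mm i Z))
    (\<lambda>Z. mm p (A X' Z) ** Am P (mm p' Z) ** et P P c Z)
    (\<lambda>Z. th P P e Z ** mm i (A P Z) ** Am X (mm i' Z))
    (\<lambda>Z. mm p' (A X Z) ** Am P (mm p Z) ** et P P c Z)"
proof -
  let ?e = "th P P e" and ?c = "et P P c"
  have [simp]: "X \<in> Ob C" "X' \<in> Ob C" using ca_Ob[of i] ca_Ob[of i'] by simp_all
  have eps: "(?e (tgt h) ** mm j' (A P (tgt h)) ** Am Y' (mm j (tgt h))) ** Am Y' (Am Y h) =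
      h ** ?e (src h) ** mm j' (A P (src h)) ** Am Y' (mm j (src h))"
    if [simp]: "arr h" "ca j" "ca j'" "fst j = Y" "fst j' = Y'" "fst (snd j) = P" "fst (snd j') = P" for h j j' Y Y'
  proof -
    have [simp]: "src h \<in> Ob B" "tgt h \<in> Ob B" "Y \<in> Ob C" "Y' \<in> Ob C" using arrD ca_Ob[of j] ca_Ob[of j'] by simp_all
    have 1: "mm j (tgt h) ** Am Y h = Am P h ** mm j (src h)" using mm_nat[of j h] by simp
    have 2: "mm j' (A P (tgt h)) ** Am Y' (Am P h) = Am P (Am P h) ** mm j' (A P (src h))" using mm_nat[of j' "Am P h"] by simp
    have 3: "?e (tgt h) ** Am P (Am P h) = h ** ?e (src h)" by (rule th_nat) simp_all
    have "(?e (tgt h) ** mm j' (A P (tgt h)) ** Am Y' (mm j (tgt h))) ** Am Y' (Am Y h) =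
      ?e (tgt h) ** mm j' (A P (tgt h)) ** Am Y' (mm j (tgt h) ** Am Y h)" by simp
    also have "... = ?e (tgt h) ** (mm j' (A P (tgt h)) ** Am Y' (Am P h)) ** Am Y' (mm j (src h))" unfolding 1 by simp
    also have "... = (?e (tgt h) ** Am P (Am P h)) ** mm j' (A P (src h)) ** Am Y' (mm j (src h))" unfolding 2 by simp
    finally show ?thesis unfolding 3 by simp
  qed
  have eta: "(mm j (A Y' (tgt h)) ** Am P (mm j' (tgt h)) ** ?c (tgt h)) ** h =
      Am Y (Am Y' h) ** mm j (A Y' (src h)) ** Am P (mm j' (src h)) ** ?c (src h)"
    if [simp]: "arr h" "ca j" "ca j'" "fst j = P" "fst j' = P" "fst (snd j) = Y" "fst (snd j') = Y'" for h j j' Y Y'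
  proof -
    have [simp]: "src h \<in> Ob B" "tgt h \<in> Ob B" "Y \<in> Ob C" "Y' \<in> Ob C" using arrD ca_Ob[of j] ca_Ob[of j'] by simp_all
    have 1: "mm j' (tgt h) ** Am P h = Am Y' h ** mm j' (src h)" using mm_nat[of j' h] by simp
    have 2: "mm j (A Y' (tgt h)) ** Am P (Am Y' h) = Am Y (Am Y' h) ** mm j (A Y' (src h))" using mm_nat[of j "Am Y' h"] by simp
    have 3: "?c (tgt h) ** h = Am P (Am P h) ** ?c (src h)" by (rule et_nat) simp_all
    have "(mm j (A Y' (tgt h)) ** Am P (mm j' (tgt h)) ** ?c (tgt h)) ** h =
      mm j (A Y' (tgt h)) ** Am P (mm j' (tgt h)) ** (?c (tgt h) ** h)" by simp
    also have "... = mm j (A Y' (tgt h)) ** Am P (mm j' (tgt h) ** Am P h) ** ?c (src h)" unfolding 3 by simp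
    also have "... = (mm j (A Y' (tgt h)) ** Am P (Am Y' h)) ** Am P (mm j' (src h)) ** ?c (src h)" unfolding 1 by simp
    finally show ?thesis unfolding 2 by simp
  qed
  have tr: "Tr t (src b) ((?e (src b) ** mm i' (A P (src b)) ** Am X' (mm i (src b))) ** Am X' a ** b) =
      Tr t (src a) ((?e (src a) ** mm i (A P (src a)) ** Am X (mm i' (src a))) ** Am X b ** a)"
    if [simp]: "arr a" "arr b" "tgt a = A X (src b)" "tgt b = A X' (src a)" for a b
  proof -
    have [simp]: "src a \<in> Ob B" "src b \<in> Ob B" using arrD by simp_all
    have 1: "mm i' (A P (src b)) ** Am X' (mm i (src b) ** a) = Am P (mm i (src b) ** a) ** mm i' (src a)"
      using mm_nat[of i' "mm i (src b) ** a"] by simp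
    have 2: "mm i (A P (src a)) ** Am X (mm i' (src a) ** b) = Am P (mm i' (src a) ** b) ** mm i (src b)"
      using mm_nat[of i "mm i' (src a) ** b"] by simp
    have "(?e (src b) ** mm i' (A P (src b)) ** Am X' (mm i (src b))) ** Am X' a ** b =
        ?e (src b) ** Am P (mm i (src b) ** a) ** mm i' (src a) ** b"
      using rw[OF 1, of b] by simp
    moreover have "(?e (src a) ** mm i (A P (src a)) ** Am X (mm i' (src a))) ** Am X b ** a =
        ?e (src a) ** Am P (mm i' (src a) ** b) ** mm i (src b) ** a"
      using rw[OF 2, of a] by simp
    ultimately show ?thesis using balancedD[OF bal, of "mm i (src b) ** a" "mm i' (src a) ** b"] by simp
  qed
  show ?thesis unfolding duality_def
    using eps[of _ i i' X X'] eta[of _ p p' X X'] eta[of _ p' p X' X] tr retract_zigzag[of P e c i X p i' X' p'] retract_zigzag[of P e c i' X' p' i X p] pi mate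
    by (simp add: arrD)
qed

end

section \<open>Mates of matrices and the evaluation of a direct sum\<close>

section \<open>Duality for matrices\<close>

text \<open>The number of the summand \<open>(a, b, c)\<close> in a threefold tensor product of
  lists of length \<open>n\<close>.\<close>

abbreviation (input) t3 :: "nat => nat => nat => nat => nat" where "t3 n a b c \<equiv> (a * n + b) * n + c"

lemma t3_simps:
  assumes "a < n" "b < n" "c < n"
  shows "t3 n a b c div n = a * n + b" "t3 n a b c mod n = c" "t3 n a b c div (n * n) = a"
    "t3 n a b c mod (n * n) = b * n + c" "t3 n a b c < n * (n * n)"
    "(a * n + b) div n = a" "(a * n + b) mod n = b" "a * n + b < n * n"
proof -
  show 1: "t3 n a b c div n = a * n + b" "t3 n a b c mod n = c" "(a * n + b) div n = a" "(a * n + b) mod n = b"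
    using assms by simp_all
  show "t3 n a b c div (n * n) = a" using 1 by (simp add: div_mult2_eq)
  then show "t3 n a b c mod (n * n) = b * n + c"
    using mult_div_mod_eq[of "n * n" "t3 n a b c"] by (simp add: algebra_simps)
  have b: "x * n + y < m * n" if "x < m" "y < n" for x y m
  proof -
    have "x * n + y < Suc x * n" using that by simp
    also have "... \<le> m * n" using that by (intro mult_le_mono1) simp
    finally show ?thesis .
  qed
  show 2: "a * n + b < n * n" using assms b by simp
  show "t3 n a b c < n * (n * n)" using b[OF 2 assms(3)] by (simp add: mult.assoc)
qed

lemma t3_ex:
  assumes "l < n * (n * n)"
  obtains a b c where "a < n" "b < n" "c < n" "l = t3 n a b c"
proof
  have n: "n > 0" using assms by (auto intro: ccontr)
  show "l div n div n < n" using assms by (simp add: less_mult_imp_div_less mult.assoc)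
  show "(l div n) mod n < n" "l mod n < n" using n by simp_all
  show "l = t3 n (l div n div n) ((l div n) mod n) (l mod n)" by simp
qed

lemma sum_t3_zero:
  fixes G :: "nat => complex"
  assumes "\<And>a b c. a < n ==> b < n ==> c < n ==> G (t3 n a b c) = 0"
  shows "(\<Sum>l<n * (n * n). G l) = 0"
  by (rule sum.neutral) (metis assms t3_ex lessThan_iff)

lemma sum_t3_single:
  fixes G :: "nat => complex"
  assumes "a < n" "b < n" "c < n"
    and "\<And>a' b' c'. a' < n ==> b' < n ==> c' < n ==> \<not> (a' = a \<and> b' = b \<and> c' = c) ==> G (t3 n a' b' c') = 0"
  shows "(\<Sum>l<n * (n * n). G l) = G (t3 n a b c)"
proof -
  have "(\<Sum>l<n * (n * n). G l) = (\<Sum>l\<in>{t3 n a b c}. G l)"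
  proof (rule sum.mono_neutral_right)
    show "\<forall>l\<in>{..<n * (n * n)} - {t3 n a b c}. G l = 0"
    proof
      fix l assume l: "l \<in> {..<n * (n * n)} - {t3 n a b c}"
      then have "l < n * (n * n)" by simp
      then obtain a' b' c' where "a' < n" "b' < n" "c' < n" "l = t3 n a' b' c'" by (rule t3_ex)
      then show "G l = 0" using assms(4)[of a' b' c'] l by auto
    qed
  qed (use t3_simps[OF assms(1-3)] in auto)
  then show ?thesis by simp
qed

context TL_ideal
begin

lemma K_interchange:
  assumes "f \<in> Hom K xs ys" "g \<in> Hom K ys zs" "f' \<in> Hom K xs' ys'" "g' \<in> Hom K ys' zs'"
  shows "cmp K (tens_mor K g g') (tens_mor K f f') = tens_mor K (cmp K g f) (cmp K g' f')"
proof -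
  obtain a where f: "f = mat xs ys a" and a: "VM xs ys a" using assms(1) by (auto simp: Hom_K)
  obtain b where g: "g = mat ys zs b" and b: "VM ys zs b" using assms(2) by (auto simp: Hom_K)
  obtain a' where f': "f' = mat xs' ys' a'" and a': "VM xs' ys' a'" using assms(3) by (auto simp: Hom_K)
  obtain b' where g': "g' = mat ys' zs' b'" and b': "VM ys' zs' b'" using assms(4) by (auto simp: Hom_K)
  show ?thesis unfolding f g f' g' K_tens[OF a a'] K_tens[OF b b'] K_cmp[OF a b] K_cmp[OF a' b']
      K_cmp[OF K_tens_VM[OF a a'] K_tens_VM[OF b b']] K_tens[OF K_cmp_VM K_cmp_VM]
  proof (rule mat_cong, rule ext)
    fix i j X assume "i < length (tl zs zs')" "j < length (tl xs xs')"
    then have i: "i < length zs * length zs'" and j: "j < length xs * length xs'" by simp_all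
    define i1 i2 j1 j2 where ij: "i1 = i div length zs'" "i2 = i mod length zs'" "j1 = j div length xs'" "j2 = j mod length xs'"
    have l: "i1 < length zs" "i2 < length zs'" "j1 < length xs" "j2 < length xs'"
      unfolding ij using div_mod_bound[OF i] div_mod_bound[OF j] by auto
    define F where "F p r = ttens (xs ! j1) (zs ! i1) (xs' ! j2) (zs' ! i2)
      (tcmp \<beta> (xs ! j1) (ys ! p) (zs ! i1) (b i1 p) (a p j1)) (tcmp \<beta> (xs' ! j2) (ys' ! r) (zs' ! i2) (b' i2 r) (a' r j2)) X" for p r
    have "(\<Sum>k<length (tl ys ys'). tcmp \<beta> (tl xs xs' ! j) (tl ys ys' ! k) (tl zs zs' ! i)
        (tmat ys zs ys' zs' b b' i k) (tmat xs ys xs' ys' a a' k j) X) =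
      (\<Sum>k<length ys * length ys'. F (k div length ys') (k mod length ys'))"
    proof (rule sum.cong)
      fix k assume "k \<in> {..<length ys * length ys'}"
      then have k: "k < length ys * length ys'" by simp
      note k' = div_mod_bound[OF k]
      show "tcmp \<beta> (tl xs xs' ! j) (tl ys ys' ! k) (tl zs zs' ! i)
        (tmat ys zs ys' zs' b b' i k) (tmat xs ys xs' ys' a a' k j) X = F (k div length ys') (k mod length ys')"
        unfolding F_def nth_tl[OF i] nth_tl[OF j] nth_tl[OF k] ij[symmetric]
        by (subst interchange) (use k' l a b a' b' in "simp_all add: VM_D")
    qed simp
    also have "... = (\<Sum>p<length ys. \<Sum>r<length ys'. F p r)" by (rule sum_div_mod)
    also have "... = ttens (xs ! j1) (zs ! i1) (xs' ! j2) (zs' ! i2)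
      (\<lambda>X. \<Sum>p<length ys. tcmp \<beta> (xs ! j1) (ys ! p) (zs ! i1) (b i1 p) (a p j1) X)
      (\<lambda>X. \<Sum>r<length ys'. tcmp \<beta> (xs' ! j2) (ys' ! r) (zs' ! i2) (b' i2 r) (a' r j2) X) X"
      unfolding F_def linop_sum[OF linop_ttens_left] linop_sum[OF linop_ttens_right] ..
    finally show "(\<Sum>k<length (tl ys ys'). tcmp \<beta> (tl xs xs' ! j) (tl ys ys' ! k) (tl zs zs' ! i)
        (tmat ys zs ys' zs' b b' i k) (tmat xs ys xs' ys' a a' k j) X) =
      tmat xs zs xs' zs' (\<lambda>i j X. \<Sum>p<length ys. tcmp \<beta> (xs ! j) (ys ! p) (zs ! i) (b i p) (a p j) X)
      (\<lambda>i j X. \<Sum>r<length ys'. tcmp \<beta> (xs' ! j) (ys' ! r) (zs' ! i) (b' i r) (a' r j) X) i j X"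
      unfolding ij .
  qed
qed

definition evm where "evm xs i j = (if j div length xs = j mod length xs then capc (xs ! (j div length xs)) else z0)"
definition cvm where "cvm xs i j = (if i div length xs = i mod length xs then cupc (xs ! (i div length xs)) else z0)"

lemma evm_VM: "VM (tl xs xs) [0] (evm xs)" by (rule VM_I) (simp add: evm_def nth_tl)

lemma cvm_VM: "VM [0] (tl xs xs) (cvm xs)" by (rule VM_I) (simp add: cvm_def nth_tl)

lemma K_dual [simp]:
  "unit_ob K = [0]" "tens_ob K = tl" "ldual K xs = xs" "rdual K xs = xs" "pivot K xs = idm K xs"
  "ev_r K xs = mat (tl xs xs) [0] (evm xs)" "ev_l K xs = mat (tl xs xs) [0] (evm xs)"
  "coev_r K xs = mat [0] (tl xs xs) (cvm xs)" "coev_l K xs = mat [0] (tl xs xs) (cvm xs)"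
proof -
  show "unit_ob K = [0]" "tens_ob K = tl" "ldual K xs = xs" "rdual K xs = xs"
    by (simp_all add: additive_completion_def)
  show "pivot K xs = idm K xs" by (simp add: additive_completion_def) (rule mk_mat_cong, simp)
  show "ev_r K xs = mat (tl xs xs) [0] (evm xs)" "ev_l K xs = mat (tl xs xs) [0] (evm xs)"
    unfolding mat_def evm_def by (simp_all add: additive_completion_def Let_def) (rule mk_mat_cong, simp add: nth_tl)+
  show "coev_r K xs = mat [0] (tl xs xs) (cvm xs)" "coev_l K xs = mat [0] (tl xs xs) (cvm xs)"
    unfolding mat_def cvm_def by (simp_all add: additive_completion_def Let_def) (rule mk_mat_cong, simp add: nth_tl)+
qed

text \<open>The transposed matrix with every entry turned by half a revolution.\<close>

definition matd where "matd xs a i j = rotc (xs ! i) (xs ! j) (a j i)"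

lemma matd_VM: "VM xs xs (matd xs a)" by (rule VM_I) (simp add: matd_def)

lemma tl_nth_t3:
  assumes "a < length xs" "b < length xs" "c < length xs"
  shows "tl xs (tl xs xs) ! (t3 (length xs) a b c) = xs ! a + (xs ! b + xs ! c)"
    "tl xs xs ! (a * length xs + b) = xs ! a + xs ! b"
  using t3_simps[OF assms] t3_simps[OF assms(2,3,1)] by (simp_all add: nth_tl)

lemma M2_entry:
  assumes "l1 < length xs" "l2 < length xs" "l3 < length xs" "k1 < length xs" "k2 < length xs" "k3 < length xs"
  shows "tmat xs xs (tl xs xs) (tl xs xs) (idmat xs) (tmat xs xs xs xs a (idmat xs)) (t3 (length xs) l1 l2 l3) (t3 (length xs) k1 k2 k3) =
    (if l1 = k1 \<and> l3 = k3 then ttens (xs ! k1) (xs ! k1) (xs ! k2 + xs ! k3) (xs ! l2 + xs ! k3) (idc (xs ! k1))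
      (ttens (xs ! k2) (xs ! l2) (xs ! k3) (xs ! k3) (a l2 k2) (idc (xs ! k3))) else z0)"
  unfolding length_tl t3_simps(1-4)[OF assms(1-3)] t3_simps(1-4)[OF assms(4-6)] t3_simps(6,7)[OF assms(2,3,1)] t3_simps(6,7)[OF assms(5,6,4)]
    tl_nth_t3(2)[OF assms(2,3,1)] tl_nth_t3(2)[OF assms(5,6,4)]
  by (cases "l1 = k1"; cases "l3 = k3"; simp add: idmat_def)

text \<open>Identity, evaluation and coevaluation matrices are so sparse that for the entry at
  \<open>i\<close>, \<open>j\<close> one path survives: it passes through the triples
  \<open>(i, i, j)\<close> and \<open>(i, j, j)\<close>. Its contribution is a right mate in
  \<open>TL \<beta>\<close>.\<close>

lemma rdual_mat:
  assumes a: "VM xs xs a"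
  shows "rdual_mor K xs xs (mat xs xs a) = mat xs xs (matd xs a)"
proof -
  let ?n = "length xs" and ?T = "tl xs (tl xs xs)"
  define M1 where "M1 = tmat xs xs (tl xs xs) [0] (idmat xs) (evm xs)"
  define M2 where "M2 = tmat xs xs (tl xs xs) (tl xs xs) (idmat xs) (tmat xs xs xs xs a (idmat xs))"
  define M3 where "M3 = tmat [0] (tl xs xs) xs xs (cvm xs) (idmat xs)"
  note M_defs = M1_def M2_def M3_def
  let ?W = "\<lambda>i k X. \<Sum>l<length ?T. tcmp \<beta> (?T ! k) (?T ! l) (xs ! i) (M1 i l) (M2 l k) X"
  have 1: "VM ?T xs M1" unfolding M_defs using K_tens_VM[OF idmat_VM evm_VM, of xs xs] by simp
  have 2: "VM ?T ?T M2" unfolding M_defs using K_tens_VM[OF idmat_VM K_tens_VM[OF a idmat_VM], of xs xs] .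
  have 3: "VM xs ?T M3" unfolding M_defs using K_tens_VM[OF cvm_VM idmat_VM, of xs xs] by (simp add: tl_assoc)
  have "rdual_mor K xs xs (mat xs xs a) = cmp K (cmp K (mat ?T xs M1) (mat ?T ?T M2)) (mat xs ?T M3)"
    unfolding rdual_mor_def right_mate_def K_dual K_id
      K_tens[OF a idmat_VM] K_tens[OF idmat_VM K_tens_VM[OF a idmat_VM]] K_tens[OF idmat_VM evm_VM] K_tens[OF cvm_VM idmat_VM]
    by (simp add: tl_assoc M_defs)
  also have "... = mat xs xs (\<lambda>i j X. \<Sum>k<length ?T. tcmp \<beta> (xs ! j) (?T ! k) (xs ! i) (?W i k) (M3 k j) X)"
    unfolding K_cmp[OF 2 1] by (rule K_cmp[OF 3 K_cmp_VM])
  also have "... = mat xs xs (matd xs a)"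
  proof (rule mat_cong, rule ext)
    fix i j X assume i: "i < ?n" and j: "j < ?n"
    have M2: "M2 (t3 ?n l1 l2 l3) (t3 ?n k1 k2 k3) =
      (if l1 = k1 \<and> l3 = k3 then ttens (xs ! k1) (xs ! k1) (xs ! k2 + xs ! k3) (xs ! l2 + xs ! k3) (idc (xs ! k1))
        (ttens (xs ! k2) (xs ! l2) (xs ! k3) (xs ! k3) (a l2 k2) (idc (xs ! k3))) else z0)"
      if "l1 < ?n" "l2 < ?n" "l3 < ?n" "k1 < ?n" "k2 < ?n" "k3 < ?n" for l1 l2 l3 k1 k2 k3
      unfolding M2_def by (rule M2_entry[OF that])
    have M1: "M1 i (t3 ?n l1 l2 l3) = (if l1 = i \<and> l2 = l3 then ttens (xs ! i) (xs ! i) (xs ! l2 + xs ! l2) 0 (idc (xs ! i)) (capc (xs ! l2)) else z0)"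
      if "l1 < ?n" "l2 < ?n" "l3 < ?n" for l1 l2 l3
      unfolding M_defs using that t3_simps[OF that] t3_simps[OF that(2,3,1)] i tl_nth_t3(2)[of l2 xs l3 l1] tl_nth_t3(2)[of l1 xs l2 l3] by (auto simp: idmat_def evm_def)
    have M3: "M3 (t3 ?n k1 k2 k3) j = (if k1 = k2 \<and> k3 = j then ttens 0 (xs ! k1 + xs ! k1) (xs ! j) (xs ! j) (cupc (xs ! k1)) (idc (xs ! j)) else z0)"
      if "k1 < ?n" "k2 < ?n" "k3 < ?n" for k1 k2 k3
      unfolding M_defs using that t3_simps[OF that] t3_simps[OF that(2,3,1)] j tl_nth_t3(2)[of k2 xs k3 k1] tl_nth_t3(2)[of k1 xs k2 k3] by (auto simp: idmat_def cvm_def)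
    \<comment> \<open>The identity strand on the left fixes the first index.\<close>
    have W0: "?W i (t3 ?n k1 k2 k3) = z0" if k: "k1 < ?n" "k2 < ?n" "k3 < ?n" "k1 \<noteq> i" for k1 k2 k3
    proof
      fix X show "?W i (t3 ?n k1 k2 k3) X = 0" unfolding length_tl
        by (rule sum_t3_zero) (use k in "auto simp: M1 M2[OF _ _ _ k(1-3)]")
    qed
    \<comment> \<open>The evaluation joins the last two indices and the identity on the right
      preserves the third, so both become \<open>j\<close>.\<close>
    have W: "?W i (t3 ?n i i j) = tcmp \<beta> (xs ! i + (xs ! i + xs ! j)) (xs ! i + (xs ! j + xs ! j)) (xs ! i)
        (ttens (xs ! i) (xs ! i) (xs ! j + xs ! j) 0 (idc (xs ! i)) (capc (xs ! j)))
        (ttens (xs ! i) (xs ! i) (xs ! i + xs ! j) (xs ! j + xs ! j) (idc (xs ! i)) (ttens (xs ! i) (xs ! j) (xs ! j) (xs ! j) (a j i) (idc (xs ! j))))"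
      unfolding length_tl by (rule ext, subst sum_t3_single[OF i j j]) (use i j in "auto simp: M1 M2[OF _ _ _ i i j] tl_nth_t3")
    have "(\<Sum>k<length ?T. tcmp \<beta> (xs ! j) (?T ! k) (xs ! i) (?W i k) (M3 k j) X) =
        tcmp \<beta> (xs ! j) (?T ! t3 ?n i i j) (xs ! i) (?W i (t3 ?n i i j)) (M3 (t3 ?n i i j) j) X"
      unfolding length_tl
    proof (rule sum_t3_single[OF i i j])
      fix a' b' c' assume l: "a' < ?n" "b' < ?n" "c' < ?n" and n: "\<not> (a' = i \<and> b' = i \<and> c' = j)"
      consider "a' \<noteq> i" | "\<not> (a' = b' \<and> c' = j)" using n by blast
      then show "tcmp \<beta> (xs ! j) (?T ! t3 ?n a' b' c') (xs ! i) (\<lambda>X. \<Sum>l<?n * (?n * ?n). tcmp \<beta> (?T ! t3 ?n a' b' c') (?T ! l) (xs ! i) (M1 i l) (M2 l (t3 ?n a' b' c')) X) (M3 (t3 ?n a' b' c') j) X = 0"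
      proof cases
        case 1
        show ?thesis unfolding W0[OF l 1, unfolded length_tl] by simp
      next
        case 2
        have "M3 (t3 ?n a' b' c') j = z0" unfolding M3[OF l] by (rule if_not_P[OF 2])
        then show ?thesis by simp
      qed
    qed
    also have "... = rotc (xs ! i) (xs ! j) (a j i) X"
      unfolding W unfolding M3[OF i i j] tl_nth_t3(1)[OF i i j] using right_mate_coeffs[of "a j i" "xs ! i" "xs ! j"] VM_D[OF a j i] by simp
    finally show "(\<Sum>k<length ?T. tcmp \<beta> (xs ! j) (?T ! k) (xs ! i) (?W i k) (M3 k j) X) = matd xs a i j X"
      by (simp only: matd_def)
  qed
  finally show ?thesis .
qed

text \<open>The mirror image: the surviving triples are now \<open>(j, i, i)\<close> and
  \<open>(j, j, i)\<close>, and a left mate in \<open>TL \<beta>\<close> appears. Since it is the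
  same half turn, the matrix agrees with that of the right dual.\<close>

lemma ldual_mat:
  assumes a: "VM xs xs a"
  shows "ldual_mor K xs xs (mat xs xs a) = mat xs xs (matd xs a)"
proof -
  let ?n = "length xs" and ?T = "tl xs (tl xs xs)"
  define M1 where "M1 = tmat (tl xs xs) [0] xs xs (evm xs) (idmat xs)"
  define M2 where "M2 = tmat xs xs (tl xs xs) (tl xs xs) (idmat xs) (tmat xs xs xs xs a (idmat xs))"
  define M3 where "M3 = tmat xs xs [0] (tl xs xs) (idmat xs) (cvm xs)"
  note M_defs = M1_def M2_def M3_def
  let ?W = "\<lambda>i k X. \<Sum>l<length ?T. tcmp \<beta> (?T ! k) (?T ! l) (xs ! i) (M1 i l) (M2 l k) X"
  have 1: "VM ?T xs M1" unfolding M_defs using K_tens_VM[OF evm_VM idmat_VM, of xs xs] by (simp add: tl_assoc)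
  have 2: "VM ?T ?T M2" unfolding M_defs using K_tens_VM[OF idmat_VM K_tens_VM[OF a idmat_VM], of xs xs] .
  have 3: "VM xs ?T M3" unfolding M_defs using K_tens_VM[OF idmat_VM cvm_VM, of xs xs] by simp
  have "ldual_mor K xs xs (mat xs xs a) = cmp K (cmp K (mat ?T xs M1) (mat ?T ?T M2)) (mat xs ?T M3)"
    unfolding ldual_mor_def left_mate_def K_dual K_id
      K_tens[OF a idmat_VM] K_tens[OF idmat_VM K_tens_VM[OF a idmat_VM]] K_tens[OF evm_VM idmat_VM] K_tens[OF idmat_VM cvm_VM]
    by (simp add: tl_assoc M_defs)
  also have "... = mat xs xs (\<lambda>i j X. \<Sum>k<length ?T. tcmp \<beta> (xs ! j) (?T ! k) (xs ! i) (?W i k) (M3 k j) X)"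
    unfolding K_cmp[OF 2 1] by (rule K_cmp[OF 3 K_cmp_VM])
  also have "... = mat xs xs (matd xs a)"
  proof (rule mat_cong, rule ext)
    fix i j X assume i: "i < ?n" and j: "j < ?n"
    have M2: "M2 (t3 ?n l1 l2 l3) (t3 ?n k1 k2 k3) =
      (if l1 = k1 \<and> l3 = k3 then ttens (xs ! k1) (xs ! k1) (xs ! k2 + xs ! k3) (xs ! l2 + xs ! k3) (idc (xs ! k1))
        (ttens (xs ! k2) (xs ! l2) (xs ! k3) (xs ! k3) (a l2 k2) (idc (xs ! k3))) else z0)"
      if "l1 < ?n" "l2 < ?n" "l3 < ?n" "k1 < ?n" "k2 < ?n" "k3 < ?n" for l1 l2 l3 k1 k2 k3
      unfolding M2_def by (rule M2_entry[OF that])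
    have M1: "M1 i (t3 ?n l1 l2 l3) = (if l1 = l2 \<and> l3 = i then ttens (xs ! l1 + xs ! l1) 0 (xs ! i) (xs ! i) (capc (xs ! l1)) (idc (xs ! i)) else z0)"
      if "l1 < ?n" "l2 < ?n" "l3 < ?n" for l1 l2 l3
      unfolding M_defs using that t3_simps[OF that] t3_simps[OF that(2,3,1)] i tl_nth_t3(2)[of l2 xs l3 l1] tl_nth_t3(2)[of l1 xs l2 l3] by (auto simp: idmat_def evm_def)
    have M3: "M3 (t3 ?n k1 k2 k3) j = (if k1 = j \<and> k2 = k3 then ttens (xs ! j) (xs ! j) 0 (xs ! k2 + xs ! k2) (idc (xs ! j)) (cupc (xs ! k2)) else z0)"
      if "k1 < ?n" "k2 < ?n" "k3 < ?n" for k1 k2 k3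
      unfolding M_defs using that t3_simps[OF that] t3_simps[OF that(2,3,1)] j tl_nth_t3(2)[of k2 xs k3 k1] tl_nth_t3(2)[of k1 xs k2 k3] by (auto simp: idmat_def cvm_def)
    have W0: "?W i (t3 ?n k1 k2 k3) = z0" if k: "k1 < ?n" "k2 < ?n" "k3 < ?n" "k3 \<noteq> i" for k1 k2 k3
    proof
      fix X show "?W i (t3 ?n k1 k2 k3) X = 0" unfolding length_tl
        by (rule sum_t3_zero) (use k in "auto simp: M1 M2[OF _ _ _ k(1-3)]")
    qed
    have W: "?W i (t3 ?n j i i) = tcmp \<beta> (xs ! j + (xs ! i + xs ! i)) (xs ! j + (xs ! j + xs ! i)) (xs ! i)
        (ttens (xs ! j + xs ! j) 0 (xs ! i) (xs ! i) (capc (xs ! j)) (idc (xs ! i)))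
        (ttens (xs ! j) (xs ! j) (xs ! i + xs ! i) (xs ! j + xs ! i) (idc (xs ! j)) (ttens (xs ! i) (xs ! j) (xs ! i) (xs ! i) (a j i) (idc (xs ! i))))"
      unfolding length_tl by (rule ext, subst sum_t3_single[OF j j i]) (use i j in "auto simp: M1 M2[OF _ _ _ j i i] tl_nth_t3")
    have "(\<Sum>k<length ?T. tcmp \<beta> (xs ! j) (?T ! k) (xs ! i) (?W i k) (M3 k j) X) =
        tcmp \<beta> (xs ! j) (?T ! t3 ?n j i i) (xs ! i) (?W i (t3 ?n j i i)) (M3 (t3 ?n j i i) j) X"
      unfolding length_tl
    proof (rule sum_t3_single[OF j i i])
      fix a' b' c' assume l: "a' < ?n" "b' < ?n" "c' < ?n" and n: "\<not> (a' = j \<and> b' = i \<and> c' = i)"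
      consider "c' \<noteq> i" | "\<not> (a' = j \<and> b' = c')" using n by blast
      then show "tcmp \<beta> (xs ! j) (?T ! t3 ?n a' b' c') (xs ! i) (\<lambda>X. \<Sum>l<?n * (?n * ?n). tcmp \<beta> (?T ! t3 ?n a' b' c') (?T ! l) (xs ! i) (M1 i l) (M2 l (t3 ?n a' b' c')) X) (M3 (t3 ?n a' b' c') j) X = 0"
      proof cases
        case 1
        show ?thesis unfolding W0[OF l 1, unfolded length_tl] by simp
      next
        case 2
        have "M3 (t3 ?n a' b' c') j = z0" unfolding M3[OF l] by (rule if_not_P[OF 2])
        then show ?thesis by simp
      qed
    qed
    also have "... = rotc (xs ! i) (xs ! j) (a j i) X"
      unfolding W unfolding M3[OF j i i] tl_nth_t3(1)[OF j i i] using left_mate_coeffs[of "a j i" "xs ! i" "xs ! j"] VM_D[OF a j i] by simp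
    finally show "(\<Sum>k<length ?T. tcmp \<beta> (xs ! j) (?T ! k) (xs ! i) (?W i k) (M3 k j) X) = matd xs a i j X"
      by (simp only: matd_def)
  qed
  finally show ?thesis .
qed

abbreviation rd where "rd xs \<equiv> rdual_mor K xs xs"

lemma ldual_eq_rdual: "f \<in> Hom K xs xs ==> ldual_mor K xs xs f = rd xs f"
  by (auto simp: Hom_K ldual_mat rdual_mat)

lemma rd_Hom: "f \<in> Hom K xs xs ==> rd xs f \<in> Hom K xs xs"
  using rdual_mat matd_VM mat_Hom by (auto simp: Hom_K)

lemma rd_rd: "f \<in> Hom K xs xs ==> rd xs (rd xs f) = f"
proof -
  assume "f \<in> Hom K xs xs"
  then obtain a where f: "f = mat xs xs a" and a: "VM xs xs a" by (auto simp: Hom_K)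
  show ?thesis unfolding f rdual_mat[OF a] rdual_mat[OF matd_VM]
    by (rule mat_cong) (use a in "simp add: matd_def rotc_rotc VM_D")
qed

lemma rd_id: "rd xs (idm K xs) = idm K xs"
proof -
  have "rotc m n z0 = z0" for m n by (rule linop_zero[OF linop_rotc])
  then show ?thesis unfolding K_id rdual_mat[OF idmat_VM]
    by (intro mat_cong) (simp add: matd_def idmat_def rotc_id)
qed

lemma rd_cmp:
  assumes "f \<in> Hom K xs xs" "g \<in> Hom K xs xs"
  shows "rd xs (cmp K g f) = cmp K (rd xs f) (rd xs g)"
proof -
  obtain a where f: "f = mat xs xs a" and a: "VM xs xs a" using assms(1) by (auto simp: Hom_K)
  obtain b where g: "g = mat xs xs b" and b: "VM xs xs b" using assms(2) by (auto simp: Hom_K)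
  show ?thesis unfolding f g K_cmp[OF a b] rdual_mat[OF a] rdual_mat[OF b] rdual_mat[OF K_cmp_VM] K_cmp[OF matd_VM matd_VM]
  proof (rule mat_cong)
    fix i j assume i: "i < length xs" and j: "j < length xs"
    have "rotc (xs ! i) (xs ! j) (\<lambda>X. \<Sum>k<length xs. tcmp \<beta> (xs ! i) (xs ! k) (xs ! j) (b j k) (a k i) X) =
        (\<lambda>X. \<Sum>k<length xs. rotc (xs ! i) (xs ! j) (tcmp \<beta> (xs ! i) (xs ! k) (xs ! j) (b j k) (a k i)) X)"
      by (rule linop_sum[OF linop_rotc])
    also have "... = (\<lambda>X. \<Sum>k<length xs. tcmp \<beta> (xs ! j) (xs ! k) (xs ! i) (matd xs a i k) (matd xs b k j) X)"
      using i j a b by (intro ext sum.cong refl) (simp add: matd_def rotc_tcmp VM_D)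
    finally show "matd xs (\<lambda>i j X. \<Sum>k<length xs. tcmp \<beta> (xs ! j) (xs ! k) (xs ! i) (b i k) (a k j) X) i j =
        (\<lambda>X. \<Sum>k<length xs. tcmp \<beta> (xs ! j) (xs ! k) (xs ! i) (matd xs a i k) (matd xs b k j) X)"
      unfolding matd_def .
  qed
qed

text \<open>The projection of a direct sum onto its summand number \<open>k\<close>.\<close>

definition row where "row xs k = (\<lambda>_ j. if j = k then idc (xs ! k) else z0)"

lemma row_VM: "k < length xs ==> VM xs [xs ! k] (row xs k)" by (rule VM_I) (auto simp: row_def)

lemma ev_row:
  assumes k: "k < length xs"
  shows "cmp K (mat (tl [xs ! k] [xs ! k]) [0] (evm [xs ! k])) (tens_mor K (mat xs [xs ! k] (row xs k)) (mat xs [xs ! k] (row xs k))) =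
    mat (tl xs xs) [0] (\<lambda>_ j. if j div length xs = k \<and> j mod length xs = k then capc (xs ! k) else z0)"
  unfolding K_tens[OF row_VM[OF k] row_VM[OF k]] K_cmp[OF K_tens_VM[OF row_VM[OF k] row_VM[OF k]] evm_VM]
proof (rule mat_cong, rule ext)
  fix i j X assume i: "i < length [0 :: nat]" and "j < length (tl xs xs)"
  then have j: "j < length xs * length xs" by simp
  have "tl [xs ! k] [xs ! k] ! 0 = xs ! k + xs ! k" by (simp add: nth_tl)
  then show "(\<Sum>l<length (tl [xs ! k] [xs ! k]). tcmp \<beta> (tl xs xs ! j) (tl [xs ! k] [xs ! k] ! l) ([0] ! i) (evm [xs ! k] i l)
      (tmat xs [xs ! k] xs [xs ! k] (row xs k) (row xs k) l j) X) =
    (if j div length xs = k \<and> j mod length xs = k then capc (xs ! k) else z0) X"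
    using i j by (auto simp: row_def evm_def nth_tl ttens_id tcmp_id_right)
qed

lemma K_sum:
  assumes "\<And>k. k \<in> set ks ==> VM xs ys (h k)"
  shows "sum_mor K xs ys (map (\<lambda>k. mat xs ys (h k)) ks) = mat xs ys (\<lambda>i j X. \<Sum>k\<leftarrow>ks. h k i j X) \<and>
    VM xs ys (\<lambda>i j X. \<Sum>k\<leftarrow>ks. h k i j X)"
  using assms
proof (induction ks)
  case (Cons k ks)
  then have "VM xs ys (h k)" "VM xs ys (\<lambda>i j X. \<Sum>k\<leftarrow>ks. h k i j X)" by simp_all
  then have "VM xs ys (\<lambda>i j X. h k i j X + (\<Sum>k\<leftarrow>ks. h k i j X))" unfolding VM_def by (simp add: V_add)
  then show ?case using Cons by (simp add: sum_mor_def K_add)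
qed (auto simp: sum_mor_def K_zero intro: VM_I)

text \<open>The evaluation of a direct sum is the sum of the evaluations of the summands, restricted
  along the projections. It reduces the symmetry of the trace for lists to single objects.\<close>

lemma ev_sum: "mat (tl xs xs) [0] (evm xs) = sum_mor K (tl xs xs) [0] (map (\<lambda>k.
    cmp K (mat (tl [xs ! k] [xs ! k]) [0] (evm [xs ! k])) (tens_mor K (mat xs [xs ! k] (row xs k)) (mat xs [xs ! k] (row xs k)))) [0..<length xs])"
proof -
  let ?h = "\<lambda>k _ j. if j div length xs = k \<and> j mod length xs = k then capc (xs ! k) else z0"
  have VM: "VM (tl xs xs) [0] (?h k)" for k by (rule VM_I) (simp add: nth_tl)
  have "map (\<lambda>k. cmp K (mat (tl [xs ! k] [xs ! k]) [0] (evm [xs ! k])) (tens_mor K (mat xs [xs ! k] (row xs k)) (mat xs [xs ! k] (row xs k)))) [0..<length xs] =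
      map (\<lambda>k. mat (tl xs xs) [0] (?h k)) [0..<length xs]"
    by (intro map_cong refl ev_row) simp
  moreover have "sum_mor K (tl xs xs) [0] (map (\<lambda>k. mat (tl xs xs) [0] (?h k)) [0..<length xs]) =
      mat (tl xs xs) [0] (\<lambda>i j X. \<Sum>k\<leftarrow>[0..<length xs]. ?h k i j X)"
    by (intro conjunct1[OF K_sum] VM)
  moreover have "... = mat (tl xs xs) [0] (evm xs)"
  proof (rule mat_cong, rule ext)
    fix i j X assume "j < length (tl xs xs)"
    then have j: "j div length xs < length xs" using div_mod_bound by simp
    have "(\<Sum>k\<leftarrow>[0..<length xs]. ?h k i j X) = (\<Sum>k<length xs. if k = j div length xs then evm xs i j X else 0)"
      unfolding interv_sum_list_conv_sum_set_nat atLeast0LessThan[symmetric] by (intro sum.cong) (auto simp: evm_def)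
    then show "(\<Sum>k\<leftarrow>[0..<length xs]. ?h k i j X) = evm xs i j X" using j by simp
  qed
  ultimately show ?thesis by (simp only:)
qed

end

section \<open>Innermost arcs as factors\<close>

section \<open>Removing an innermost arc\<close>

text \<open>The remaining arcs are renumbered so that the gap closes. The renumbering is monotone,
  which preserves the noncrossing condition, and \<open>stack_cap_at\<close> restores the
  arc.\<close>

lemma inner_arc_decomposition:
  assumes D: "D \<in> diagrams (i + (2 + r)) 0" and a: "{Bot i, Bot (Suc i)} \<in> D"
  shows "\<exists>D'\<in>diagrams (i + r) 0. stack D' (cap_at i r) = D \<and> loops D' (cap_at i r) = 0"
proof -
  note d = diagramsD[OF D]
  let ?s = "skip_point i" and ?a = "{Bot i, Bot (Suc i)}"
  define D0 where "D0 = D - {?a}"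
  define D' where "D' = (\<lambda>b. ?s -` b) ` D0"
  have sub: "b \<subseteq> points (i + (2 + r)) 0" if "b \<in> D0" for b using that d(4) by (auto simp: D0_def)
  have arc: "Bot i \<notin> b" "Bot (Suc i) \<notin> b" if "b \<in> D0" for b
    using block_unique[OF D _ a, of b] that by (auto simp: D0_def)
  have rng: "b \<subseteq> range ?s" if b: "b \<in> D0" for b
  proof
    fix x assume x: "x \<in> b"
    then obtain k where "x = Bot k" using sub[OF b] by (auto simp: points_def)
    then show "x \<in> range ?s" using arc[OF b] x by (auto simp: range_skip)
  qed
  have ret: "?s ` (?s -` b) = b" if "b \<in> D0" for b using rng[OF that] by (simp add: image_vimage_eq Int_absorb2)
  have D'_D: "?s ` c \<in> D" if c: "c \<in> D'" for c
  proof -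
    obtain b where "b \<in> D0" "c = ?s -` b" using c by (auto simp: D'_def)
    then show ?thesis using ret[of b] by (simp add: D0_def)
  qed
  have pts: "?s x \<in> points (i + (2 + r)) 0 \<longleftrightarrow> x \<in> points (i + r) 0" for x by (cases x) (auto simp: points_def)
  have nota: "?s x \<notin> ?a" for x using range_skip[of i i] range_skip[of "Suc i" i] by (auto simp del: skip_point.simps) (metis rangeI)+
  have "partition_on (points (i + r) 0) D'"
  proof (rule partition_onI)
    show "\<Union>D' = points (i + r) 0"
    proof (intro set_eqI iffI)
      fix x assume "x \<in> \<Union>D'"
      then obtain b where "b \<in> D0" "?s x \<in> b" by (auto simp: D'_def)
      then show "x \<in> points (i + r) 0" using sub pts by blast
    next
      fix x assume "x \<in> points (i + r) 0"
      then have "?s x \<in> \<Union>D" using pts d(4) by simp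
      then obtain b where b: "b \<in> D" "?s x \<in> b" by blast
      then have "b \<in> D0" using nota by (auto simp: D0_def)
      then show "x \<in> \<Union>D'" using b by (auto simp: D'_def)
    qed
    show "{} \<notin> D'"
    proof
      assume "{} \<in> D'"
      from D'_D[OF this] show False using d(2) by fastforce
    qed
    fix p p' assume "p \<in> D'" "p' \<in> D'" "p \<noteq> p'"
    then obtain b b' where b: "b \<in> D0" "p = ?s -` b" "b' \<in> D0" "p' = ?s -` b'" "b \<noteq> b'" by (auto simp: D'_def)
    then have "b \<inter> b' = {}" using partition_onD2[OF d(1)] by (auto simp: D0_def disjoint_def)
    then show "disjnt p p'" using b by (auto simp: disjnt_def)
  qed
  moreover have "\<forall>c\<in>D'. card c = 2"
  proof
    fix c assume c: "c \<in> D'"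
    have "card (?s ` c) = card c" by (rule card_image[OF inj_on_subset[OF inj_skip]]) simp
    then show "card c = 2" using d(2)[OF D'_D[OF c]] by simp
  qed
  moreover have "noncrossing (i + r) 0 D'"
  proof (rule noncrossingI)
    fix u v w z
    assume 1: "{u, v} \<in> D'" "{w, z} \<in> D'" and lt: "boundary_pos (i + r) 0 u < boundary_pos (i + r) 0 w"
      "boundary_pos (i + r) 0 w < boundary_pos (i + r) 0 v" "boundary_pos (i + r) 0 v < boundary_pos (i + r) 0 z"
    have 2: "{?s u, ?s v} \<in> D" "{?s w, ?s z} \<in> D" using D'_D[OF 1(1)] D'_D[OF 1(2)] by simp_all
    have "?s u \<in> points (i + (2 + r)) 0" "?s v \<in> points (i + (2 + r)) 0" "?s w \<in> points (i + (2 + r)) 0" "?s z \<in> points (i + (2 + r)) 0"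
      using 2 d(4) by blast+
    then obtain u' v' w' z' where e: "u = Bot u'" "v = Bot v'" "w = Bot w'" "z = Bot z'"
      unfolding pts by (auto simp: points_def)
    have m: "boundary_pos (i + (2 + r)) 0 (?s (Bot x)) < boundary_pos (i + (2 + r)) 0 (?s (Bot y))" if "x < y" for x y
      using that by auto
    have "boundary_pos (i + (2 + r)) 0 (?s u) < boundary_pos (i + (2 + r)) 0 (?s w)"
      "boundary_pos (i + (2 + r)) 0 (?s w) < boundary_pos (i + (2 + r)) 0 (?s v)"
      "boundary_pos (i + (2 + r)) 0 (?s v) < boundary_pos (i + (2 + r)) 0 (?s z)"
      unfolding e by (rule m; use lt e in simp)+
    then show False using d(3) 2 unfolding noncrossing_def by blast
  qed
  ultimately have D'd: "D' \<in> diagrams (i + r) 0" by (simp add: diagrams_def)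
  have "(\<lambda>b. ?s ` b) ` D' = D0" unfolding D'_def image_image using ret by simp
  then have "insert ?a ((\<lambda>b. ?s ` b) ` D') = D" using a by (auto simp: D0_def)
  then show ?thesis using stack_cap_at[OF D'd] D'd by auto
qed

text \<open>A rainbow grows from the inside, by an arc in the middle.\<close>

lemma stack_cap_cap_at: "stack (cap_diagram n) (cap_at n n) = cap_diagram (Suc n) \<and> loops (cap_diagram n) (cap_at n n) = 0"
proof -
  have "(\<lambda>b. skip_point n ` b) ` cap_diagram n = (\<lambda>i. {Bot i, Bot (2 * Suc n - 1 - i)}) ` {..<n}"
    unfolding cap_diagram_def image_image by (intro image_cong refl) (auto simp: Suc_diff_Suc numeral_2_eq_2)
  then have "insert {Bot n, Bot (Suc n)} ((\<lambda>b. skip_point n ` b) ` cap_diagram n) = cap_diagram (Suc n)"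
    by (simp add: cap_diagram_def lessThan_Suc)
  then show ?thesis using stack_cap_at[of "cap_diagram n" n n] cap_diagram_closed[of n] by simp
qed

lemma cap_at_left: "juxtapose i i (id_diagram i) (cap_at j r) = cap_at (i + j) r"
  unfolding juxtapose_id[symmetric] juxtapose_assoc ..

lemma cap_at_right: "juxtapose (j + (2 + r)) (j + r) (cap_at j r) (id_diagram s) = cap_at j (r + s)"
proof -
  have "juxtapose (j + (2 + r)) (j + (0 + r)) (cap_at j r) (id_diagram s) = cap_at j (r + s)"
    unfolding juxtapose_assoc juxtapose_id ..
  then show ?thesis by simp
qed

abbreviation "catc i r \<equiv> dg (cap_at i r)"

lemma catc_V [simp]: "catc i r \<in> V (i + (2 + r)) (i + r)" by (rule dg_V[OF cap_at_closed])

lemma ttens_catc_left: "ttens i i (j + (2 + r)) (j + r) (idc i) (catc j r) = catc (i + j) r"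
  by (simp only: ttens_dg[OF id_diagram_closed cap_at_closed] cap_at_left)

lemma ttens_catc_right: "ttens (j + (2 + r)) (j + r) s s (catc j r) (idc s) = catc j (r + s)"
  by (simp only: ttens_dg[OF cap_at_closed id_diagram_closed] cap_at_right)

lemma capc_catc: "tcmp \<beta> (n + (2 + n)) (n + n) 0 (capc n) (catc n n) = capc (Suc n)"
  by (rule tcmp_dg'[OF cap_at_closed cap_diagram_closed stack_cap_cap_at])

lemma catc_0: "ttens i i 2 0 (idc i) (capc 1) = catc i 0"
proof -
  have "cap_diagram 1 \<in> diagrams 2 0" using cap_diagram_closed[of 1] by (simp add: numeral_2_eq_2)
  then show ?thesis by (simp add: ttens_dg id_diagram_closed) (simp add: juxtapose_def id_diagram_def)
qed

lemma catc_cap: "ttens n n (2 + n) n (idc n) (ttens 2 0 n n (capc 1) (idc n)) = catc n n"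
proof -
  have "cap_diagram 1 \<in> diagrams 2 0" using cap_diagram_closed[of 1] by (simp add: numeral_2_eq_2)
  then show ?thesis using juxtapose_closed[of "cap_diagram 1" 2 0 "id_diagram n" n n]
    by (simp add: ttens_dg id_diagram_closed)
qed

lemma capc_0: "capc 0 = idc 0" by (simp add: cap_diagram_def id_diagram_def)

section \<open>Objects of the fusion category as retracts of lists\<close>

section \<open>The idempotent completion\<close>

context TL_ideal
begin

abbreviation CC where "CC \<equiv> TL_fusion \<beta> N"

lemma CC_simps [simp]:
  "(xs, e) \<in> Ob CC \<longleftrightarrow> e \<in> Hom K xs xs \<and> cmp K e e = e"
  "(X', Y', f) \<in> Hom CC X Y \<longleftrightarrow> X' = X \<and> Y' = Y \<and> f \<in> Hom K (fst X) (fst Y) \<and> cmp K (cmp K (snd Y) f) (snd X) = f"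
  "idm CC X = (X, X, snd X)"
  "cmp CC (Y', Z, g) (X, Y, f) = (X, Z, cmp K g f)"
  "zero_mor CC X Y = (X, Y, zero_mor K (fst X) (fst Y))"
  "add_mor CC (X, Y, f) (X', Y', f') = (X, Y, add_mor K f f')"
  "scale_mor CC c (X, Y, f) = (X, Y, scale_mor K c f)"
  "unit_ob CC = ([0], idm K [0])"
  "tens_ob CC (xs, e) (ys, e') = (tl xs ys, tens_mor K e e')"
  "tens_mor CC (X, Y, f) (X', Y', f') = (tens_ob CC X X', tens_ob CC Y Y', tens_mor K f f')"
  by (cases f; auto simp: TL_fusion_def idempotent_completion_def kar_unit_def kar_tens_def)+

text \<open>The embedding of the additive completion into its idempotent completion;
  \<open>kh\<close> is the same on morphisms.\<close>

definition P :: "nat list => fusion_ob" where "P xs = (xs, idm K xs)"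
definition kh where "kh xs ys f = (P xs, P ys, f)"

lemma P_Ob [simp]: "P xs \<in> Ob CC" by (simp add: P_def K_id_Hom K_id_left[OF K_id_Hom])

lemma P_tens: "tens_ob CC (P xs) (P ys) = P (tl xs ys)" by (simp add: P_def K_id_tens)

lemma P_unit: "unit_ob CC = P [0]" by (simp add: P_def)

lemma kh_Hom: "f \<in> Hom K xs ys ==> kh xs ys f \<in> Hom CC (P xs) (P ys)"
  by (simp add: kh_def P_def K_id_left[of f xs ys] K_id_right[of f xs ys])

lemma kh_cmp: "cmp CC (kh ys zs g) (kh xs ys f) = kh xs zs (cmp K g f)" by (simp add: kh_def)

lemma kh_tens: "tens_mor CC (kh xs ys f) (kh xs' ys' g) = kh (tl xs xs') (tl ys ys') (tens_mor K f g)"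
  by (simp add: kh_def P_tens)

lemma kh_id: "idm CC (P xs) = kh xs xs (idm K xs)" by (simp add: kh_def P_def)

lemma kh_add: "add_mor CC (kh xs ys f) (kh xs ys g) = kh xs ys (add_mor K f g)" by (simp add: kh_def)

lemma CC_tens_Ob:
  assumes "X \<in> Ob CC" "Y \<in> Ob CC" shows "tens_ob CC X Y \<in> Ob CC"
proof -
  obtain xs e where X: "X = (xs, e)" "e \<in> Hom K xs xs" "cmp K e e = e" using assms(1) by (cases X) simp
  obtain ys d where Y: "Y = (ys, d)" "d \<in> Hom K ys ys" "cmp K d d = d" using assms(2) by (cases Y) simp
  show ?thesis by (simp add: X(1) Y(1) K_tens_Hom[OF X(2) Y(2)] K_interchange[OF X(2,2) Y(2,2)] X(3) Y(3))
qed

lemma CC_id: "X \<in> Ob CC ==> idm CC X \<in> Hom CC X X" by (cases X) simp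

lemma CC_tens:
  assumes "X \<in> Ob CC" "Y \<in> Ob CC" "X' \<in> Ob CC" "Y' \<in> Ob CC" "f \<in> Hom CC X Y" "g \<in> Hom CC X' Y'"
  shows "tens_mor CC f g \<in> Hom CC (tens_ob CC X X') (tens_ob CC Y Y')"
proof -
  obtain xs e where X: "X = (xs, e)" "e \<in> Hom K xs xs" using assms(1) by (cases X) simp
  obtain ys d where Y: "Y = (ys, d)" "d \<in> Hom K ys ys" using assms(2) by (cases Y) simp
  obtain xs' e' where X': "X' = (xs', e')" "e' \<in> Hom K xs' xs'" using assms(3) by (cases X') simp
  obtain ys' d' where Y': "Y' = (ys', d')" "d' \<in> Hom K ys' ys'" using assms(4) by (cases Y') simp
  obtain f0 where f: "f = (X, Y, f0)" "f0 \<in> Hom K xs ys" "cmp K (cmp K d f0) e = f0" using assms(5) by (cases f) (simp add: X Y)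
  obtain g0 where g: "g = (X', Y', g0)" "g0 \<in> Hom K xs' ys'" "cmp K (cmp K d' g0) e' = g0" using assms(6) by (cases g) (simp add: X' Y')
  have "cmp K (cmp K (tens_mor K d d') (tens_mor K f0 g0)) (tens_mor K e e') = tens_mor K f0 g0"
    by (simp add: K_interchange[OF f(2) Y(2) g(2) Y'(2)]
      K_interchange[OF X(2) K_cmp_Hom[OF f(2) Y(2)] X'(2) K_cmp_Hom[OF g(2) Y'(2)]] f(3) g(3))
  then show ?thesis using K_tens_Hom[OF f(2) g(2)] by (simp add: f(1) g(1) X(1) Y(1) X'(1) Y'(1))
qed

text \<open>The idempotent itself, with different source and target labels, is both inclusion and
  projection.\<close>

lemma retract:
  assumes X: "(xs, e) \<in> Ob CC"
  shows "((xs, e), P xs, e) \<in> Hom CC (xs, e) (P xs)" "(P xs, (xs, e), e) \<in> Hom CC (P xs) (xs, e)"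
    "cmp CC (P xs, (xs, e), e) ((xs, e), P xs, e) = idm CC (xs, e)"
    "cmp CC ((xs, e), P xs, e) (P xs, (xs, e), e) = kh xs xs e"
proof -
  have e: "e \<in> Hom K xs xs" "cmp K e e = e" using X by simp_all
  show "((xs, e), P xs, e) \<in> Hom CC (xs, e) (P xs)" "(P xs, (xs, e), e) \<in> Hom CC (P xs) (xs, e)"
    "cmp CC (P xs, (xs, e), e) ((xs, e), P xs, e) = idm CC (xs, e)"
    "cmp CC ((xs, e), P xs, e) (P xs, (xs, e), e) = kh xs xs e"
    by (simp_all add: P_def kh_def K_id_left[OF e(1)] K_id_right[OF e(1)] e)
qed

lemma dual_Ob:
  assumes X: "(xs, e) \<in> Ob CC"
  shows "(xs, rd xs e) \<in> Ob CC"
  using X rd_cmp[of e xs e] by (simp add: rd_Hom)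

lemma CC_dual:
  assumes X: "(xs, e) \<in> Ob CC"
  shows "ldual CC (xs, e) = (xs, rd xs e)" "rdual CC (xs, e) = (xs, rd xs e)"
    "pivot CC (xs, e) = idm CC (xs, rd xs e)"
proof -
  have e: "e \<in> Hom K xs xs" using X by simp
  have 1: "cmp K (rd xs e) (rd xs e) = rd xs e" using dual_Ob[OF X] by simp
  show l: "ldual CC (xs, e) = (xs, rd xs e)" and r: "rdual CC (xs, e) = (xs, rd xs e)"
    using ldual_eq_rdual[OF e] by (simp_all add: TL_fusion_def idempotent_completion_def kar_ldual_def kar_rdual_def)
  have "pivot CC (xs, e) = kar_mk K (ldual CC (xs, e)) (rdual CC (xs, e)) (idm K xs)"
    by (simp add: TL_fusion_def idempotent_completion_def)
  then show "pivot CC (xs, e) = idm CC (xs, rd xs e)"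
    unfolding l r by (simp add: kar_mk_def K_id_right[OF rd_Hom[OF e]] 1)
qed

abbreviation EV where "EV xs \<equiv> kh (tl xs xs) [0] (mat (tl xs xs) [0] (evm xs))"
abbreviation CV where "CV xs \<equiv> kh [0] (tl xs xs) (mat [0] (tl xs xs) (cvm xs))"

text \<open>In the idempotent completion evaluations and coevaluations are cut down by idempotents;
  written with inclusions and projections, they are restrictions of those of
  \<open>P xs\<close>.\<close>

lemma CC_ev:
  assumes X: "(xs, e) \<in> Ob CC"
  shows "ev_l CC (xs, e) = cmp CC (EV xs) (tens_mor CC ((xs, rd xs e), P xs, rd xs e) ((xs, e), P xs, e))"
    "ev_r CC (xs, e) = cmp CC (EV xs) (tens_mor CC ((xs, e), P xs, e) ((xs, rd xs e), P xs, rd xs e))"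
    "coev_l CC (xs, e) = cmp CC (tens_mor CC (P xs, (xs, e), e) (P xs, (xs, rd xs e), rd xs e)) (CV xs)"
    "coev_r CC (xs, e) = cmp CC (tens_mor CC (P xs, (xs, rd xs e), rd xs e) (P xs, (xs, e), e)) (CV xs)"
proof -
  have e: "e \<in> Hom K xs xs" using X by simp
  note lr = CC_dual(1,2)[OF X, unfolded TL_fusion_def idempotent_completion_def, simplified]
  have ev: "cmp K (idm K [0]) (mat (tl xs xs) [0] (evm xs)) = mat (tl xs xs) [0] (evm xs)"
    by (rule K_id_left[OF mat_Hom[OF evm_VM]])
  have cv: "cmp K f (idm K [0]) = f" if "f \<in> Hom K [0] (tl xs xs)" for f by (rule K_id_right[OF that])
  have t: "tens_mor K f g \<in> Hom K (tl xs xs) (tl xs xs)" if "f \<in> Hom K xs xs" "g \<in> Hom K xs xs" for f g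
    by (rule K_tens_Hom[OF that])
  show "ev_l CC (xs, e) = cmp CC (EV xs) (tens_mor CC ((xs, rd xs e), P xs, rd xs e) ((xs, e), P xs, e))"
    "ev_r CC (xs, e) = cmp CC (EV xs) (tens_mor CC ((xs, e), P xs, e) ((xs, rd xs e), P xs, rd xs e))"
    by (simp_all add: TL_fusion_def idempotent_completion_def kar_mk_def lr kar_unit_def kar_tens_def kh_def ev P_def)
  show "coev_l CC (xs, e) = cmp CC (tens_mor CC (P xs, (xs, e), e) (P xs, (xs, rd xs e), rd xs e)) (CV xs)"
    "coev_r CC (xs, e) = cmp CC (tens_mor CC (P xs, (xs, rd xs e), rd xs e) (P xs, (xs, e), e)) (CV xs)"
    using e by (simp_all add: TL_fusion_def idempotent_completion_def kar_mk_def lr kar_unit_def kar_tens_def kh_def P_def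
      cv K_cmp_Hom[OF mat_Hom[OF cvm_VM] t] rd_Hom)
qed

lemma mate_kh: "cmp CC (cmp CC (tens_mor CC (idm CC (P xs)) (EV xs))
      (tens_mor CC (idm CC (P xs)) (tens_mor CC (kh xs xs f) (idm CC (P xs))))) (tens_mor CC (CV xs) (idm CC (P xs))) = kh xs xs (rd xs f)"
  unfolding kh_id kh_tens kh_cmp by (simp only: tl_assoc kh_cmp) (simp add: rdual_mor_def right_mate_def)

text \<open>The image of a Temperley-Lieb morphism in the fusion category, as a matrix with one
  entry.\<close>

definition em where "em m n f = kh [m] [n] (mat [m] [n] (\<lambda>_ _. f))"

lemma tl_single [simp]: "tl [m] [n] = [m + n]" by (simp add: tens_list_def)

lemma em_VM: "f \<in> V m n ==> VM [m] [n] (\<lambda>_ _. f)" by (rule VM_I) simp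

lemma em_Hom: "f \<in> V m n ==> em m n f \<in> Hom CC (P [m]) (P [n])"
  unfolding em_def by (rule kh_Hom[OF mat_Hom[OF em_VM]])

lemma em_cmp: "f \<in> V m n ==> g \<in> V n p ==> cmp CC (em n p g) (em m n f) = em m p (tcmp \<beta> m n p g f)"
  unfolding em_def kh_cmp by (subst K_cmp[OF em_VM em_VM]) (auto intro!: arg_cong[where f = "kh _ _"] mat_cong)

lemma em_tens: "f \<in> V m n ==> g \<in> V m' n' ==> tens_mor CC (em m n f) (em m' n' g) = em (m + m') (n + n') (ttens m n m' n' f g)"
  unfolding em_def kh_tens by (subst K_tens[OF em_VM em_VM]) (auto intro!: arg_cong[where f = "kh _ _"] mat_cong)

lemma em_id: "idm CC (P [n]) = em n n (idc n)"
  unfolding em_def kh_id K_id by (auto intro!: arg_cong[where f = "kh _ _"] mat_cong simp: idmat_def)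

lemma em_add: "f \<in> V m n ==> g \<in> V m n ==> add_mor CC (em m n f) (em m n g) = em m n (\<lambda>X. f X + g X)"
  unfolding em_def kh_add by (subst K_add[OF em_VM em_VM]) auto

lemma em_scale: "f \<in> V m n ==> scale_mor CC c (em m n f) = em m n (\<lambda>X. c * f X)"
  unfolding em_def kh_def by (simp add: K_scale[OF em_VM])

text \<open>The only place where elements of the ideal turn into relations of the fusion
  category.\<close>

lemma em_ideal: "(m, n, f) \<in> N m n ==> em m n f = em m n z0"
  unfolding em_def by (rule arg_cong[where f = "kh _ _"], rule mat_eqvI) (auto intro!: em_VM simp: N_V eqv_def)

lemma EV_single: "EV [n] = em (n + n) 0 (capc n)"
  unfolding em_def by (auto intro!: arg_cong[where f = "kh _ _"] mat_cong simp: evm_def)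

lemma CV_single: "CV [n] = em 0 (n + n) (cupc n)"
  unfolding em_def by (auto intro!: arg_cong[where f = "kh _ _"] mat_cong simp: cvm_def)

end

section \<open>Mates in the category of endofunctors\<close>

section \<open>Duals on the full image\<close>

context lincat
begin

text \<open>The laws hold as equalities because functors are extensional on objects and on
  arrows.\<close>

lemma endo_unit:
  assumes "endofunctor B F"
  shows "endo_cmp B F (endo_id B) = F" "endo_cmp B (endo_id B) F = F"
proof -
  have o: "fst F \<in> Ob B \<rightarrow>\<^sub>E Ob B" and m: "snd F \<in> extensional (Arr B)"
    using assms unfolding endofunctor_def by blast+
  have h: "arr (snd F f)" if f: "arr f" for f
  proof -
    have "snd F f \<in> Hom B (fst F (src f)) (fst F (tgt f))"
      using assms arrD[OF f] unfolding endofunctor_def by metis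
    then show ?thesis using HomD(1) PiE_mem[OF o] arrD[OF f] by blast
  qed
  have 1: "(\<lambda>X\<in>Ob B. fst F (fst (endo_id B) X)) = fst F" "(\<lambda>X\<in>Ob B. fst (endo_id B) (fst F X)) = fst F"
    using o by (auto simp: fun_eq_iff PiE_mem[OF o] PiE_arb[OF o] restrict_def)
  have 2: "(\<lambda>f\<in>Arr B. snd F (snd (endo_id B) f)) = snd F" "(\<lambda>f\<in>Arr B. snd (endo_id B) (snd F f)) = snd F"
    using m h by (auto simp: fun_eq_iff restrict_def Arr_iff extensional_def)
  show "endo_cmp B F (endo_id B) = F" "endo_cmp B (endo_id B) F = F" using 1 2 by (simp_all add: endo_cmp_def)
qed

end

context module_functor
begin

lemma on_mor_cmp:
  assumes "ca f" "ca g" "fst g = fst (snd f)"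
  shows "on_mor M (g \<cdot> f) = (on_ob M (fst f), on_ob M (fst (snd g)), \<lambda>Z\<in>Ob B. mm g Z ** mm f Z)"
proof -
  have "on_mor M (g \<cdot> f) = on_mor M g \<cdot>\<^bsub>End_cat B\<^esub> on_mor M f"
    using mf_cmp[of "fst f" "fst (snd f)" "fst (snd g)" f g] assms unfolding ca_def by simp
  then show ?thesis by (simp add: on_mor_eq assms)
qed

text \<open>Stated for a composite because evaluations of retracts arise as restrictions, by
  \<open>CC_ev\<close>.\<close>

lemma image_ev_eq:
  assumes [simp]: "X \<in> Ob C" "Y \<in> Ob C" "ca f" "ca g" "fst g = fst (snd f)" "fst f = X \<odot> Y" "fst (snd g) = U"
  shows "image_ev C (End_cat B) M X Y (g \<cdot> f) = (endo_cmp B (on_ob M X) (on_ob M Y), endo_id B, \<lambda>Z\<in>Ob B. th X Y (g \<cdot> f) Z)"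
  unfolding image_ev_def th_def
  by (auto simp: unit_iso_inv on_mor_cmp mult_iso_eq mm_cmp intro!: restrict_ext)

lemma image_coev_eq:
  assumes [simp]: "X \<in> Ob C" "Y \<in> Ob C" "ca f" "ca g" "fst g = fst (snd f)" "fst (snd g) = X \<odot> Y" "fst f = U"
  shows "image_coev C (End_cat B) M X Y (g \<cdot> f) = (endo_id B, endo_cmp B (on_ob M X) (on_ob M Y), \<lambda>Z\<in>Ob B. et X Y (g \<cdot> f) Z)"
  unfolding image_coev_def et_def
  by (auto simp: unit_iso_eq mult_iso_inv on_mor_cmp mm_cmp intro!: restrict_ext)

lemma left_mate_End:
  assumes [simp]: "X \<in> Ob C" "X' \<in> Ob C" "Y \<in> Ob C" "Y' \<in> Ob C"
    and [simp]: "\<And>Z. Z \<in> Ob B ==> arr (\<epsilon> Z)" "\<And>Z. Z \<in> Ob B ==> src (\<epsilon> Z) = A Y' (A Y Z)" "\<And>Z. Z \<in> Ob B ==> tgt (\<epsilon> Z) = Z"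
    and [simp]: "\<And>Z. Z \<in> Ob B ==> arr (\<eta> Z)" "\<And>Z. Z \<in> Ob B ==> src (\<eta> Z) = Z" "\<And>Z. Z \<in> Ob B ==> tgt (\<eta> Z) = A X (A X' Z)"
    and [simp]: "\<And>Z. Z \<in> Ob B ==> arr (\<alpha> Z)" "\<And>Z. Z \<in> Ob B ==> src (\<alpha> Z) = A X Z" "\<And>Z. Z \<in> Ob B ==> tgt (\<alpha> Z) = A Y Z"
  shows "left_mate (End_cat B) (on_ob M X') (on_ob M Y')
      (endo_id B, endo_cmp B (on_ob M X) (on_ob M X'), \<lambda>Z\<in>Ob B. \<eta> Z)
      (endo_cmp B (on_ob M Y') (on_ob M Y), endo_id B, \<lambda>Z\<in>Ob B. \<epsilon> Z) (on_ob M X, on_ob M Y, \<alpha>) =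
    (on_ob M Y', on_ob M X', \<lambda>Z\<in>Ob B. \<epsilon> (A X' Z) ** Am Y' (\<alpha> (A X' Z)) ** Am Y' (\<eta> Z))"
proof -
  have a: "fst (on_ob M W) = A W" "snd (on_ob M W) = Am W" for W by (simp_all add: A_def Am_def)
  show ?thesis unfolding left_mate_def by (auto simp: endo_unit on_ob a intro!: restrict_ext)
qed

lemma right_mate_End:
  assumes [simp]: "X \<in> Ob C" "X' \<in> Ob C" "Y \<in> Ob C" "Y' \<in> Ob C"
    and [simp]: "\<And>Z. Z \<in> Ob B ==> arr (\<epsilon> Z)" "\<And>Z. Z \<in> Ob B ==> src (\<epsilon> Z) = A Y (A Y' Z)" "\<And>Z. Z \<in> Ob B ==> tgt (\<epsilon> Z) = Z"
    and [simp]: "\<And>Z. Z \<in> Ob B ==> arr (\<eta> Z)" "\<And>Z. Z \<in> Ob B ==> src (\<eta> Z) = Z" "\<And>Z. Z \<in> Ob B ==> tgt (\<eta> Z) = A X' (A X Z)"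
    and [simp]: "\<And>Z. Z \<in> Ob B ==> arr (\<alpha> Z)" "\<And>Z. Z \<in> Ob B ==> src (\<alpha> Z) = A X Z" "\<And>Z. Z \<in> Ob B ==> tgt (\<alpha> Z) = A Y Z"
  shows "right_mate (End_cat B) (on_ob M X') (on_ob M Y')
      (endo_id B, endo_cmp B (on_ob M X') (on_ob M X), \<lambda>Z\<in>Ob B. \<eta> Z)
      (endo_cmp B (on_ob M Y) (on_ob M Y'), endo_id B, \<lambda>Z\<in>Ob B. \<epsilon> Z) (on_ob M X, on_ob M Y, \<alpha>) =
    (on_ob M Y', on_ob M X', \<lambda>Z\<in>Ob B. Am X' (\<epsilon> Z) ** Am X' (\<alpha> (A Y' Z)) ** \<eta> (A Y' Z))"
proof -
  have a: "fst (on_ob M W) = A W" "snd (on_ob M W) = Am W" for W by (simp_all add: A_def Am_def)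
  show ?thesis unfolding right_mate_def by (auto simp: endo_unit on_ob a intro!: restrict_ext)
qed

lemma balanced_zero:
  assumes [simp]: "X \<in> Ob C" "ca e" "fst e = X \<odot> X" "fst (snd e) = U" and z: "scale_mor C 0 e = e"
  shows "balanced t X e"
  unfolding balanced_def
proof (intro allI impI)
  fix Z W a b
  assume [simp]: "Z \<in> Ob B" "W \<in> Ob B" "arr a" "src a = Z" "tgt a = A X W" "arr b" "src b = W" "tgt b = A X Z"
  have 1: "th X X e V = zr (A X (A X V)) V" if [simp]: "V \<in> Ob B" for V
    using mm_sc[of e V 0] by (simp add: th_def z)
  show "Tr t W (th X X e W ** Am X a ** b) = Tr t Z (th X X e Z ** Am X b ** a)" by (simp add: 1 Tr_zr)
qed

end

section \<open>Module categories over the Temperley--Lieb fusion category\<close>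

declare (in TL_ideal) CC_simps [simp del]

locale TL_module = TL_ideal \<beta> N + sscat B for \<beta> N and B :: "('o, 'm) lin_cat" +
  fixes M :: "(fusion_ob, fusion_mor, ('o, 'm) endo, ('o, 'm) nat_trans) mon_functor"
  assumes M: "monoidal_functor (TL_fusion \<beta> N) (End_cat B) M"
    and proper: "\<exists>m n x. x \<in> N m n \<and> x \<noteq> zero_mor (TL \<beta>) m n"

sublocale TL_module \<subseteq> module_functor B "TL_fusion \<beta> N" M "range P"
proof unfold_locales
  show "monoidal_functor (TL_fusion \<beta> N) (End_cat B) M" by (rule M)
  show "tens_ob CC X Y \<in> Ob CC" if "X \<in> Ob CC" "Y \<in> Ob CC" for X Y by (rule CC_tens_Ob[OF that])
  show "X \<in> Ob CC" if "X \<in> range P" for X using that by auto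
  show "unit_ob CC \<in> range P" by (simp add: P_unit)
  show "tens_ob CC X Y \<in> range P" if "X \<in> range P" "Y \<in> range P" for X Y using that by (auto simp: P_tens)
  show "tens_ob CC (tens_ob CC X Y) W = tens_ob CC X (tens_ob CC Y W)" if "X \<in> range P" "Y \<in> range P" "W \<in> range P" for X Y W
    using that by (auto simp: P_tens tl_assoc)
  show "tens_ob CC (unit_ob CC) X = X" "tens_ob CC X (unit_ob CC) = X" if "X \<in> range P" for X
    using that by (auto simp: P_tens P_unit)
  show "idm CC X \<in> Hom CC X X" if "X \<in> Ob CC" for X by (rule CC_id[OF that])
  show "tens_mor CC f g \<in> Hom CC (tens_ob CC X X') (tens_ob CC Y Y')"
    if "X \<in> Ob CC" "Y \<in> Ob CC" "X' \<in> Ob CC" "Y' \<in> Ob CC" "f \<in> Hom CC X Y" "g \<in> Hom CC X' Y'" for X Y X' Y' f g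
    by (rule CC_tens[OF that])
  show "fst f = X \<and> fst (snd f) = Y" if "f \<in> Hom CC X Y" for f X Y
    using that by (cases f) (simp add: CC_simps)
qed

text \<open>A name for the number 1 that the simplifier does not rewrite.\<close>

definition one :: nat where "one = 1"

text \<open>An opaque name for a single cap between strands, with two points written as
  \<open>one + one\<close> so that it fits the tensor products of the generating object.\<close>

definition cat :: "nat => nat => coeffs" where "cat a b = catc a b"

lemma cat_V: "m = a + (one + one + b) ==> n = a + b ==> cat a b \<in> V m n"
  unfolding one_def one_add_one cat_def using catc_V[of a b] by simp

lemma cat_left: "m = a + (one + one + b) ==> n = a + b ==> c = i + a ==> ttens i i m n (idc i) (cat a b) = cat c b"
  unfolding one_def one_add_one cat_def by (simp only: ttens_catc_left)

lemma cat_right: "m = a + (one + one + b) ==> n = a + b ==> c = b + s ==> ttens m n s s (cat a b) (idc s) = cat a c"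
  unfolding one_def one_add_one cat_def by (simp only: ttens_catc_right)

lemma cap_cat: "m = n + (one + one + n) ==> k = n + n ==> c = n + one ==> tcmp \<beta> m k 0 (capc n) (cat n n) = capc c"
  unfolding one_def one_add_one cat_def by (simp only: capc_catc Suc_eq_plus1[symmetric])

lemma cat_0: "ttens i i (one + one) 0 (idc i) (capc one) = cat i 0"
  unfolding one_def one_add_one cat_def by (rule catc_0)

lemma cat_cap: "ttens n n (one + one + n) n (idc n) (ttens (one + one) 0 n n (capc one) (idc n)) = cat n n"
  unfolding one_def one_add_one cat_def by (rule catc_cap)

section \<open>Nested evaluations of the powers of the generating object\<close>

context TL_module
begin

lemma U_P: "P [0] = U" by (simp add: P_unit)

declare U_P [simp] P_tens [simp]

lemma ca_kh [simp]:
  assumes "f \<in> Hom K xs ys"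
  shows "ca (kh xs ys f)"
  by (rule caI[OF P_Ob P_Ob kh_Hom[OF assms]])

lemma kh_fst [simp]: "fst (kh xs ys f) = P xs" "fst (snd (kh xs ys f)) = P ys" by (simp_all add: kh_def)

lemma ca_em [simp]: "f \<in> V m n ==> ca (em m n f)" "fst (em m n f) = P [m]" "fst (snd (em m n f)) = P [n]"
  using caI[OF P_Ob P_Ob em_Hom] by (simp_all add: em_def)

abbreviation ev where "ev n \<equiv> em (n + n) 0 (capc n)"
abbreviation tv where "tv n \<equiv> th (P [n]) (P [n]) (ev n)"

lemma mm_em_cmp:
  assumes "f \<in> V m n" "g \<in> V n p" "Z \<in> Ob B"
  shows "mm (em n p g) Z ** mm (em m n f) Z = mm (em m p (tcmp \<beta> m n p g f)) Z"
  using mm_cmp[of "em m n f" "em n p g" Z] assms by (simp add: em_cmp)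

lemma mm_em_cmp_eq:
  assumes "f \<in> V m n" "g \<in> V n p" "Z \<in> Ob B" "tcmp \<beta> m n p g f = h" "m = m'"
  shows "mm (em m' p h) Z = mm (em n p g) Z ** mm (em m n f) Z"
  using mm_em_cmp[OF assms(1-3)] assms(4,5) by simp

lemma tens_id_ev: "tens_mor CC (idm CC (P [k])) (tens_mor CC (ev n) (idm CC (P [k]))) =
    em (k + (n + n + k)) (k + k) (ttens k k (n + n + k) k (idc k) (ttens (n + n) 0 k k (capc n) (idc k)))"
proof -
  have 1: "tens_mor CC (ev n) (idm CC (P [k])) = em (n + n + k) k (ttens (n + n) 0 k k (capc n) (idc k))"
    unfolding em_id by (simp only: em_tens[OF capc_V idc_V] add_0)
  have "ttens (n + n) 0 k k (capc n) (idc k) \<in> V (n + n + k) k"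
    using ttens_V[of "n + n" 0 k k "capc n" "idc k"] by simp
  then show ?thesis unfolding 1 unfolding em_id by (simp only: em_tens[OF idc_V])
qed

lemma mm_em_id [simp]: "Z \<in> Ob B ==> mm (em n n (idc n)) Z = i1 (A (P [n]) Z)"
  unfolding em_id[symmetric] by (rule mm_id[OF P_Ob])

lemma mm_em_left:
  assumes "f \<in> V m n" "Z \<in> Ob B"
  shows "mm (em (k + m) (k + n) (ttens k k m n (idc k) f)) Z ** mu (P [k]) (P [m]) Z = mu (P [k]) (P [n]) Z ** Am (P [k]) (mm (em m n f) Z)"
  using mm_id_tens[of "em m n f" "P [k]" Z] assms by (simp add: em_id em_tens)

lemma mm_em_right:
  assumes "f \<in> V m n" "Z \<in> Ob B"
  shows "mm (em (m + k) (n + k) (ttens m n k k f (idc k))) Z ** mu (P [m]) (P [k]) Z = mu (P [n]) (P [k]) Z ** mm (em m n f) (A (P [k]) Z)"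
  using mm_tens_id[of "em m n f" "P [k]" Z] assms by (simp add: em_id em_tens)

lemma ev_ca [simp]: "ca (ev n)" "fst (ev n) = P [n + n]" "fst (snd (ev n)) = U" by simp_all

lemma tv_arr [simp]:
  assumes "Z \<in> Ob B"
  shows "arr (tv n Z)" "src (tv n Z) = A (P [n]) (A (P [n]) Z)" "tgt (tv n Z) = Z"
  by (rule th_arr; use assms in simp)+

text \<open>The new arc is put innermost, below the nested evaluation of \<open>n\<close>
  strands.\<close>

lemma ev_outer:
  assumes Z: "Z \<in> Ob B"
  shows "mm (ev (n + one)) Z = mm (ev n) Z ** mm (tens_mor CC (idm CC (P [n])) (tens_mor CC (ev one) (idm CC (P [n])))) Z"
  unfolding tens_id_ev cat_cap
  by (rule mm_em_cmp_eq[OF cat_V capc_V Z cap_cat]) simp_all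

text \<open>The other way of nesting, with the single arc outermost. By induction: the innermost arc
  is split off with \<open>cap_cat\<close> and passes through the outer strands.\<close>

lemma ev_inner:
  assumes Z: "Z \<in> Ob B"
  shows "mm (ev (n + one)) Z = mm (ev one) Z ** mm (tens_mor CC (idm CC (P [one])) (tens_mor CC (ev n) (idm CC (P [one])))) Z"
proof (induction n)
  case 0
  have "ttens 0 0 one one (capc 0) (idc one) = idc one" using ttens_id[of 0 one] by (simp add: capc_0)
  then have "tens_mor CC (idm CC (P [one])) (tens_mor CC (ev 0) (idm CC (P [one]))) = em (one + one) (one + one) (idc (one + one))"
    unfolding tens_id_ev by (simp add: ttens_id)
  then show ?case using Z mm_em_id[of Z "one + one"] by simp
next
  case (Suc n)
  let ?N = "n + one"
  let ?T = "\<lambda>n. ttens (n + n) 0 one one (capc n) (idc one)"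
  let ?f = "\<lambda>n. ttens one one (n + n + one) one (idc one) (?T n)"
  let ?m = "n + (one + one + n)"
  have T: "?T n \<in> V (n + n + one) one" for n using ttens_V[of "n + n" 0 one one "capc n" "idc one"] by simp
  have fV: "?f n \<in> V (one + (n + n + one)) (one + one)" for n by simp
  have c: "cat ?N ?N = ttens one one (?m + one) (n + n + one) (idc one) (ttens ?m (n + n) one one (cat n n) (idc one))"
    by (subst cat_right[OF refl refl refl], subst cat_left[OF _ _ refl]) (simp_all add: add_ac)
  have T': "ttens ?m (n + n) one one (cat n n) (idc one) \<in> V (?m + one) (n + n + one)" by simp
  have cV: "cat ?N ?N \<in> V (one + (?m + one)) (one + (n + n + one))" by (rule cat_V) simp_all
  have i: "tcmp \<beta> (?m + one) (n + n + one) one (?T n) (ttens ?m (n + n) one one (cat n n) (idc one)) =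
      ttens ?m 0 one one (capc ?N) (idc one)"
    using interchange[OF cat_V[OF refl refl] capc_V idc_V idc_V, of \<beta> n one]
    by (simp add: cap_cat[OF refl refl refl] tcmp_id_left)
  \<comment> \<open>The innermost cap touches only the middle factor, so the interchange law absorbs
    it into the inner rainbow.\<close>
  have "tcmp \<beta> (one + (?m + one)) (one + (n + n + one)) (one + one) (?f n) (cat ?N ?N) =
      ttens one one (?m + one) one (tcmp \<beta> one one one (idc one) (idc one))
       (tcmp \<beta> (?m + one) (n + n + one) one (?T n) (ttens ?m (n + n) one one (cat n n) (idc one)))"
    unfolding c by (rule interchange[OF idc_V idc_V T' T])
  also have "... = ?f ?N"
  proof -
    have "?m = ?N + ?N" by simp
    then show ?thesis unfolding i by (simp only: tcmp_id_left[OF idc_V])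
  qed
  finally have step: "tcmp \<beta> (one + (?m + one)) (one + (n + n + one)) (one + one) (?f n) (cat ?N ?N) = ?f ?N" .
  have e1: "?N + (one + one + ?N) = one + (?m + one)" "?N + ?N = one + (n + n + one)" "(?N + one) + (?N + one) = one + (?m + one)" by simp_all
  have "mm (ev (?N + one)) Z = mm (ev ?N) Z ** mm (em (one + (?m + one)) (?N + ?N) (cat ?N ?N)) Z"
    by (rule mm_em_cmp_eq[OF cat_V capc_V Z cap_cat]) simp_all
  also have "mm (ev ?N) Z = mm (ev one) Z ** mm (em (one + (n + n + one)) (one + one) (?f n)) Z"
    using Suc unfolding tens_id_ev .
  also have "(mm (ev one) Z ** mm (em (one + (n + n + one)) (one + one) (?f n)) Z) ** mm (em (one + (?m + one)) (?N + ?N) (cat ?N ?N)) Z =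
     mm (ev one) Z ** mm (em (one + (n + n + one)) (one + one) (?f n)) Z ** mm (em (one + (?m + one)) (one + (n + n + one)) (cat ?N ?N)) Z"
    unfolding e1(2) by (rule assoc) (use Z cV fV in simp_all)
  also have "mm (em (one + (n + n + one)) (one + one) (?f n)) Z ** mm (em (one + (?m + one)) (one + (n + n + one)) (cat ?N ?N)) Z =
      mm (em (one + (?N + ?N + one)) (one + one) (?f ?N)) Z"
    by (rule mm_em_cmp_eq[OF cV fV Z step, symmetric]) simp
  finally show ?case unfolding tens_id_ev by (simp add: one_def)
qed

end

context TL_module
begin

abbreviation F where "F \<equiv> P [one]"

text \<open>Specializes \<open>mate_transport\<close> to objects given by lists. With
  \<open>f\<close> an identity it yields the zigzag identity, with \<open>f\<close> an idempotent
  the dual idempotent.\<close>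

lemma mateP:
  assumes f: "f \<in> Hom K xs xs" and Z: "Z \<in> Ob B"
  shows "Am (P xs) (th (P xs) (P xs) (EV xs) Z ** mm (kh xs xs f) (A (P xs) Z)) ** et (P xs) (P xs) (CV xs) (A (P xs) Z) =
    mm (kh xs xs (rd xs f)) Z"
proof -
  let ?k = "cmp CC (tens_mor CC (idm CC (P xs)) (EV xs)) (tens_mor CC (idm CC (P xs)) (tens_mor CC (kh xs xs f) (idm CC (P xs))))"
  have ev: "mat (tl xs xs) [0] (evm xs) \<in> Hom K (tl xs xs) [0]" and cv: "mat [0] (tl xs xs) (cvm xs) \<in> Hom K [0] (tl xs xs)"
    by (rule mat_Hom[OF evm_VM], rule mat_Hom[OF cvm_VM])
  have k: "?k = kh (tl xs (tl xs xs)) xs (cmp K (tens_mor K (idm K xs) (mat (tl xs xs) [0] (evm xs))) (tens_mor K (idm K xs) (tens_mor K f (idm K xs))))"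
    unfolding kh_id kh_tens kh_cmp by simp
  have "tens_mor K (idm K xs) (mat (tl xs xs) [0] (evm xs)) \<in> Hom K (tl xs (tl xs xs)) xs"
    using K_tens_Hom[OF K_id_Hom ev, of xs] by simp
  then have kH: "cmp K (tens_mor K (idm K xs) (mat (tl xs xs) [0] (evm xs))) (tens_mor K (idm K xs) (tens_mor K f (idm K xs))) \<in>
      Hom K (tl xs (tl xs xs)) xs"
    by (rule K_cmp_Hom[OF K_tens_Hom[OF K_id_Hom K_tens_Hom[OF f K_id_Hom]]])
  show ?thesis
  proof (rule mate_transport[of _ _ _ _ _ ?k, OF _ Z])
    show "ca ?k" "fst ?k = tens_ob CC (P xs) (tens_ob CC (P xs) (P xs))" "fst (snd ?k) = P xs"
      unfolding k using kH by simp_all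
    show "cmp CC ?k (tens_mor CC (CV xs) (idm CC (P xs))) = kh xs xs (rd xs f)" by (rule mate_kh)
  qed (use ev cv f in simp_all)
qed

lemma mm_kh_id: "Z \<in> Ob B ==> mm (kh xs xs (idm K xs)) Z = i1 (A (P xs) Z)"
  unfolding kh_id[symmetric] by (rule mm_id[OF P_Ob])

lemma zigzag:
  assumes Z [simp]: "Z \<in> Ob B"
  shows "Am (P [n]) (tv n Z) ** et (P [n]) (P [n]) (em 0 (n + n) (cupc n)) (A (P [n]) Z) = i1 (A (P [n]) Z)"
  using mateP[OF K_id_Hom Z, of "[n]", unfolded rd_id EV_single CV_single] by (simp add: mm_kh_id)

text \<open>By the zigzag identity \<open>x\<close> can be recovered from its mate, so the mate is
  nonzero; its target is simple, hence it splits.\<close>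

lemma mate_split:
  assumes S: "S \<in> VV" and x [simp]: "arr x" "tgt x = A F S" and nz: "x \<noteq> zr (src x) (A F S)"
  shows "\<exists>r. arr r \<and> src r = S \<and> tgt r = A F (src x) \<and> tv one S ** Am F x ** r = i1 S"
proof -
  have [simp]: "S \<in> Ob B" "src x \<in> Ob B" using S arrD[of x] by simp_all
  let ?h = "et F F (em 0 (one + one) (cupc one))"
  have "tv one S ** Am F x \<noteq> zr (A F (src x)) S"
  proof
    assume a: "tv one S ** Am F x = zr (A F (src x)) S"
    have n: "?h (A F S) ** x = Am F (Am F x) ** ?h (src x)"
      using et_nat[of F F "em 0 (one + one) (cupc one)" x] by simp
    have "x = (Am F (tv one S) ** ?h (A F S)) ** x" unfolding zigzag[OF \<open>S \<in> Ob B\<close>] by simp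
    also have "... = Am F (tv one S) ** (?h (A F S) ** x)" by simp
    also have "... = Am F (tv one S ** Am F x) ** ?h (src x)" unfolding n by simp
    also have "... = zr (src x) (A F S)" unfolding a by simp
    finally show False using nz by simp
  qed
  then show ?thesis using split_epi[OF S, of "tv one S ** Am F x"] by auto
qed

lemma tv_inner:
  assumes [simp]: "Z \<in> Ob B"
  shows "tv (n + one) Z ** mu F (P [n]) (A (P [n + one]) Z) ** Am F (Am (P [n]) (mu (P [n]) F Z)) = tv one Z ** Am F (tv n (A F Z))"
  using th_nested[of F "P [n]" Z "ev one" "ev n" "ev (n + one)"] ev_inner[OF assms, of n]
  by (simp add: add_ac)

section \<open>Reduced walks and the bound on their length\<close>

text \<open>Composites of reduced walks of length \<open>k\<close> in the fusion graph have this property.\<close>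

definition reduced where
  "reduced k S T Y \<longleftrightarrow> T \<in> Ob B \<and> arr Y \<and> src Y = T \<and> tgt Y = A (P [k]) S \<and>
    (\<forall>a b. a + (one + one + b) = k \<longrightarrow> mm (em k (a + b) (cat a b)) S ** Y = zr T (A (P [a + b]) S)) \<and>
    (\<exists>r. arr r \<and> src r = S \<and> tgt r = A (P [k]) T \<and> tv k S ** Am (P [k]) Y ** r = i1 S)"

text \<open>The edge \<open>x\<close> adds a strand on the right. Caps away from this strand already
  annihilate the old walk, and \<open>kill\<close> deals with the cap that meets it. For detection,
  sections of the old nested evaluation and of the mate of \<open>x\<close> are composed.\<close>

lemma reduced_step:
  assumes S: "S \<in> VV" and x [simp]: "arr x" "tgt x = A F S" "src x = S'" "x \<noteq> zr S' (A F S)"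
    and red: "reduced k S' T Y"
    and kill: "\<And>a. a + (one + one) = k + one ==> mm (em (k + one) a (cat a 0)) S ** mu (P [k]) F S ** Am (P [k]) x ** Y = zr T (A (P [a]) S)"
  shows "reduced (k + one) S T (mu (P [k]) F S ** Am (P [k]) x ** Y)"
proof -
  have [simp]: "S \<in> Ob B" "S' \<in> Ob B" using S arrD[of x] by simp_all
  have [simp]: "T \<in> Ob B" "arr Y" "src Y = T" "tgt Y = A (P [k]) S'" using red by (simp_all add: reduced_def)
  obtain r where [simp]: "arr r" "src r = S'" "tgt r = A (P [k]) T" and r: "tv k S' ** Am (P [k]) Y ** r = i1 S'"
    using red by (auto simp: reduced_def)
  obtain r1 where [simp]: "arr r1" "src r1 = S" "tgt r1 = A F S'" and r1: "tv one S ** Am F x ** r1 = i1 S"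
    using mate_split[OF S x(1,2)] x by auto
  let ?Y = "mu (P [k]) F S ** Am (P [k]) x ** Y"
  have c [simp]: "P [one + k] = P [k + one]" by (simp add: add.commute)
  have "mm (em (k + one) (a + b) (cat a b)) S ** ?Y = zr T (A (P [a + b]) S)" if ab: "a + (one + one + b) = k + one" for a b
  proof (cases b)
    case 0
    then show ?thesis using kill[of a] ab by simp
  next
    \<comment> \<open>A cap with at least one strand to its right acts on the old walk
      \<open>Y\<close> alone: it commutes with the structure map and with \<open>x\<close>.\<close>
    case (Suc b')
    have k: "k = a + (one + one + b')" using ab Suc by (simp add: one_def)
    have cV: "cat a b' \<in> V k (a + b')" by (rule cat_V) (simp_all add: k)
    have e: "a + b = a + b' + one" using Suc by (simp add: one_def)
    have "cat a b = ttens k (a + b') one one (cat a b') (idc one)"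
      by (rule cat_right[symmetric]) (simp_all add: k Suc one_def)
    then have 1: "mm (em (k + one) (a + b) (cat a b)) S ** mu (P [k]) F S = mu (P [a + b']) F S ** mm (em k (a + b') (cat a b')) (A F S)"
      using mm_em_right[OF cV \<open>S \<in> Ob B\<close>, of one] unfolding e by simp
    have 2: "mm (em k (a + b') (cat a b')) (A F S) ** Am (P [k]) x = Am (P [a + b']) x ** mm (em k (a + b') (cat a b')) S'"
      using mm_nat[of "em k (a + b') (cat a b')" x] cV by simp
    have 3: "mm (em k (a + b') (cat a b')) S' ** Y = zr T (A (P [a + b']) S')"
      using red k unfolding reduced_def by blast
    have abV: "cat a b \<in> V (k + one) (a + b)" by (rule cat_V) (simp_all add: k Suc one_def)
    have "mm (em (k + one) (a + b) (cat a b)) S ** ?Y = (mm (em (k + one) (a + b) (cat a b)) S ** mu (P [k]) F S) ** Am (P [k]) x ** Y"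
      using abV by simp
    also have "... = mu (P [a + b']) F S ** (mm (em k (a + b') (cat a b')) (A F S) ** Am (P [k]) x) ** Y"
      unfolding 1 using cV by simp
    also have "... = mu (P [a + b']) F S ** Am (P [a + b']) x ** (mm (em k (a + b') (cat a b')) S' ** Y)"
      unfolding 2 using cV by simp
    also have "... = zr T (A (P [a + b]) S)" unfolding 3 e by simp
    finally show ?thesis .
  qed
  moreover have "\<exists>r. arr r \<and> src r = S \<and> tgt r = A (P [k + one]) T \<and> tv (k + one) S ** Am (P [k + one]) ?Y ** r = i1 S"
  proof (intro exI conjI)
    \<comment> \<open>The new factor is the outermost one in the nested evaluation, so its section
      \<open>r1\<close> comes first and the section \<open>r\<close> of the old walk is applied
      inside.\<close>
    let ?r = "mu F (P [k]) T ** Am F r ** r1"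
    show "arr ?r" "src ?r = S" "tgt ?r = A (P [k + one]) T" by simp_all
    have 1: "Am (P [k + one]) ?Y ** mu F (P [k]) T = mu F (P [k]) (A (P [k + one]) S) ** Am F (Am (P [k]) ?Y)"
      using mu_nat[of F "P [k]" ?Y] by simp
    have 2: "tv k (A F S) ** Am (P [k]) (Am (P [k]) x) = x ** tv k S'"
      using th_nat[of "P [k]" "P [k]" "ev k" x] by simp
    have "tv (k + one) S ** Am (P [k + one]) ?Y ** ?r = tv (k + one) S ** (Am (P [k + one]) ?Y ** mu F (P [k]) T) ** Am F r ** r1"
      by simp
    also have "... = (tv (k + one) S ** mu F (P [k]) (A (P [k + one]) S) ** Am F (Am (P [k]) (mu (P [k]) F S))) **
        Am F (Am (P [k]) (Am (P [k]) x ** Y)) ** Am F r ** r1" unfolding 1 by simp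
    also have "... = tv one S ** Am F ((tv k (A F S) ** Am (P [k]) (Am (P [k]) x)) ** Am (P [k]) Y ** r) ** r1"
      unfolding tv_inner[OF \<open>S \<in> Ob B\<close>] by simp
    also have "... = tv one S ** Am F x ** Am F (tv k S' ** Am (P [k]) Y ** r) ** r1" unfolding 2 by simp
    also have "... = i1 S" unfolding r using r1 by simp
    finally show "tv (k + one) S ** Am (P [k + one]) ?Y ** ?r = i1 S" .
  qed
  ultimately show ?thesis by (simp add: reduced_def)
qed

lemma reduced_0:
  assumes [simp]: "S \<in> Ob B"
  shows "reduced 0 S S (un S)"
proof -
  have "tv 0 S ** Am (P [0]) (un S) ** un S = i1 S"
  proof -
    have "mm (ev 0) S = i1 (A U S)" using mm_em_id[of S 0] by (simp add: capc_0)
    then have "tv 0 S = uni S ** mu U U S" by (simp add: th_def)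
    then show ?thesis using rw[OF mu_unit_right[of "U" S], of "un S"] by simp
  qed
  then show ?thesis unfolding reduced_def by (auto simp: one_def intro!: exI[of _ "un S"])
qed

text \<open>A diagram other than the rainbow joins two neighbours among the last \<open>k\<close>
  points. These are the strands carrying \<open>Y\<close>, so the diagram factors through a cap that
  annihilates \<open>Y\<close>.\<close>

lemma reduced_kill:
  assumes "reduced k S T Y" "S \<in> Ob B" and D: "D \<in> diagrams (k + k) 0" "D \<noteq> cap_diagram k"
  shows "mm (em (k + k) 0 (dg D)) S ** mu (P [k]) (P [k]) S ** Am (P [k]) Y = zr (A (P [k]) T) (A U S)"
proof -
  obtain i where i: "k \<le> i" "Suc i < k + k" "{Bot i, Bot (Suc i)} \<in> D" using inner_arc[OF D] by blast
  \<comment> \<open>\<open>a\<close> and \<open>b\<close> count the strands of \<open>Y\<close> on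
    the left and on the right of the arc.\<close>
  define a where "a = i - k"
  define b where "b = k + k - i - 2"
  have k: "a + (one + one + b) = k" and i': "i = k + a" and kk: "i + (2 + b) = k + k"
    using i by (simp_all add: a_def b_def one_def)
  have [simp]: "T \<in> Ob B" "arr Y" "src Y = T" "tgt Y = A (P [k]) S" "S \<in> Ob B" using assms by (simp_all add: reduced_def)
  obtain D' where D': "D' \<in> diagrams (i + b) 0" "stack D' (cap_at i b) = D \<and> loops D' (cap_at i b) = 0"
    using inner_arc_decomposition[of D i b] D(1) i(3) kk by auto
  have iV: "cat i b \<in> V (k + k) (i + b)" by (rule cat_V) (use k i' in auto)
  have aV: "cat a b \<in> V k (a + b)" by (rule cat_V) (use k in auto)
  have "tcmp \<beta> (k + k) (i + b) 0 (dg D') (cat i b) = dg D"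
    unfolding cat_def kk[symmetric] by (rule tcmp_dg'[OF cap_at_closed D'])
  then have 1: "mm (em (k + k) 0 (dg D)) S = mm (em (i + b) 0 (dg D')) S ** mm (em (k + k) (i + b) (cat i b)) S"
    by (rule mm_em_cmp_eq[OF iV dg_V[OF D'(1)] \<open>S \<in> Ob B\<close>]) simp
  have "ttens k k k (a + b) (idc k) (cat a b) = cat i b" by (rule cat_left) (use k i' in auto)
  then have 2: "mm (em (k + k) (i + b) (cat i b)) S ** mu (P [k]) (P [k]) S = mu (P [k]) (P [a + b]) S ** Am (P [k]) (mm (em k (a + b) (cat a b)) S)"
    using mm_em_left[OF aV \<open>S \<in> Ob B\<close>, of k] i' by (simp add: add.assoc)
  have 3: "mm (em k (a + b) (cat a b)) S ** Y = zr T (A (P [a + b]) S)"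
    using assms(1) k unfolding reduced_def by blast
  have "mm (em (k + k) 0 (dg D)) S ** mu (P [k]) (P [k]) S ** Am (P [k]) Y =
      mm (em (i + b) 0 (dg D')) S ** (mm (em (k + k) (i + b) (cat i b)) S ** mu (P [k]) (P [k]) S) ** Am (P [k]) Y"
    unfolding 1 using iV dg_V[OF D'(1)] by simp
  also have "... = mm (em (i + b) 0 (dg D')) S ** mu (P [k]) (P [a + b]) S ** Am (P [k]) (mm (em k (a + b) (cat a b)) S ** Y)"
    unfolding 2 using aV dg_V[OF D'(1)] by simp
  also have "... = zr (A (P [k]) T) (A U S)"
  proof -
    have "P [i + b] = P [k + (a + b)]" using i' by (simp add: add.assoc)
    then show ?thesis unfolding 3 using dg_V[OF D'(1)] by simp
  qed
  finally show ?thesis .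
qed

lemma em_add_mm:
  assumes "f \<in> V m n" "g \<in> V m n" "Z \<in> Ob B"
  shows "mm (em m n (\<lambda>X. f X + g X)) Z = ad (mm (em m n f) Z) (mm (em m n g) Z)"
  using mm_ad[of "em m n f" "em m n g" Z] assms by (simp add: em_add)

lemma em_scale_mm:
  assumes "f \<in> V m n" "Z \<in> Ob B"
  shows "mm (em m n (\<lambda>X. c * f X)) Z = sc c (mm (em m n f) Z)"
  using mm_sc[of "em m n f" Z c] assms by (simp add: em_scale)

lemma em_zero_mm: "Z \<in> Ob B ==> mm (em m n z0) Z = zr (A (P [m]) Z) (A (P [n]) Z)"
  using em_scale_mm[of z0 m n Z 0] by simp

text \<open>A rainbow in the ideal: all other terms of the ideal element annihilate \<open>Y\<close>, so the
  rainbow would, too.\<close>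

lemma not_reduced:
  assumes g: "(k + k, 0, g) \<in> N (k + k) 0" "g (cap_diagram k) \<noteq> 0" and S: "S \<in> VV"
  shows "\<not> reduced k S T Y"
proof
  assume red: "reduced k S T Y"
  have [simp]: "S \<in> Ob B" using S by simp
  have [simp]: "T \<in> Ob B" "arr Y" "src Y = T" "tgt Y = A (P [k]) S" using red by (simp_all add: reduced_def)
  have gV: "g \<in> V (k + k) 0" using N_V[OF g(1)] by simp
  let ?y = "mu (P [k]) (P [k]) S ** Am (P [k]) Y"
  let ?z = "zr (A (P [k]) T) (A U S)"
  let ?D = "diagrams (k + k) 0"
  let ?r = "mm (em (k + k) 0 (\<lambda>X. \<Sum>D\<in>?D - {cap_diagram k}. g D * dg D X)) S"
  have sum: "mm (em (k + k) 0 (\<lambda>X. \<Sum>D\<in>R. g D * dg D X)) S ** ?y = ?z \<and> (\<lambda>X. \<Sum>D\<in>R. g D * dg D X) \<in> V (k + k) 0"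
    if "finite R" "R \<subseteq> ?D - {cap_diagram k}" for R
    using that
  proof (induction R rule: finite_induct)
    case empty
    then show ?case by (simp add: em_zero_mm)
  next
    case (insert D R)
    then have D: "D \<in> ?D" "D \<noteq> cap_diagram k" and IH: "mm (em (k + k) 0 (\<lambda>X. \<Sum>D\<in>R. g D * dg D X)) S ** ?y = ?z"
      "(\<lambda>X. \<Sum>D\<in>R. g D * dg D X) \<in> V (k + k) 0" by auto
    have dV: "dg D \<in> V (k + k) 0" and sV: "(\<lambda>X. g D * dg D X) \<in> V (k + k) 0" using dg_V[OF D(1)] V_scale by auto
    have "mm (em (k + k) 0 (\<lambda>X. g D * dg D X)) S ** ?y = ?z"
      using reduced_kill[OF red _ D] dV by (simp add: em_scale_mm)
    then have "mm (em (k + k) 0 (\<lambda>X. g D * dg D X + (\<Sum>D\<in>R. g D * dg D X))) S ** ?y = ?z"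
      unfolding em_add_mm[OF sV IH(2) \<open>S \<in> Ob B\<close>] using IH sV by (subst ad_comp) (simp_all add: par_def)
    then show ?case using insert(1,2) V_add[OF sV IH(2)] by simp
  qed
  have cD: "cap_diagram k \<in> ?D" by (rule cap_diagram_closed)
  have fin: "finite ?D" by (rule finite_diagrams)
  note R = sum[OF finite_Diff[OF fin] subset_refl]
  have cV: "(\<lambda>X. g (cap_diagram k) * capc k X) \<in> V (k + k) 0" by (intro V_scale capc_V)
  have "g = (\<lambda>X. g (cap_diagram k) * capc k X + (\<Sum>D\<in>?D - {cap_diagram k}. g D * dg D X))"
    using expand[OF gV] sum.remove[OF fin cD, of "\<lambda>D. g D * dg D _"] by (metis (no_types, lifting) ext)
  then have "mm (em (k + k) 0 g) S = ad (sc (g (cap_diagram k)) (mm (ev k) S)) (?r)"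
    using em_add_mm[OF cV conjunct2[OF R] \<open>S \<in> Ob B\<close>] em_scale_mm[OF capc_V \<open>S \<in> Ob B\<close>] by metis
  moreover have "mm (em (k + k) 0 g) S = zr (A (P [k + k]) S) (A U S)"
    using em_zero_mm[of S "k + k" 0] em_ideal[OF g(1)] by simp
  ultimately have ad0: "ad (sc (g (cap_diagram k)) (mm (ev k) S)) (?r) =
      zr (A (P [k + k]) S) (A U S)"
    by metis
  have "ad (sc (g (cap_diagram k)) (mm (ev k) S)) (?r) ** ?y = ?z" unfolding ad0 by simp
  then have "sc (g (cap_diagram k)) (mm (ev k) S ** ?y) = ?z"
    using conjunct1[OF R] conjunct2[OF R] by (subst (asm) ad_comp) (simp_all add: par_def)
  then have "mm (ev k) S ** ?y = ?z"
    using sc_eq_zeroD[of "mm (ev k) S ** ?y" "g (cap_diagram k)"] g(2) by simp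
  \<comment> \<open>The vanishing of the nested evaluation contradicts the section that belongs to a
    reduced walk.\<close>
  then have z: "tv k S ** Am (P [k]) Y = zr (A (P [k]) T) S" by (simp add: th_def)
  obtain r where r: "arr r" "src r = S" "tgt r = A (P [k]) T" "tv k S ** Am (P [k]) Y ** r = i1 S"
    using red by (auto simp: reduced_def)
  have "i1 S = (tv k S ** Am (P [k]) Y) ** r" using r by simp
  then have "i1 S = zr S S" unfolding z using r by simp
  then show False using simple_id_nonzero[OF VV_simple[OF S]] by simp
qed

text \<open>A coinductively given walk has initial pieces of every length, and their composites are
  reduced; the relation in the ideal forbids one length.\<close>

lemma no_reduced_walk:
  assumes W: "\<And>S S' x. W S S' x ==> S \<in> VV \<and> S' \<in> VV \<and> arr x \<and> src x = S' \<and> tgt x = A F S \<and> x \<noteq> zr S' (A F S)"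
    and step: "\<And>S S' x. W S S' x ==> \<exists>S'' x'. W S' S'' x' \<and> tv one S ** Am F x ** x' = zr S'' S"
  shows "\<not> W S S' x"
proof
  assume w: "W S S' x"
  \<comment> \<open>The induction is over all edges of the walk: a piece that starts with
    \<open>x\<close> arises from the shorter piece that starts with the continuation of
    \<open>x\<close>. The tail is kept in the statement because its reducedness is needed for the
    extension.\<close>
  have red: "W S S' x ==> \<exists>T Y. reduced k S' T Y \<and> reduced (k + one) S T (mu (P [k]) F S ** Am (P [k]) x ** Y)" for k S S' x
  proof (induction k arbitrary: S S' x)
    case 0
    note w = W[OF 0]
    have "reduced (0 + one) S S' (mu (P [0]) F S ** Am (P [0]) x ** un S')"
      by (rule reduced_step[OF _ _ _ _ _ reduced_0]) (use w in "auto simp: one_def")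
    then show ?case using reduced_0[of S'] w by auto
  next
    case (Suc k)
    note w = W[OF Suc.prems]
    obtain S'' x' where x': "W S' S'' x'" "tv one S ** Am F x ** x' = zr S'' S" using step[OF Suc.prems] by blast
    note w' = W[OF x'(1)]
    obtain T Y where Y: "reduced k S'' T Y" "reduced (k + one) S' T (mu (P [k]) F S' ** Am (P [k]) x' ** Y)"
      using Suc.IH[OF x'(1)] by blast
    have [simp]: "S \<in> Ob B" "S' \<in> Ob B" "S'' \<in> Ob B" "arr x" "src x = S'" "tgt x = A F S" "arr x'" "src x' = S''" "tgt x' = A F S'"
      "T \<in> Ob B" "arr Y" "src Y = T" "tgt Y = A (P [k]) S''"
      using w w' Y(1) by (auto simp: reduced_def)
    let ?Y = "mu (P [k]) F S' ** Am (P [k]) x' ** Y"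
    have "reduced (k + one + one) S T (mu (P [k + one]) F S ** Am (P [k + one]) x ** ?Y)"
    proof (rule reduced_step[OF _ _ _ _ _ Y(2)])
      \<comment> \<open>The cap at the two rightmost strands, which carry \<open>x'\<close> and
        \<open>x\<close>: moved inwards, it becomes the evaluation of the two edges, zero by the
        choice of \<open>x'\<close>.\<close>
      fix a assume "a + (one + one) = k + one + one"
      then have a: "a = k" by simp
      have cV: "cat k 0 \<in> V (k + one + one) k" by (rule cat_V) simp_all
      have 1: "Am (P [k + one]) x ** mu (P [k]) F S' = mu (P [k]) F (A F S) ** Am (P [k]) (Am F x)"
        using mu_nat[of "P [k]" F x] by simp
      have 2: "mu (P [k + one]) F S ** mu (P [k]) F (A F S) = mu (P [k]) (P [one + one]) S ** Am (P [k]) (mu F F S)"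
        using mu_assoc[of "P [k]" F F S] by simp
      have 3: "mm (em (k + one + one) k (cat k 0)) S ** mu (P [k]) (P [one + one]) S = mu (P [k]) (P [0]) S ** Am (P [k]) (mm (ev one) S)"
        using mm_em_left[OF capc_V \<open>S \<in> Ob B\<close>, of k one] by (simp add: cat_0 add.assoc)
      have 4: "mm (ev one) S ** mu F F S = un S ** tv one S" using un_th[of F F "ev one" S] by simp
      have "mm (em (k + one + one) k (cat k 0)) S ** mu (P [k + one]) F S ** Am (P [k + one]) x ** ?Y =
        mm (em (k + one + one) k (cat k 0)) S ** mu (P [k + one]) F S ** (Am (P [k + one]) x ** mu (P [k]) F S') ** Am (P [k]) x' ** Y"
        using cV by simp
      also have "... = mm (em (k + one + one) k (cat k 0)) S ** (mu (P [k + one]) F S ** mu (P [k]) F (A F S)) ** Am (P [k]) (Am F x) ** Am (P [k]) x' ** Y"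
        unfolding 1 using cV by simp
      also have "... = (mm (em (k + one + one) k (cat k 0)) S ** mu (P [k]) (P [one + one]) S) ** Am (P [k]) (mu F F S ** Am F x ** x') ** Y"
        unfolding 2 using cV by (simp add: add.assoc)
      also have "... = mu (P [k]) (P [0]) S ** Am (P [k]) ((mm (ev one) S ** mu F F S) ** Am F x ** x') ** Y"
        unfolding 3 by simp
      also have "... = mu (P [k]) (P [0]) S ** Am (P [k]) (un S ** (tv one S ** Am F x ** x')) ** Y"
        unfolding 4 by simp
      also have "... = zr T (A (P [k]) S)" unfolding x'(2) by simp
      finally show "mm (em (k + one + one) a (cat a 0)) S ** mu (P [k + one]) F S ** Am (P [k + one]) x ** ?Y = zr T (A (P [a]) S)"
        unfolding a .
    qed (use w in auto)
    then show ?case using Y(2) by (auto simp: one_def)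
  qed
  \<comment> \<open>The length is dictated by the ideal: half the number of points of the
    rainbow.\<close>
  obtain k g where g: "(k + k, 0, g) \<in> N (k + k) 0" "g (cap_diagram k) \<noteq> 0"
    using proper contains_rainbow by blast
  show False using red[OF w, of k] not_reduced[OF g] W[OF w] by blast
qed

end

section \<open>The symmetric trace and its extension to all objects\<close>

context TL_module
begin

abbreviation "hv \<equiv> et F F (em 0 (one + one) (cupc one))"

lemma self_dual_F: "self_dual B (A F) (Am F) (tv one) hv"
proof -
  interpret endo_data B "A F" "Am F" by (rule endo_data[OF P_Ob])
  show ?thesis
  proof unfold_locales
    show "arr (tv one Z)" "src (tv one Z) = A F (A F Z)" "tgt (tv one Z) = Z" if "Z \<in> Ob B" for Z
      using that by simp_all
    show "arr (hv Z)" "src (hv Z) = Z"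
      "tgt (hv Z) = A F (A F Z)" if "Z \<in> Ob B" for Z
      using that by simp_all
    show "tv one (tgt f) ** Am F (Am F f) = f ** tv one (src f)" if "arr f" for f
      using that by (intro th_nat) simp_all
    show "hv (tgt f) ** f = Am F (Am F f) ** hv (src f)"
      if "arr f" for f
      using that by (intro et_nat) simp_all
    show "Am F (tv one Z) ** hv (A F Z) = i1 (A F Z)" if "Z \<in> Ob B" for Z by (rule zigzag[OF that])
    show "\<not> W S S' x"
      if w: "\<And>S S' x. W S S' x ==> S \<in> VV \<and> S' \<in> VV \<and> arr x \<and> src x = S' \<and> tgt x = A F S \<and> x \<noteq> zr S' (A F S)"
        and st: "\<And>S S' x. W S S' x ==> \<exists>S'' x'. W S' S'' x' \<and> tv one S ** Am F x ** x' = zr S'' S" for W S S' x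
      by (rule no_reduced_walk[of W, OF w st])
  qed
qed

lemma balanced_trace: "\<exists>t. (\<forall>T. t T \<noteq> 0) \<and> balanced t F (ev one)"
proof -
  interpret sd: self_dual B "A F" "Am F" "tv one" "hv" by (rule self_dual_F)
  show ?thesis using sd.trace_exists unfolding balanced_def by blast
qed

text \<open>On the unit object the evaluation consists of unit constraints, and the two traces are
  those of the same two arrows composed in the two cyclic orders.\<close>

lemma balanced_unit: "balanced t U (ev 0)" unfolding balanced_def
proof (intro allI impI)
  fix Z W a b
  assume [simp]: "Z \<in> Ob B" "W \<in> Ob B" "arr a" "src a = Z" "tgt a = A U W" "arr b" "src b = W" "tgt b = A U Z"
  have mu: "mu U U V = uni (A U V)" if [simp]: "V \<in> Ob B" for V
  proof -
    have "mu U U V = mu U U V ** un (A U V) ** uni (A U V)" by simp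
    also have "... = uni (A U V)" using rw[OF mu_unit_left[of U V], of "uni (A U V)"] by simp
    finally show ?thesis .
  qed
  have th: "th U U (ev 0) V = uni V ** uni (A U V)" if "V \<in> Ob B" for V
    using mm_em_id[of V 0] that by (simp add: th_def capc_0 mu)
  have 1: "uni (A U W) ** Am U a = a ** uni Z" "uni (A U Z) ** Am U b = b ** uni W"
    using uni_nat[of a] uni_nat[of b] by simp_all
  have "th U U (ev 0) W ** Am U a ** b = (uni W ** a) ** (uni Z ** b)"
    unfolding th[OF \<open>W \<in> Ob B\<close>] using rw[OF 1(1), of b] by simp
  moreover have "th U U (ev 0) Z ** Am U b ** a = (uni Z ** b) ** (uni W ** a)"
    unfolding th[OF \<open>Z \<in> Ob B\<close>] using rw[OF 1(2), of a] by simp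
  ultimately show "Tr t W (th U U (ev 0) W ** Am U a ** b) = Tr t Z (th U U (ev 0) Z ** Am U b ** a)"
    using Tr_cyclic[of "uni W ** a" Z W "uni Z ** b" t] by simp
qed

text \<open>Induction by adding one strand. \<open>ev_inner\<close> and \<open>ev_outer\<close>
  provide the two ways of nesting that \<open>balanced_nested\<close> requires.\<close>

lemma balanced_ev:
  assumes "balanced t F (ev one)"
  shows "balanced t (P [n]) (ev n)"
proof (induction n)
  case 0
  then show ?case using balanced_unit by simp
next
  case (Suc n)
  have e: "P [one + (n + (n + one))] = P [(n + one) + (n + one)]" "P [n + one] = P [one + n]"
    by (simp_all add: add_ac)
  have "balanced t (tens_ob CC F (P [n])) (ev (n + one))"
  proof (rule balanced_nested[OF _ _ _ _ _ _ _ _ _ _ _ _ _ _ assms Suc])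
    show "fst (ev (n + one)) = tens_ob CC F (tens_ob CC (P [n]) (tens_ob CC (P [n]) F))" by (simp add: add_ac)
    show "tens_ob CC (P [n]) F = tens_ob CC F (P [n])" by (simp add: add_ac)
    show "mm (ev (n + one)) Z = mm (ev one) Z ** mm (tens_mor CC (idm CC F) (tens_mor CC (ev n) (idm CC F))) Z"
      if "Z \<in> Ob B" for Z by (rule ev_inner[OF that])
    show "mm (ev (n + one)) Z = mm (ev n) Z ** mm (tens_mor CC (idm CC (P [n])) (tens_mor CC (ev one) (idm CC (P [n])))) Z"
      if "Z \<in> Ob B" for Z by (rule ev_outer[OF that])
  qed simp_all
  then show ?case by (simp add: one_def)
qed

text \<open>By \<open>ev_sum\<close> the evaluation of a list is a sum of restrictions of
  evaluations of single objects, and symmetry under the trace is stable under restriction and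
  sums.\<close>

lemma balanced_EV:
  assumes bal: "balanced t F (ev one)"
  shows "balanced t (P xs) (EV xs)"
proof -
  let ?R = "\<lambda>k. mat xs [xs ! k] (row xs k)"
  let ?m = "\<lambda>k. cmp K (mat (tl [xs ! k] [xs ! k]) [0] (evm [xs ! k])) (tens_mor K (?R k) (?R k))"
  have m: "?m k \<in> Hom K (tl xs xs) [0] \<and> balanced t (P xs) (kh (tl xs xs) [0] (?m k))" if k: "k < length xs" for k
  proof
    have R: "?R k \<in> Hom K xs [xs ! k]" by (rule mat_Hom[OF row_VM[OF k]])
    show "?m k \<in> Hom K (tl xs xs) [0]" by (rule K_cmp_Hom[OF K_tens_Hom[OF R R] mat_Hom[OF evm_VM]])
    have "kh (tl xs xs) [0] (?m k) = cmp CC (EV [xs ! k]) (tens_mor CC (kh xs [xs ! k] (?R k)) (kh xs [xs ! k] (?R k)))"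
      by (simp only: kh_tens kh_cmp)
    also have "balanced t (P xs) ..."
      using balanced_restrict[of "ev (xs ! k)" "P [xs ! k]" "kh xs [xs ! k] (?R k)" "P xs" t] R balanced_ev[OF bal]
      unfolding EV_single by simp
    finally show "balanced t (P xs) (kh (tl xs xs) [0] (?m k))" .
  qed
  have "sum_mor K (tl xs xs) [0] (map ?m ks) \<in> Hom K (tl xs xs) [0] \<and> balanced t (P xs) (kh (tl xs xs) [0] (sum_mor K (tl xs xs) [0] (map ?m ks)))"
    if "\<forall>k\<in>set ks. k < length xs" for ks
    using that
  proof (induction ks)
    case Nil
    have V: "VM (tl xs xs) [0] (\<lambda>_ _. z0)" by (rule VM_I) simp
    have z: "zero_mor K (tl xs xs) [0] \<in> Hom K (tl xs xs) [0]" unfolding K_zero by (rule mat_Hom[OF V])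
    have "scale_mor CC 0 (kh (tl xs xs) [0] (zero_mor K (tl xs xs) [0])) = kh (tl xs xs) [0] (zero_mor K (tl xs xs) [0])"
      unfolding kh_def K_zero by (simp add: CC_simps K_scale[OF V])
    then show ?case using z by (auto simp: sum_mor_def intro!: balanced_zero)
  next
    case (Cons k ks)
    let ?s = "sum_mor K (tl xs xs) [0] (map ?m ks)"
    have 1: "?m k \<in> Hom K (tl xs xs) [0]" "balanced t (P xs) (kh (tl xs xs) [0] (?m k))" using m Cons.prems by auto
    have 2: "?s \<in> Hom K (tl xs xs) [0]" "balanced t (P xs) (kh (tl xs xs) [0] ?s)" using Cons by auto
    have 3: "add_mor K (?m k) ?s \<in> Hom K (tl xs xs) [0]"
    proof -
      obtain a b where ab: "?m k = mat (tl xs xs) [0] a" "VM (tl xs xs) [0] a" "?s = mat (tl xs xs) [0] b" "VM (tl xs xs) [0] b"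
        using 1(1) 2(1) unfolding Hom_K by blast
      have "VM (tl xs xs) [0] (\<lambda>i j X. a i j X + b i j X)" using ab(2,4) unfolding VM_def by (simp add: V_add)
      then show ?thesis unfolding ab(1,3) K_add[OF ab(2,4)] by (rule mat_Hom)
    qed
    have e: "sum_mor K (tl xs xs) [0] (map ?m (k # ks)) = add_mor K (?m k) ?s" by (simp add: sum_mor_def)
    have "balanced t (P xs) (add_mor CC (kh (tl xs xs) [0] (?m k)) (kh (tl xs xs) [0] ?s))"
      by (rule balanced_add[OF _ _ _ _ _ _ _ _ _ _ 1(2) 2(2)])
        (use 1(1) 2(1) 3 in "simp_all add: kh_add del: tl_single")
    then show ?case unfolding e kh_add using 3 by blast
  qed
  from conjunct2[OF this[of "[0..<length xs]"]] show ?thesis unfolding ev_sum[symmetric] by simp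
qed

abbreviation "thP X \<equiv> th (P (fst X)) (P (fst X)) (EV (fst X))"
abbreviation "etP X \<equiv> et (P (fst X)) (P (fst X)) (CV (fst X))"

definition incl where "incl X = (X, P (fst X), snd X)"
definition proj where "proj X = (P (fst X), X, snd X)"
definition dual where "dual X = (fst X, rd (fst X) (snd X))"
text \<open>Evaluation and coevaluation of \<open>P (fst X)\<close>, cut down to retracts on both
  sides.\<close>

definition pair where "pair X Y = (\<lambda>Z. thP X Z ** mm (incl X) (A (P (fst X)) Z) ** Am X (mm (incl Y) Z))"
definition copair where "copair X Y = (\<lambda>Z. mm (proj X) (A Y Z) ** Am (P (fst X)) (mm (proj Y) Z) ** etP X Z)"

lemma incl_ca [simp]: "X \<in> Ob CC ==> ca (incl X)" "fst (incl X) = X" "fst (snd (incl X)) = P (fst X)"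
  using retract(1)[of "fst X" "snd X"] caI[of X "P (fst X)" "incl X"] by (simp_all add: incl_def)

lemma proj_ca [simp]: "X \<in> Ob CC ==> ca (proj X)" "fst (proj X) = P (fst X)" "fst (snd (proj X)) = X"
  using retract(2)[of "fst X" "snd X"] caI[of "P (fst X)" X "proj X"] by (simp_all add: proj_def)

lemma proj_incl:
  assumes "X \<in> Ob CC" "Z \<in> Ob B"
  shows "mm (proj X) Z ** mm (incl X) Z = i1 (A X Z)"
proof -
  have "mm (cmp CC (proj X) (incl X)) Z = mm (proj X) Z ** mm (incl X) Z"
    by (rule mm_cmp) (simp_all add: assms)
  then show ?thesis using retract(3)[of "fst X" "snd X"] assms by (simp add: incl_def proj_def)
qed

lemma incl_proj:
  assumes "X \<in> Ob CC" "Z \<in> Ob B"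
  shows "mm (incl X) Z ** mm (proj X) Z = mm (kh (fst X) (fst X) (snd X)) Z"
proof -
  have "mm (cmp CC (incl X) (proj X)) Z = mm (incl X) Z ** mm (proj X) Z"
    by (rule mm_cmp) (simp_all add: assms)
  then show ?thesis using retract(4)[of "fst X" "snd X"] assms by (simp add: incl_def proj_def)
qed

lemma dual_CC:
  assumes "X \<in> Ob CC"
  shows "dual X \<in> Ob CC" "ldual CC X = dual X" "rdual CC X = dual X" "pivot CC X = idm CC (dual X)" "fst (dual X) = fst X"
    "ev_l CC X = cmp CC (EV (fst X)) (tens_mor CC (incl (dual X)) (incl X))"
    "ev_r CC X = cmp CC (EV (fst X)) (tens_mor CC (incl X) (incl (dual X)))"
    "coev_l CC X = cmp CC (tens_mor CC (proj X) (proj (dual X))) (CV (fst X))"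
    "coev_r CC X = cmp CC (tens_mor CC (proj (dual X)) (proj X)) (CV (fst X))"
  using assms dual_Ob[of "fst X" "snd X"] CC_dual[of "fst X" "snd X"] CC_ev[of "fst X" "snd X"]
  by (simp_all add: dual_def incl_def proj_def)

lemma EV_ca [simp]: "ca (EV xs)" "ca (CV xs)"
  using mat_Hom[OF evm_VM] mat_Hom[OF cvm_VM] by (simp_all del: tl_single)

text \<open>The idempotents of \<open>X\<close> and of its dual are mates of each other because
  taking the mate twice gives the original; this is the hypothesis of
  \<open>retract_duality\<close>.\<close>

lemma duality_CC:
  assumes X [simp]: "X \<in> Ob CC" and bal: "balanced t F (ev one)"
  shows "duality t X (dual X) (pair (dual X) X) (copair X (dual X)) (pair X (dual X)) (copair (dual X) X)"
proof -
  note [simp] = dual_CC(1,5)[OF X]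
  have e: "snd X \<in> Hom K (fst X) (fst X)" using X by (cases X) (simp add: CC_simps)
  have e': "rd (fst X) (snd X) \<in> Hom K (fst X) (fst X)" by (rule rd_Hom[OF e])
  have [simp]: "snd (dual X) = rd (fst X) (snd X)" by (simp add: dual_def)
  show ?thesis unfolding pair_def copair_def dual_CC(5)[OF X]
  proof (rule retract_duality)
    show "mm (proj X) Z ** mm (incl X) Z = i1 (A X Z)" "mm (proj (dual X)) Z ** mm (incl (dual X)) Z = i1 (A (dual X) Z)"
      if "Z \<in> Ob B" for Z using proj_incl that by simp_all
    show "Am (P (fst X)) (thP X Z ** mm (incl (dual X)) (A (P (fst X)) Z) ** mm (proj (dual X)) (A (P (fst X)) Z)) **
        etP X (A (P (fst X)) Z) = mm (incl X) Z ** mm (proj X) Z" if "Z \<in> Ob B" for Z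
      using mateP[OF e' that] incl_proj[OF X that] incl_proj[of "dual X" "A (P (fst X)) Z"] that by (simp add: rd_rd[OF e])
    show "Am (P (fst X)) (thP X Z ** mm (incl X) (A (P (fst X)) Z) ** mm (proj X) (A (P (fst X)) Z)) **
        etP X (A (P (fst X)) Z) = mm (incl (dual X)) Z ** mm (proj (dual X)) Z" if "Z \<in> Ob B" for Z
      using mateP[OF e that] incl_proj[of "dual X" Z] incl_proj[OF X, of "A (P (fst X)) Z"] that by simp
    show "balanced t (P (fst X)) (EV (fst X))" by (rule balanced_EV[OF bal])
  qed simp_all
qed

lemma image_pair:
  assumes [simp]: "X \<in> Ob CC" "Y \<in> Ob CC" and e: "fst Y = fst X"
  shows "image_ev CC (End_cat B) M X Y (cmp CC (EV (fst X)) (tens_mor CC (incl X) (incl Y))) =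
      (endo_cmp B (on_ob M X) (on_ob M Y), endo_id B, \<lambda>Z\<in>Ob B. pair X Y Z)"
    "image_coev CC (End_cat B) M X Y (cmp CC (tens_mor CC (proj X) (proj Y)) (CV (fst X))) =
      (endo_id B, endo_cmp B (on_ob M X) (on_ob M Y), \<lambda>Z\<in>Ob B. copair X Y Z)"
proof -
  have 1: "image_ev CC (End_cat B) M X Y (cmp CC (EV (fst X)) (tens_mor CC (incl X) (incl Y))) =
      (endo_cmp B (on_ob M X) (on_ob M Y), endo_id B, \<lambda>Z\<in>Ob B. th X Y (cmp CC (EV (fst X)) (tens_mor CC (incl X) (incl Y))) Z)"
    by (rule image_ev_eq) (simp_all add: e)
  have 2: "image_coev CC (End_cat B) M X Y (cmp CC (tens_mor CC (proj X) (proj Y)) (CV (fst X))) =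
      (endo_id B, endo_cmp B (on_ob M X) (on_ob M Y), \<lambda>Z\<in>Ob B. et X Y (cmp CC (tens_mor CC (proj X) (proj Y)) (CV (fst X))) Z)"
    by (rule image_coev_eq) (simp_all add: e)
  show "image_ev CC (End_cat B) M X Y (cmp CC (EV (fst X)) (tens_mor CC (incl X) (incl Y))) =
      (endo_cmp B (on_ob M X) (on_ob M Y), endo_id B, \<lambda>Z\<in>Ob B. pair X Y Z)"
    unfolding 1 pair_def
    by (auto intro!: restrict_ext th_restrict simp: e)
  show "image_coev CC (End_cat B) M X Y (cmp CC (tens_mor CC (proj X) (proj Y)) (CV (fst X))) =
      (endo_id B, endo_cmp B (on_ob M X) (on_ob M Y), \<lambda>Z\<in>Ob B. copair X Y Z)"
    unfolding 2 copair_def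
    by (auto intro!: restrict_ext et_restrict simp: e)
qed

lemma pair_arr [simp]:
  assumes "X \<in> Ob CC" "Y \<in> Ob CC" "fst Y = fst X" "Z \<in> Ob B"
  shows "arr (pair X Y Z)" "src (pair X Y Z) = A X (A Y Z)" "tgt (pair X Y Z) = Z"
    "arr (copair X Y Z)" "src (copair X Y Z) = Z" "tgt (copair X Y Z) = A X (A Y Z)"
  using assms by (simp_all add: pair_def copair_def)

text \<open>The pivotal structure consists of identities, so the claim is that the two mates of a
  transformation coincide. Both mates are written out with \<open>pair\<close> and
  \<open>copair\<close> and compared on components by \<open>mates_agree\<close>.\<close>

theorem pivotal: "induces_pivotal_on_full_image CC (End_cat B) M" unfolding induces_pivotal_on_full_image_def
proof (intro ballI)
  fix X Y \<alpha>
  assume X [simp]: "X \<in> Ob CC" and Y [simp]: "Y \<in> Ob CC" and \<alpha>: "\<alpha> \<in> Hom (End_cat B) (on_ob M X) (on_ob M Y)"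
  obtain t where t: "\<And>T. t T \<noteq> 0" and bal: "balanced t F (ev one)" using balanced_trace by blast
  obtain a where a: "\<alpha> = (on_ob M X, on_ob M Y, a)" and nat: "nat_transformation B (on_ob M X) (on_ob M Y) a"
    using \<alpha> unfolding Hom_End by blast
  have a_arr: "arr (a Z)" "src (a Z) = A X Z" "tgt (a Z) = A Y Z" if "Z \<in> Ob B" for Z
    using HomD[OF nat_transformationD(1)[OF nat that]] that X Y A_Ob unfolding A_def by blast+
  have a_nat: "a (tgt h) ** Am X h = Am Y h ** a (src h)" if "arr h" for h
    using nat_transformationD(2)[OF nat that] unfolding Am_def .
  note dX = dual_CC[OF X] and dY = dual_CC[OF Y]
  have l: "image_ldual_mor CC (End_cat B) M X Y \<alpha> = (on_ob M (dual Y), on_ob M (dual X),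
      \<lambda>Z\<in>Ob B. pair (dual Y) Y (A (dual X) Z) ** Am (dual Y) (a (A (dual X) Z)) ** Am (dual Y) (copair X (dual X) Z))"
    unfolding image_ldual_mor_def dX(2,8) dY(2,6) a
      image_pair(2)[OF X dX(1,5)] image_pair(1)[OF dY(1) Y dY(5)[symmetric], unfolded dY(5)]
    by (rule left_mate_End) (use dX(1,5) dY(1,5) a_arr in simp_all)
  have r: "image_rdual_mor CC (End_cat B) M X Y \<alpha> = (on_ob M (dual Y), on_ob M (dual X),
      \<lambda>Z\<in>Ob B. Am (dual X) (pair Y (dual Y) Z) ** Am (dual X) (a (A (dual Y) Z)) ** copair (dual X) X (A (dual Y) Z))"
    unfolding image_rdual_mor_def dX(3,9) dY(3,7) a
      image_pair(1)[OF Y dY(1,5)] image_pair(2)[OF dX(1) X dX(5)[symmetric], unfolded dX(5)]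
    by (rule right_mate_End) (use dX(1,5) dY(1,5) a_arr in simp_all)
  have eq: "Am (dual X) (pair Y (dual Y) Z) ** Am (dual X) (a (A (dual Y) Z)) ** copair (dual X) X (A (dual Y) Z) =
      pair (dual Y) Y (A (dual X) Z) ** Am (dual Y) (a (A (dual X) Z)) ** Am (dual Y) (copair X (dual X) Z)" if "Z \<in> Ob B" for Z
    by (rule mates_agree[OF duality_CC[OF X bal] duality_CC[OF Y bal] t a_arr a_nat that])
  have id: "on_mor M (idm CC (dual W)) = (on_ob M (dual W), on_ob M (dual W), \<lambda>Z\<in>Ob B. i1 (A (dual W) Z))"
    if "dual W \<in> Ob CC" for W
    using mf_id[OF that] by (simp add: A_def)
  show "cmp (End_cat B) (image_rdual_mor CC (End_cat B) M X Y \<alpha>) (on_mor M (pivot CC Y)) =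
      cmp (End_cat B) (on_mor M (pivot CC X)) (image_ldual_mor CC (End_cat B) M X Y \<alpha>)"
    unfolding l r dX(4) dY(4) id[OF dX(1)] id[OF dY(1)]
    using eq a_arr dX(1,5) dY(1,5) by (auto intro!: restrict_ext)
qed

end

theorem corollary8p4:
  fixes q \<beta> :: complex
    and n :: nat
    and N :: "nat \<Rightarrow> nat \<Rightarrow> tl_mor set"
    and B :: "('o, 'm) lin_cat"
    and M :: "(fusion_ob, fusion_mor, ('o, 'm) endo, ('o, 'm) nat_trans) mon_functor"
  assumes "primitive_root_of_unity n q" and "even n"
    and "\<beta> = - (q + inverse q)" and "\<beta> \<noteq> 0"
    and "proper_nonzero_tensor_ideal (TL \<beta>) N"
    and "module_category (TL_fusion \<beta> N) B M"
    and "semisimple_category B" and "finitely_many_simples B"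
  shows "induces_pivotal_on_full_image (TL_fusion \<beta> N) (End_cat B) M"
proof -
  have lc: "linear_category B" and mf: "monoidal_functor (TL_fusion \<beta> N) (End_cat B) M"
    using assms(6) by (auto simp: module_category_def)
  have ideal: "tensor_ideal (TL \<beta>) N" and ne: "\<exists>X\<in>Ob (TL \<beta>). \<exists>Y\<in>Ob (TL \<beta>). N X Y \<noteq> {zero_mor (TL \<beta>) X Y}"
    using assms(5) by (auto simp: proper_nonzero_tensor_ideal_def)
  have "zero_mor (TL \<beta>) X Y \<in> N X Y" if "X \<in> Ob (TL \<beta>)" "Y \<in> Ob (TL \<beta>)" for X Y
    using ideal that unfolding tensor_ideal_def by blast
  then have proper: "\<exists>m n x. x \<in> N m n \<and> x \<noteq> zero_mor (TL \<beta>) m n" using ne by blast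
  interpret TL_module \<beta> N B M
    by (intro TL_module.intro TL_ideal.intro sscat.intro lincat.intro sscat_axioms.intro TL_module_axioms.intro
      ideal lc mf proper assms(7))
  show ?thesis by (rule pivotal)
qed


end
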